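(* Let $r\ge0$, $q=r+1$, $p\ge1$, $d_h,\rho_h>0$ ($1\le h\le r$), $\widehat a_*\in\mathbb R$, let $\xi_1,\dots,\xi_p\in\mathbb R$ be pairwise distinct with $\xi_i+\rho_h>0$ for all $i,h$; fix a row index $\boldsymbol\lambda=(n_1,\dots,n_r,\eta)\in\mathbb N_0^{r+1}$ with entries pairwise differing by at most one, such that the rates $\rho_h$ with $n_h>0$ are pairwise distinct. Then the direct Jacobi–Hermite limit (matrix $\mathbf M^{(0)}_\tau$, $\tau\to+\infty$) and the two iterated limits through Laguerre of the first and second kinds (matrices $\mathbf M^{(1)}_{\tau,\kappa}$ and $\mathbf M^{(2)}_{\tau,\kappa}$ of the context; first $\kappa\to+\infty$ with $\tau$ fixed, then $\tau\to+\infty$) give the same matrix $[U_j^{\mathrm H}(t)\mathrm e^{\xi_it}]_{j,i}\,\mathrm dt$ in every fixed mixed moment: for all $i,j$ and $v\in\mathbb N_0$ the corresponding limits of the moments of order $v$ of the $(j,i)$ entries all equal $\int_{\mathbb R}t^vU_j^{\mathrm H}(t)\mathrm e^{\xi_it}\,\mathrm dt$. In the respective $A$- and $B$-balances ($|\boldsymbol m|=|\boldsymbol\lambda|+1$ and $|\boldsymbol\lambda|=|\boldsymbol m|+1$), their transformed polynomial vectors (solution vectors of the $A$- and $B$-problems for these matrices) converge coefficientwise, in the same (direct, respectively iterated) sense, to the same vectors $\boldsymbol A^{\mathrm H}$ and $\boldsymbol B^{\mathrm H}$ (solution vectors of the Hermite problems) when the same nonzero coefficients are normalized to one.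
   Context: Common notation. $\mathcal B_{a,b}(x)=\frac{x^a(1-x)^{b-a-1}}{\Gamma(b-a)}\mathbf 1_{(0,1)}(x)$; Mellin convolution $(f*g)(x)=\int_0^\infty f(u)g(x/u)\frac{\mathrm du}u$; Jacobi weights $w_j^{\mathrm J}(x;\boldsymbol a,\boldsymbol b)=\mathcal B_{a_1,b_1+\delta_{1,j}}*\cdots*\mathcal B_{a_q,b_q+\delta_{q,j}}$, $1\le j\le q$. $\phi_a(t)=\pi^{-1/2}\mathrm e^{-(t-a)^2}$; $(K_{\rho,d}f)(t)=\int_0^\infty\frac{\rho^d}{\Gamma(d)}u^{d-1}\mathrm e^{-\rho u}f(t+u)\,\mathrm du$; $F=K_{\rho_1,d_1}\cdots K_{\rho_r,d_r}\phi_{\widehat a_*}$; $U_h^{\mathrm H}=K_{\rho_h,1}F$ ($h\le r$), $U_q^{\mathrm H}=F$. $\lambda_h=n_h$, $\lambda_q=\eta$. All matrices below are extended by zero outside the indicated $t$-range. Direct route $\mathbf M^{(0)}_\tau$: $a_h(\tau)+1=\rho_h\sqrt\tau$, $b_h(\tau)=a_h(\tau)+d_h$ ($h\le r$), $a_q(\tau)+1=\tau+\widehat a_*\sqrt\tau$, $b_q(\tau)+1=2\tau$; entries $\frac{\tau^{-1/2}}{2Z_j}w_j^{\mathrm J}\bigl(\tfrac12(1+\tau^{-1/2}t);\boldsymbol a(\tau),\boldsymbol b(\tau)\bigr)(1+\tau^{-1/2}t)^{\xi_i\sqrt\tau}\,\mathrm dt$, $|t|<\sqrt\tau$, $Z_j=\int_0^1w_j^{\mathrm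 J}$. Route through Laguerre of the first kind $\mathbf M^{(1)}_{\tau,\kappa}$: parameters with $a_\nu(\tau)>-1$, $b_h(\tau)>a_h(\tau)$, $\varepsilon_\tau=\sqrt{2/\tau}$, $a_q(\tau)+1=\tau+\sqrt{2\tau}\,\widehat a_*+\mathrm O(1)$, $\varepsilon_\tau(a_h(\tau)+1)\to\rho_h$, $b_h(\tau)-a_h(\tau)\to d_h$ ($h\le r$), $\varepsilon_\tau\beta_i(\tau)\to\xi_i$. For fixed $\tau$ and a fixed $\omega>0$ put $C_\kappa=\kappa\omega-a_q(\tau)-1$, $\delta_\kappa=C_\kappa^{a_q(\tau)}\Gamma(C_\kappa+1)$, $\boldsymbol b^{\mathrm J}=(b_1(\tau),\dots,b_r(\tau),\kappa\omega)$, $x_\tau(t)=\tau(1+\varepsilon_\tau t)$, $Z_\tau=\prod_{\nu\le q}\Gamma(a_\nu(\tau)+1)/\prod_{h\le r}\Gamma(b_h(\tau)+1)$. Rows: $\frac{\tau\varepsilon_\tau(b_h(\tau)+1)}{Z_\tau}\delta_\kappa w_h^{\mathrm J}(x_\tau(t)/C_\kappa;\boldsymbol a(\tau),\boldsymbol b^{\mathrm J})$ for $h\le r$, and $\frac{\tau\varepsilon_\tau}{Z_\tau}\kappa\omega\,\delta_\kappa w_q^{\mathrm J}(x_\tau(t)/C_\kappa;\boldsymbol a(\tau),\boldsymbol b^{\mathrm J})$ for $j=q$; columns $(1+\varepsilon_\tau t)^{\beta_i(\tau)}$; range $0<x_\tau(t)<C_\kappa$. (As $\kappa\to\infty$ these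 become the Laguerre rows of the first kind, centered and normalized.) Route through Laguerre of the second kind $\mathbf M^{(2)}_{\tau,\kappa}$: $h_\tau=\sqrt{2\tau}$, $\boldsymbol d_\tau=(d_1,\dots,d_r,\tau)$, $\boldsymbol\varrho_\tau=(\rho_1/h_\tau,\dots,\rho_r/h_\tau,1)$, $D_\tau=\sum_hd_{h,\tau}$, $\sigma_{j,\tau}=\varrho_{j,\tau}\prod_h\varrho_{h,\tau}^{d_{h,\tau}}$, $y_\tau(t)=\tau+h_\tau(\widehat a_*-t)$; Jacobi parameters $a_h=\kappa\varrho_{h,\tau}-1$, $b_h=a_h+d_{h,\tau}$, $\alpha_i=\kappa\xi_i/h_\tau$. Rows $h_\tau\sigma_{j,\tau}\kappa^{D_\tau}w_j^{\mathrm J}(1-y_\tau(t)/\kappa;\boldsymbol a,\boldsymbol b)$; columns $\mathrm e^{\xi_i(\tau/h_\tau+\widehat a_* )}(1-y_\tau(t)/\kappa)^{\alpha_i}$; range $0<y_\tau(t)<\kappa$. For a matrix with rows $U_j$ and columns $V_i$: $A$-problem ($|\boldsymbol m|=|\boldsymbol\lambda|+1$): polynomial vectors $(A_i)$, $\deg A_i<m_i$, $\int t^kU_j\sum_iA_iV_i\,\mathrm dt=0$ for $0\le k<\lambda_j$; $B$-problem ($|\boldsymbol\lambda|=|\boldsymbol m|+1$): $(B_j)$, $\deg B_j<\lambda_j$, $\int t^kV_i\sum_jB_jU_j\,\mathrm dt=0$ for $0\le k<m_i$. $\boldsymbol A^{\mathrm H}$, $\boldsymbol B^{\mathrm H}$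 are the nonzero solutions (unique up to scalar) for $U_j=U_j^{\mathrm H}$, $V_i=\mathrm e^{\xi_it}$; one nonzero coefficient of each is normalized to one and the same coefficient is normalized to one in the finite-parameter vectors (possible for $\tau$ large, and then $\kappa$ large depending on $\tau$). *)

theory Defs
  imports "HOL-Analysis.Analysis" "HOL-Library.Landau_Symbols" "HOL-Computational_Algebra.Polynomial"
begin

text \<open>
  Indices start at 0: the rows are \<open>j \<le> r\<close>, where \<open>j < r\<close> are the indices called \<open>h\<close> in the
  text and \<open>j = r\<close> is the last index \<open>q\<close>; the columns are \<open>i < p\<close>. Families such as \<open>a\<close>, \<open>b\<close>,
  \<open>d\<close>, \<open>\<rho>\<close> are functions on \<open>nat\<close> of which only these entries matter.
\<close>

subsection \<open>Jacobi weights\<close>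

definition beta_kernel :: "real \<Rightarrow> real \<Rightarrow> real \<Rightarrow> real" where
  "beta_kernel a b x =
     x powr a * (1 - x) powr (b - a - 1) / Gamma (b - a) * indicat_real {0<..<1} x"

definition mellin_conv :: "(real \<Rightarrow> real) \<Rightarrow> (real \<Rightarrow> real) \<Rightarrow> real \<Rightarrow> real" where
  "mellin_conv f g x = (LINT u:{0<..}|lborel. f u * g (x / u) / u)"

primrec mellin_conv_upto :: "(nat \<Rightarrow> real \<Rightarrow> real) \<Rightarrow> nat \<Rightarrow> real \<Rightarrow> real" where
  "mellin_conv_upto f 0 = f 0"
| "mellin_conv_upto f (Suc n) = mellin_conv (mellin_conv_upto f n) (f (Suc n))"

definition jacobi_weight ::
  "nat \<Rightarrow> nat \<Rightarrow> (nat \<Rightarrow> real) \<Rightarrow> (nat \<Rightarrow> real) \<Rightarrow> real \<Rightarrow> real" where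
  "jacobi_weight r j a b =
     mellin_conv_upto (\<lambda>h. beta_kernel (a h) (b h + (if h = j then 1 else 0))) r"

subsection \<open>Hermite limit\<close>

definition gauss_density :: "real \<Rightarrow> real \<Rightarrow> real" where
  "gauss_density a t = exp (- ((t - a)\<^sup>2)) / sqrt pi"

definition gamma_op :: "real \<Rightarrow> real \<Rightarrow> (real \<Rightarrow> real) \<Rightarrow> real \<Rightarrow> real" where
  "gamma_op \<rho> d f t =
     (LINT u:{0<..}|lborel. \<rho> powr d / Gamma d * u powr (d - 1) * exp (- \<rho> * u) * f (t + u))"

definition hermite_base ::
  "nat \<Rightarrow> (nat \<Rightarrow> real) \<Rightarrow> (nat \<Rightarrow> real) \<Rightarrow> real \<Rightarrow> real \<Rightarrow> real" where
  "hermite_base r \<rho> d ah = foldr (\<lambda>h. gamma_op (\<rho> h) (d h)) [0..<r] (gauss_density ah)"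

definition hermite_row ::
  "nat \<Rightarrow> (nat \<Rightarrow> real) \<Rightarrow> (nat \<Rightarrow> real) \<Rightarrow> real \<Rightarrow> nat \<Rightarrow> real \<Rightarrow> real" where
  "hermite_row r \<rho> d ah j =
     (if j < r then gamma_op (\<rho> j) 1 (hermite_base r \<rho> d ah) else hermite_base r \<rho> d ah)"

definition hermite_col :: "(nat \<Rightarrow> real) \<Rightarrow> nat \<Rightarrow> real \<Rightarrow> real" where
  "hermite_col \<xi> i t = exp (\<xi> i * t)"

text \<open>
  In the three matrices below the extension by zero outside the \<open>t\<close>-range is put into the rows, so
  that the entries \<open>U\<^sub>j(t) V\<^sub>i(t)\<close> vanish there.
\<close>

subsection \<open>Direct route\<close>

definition direct_a :: "nat \<Rightarrow> (nat \<Rightarrow> real) \<Rightarrow> real \<Rightarrow> real \<Rightarrow> nat \<Rightarrow> real" where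
  "direct_a r \<rho> ah \<tau> h = (if h < r then \<rho> h * sqrt \<tau> - 1 else \<tau> + ah * sqrt \<tau> - 1)"

definition direct_b ::
  "nat \<Rightarrow> (nat \<Rightarrow> real) \<Rightarrow> (nat \<Rightarrow> real) \<Rightarrow> real \<Rightarrow> real \<Rightarrow> nat \<Rightarrow> real" where
  "direct_b r \<rho> d ah \<tau> h = (if h < r then direct_a r \<rho> ah \<tau> h + d h else 2 * \<tau> - 1)"

definition direct_row ::
  "nat \<Rightarrow> (nat \<Rightarrow> real) \<Rightarrow> (nat \<Rightarrow> real) \<Rightarrow> real \<Rightarrow> real \<Rightarrow> nat \<Rightarrow> real \<Rightarrow> real" where
  "direct_row r \<rho> d ah \<tau> j t =
     (let w = jacobi_weight r j (direct_a r \<rho> ah \<tau>) (direct_b r \<rho> d ah \<tau>);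
          Z = (LINT x:{0<..<1}|lborel. w x)
      in if \<bar>t\<bar> < sqrt \<tau> then 1 / (2 * Z * sqrt \<tau>) * w ((1 + t / sqrt \<tau>) / 2) else 0)"

definition direct_col :: "(nat \<Rightarrow> real) \<Rightarrow> real \<Rightarrow> nat \<Rightarrow> real \<Rightarrow> real" where
  "direct_col \<xi> \<tau> i t = (1 + t / sqrt \<tau>) powr (\<xi> i * sqrt \<tau>)"

subsection \<open>Route through Laguerre of the first kind\<close>

text \<open>The families \<open>a\<close>, \<open>b\<close>, \<open>\<beta>\<close> are the parameters at the given \<open>\<tau>\<close>.\<close>

definition laguerre1_row ::
  "nat \<Rightarrow> (nat \<Rightarrow> real) \<Rightarrow> (nat \<Rightarrow> real) \<Rightarrow> real \<Rightarrow> real \<Rightarrow> real \<Rightarrow> nat \<Rightarrow> real \<Rightarrow> real" where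
  "laguerre1_row r a b \<omega> \<tau> \<kappa> j t =
     (let \<epsilon> = sqrt (2 / \<tau>);
          C = \<kappa> * \<omega> - a r - 1;
          \<delta> = C powr a r * Gamma (C + 1);
          bJ = b(r := \<kappa> * \<omega>);
          x = \<tau> * (1 + \<epsilon> * t);
          Z = (\<Prod>\<nu>\<le>r. Gamma (a \<nu> + 1)) / (\<Prod>h<r. Gamma (b h + 1))
      in if 0 < x \<and> x < C
         then \<tau> * \<epsilon> * (if j < r then b j + 1 else \<kappa> * \<omega>) / Z * \<delta> * jacobi_weight r j a bJ (x / C)
         else 0)"

definition laguerre1_col :: "(nat \<Rightarrow> real) \<Rightarrow> real \<Rightarrow> nat \<Rightarrow> real \<Rightarrow> real" where
  "laguerre1_col \<beta> \<tau> i t = (1 + sqrt (2 / \<tau>) * t) powr \<beta> i"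

subsection \<open>Route through Laguerre of the second kind\<close>

definition laguerre2_rate :: "nat \<Rightarrow> (nat \<Rightarrow> real) \<Rightarrow> real \<Rightarrow> nat \<Rightarrow> real" where
  "laguerre2_rate r \<rho> \<tau> h = (if h < r then \<rho> h / sqrt (2 * \<tau>) else 1)"

definition laguerre2_row ::
  "nat \<Rightarrow> (nat \<Rightarrow> real) \<Rightarrow> (nat \<Rightarrow> real) \<Rightarrow> real \<Rightarrow> real \<Rightarrow> real \<Rightarrow> nat \<Rightarrow> real \<Rightarrow> real" where
  "laguerre2_row r \<rho> d ah \<tau> \<kappa> j t =
     (let h\<^sub>\<tau> = sqrt (2 * \<tau>);
          d\<^sub>\<tau> = d(r := \<tau>);
          \<rho>\<^sub>\<tau> = laguerre2_rate r \<rho> \<tau>;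
          D = (\<Sum>h\<le>r. d\<^sub>\<tau> h);
          \<sigma> = \<rho>\<^sub>\<tau> j * (\<Prod>h\<le>r. \<rho>\<^sub>\<tau> h powr d\<^sub>\<tau> h);
          y = \<tau> + h\<^sub>\<tau> * (ah - t);
          a = (\<lambda>h. \<kappa> * \<rho>\<^sub>\<tau> h - 1);
          b = (\<lambda>h. a h + d\<^sub>\<tau> h)
      in if 0 < y \<and> y < \<kappa>
         then h\<^sub>\<tau> * \<sigma> * \<kappa> powr D * jacobi_weight r j a b (1 - y / \<kappa>)
         else 0)"

definition laguerre2_col ::
  "(nat \<Rightarrow> real) \<Rightarrow> real \<Rightarrow> real \<Rightarrow> real \<Rightarrow> nat \<Rightarrow> real \<Rightarrow> real" where
  "laguerre2_col \<xi> ah \<tau> \<kappa> i t =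
     (let h\<^sub>\<tau> = sqrt (2 * \<tau>);
          y = \<tau> + h\<^sub>\<tau> * (ah - t)
      in exp (\<xi> i * (\<tau> / h\<^sub>\<tau> + ah)) * (1 - y / \<kappa>) powr (\<kappa> * \<xi> i / h\<^sub>\<tau>))"

subsection \<open>The two mixed orthogonality problems\<close>

text \<open>
  Entries outside the index range are required to be zero, so that equality of solutions means
  equality of vectors.
\<close>

definition A_solution ::
  "nat \<Rightarrow> nat \<Rightarrow> (nat \<Rightarrow> nat) \<Rightarrow> (nat \<Rightarrow> nat) \<Rightarrow>
   (nat \<Rightarrow> real \<Rightarrow> real) \<Rightarrow> (nat \<Rightarrow> real \<Rightarrow> real) \<Rightarrow> (nat \<Rightarrow> real poly) \<Rightarrow> bool" where
  "A_solution p r m l U V A \<longleftrightarrow>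
     (\<forall>i<p. A i = 0 \<or> degree (A i) < m i) \<and> (\<forall>i\<ge>p. A i = 0) \<and>
     (\<forall>j\<le>r. \<forall>k<l j. (LINT t|lborel. t ^ k * U j t * (\<Sum>i<p. poly (A i) t * V i t)) = 0)"

definition B_solution ::
  "nat \<Rightarrow> nat \<Rightarrow> (nat \<Rightarrow> nat) \<Rightarrow> (nat \<Rightarrow> nat) \<Rightarrow>
   (nat \<Rightarrow> real \<Rightarrow> real) \<Rightarrow> (nat \<Rightarrow> real \<Rightarrow> real) \<Rightarrow> (nat \<Rightarrow> real poly) \<Rightarrow> bool" where
  "B_solution p r m l U V B \<longleftrightarrow>
     (\<forall>j\<le>r. B j = 0 \<or> degree (B j) < l j) \<and> (\<forall>j>r. B j = 0) \<and>
     (\<forall>i<p. \<forall>k<m i. (LINT t|lborel. t ^ k * V i t * (\<Sum>j\<le>r. poly (B j) t * U j t)) = 0)"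

definition unique_up_to_scalar :: "((nat \<Rightarrow> real poly) \<Rightarrow> bool) \<Rightarrow> bool" where
  "unique_up_to_scalar S \<longleftrightarrow>
     (\<exists>P. S P \<and> P \<noteq> (\<lambda>_. 0) \<and> (\<forall>Q. S Q \<longrightarrow> (\<exists>c. Q = (\<lambda>i. smult c (P i)))))"

subsection \<open>Direct and iterated limits\<close>

definition iterated_limit :: "(real \<Rightarrow> real \<Rightarrow> real) \<Rightarrow> real \<Rightarrow> bool" where
  "iterated_limit f L \<longleftrightarrow>
     (\<exists>g. (\<forall>\<^sub>F \<tau> in at_top. (f \<tau> \<longlongrightarrow> g \<tau>) at_top) \<and> (g \<longlongrightarrow> L) at_top)"

text \<open>
  Integrability is demanded along with convergence of the integrals, because a non-integrable
  function has the integral 0 by convention.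
\<close>

definition direct_integral_limit :: "(real \<Rightarrow> real \<Rightarrow> real) \<Rightarrow> real \<Rightarrow> bool" where
  "direct_integral_limit f L \<longleftrightarrow>
     (\<forall>\<^sub>F \<tau> in at_top. integrable lborel (f \<tau>)) \<and>
     ((\<lambda>\<tau>. LINT t|lborel. f \<tau> t) \<longlongrightarrow> L) at_top"

definition iterated_integral_limit :: "(real \<Rightarrow> real \<Rightarrow> real \<Rightarrow> real) \<Rightarrow> real \<Rightarrow> bool" where
  "iterated_integral_limit f L \<longleftrightarrow>
     (\<forall>\<^sub>F \<tau> in at_top. \<forall>\<^sub>F \<kappa> in at_top. integrable lborel (f \<tau> \<kappa>)) \<and>
     iterated_limit (\<lambda>\<tau> \<kappa>. LINT t|lborel. f \<tau> \<kappa> t) L"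

text \<open>
  \<open>S \<tau>\<close>, respectively \<open>S \<tau> \<kappa>\<close>, is the property of being a solution at finite parameters. The
  solution whose coefficient of degree \<open>k\<^sub>0\<close> in component \<open>i\<^sub>0\<close> is one exists and is unique for large
  parameters, and it converges coefficientwise to \<open>P\<close>.
\<close>

definition direct_vector_limit ::
  "(real \<Rightarrow> (nat \<Rightarrow> real poly) \<Rightarrow> bool) \<Rightarrow> nat \<Rightarrow> nat \<Rightarrow> (nat \<Rightarrow> real poly) \<Rightarrow> bool" where
  "direct_vector_limit S i\<^sub>0 k\<^sub>0 P \<longleftrightarrow>
     (\<forall>\<^sub>F \<tau> in at_top. \<exists>!Q. S \<tau> Q \<and> coeff (Q i\<^sub>0) k\<^sub>0 = 1) \<and>
     (\<forall>Q. (\<forall>\<^sub>F \<tau> in at_top. S \<tau> (Q \<tau>) \<and> coeff (Q \<tau> i\<^sub>0) k\<^sub>0 = 1) \<longrightarrow>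
        (\<forall>i k. ((\<lambda>\<tau>. coeff (Q \<tau> i) k) \<longlongrightarrow> coeff (P i) k) at_top))"

definition iterated_vector_limit ::
  "(real \<Rightarrow> real \<Rightarrow> (nat \<Rightarrow> real poly) \<Rightarrow> bool) \<Rightarrow> nat \<Rightarrow> nat \<Rightarrow> (nat \<Rightarrow> real poly) \<Rightarrow> bool" where
  "iterated_vector_limit S i\<^sub>0 k\<^sub>0 P \<longleftrightarrow>
     (\<forall>\<^sub>F \<tau> in at_top. \<forall>\<^sub>F \<kappa> in at_top. \<exists>!Q. S \<tau> \<kappa> Q \<and> coeff (Q i\<^sub>0) k\<^sub>0 = 1) \<and>
     (\<forall>Q. (\<forall>\<^sub>F \<tau> in at_top. \<forall>\<^sub>F \<kappa> in at_top. S \<tau> \<kappa> (Q \<tau> \<kappa>) \<and> coeff (Q \<tau> \<kappa> i\<^sub>0) k\<^sub>0 = 1) \<longrightarrow>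
        (\<forall>i k. iterated_limit (\<lambda>\<tau> \<kappa>. coeff (Q \<tau> \<kappa> i) k) (coeff (P i) k)))"

end

theory Submission
  imports Defs "HOL-Probability.Distributions" "HOL-Real_Asymp.Real_Asymp" "Jordan_Normal_Form.Determinant"
begin

text \<open>
  With \<open>x = exp (\<epsilon> * T)\<close> the Mellin transform of a scaled Jacobi row becomes the Laplace transform of
  a positive measure in \<open>T\<close>; it is a product of Gamma quotients, which along each route converges
  pointwise near \<open>\<xi> i\<close> to the Laplace transform of the Hermite row. Pointwise convergence suffices:
  a moment of order \<open>v\<close> is the value of the transform on an exponential polynomial whose distance
  to \<open>t ^ v * exp (\<xi> i * t)\<close> is at most a small multiple of
  \<open>exp ((\<xi> i + \<delta>) * t) + exp ((\<xi> i - \<delta>) * t)\<close>. Only the positivity of the functional enters, and it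
  passes to pointwise limits, so the Laguerre limits need not be identified as measures.

  By Cramer's rule the normalized solutions depend continuously on the moments as soon as the
  Hermite problem has a one-dimensional solution space. The transform of
  \<open>\<Sum>j\<le>r. B j * U j\<close> is \<open>\<Phi> * P / (\<Prod>h<r. (s + \<rho> h) ^ l h)\<close> with a polynomial \<open>P\<close> of degree less
  than \<open>\<Sum>j\<le>r. l j\<close>, because the entries of \<open>l\<close> differ by at most one. As many zeros at the
  \<open>\<xi> i\<close> force \<open>P = 0\<close>, and then the coefficients of \<open>B\<close> vanish one after the other, by
  evaluating \<open>P\<close> at \<open>- \<rho> j\<close> or taking its leading coefficient. The \<open>A\<close>-problem is the transpose.
\<close>

subsection \<open>Square linear systems\<close>

text \<open>The substitution is \<open>T = c + ln (1 + \<epsilon> * (t - c)) / \<epsilon>\<close>.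
  It makes every column a constant exponential \<open>exp (s * T)\<close> and gives t back as an
  affine function of \<open>exp (\<epsilon> * T)\<close>. So t^v times a column is an exponential
  polynomial in T, and each moment at finite parameters is exactly a finite combination of Gamma
  products. The obstacle: these combinations contain powers of 1 / \<epsilon>, so convergence of the
  Gamma products alone does not control them as \<epsilon> tends to 0. The remedy is to compare,
  under one and the same positive functional, the shrinking step with a fixed small one. The
  iterated routes differ in where the step shrinks: on the first it is
  \<open>sqrt (2 / \<tau>)\<close>, constant in the inner limit; on the second it is
  \<open>sqrt (2 * \<tau>) / \<kappa>\<close>, so the inner limit already yields derivatives of the
  transform. In the kernel problem the moment conditions at \<open>\<xi> i\<close> concern
  successive derivatives of one function. The numerators of all these derivatives obey a common
  first-order recursion, which converts the conditions into a zero of order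
  \<open>m i\<close>.\<close>

definition sys_matrix :: "nat \<Rightarrow> (nat \<Rightarrow> 'i) \<Rightarrow> (nat \<Rightarrow> 'j) \<Rightarrow> ('i \<Rightarrow> 'j \<Rightarrow> real) \<Rightarrow> real mat" where
  "sys_matrix n e f G = Matrix.mat n n (\<lambda>(i, k). G (e i) (f k))"

text \<open>The enumerations \<open>e\<close> and \<open>f\<close> carry arbitrary index sets over
  to the numbers that \<open>det\<close> demands. For bijections their choice affects only a sign,
  which cancels in Cramer's quotients and in the test for zero.\<close>

definition sys_det :: "nat \<Rightarrow> (nat \<Rightarrow> 'i) \<Rightarrow> (nat \<Rightarrow> 'j) \<Rightarrow> ('i \<Rightarrow> 'j \<Rightarrow> real) \<Rightarrow> real" where
  "sys_det n e f G = Determinant.det (sys_matrix n e f G)"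

text \<open>The numerators in Cramer's rule.\<close>

definition sys_num :: "nat \<Rightarrow> (nat \<Rightarrow> 'i) \<Rightarrow> (nat \<Rightarrow> 'j) \<Rightarrow> ('i \<Rightarrow> real) \<Rightarrow> ('i \<Rightarrow> 'j \<Rightarrow> real) \<Rightarrow> 'j \<Rightarrow> real" where
  "sys_num n e f b G j =
     Determinant.det (replace_col (sys_matrix n e f G) (Matrix.vec n (\<lambda>i. b (e i))) (inv_into {..<n} f j))"

lemma sys_matrix_carrier [simp]: "sys_matrix n e f G \<in> carrier_mat n n"
  by (simp add: sys_matrix_def)

text \<open>By the Leibniz formula the determinant is a finite sum of products of entries.\<close>

lemma tendsto_det:
  fixes A :: "'x \<Rightarrow> real mat"
  assumes "\<And>x. A x \<in> carrier_mat n n" "B \<in> carrier_mat n n"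
    and "\<And>i k. i < n \<Longrightarrow> k < n \<Longrightarrow> ((\<lambda>x. A x $$ (i, k)) \<longlongrightarrow> B $$ (i, k)) F"
  shows "((\<lambda>x. Determinant.det (A x)) \<longlongrightarrow> Determinant.det B) F"
proof -
  have "((\<lambda>x. \<Sum>\<pi> | \<pi> permutes {0..<n}. signof \<pi> * (\<Prod>i = 0..<n. A x $$ (i, \<pi> i)))
      \<longlongrightarrow> (\<Sum>\<pi> | \<pi> permutes {0..<n}. signof \<pi> * (\<Prod>i = 0..<n. B $$ (i, \<pi> i)))) F"
    by (intro tendsto_sum tendsto_mult tendsto_const tendsto_prod assms(3))
       (auto dest: permutes_in_image)
  then show ?thesis
    by (simp add: det_def'[OF assms(1)] det_def'[OF assms(2)])
qed

context
  fixes n :: nat and e :: "nat \<Rightarrow> 'i" and f :: "nat \<Rightarrow> 'j" and I :: "'i set" and J :: "'j set"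
  assumes e: "bij_betw e {..<n} I" and f: "bij_betw f {..<n} J"
begin

lemma tendsto_sys_det:
  assumes "\<And>i j. i \<in> I \<Longrightarrow> j \<in> J \<Longrightarrow> ((\<lambda>x. G x i j) \<longlongrightarrow> G0 i j) F"
  shows "((\<lambda>x. sys_det n e f (G x)) \<longlongrightarrow> sys_det n e f G0) F"
  unfolding sys_det_def
  by (rule tendsto_det[where n = n])
     (use e f in \<open>auto simp: sys_matrix_def bij_betw_def intro!: assms\<close>)

lemma tendsto_sys_num:
  assumes "\<And>i j. i \<in> I \<Longrightarrow> j \<in> J \<Longrightarrow> ((\<lambda>x. G x i j) \<longlongrightarrow> G0 i j) F"
  shows "((\<lambda>x. sys_num n e f b (G x) j) \<longlongrightarrow> sys_num n e f b G0 j) F"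
  unfolding sys_num_def
  by (rule tendsto_det[where n = n])
     (use e f in \<open>auto simp: replace_col_def sys_matrix_def bij_betw_def intro!: assms\<close>)

lemma sys_mult_vec_index:
  assumes "k < n"
  shows "Matrix.vec_index (sys_matrix n e f G *\<^sub>v Matrix.vec n (\<lambda>k. x (f k))) k = (\<Sum>j\<in>J. G (e k) j * x j)"
proof -
  have "(\<Sum>j\<in>J. G (e k) j * x j) = (\<Sum>i<n. G (e k) (f i) * x (f i))"
    by (rule sum.reindex_bij_betw[OF f, symmetric])
  then show ?thesis
    using assms by (simp add: sys_matrix_def scalar_prod_def atLeast0LessThan)
qed

lemma sys_iff_mult_vec:
  "(\<forall>i\<in>I. (\<Sum>j\<in>J. G i j * x j) = b i) \<longleftrightarrow>
    sys_matrix n e f G *\<^sub>v Matrix.vec n (\<lambda>k. x (f k)) = Matrix.vec n (\<lambda>k. b (e k))"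
    (is "?L \<longleftrightarrow> ?A *\<^sub>v ?x = ?b")
proof -
  have "?L \<longleftrightarrow> (\<forall>k<n. (\<Sum>j\<in>J. G (e k) j * x j) = b (e k))"
    using e by (auto simp: bij_betw_def)
  also have "\<dots> \<longleftrightarrow> (\<forall>k<n. Matrix.vec_index (?A *\<^sub>v ?x) k = Matrix.vec_index ?b k)"
    by (simp only: sys_mult_vec_index index_vec cong: imp_cong)
  also have "\<dots> \<longleftrightarrow> ?A *\<^sub>v ?x = ?b"
  proof
    assume *: "\<forall>k<n. Matrix.vec_index (?A *\<^sub>v ?x) k = Matrix.vec_index ?b k"
    show "?A *\<^sub>v ?x = ?b"
      by (rule eq_vecI) (use * in \<open>simp_all add: sys_matrix_def del: index_mult_mat_vec\<close>)
  qed simp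
  finally show ?thesis .
qed

lemma vec_eq_reindex:
  assumes "v \<in> carrier_vec n"
  obtains x where "v = Matrix.vec n (\<lambda>k. x (f k))"
proof
  show "v = Matrix.vec n (\<lambda>k. (\<lambda>j. Matrix.vec_index v (inv_into {..<n} f j)) (f k))"
    using assms f by (auto simp: bij_betw_def inv_into_f_f)
qed

lemma sys_det_eq_0_iff:
  "sys_det n e f G = 0 \<longleftrightarrow> (\<exists>x. (\<exists>j\<in>J. x j \<noteq> 0) \<and> (\<forall>i\<in>I. (\<Sum>j\<in>J. G i j * x j) = 0))"
proof -
  have nz: "Matrix.vec n (\<lambda>k. x (f k)) \<noteq> 0\<^sub>v n \<longleftrightarrow> (\<exists>j\<in>J. x j \<noteq> 0)" for x :: "'j \<Rightarrow> real"
    using f by (auto simp: bij_betw_def vec_eq_iff)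
  have "sys_det n e f G = 0 \<longleftrightarrow>
    (\<exists>v. v \<in> carrier_vec n \<and> v \<noteq> 0\<^sub>v n \<and> sys_matrix n e f G *\<^sub>v v = 0\<^sub>v n)"
    unfolding sys_det_def by (rule det_0_iff_vec_prod_zero) simp
  also have "\<dots> \<longleftrightarrow> (\<exists>x. Matrix.vec n (\<lambda>k. x (f k)) \<noteq> 0\<^sub>v n \<and>
      sys_matrix n e f G *\<^sub>v Matrix.vec n (\<lambda>k. x (f k)) = 0\<^sub>v n)"
    by (metis vec_eq_reindex vec_carrier)
  also have "\<dots> \<longleftrightarrow> (\<exists>x. (\<exists>j\<in>J. x j \<noteq> 0) \<and> (\<forall>i\<in>I. (\<Sum>j\<in>J. G i j * x j) = 0))"
    unfolding nz sys_iff_mult_vec[where b = "\<lambda>_. 0"] by (simp add: zero_vec_def)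
  finally show ?thesis .
qed

text \<open>Cramer's rule as an equivalence: any solution has the stated form, and the adjugate
  shows that one exists, so the stated form is a solution.\<close>

lemma sys_solution_iff:
  assumes "sys_det n e f G \<noteq> 0"
  shows "(\<forall>i\<in>I. (\<Sum>j\<in>J. G i j * x j) = b i) \<longleftrightarrow> (\<forall>j\<in>J. x j = sys_num n e f b G j / sys_det n e f G)"
proof -
  define A where "A = sys_matrix n e f G"
  have A: "A \<in> carrier_mat n n" by (simp add: A_def)
  have D: "Determinant.det A \<noteq> 0" using assms by (simp add: A_def sys_det_def)
  have cramer: "\<forall>j\<in>J. x j = sys_num n e f b G j / sys_det n e f G"
    if "\<forall>i\<in>I. (\<Sum>j\<in>J. G i j * x j) = b i" for x
  proof
    fix j assume "j \<in> J"
    then obtain k where k: "k < n" "j = f k" using f by (auto simp: bij_betw_def)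
    have "Determinant.det (replace_col A (A *\<^sub>v Matrix.vec n (\<lambda>k. x (f k))) k)
        = Matrix.vec_index (Matrix.vec n (\<lambda>k. x (f k))) k * Determinant.det A"
      by (rule cramer_lemma_mat[OF A _ k(1)]) simp
    moreover have "A *\<^sub>v Matrix.vec n (\<lambda>k. x (f k)) = Matrix.vec n (\<lambda>k. b (e k))"
      using that sys_iff_mult_vec unfolding A_def by blast
    moreover have "inv_into {..<n} f j = k"
      using f k by (auto simp: bij_betw_def inv_into_f_f)
    ultimately show "x j = sys_num n e f b G j / sys_det n e f G"
      using D k by (simp add: sys_num_def sys_det_def A_def field_simps)
  qed
  \<comment> \<open>So far it is only known what a solution must look like; the adjugate supplies
    one.\<close>
  define v where "v = (1 / Determinant.det A) \<cdot>\<^sub>v (adj_mat A *\<^sub>v Matrix.vec n (\<lambda>k. b (e k)))"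
  have v: "v \<in> carrier_vec n" using A adj_mat(1)[OF A] by (simp add: v_def)
  have "A *\<^sub>v v = (1 / Determinant.det A) \<cdot>\<^sub>v (A *\<^sub>v (adj_mat A *\<^sub>v Matrix.vec n (\<lambda>k. b (e k))))"
    unfolding v_def using A adj_mat(1)[OF A] by (intro mult_mat_vec[OF A]) auto
  also have "A *\<^sub>v (adj_mat A *\<^sub>v Matrix.vec n (\<lambda>k. b (e k)))
      = (A * adj_mat A) *\<^sub>v Matrix.vec n (\<lambda>k. b (e k))"
    by (rule assoc_mult_mat_vec[symmetric, OF A adj_mat(1)[OF A]]) simp
  also have "(1 / Determinant.det A) \<cdot>\<^sub>v \<dots> = Matrix.vec n (\<lambda>k. b (e k))"
    unfolding adj_mat(2)[OF A] using D by (auto intro!: eq_vecI simp: scalar_prod_def if_distrib if_distribR cong: if_cong)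
  finally have "A *\<^sub>v v = Matrix.vec n (\<lambda>k. b (e k))" .
  moreover obtain y where y: "v = Matrix.vec n (\<lambda>k. y (f k))" using vec_eq_reindex[OF v] .
  ultimately have sol: "\<forall>i\<in>I. (\<Sum>j\<in>J. G i j * y j) = b i"
    using sys_iff_mult_vec unfolding A_def by blast
  show ?thesis
  proof
    assume "\<forall>j\<in>J. x j = sys_num n e f b G j / sys_det n e f G"
    then have "\<forall>j\<in>J. x j = y j" using cramer[OF sol] by simp
    then show "\<forall>i\<in>I. (\<Sum>j\<in>J. G i j * x j) = b i" using sol by simp
  qed (rule cramer)
qed

end

lemma sys_det_transpose: "sys_det n f e (\<lambda>j i. G i j) = sys_det n e f G"
proof -
  have "sys_matrix n f e (\<lambda>j i. G i j) = transpose_mat (sys_matrix n e f G)"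
    by (auto simp: sys_matrix_def)
  then show ?thesis by (simp add: sys_det_def Determinant.det_transpose[OF sys_matrix_carrier])
qed

subsection \<open>Vectors of polynomials solving moment equations\<close>

text \<open>One index set for two purposes: pairs (component, degree) of the free coefficients of a
  polynomial vector, and pairs (row, power of t) of the moment equations.\<close>

definition cells :: "nat \<Rightarrow> (nat \<Rightarrow> nat) \<Rightarrow> (nat \<times> nat) set" where
  "cells P m = (SIGMA i:{..<P}. {..<m i})"

definition deg_vec :: "nat \<Rightarrow> (nat \<Rightarrow> nat) \<Rightarrow> (nat \<Rightarrow> real poly) \<Rightarrow> bool" where
  "deg_vec P m Q \<longleftrightarrow> (\<forall>i<P. Q i = 0 \<or> degree (Q i) < m i) \<and> (\<forall>i\<ge>P. Q i = 0)"

text \<open>The common form of both mixed problems, with \<open>M j i v\<close> the moment of order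
  v of the pair of row j and column i. The A-problem reads it as it stands; the B-problem exchanges
  (\<open>P\<close>, \<open>m\<close>) with (\<open>R\<close>, \<open>l\<close>) and transposes
  \<open>M\<close>.\<close>

definition poly_sol ::
  "nat \<Rightarrow> (nat \<Rightarrow> nat) \<Rightarrow> nat \<Rightarrow> (nat \<Rightarrow> nat) \<Rightarrow> (nat \<Rightarrow> nat \<Rightarrow> nat \<Rightarrow> real) \<Rightarrow> (nat \<Rightarrow> real poly) \<Rightarrow> bool" where
  "poly_sol P m R l M Q \<longleftrightarrow>
     deg_vec P m Q \<and> (\<forall>j<R. \<forall>k<l j. (\<Sum>i<P. \<Sum>n<m i. coeff (Q i) n * M j i (k + n)) = 0)"

definition of_cells :: "nat \<Rightarrow> (nat \<Rightarrow> nat) \<Rightarrow> (nat \<times> nat \<Rightarrow> real) \<Rightarrow> nat \<Rightarrow> real poly" where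
  "of_cells P m x i = (if i < P then \<Sum>n<m i. monom (x (i, n)) n else 0)"

definition moment_entry :: "(nat \<Rightarrow> nat \<Rightarrow> nat \<Rightarrow> real) \<Rightarrow> nat \<times> nat \<Rightarrow> nat \<times> nat \<Rightarrow> real" where
  "moment_entry M e c = M (fst e) (fst c) (snd e + snd c)"

text \<open>The moment equations together with one normalizing equation, given by the row \<open>\<phi>\<close>.\<close>

definition normalized_rows :: "nat \<Rightarrow> (nat \<Rightarrow> nat) \<Rightarrow> (nat \<times> nat) option set" where
  "normalized_rows R l = insert None (Some ` cells R l)"

definition normalized_matrix ::
  "(nat \<times> nat \<Rightarrow> real) \<Rightarrow> (nat \<Rightarrow> nat \<Rightarrow> nat \<Rightarrow> real) \<Rightarrow> (nat \<times> nat) option \<Rightarrow> nat \<times> nat \<Rightarrow> real" where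
  "normalized_matrix \<phi> M e c = (case e of None \<Rightarrow> \<phi> c | Some e' \<Rightarrow> moment_entry M e' c)"

lemma finite_cells [simp]: "finite (cells P m)"
  by (simp add: cells_def)

lemma card_cells: "card (cells P m) = (\<Sum>i<P. m i)"
  by (simp add: cells_def)

lemma sum_cells: "(\<Sum>c\<in>cells P m. g c) = (\<Sum>i<P. \<Sum>n<m i. g (i, n))"
  unfolding cells_def by (simp add: sum.Sigma)

lemma coeff_of_cells: "coeff (of_cells P m x i) n = (if (i, n) \<in> cells P m then x (i, n) else 0)"
  by (simp add: of_cells_def cells_def coeff_sum)

text \<open>The degree bound becomes a linear condition on coefficients, so that no case distinction
  for the zero polynomial remains.\<close>

lemma deg_vec_iff: "deg_vec P m Q \<longleftrightarrow> (\<forall>i n. (i, n) \<notin> cells P m \<longrightarrow> coeff (Q i) n = 0)"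
proof
  assume "deg_vec P m Q"
  then show "\<forall>i n. (i, n) \<notin> cells P m \<longrightarrow> coeff (Q i) n = 0"
    unfolding deg_vec_def cells_def
    by (metis SigmaI coeff_0 coeff_eq_0 lessThan_iff not_le_imp_less order_less_le_trans)
next
  assume *: "\<forall>i n. (i, n) \<notin> cells P m \<longrightarrow> coeff (Q i) n = 0"
  have "degree (Q i) < m i" if "Q i \<noteq> 0" for i
  proof -
    have "coeff (Q i) (degree (Q i)) \<noteq> 0" using that by simp
    then have "(i, degree (Q i)) \<in> cells P m" using * by blast
    then show ?thesis by (simp add: cells_def)
  qed
  moreover have "Q i = 0" if "i \<ge> P" for i
    using * that by (intro poly_eqI) (simp add: cells_def)
  ultimately show "deg_vec P m Q" by (auto simp: deg_vec_def)
qed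

lemma deg_vec_of_cells: "deg_vec P m (of_cells P m x)"
  by (simp add: deg_vec_iff coeff_of_cells)

lemma of_cells_coeff:
  assumes "deg_vec P m Q"
  shows "of_cells P m (\<lambda>c. coeff (Q (fst c)) (snd c)) = Q"
  using assms by (intro ext poly_eqI) (simp add: coeff_of_cells deg_vec_iff)

lemma poly_sol_iff:
  "poly_sol P m R l M Q \<longleftrightarrow> deg_vec P m Q \<and>
     (\<forall>e\<in>cells R l. (\<Sum>c\<in>cells P m. moment_entry M e c * coeff (Q (fst c)) (snd c)) = 0)"
proof -
  have "(\<Sum>i<P. \<Sum>n<m i. coeff (Q i) n * M j i (k + n)) =
    (\<Sum>c\<in>cells P m. moment_entry M (j, k) c * coeff (Q (fst c)) (snd c))" for j k
    by (simp add: sum_cells moment_entry_def mult.commute)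
  moreover have "(\<forall>e\<in>cells R l. X e) \<longleftrightarrow> (\<forall>j<R. \<forall>k<l j. X (j, k))" for X
    by (auto simp: cells_def)
  ultimately show ?thesis by (simp add: poly_sol_def)
qed

lemma poly_sol_of_cells:
  "poly_sol P m R l M (of_cells P m x) \<longleftrightarrow>
     (\<forall>e\<in>cells R l. (\<Sum>c\<in>cells P m. moment_entry M e c * x c) = 0)"
  by (simp add: poly_sol_iff deg_vec_of_cells coeff_of_cells cong: sum.cong)

lemma of_cells_eq_0_iff: "of_cells P m x = (\<lambda>_. 0) \<longleftrightarrow> (\<forall>c\<in>cells P m. x c = 0)"
proof
  assume 0: "of_cells P m x = (\<lambda>_. 0)"
  show "\<forall>c\<in>cells P m. x c = 0"
  proof
    fix c assume "c \<in> cells P m"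
    then have "x c = coeff (of_cells P m x (fst c)) (snd c)" by (simp add: coeff_of_cells)
    then show "x c = 0" by (simp add: 0)
  qed
next
  assume "\<forall>c\<in>cells P m. x c = 0"
  then show "of_cells P m x = (\<lambda>_. 0)"
    by (intro ext poly_eqI) (auto simp: coeff_of_cells)
qed

lemma poly_sol_combine:
  assumes "poly_sol P m R l M Q" "poly_sol P m R l M Q'"
  shows "poly_sol P m R l M (\<lambda>i. Q i - Polynomial.smult s (Q' i))"
proof -
  have *: "(\<Sum>c\<in>cells P m. moment_entry M e c * (coeff (Q (fst c)) (snd c) - s * coeff (Q' (fst c)) (snd c)))
    = (\<Sum>c\<in>cells P m. moment_entry M e c * coeff (Q (fst c)) (snd c))
      - s * (\<Sum>c\<in>cells P m. moment_entry M e c * coeff (Q' (fst c)) (snd c))" for e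
    by (simp add: sum_subtractf sum_distrib_left algebra_simps)
  show ?thesis
    using assms unfolding poly_sol_iff deg_vec_iff coeff_diff coeff_smult * by auto
qed

text \<open>There is one unknown more than there are moment equations; the normalizing equation
  makes the system square.\<close>

lemma normalized_enumerations:
  assumes "(\<Sum>i<P. m i) = (\<Sum>j<R. l j) + 1"
  obtains e f where "bij_betw e {..<card (cells P m)} (normalized_rows R l)"
    "bij_betw f {..<card (cells P m)} (cells P m)"
proof -
  have "card (Some ` cells R l) = card (cells R l)" by (rule card_image) simp
  then have "card (normalized_rows R l) = card (cells P m)"
    using assms by (simp add: card_cells normalized_rows_def card_insert_if image_iff)
  moreover have "finite (normalized_rows R l)" by (simp add: normalized_rows_def)
  ultimately show ?thesis
    using that ex_bij_betw_nat_finite[of "normalized_rows R l"] ex_bij_betw_nat_finite[of "cells P m"]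
    by (auto simp: atLeast0LessThan)
qed

lemma ball_normalized_rows:
  "(\<forall>e\<in>normalized_rows R l. (\<Sum>c\<in>cells P m. normalized_matrix \<phi> M e c * x c) = (case e of None \<Rightarrow> s | Some _ \<Rightarrow> 0)) \<longleftrightarrow>
     (\<Sum>c\<in>cells P m. \<phi> c * x c) = s \<and> poly_sol P m R l M (of_cells P m x)"
  by (simp add: normalized_rows_def normalized_matrix_def poly_sol_of_cells)

lemma sys_det_normalized_eq_0_iff:
  assumes "bij_betw e {..<n} (normalized_rows R l)" "bij_betw f {..<n} (cells P m)"
  shows "sys_det n e f (normalized_matrix \<phi> M) = 0 \<longleftrightarrow>
    (\<exists>Q. poly_sol P m R l M Q \<and> (\<Sum>c\<in>cells P m. \<phi> c * coeff (Q (fst c)) (snd c)) = 0 \<and> Q \<noteq> (\<lambda>_. 0))"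
    (is "_ \<longleftrightarrow> (\<exists>Q. ?S Q)")
proof -
  have 0: "(case e of None \<Rightarrow> 0 | Some _ \<Rightarrow> 0) = (0::real)" for e :: "(nat \<times> nat) option"
    by (cases e) auto
  have "sys_det n e f (normalized_matrix \<phi> M) = 0 \<longleftrightarrow>
    (\<exists>x. (\<exists>c\<in>cells P m. x c \<noteq> 0) \<and>
      (\<forall>e\<in>normalized_rows R l. (\<Sum>c\<in>cells P m. normalized_matrix \<phi> M e c * x c) = 0))"
    by (rule sys_det_eq_0_iff[OF assms])
  also have "\<dots> \<longleftrightarrow> (\<exists>x. ?S (of_cells P m x))"
  proof (rule ex_cong1)
    fix x :: "nat \<times> nat \<Rightarrow> real"
    have "(\<Sum>c\<in>cells P m. \<phi> c * coeff (of_cells P m x (fst c)) (snd c)) = (\<Sum>c\<in>cells P m. \<phi> c * x c)"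
      by (simp add: coeff_of_cells cong: sum.cong)
    then show "(\<exists>c\<in>cells P m. x c \<noteq> 0) \<and>
      (\<forall>e\<in>normalized_rows R l. (\<Sum>c\<in>cells P m. normalized_matrix \<phi> M e c * x c) = 0) \<longleftrightarrow> ?S (of_cells P m x)"
      unfolding ball_normalized_rows[where s = 0 and x = x, unfolded 0] of_cells_eq_0_iff by metis
  qed
  also have "\<dots> \<longleftrightarrow> (\<exists>Q. ?S Q)"
  proof
    assume "\<exists>Q. ?S Q"
    then obtain Q where Q: "?S Q" by blast
    then have "of_cells P m (\<lambda>c. coeff (Q (fst c)) (snd c)) = Q"
      by (intro of_cells_coeff) (simp add: poly_sol_def)
    then show "\<exists>x. ?S (of_cells P m x)" using Q by (intro exI[of _ "\<lambda>c. coeff (Q (fst c)) (snd c)"]) simp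
  qed blast
  finally show ?thesis .
qed

lemma normalized_solution_iff:
  assumes ef: "bij_betw e {..<n} (normalized_rows R l)" "bij_betw f {..<n} (cells P m)"
    and D: "sys_det n e f (normalized_matrix \<phi> M) \<noteq> 0"
  shows "poly_sol P m R l M Q \<and> (\<Sum>c\<in>cells P m. \<phi> c * coeff (Q (fst c)) (snd c)) = 1 \<longleftrightarrow>
    Q = of_cells P m (\<lambda>c. sys_num n e f (case_option 1 (\<lambda>_. 0)) (normalized_matrix \<phi> M) c /
      sys_det n e f (normalized_matrix \<phi> M))" (is "?L \<longleftrightarrow> Q = of_cells P m ?y")
proof -
  have iff: "(\<Sum>c\<in>cells P m. \<phi> c * x c) = 1 \<and> poly_sol P m R l M (of_cells P m x) \<longleftrightarrow>
      (\<forall>c\<in>cells P m. x c = ?y c)" for x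
    unfolding ball_normalized_rows[symmetric] by (rule sys_solution_iff[OF ef D])
  show ?thesis
  proof
    assume L: ?L
    then have Q: "of_cells P m (\<lambda>c. coeff (Q (fst c)) (snd c)) = Q"
      by (intro of_cells_coeff) (simp add: poly_sol_def)
    then have "\<forall>c\<in>cells P m. coeff (Q (fst c)) (snd c) = ?y c"
      using L by (subst iff[symmetric]) auto
    then have "of_cells P m (\<lambda>c. coeff (Q (fst c)) (snd c)) = of_cells P m ?y"
      by (intro ext poly_eqI) (auto simp: coeff_of_cells)
    then show "Q = of_cells P m ?y" using Q by simp
  next
    assume "Q = of_cells P m ?y"
    then show ?L
      using iff[of ?y] by (simp add: coeff_of_cells cong: sum.cong)
  qed
qed

text \<open>\<phi> is a linear functional that is injective on the solution space, so the bordered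
  system is invertible and has a solution \<open>Q\<close> of value 1. Any solution
  \<open>Q'\<close> minus its \<phi>-value times \<open>Q\<close> is a solution of value 0, hence
  zero.\<close>

lemma unique_up_to_scalar_poly_sol:
  assumes card: "(\<Sum>i<P. m i) = (\<Sum>j<R. l j) + 1"
    and triv: "\<And>Q. poly_sol P m R l M Q \<Longrightarrow>
      (\<Sum>c\<in>cells P m. \<phi> c * coeff (Q (fst c)) (snd c)) = 0 \<Longrightarrow> Q = (\<lambda>_. 0)"
  shows "unique_up_to_scalar (poly_sol P m R l M)"
proof -
  define \<Phi> where "\<Phi> Q = (\<Sum>c\<in>cells P m. \<phi> c * coeff (Q (fst c)) (snd c))" for Q
  obtain e f where ef: "bij_betw e {..<card (cells P m)} (normalized_rows R l)"
    "bij_betw f {..<card (cells P m)} (cells P m)"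
    using normalized_enumerations[OF card] .
  have "sys_det (card (cells P m)) e f (normalized_matrix \<phi> M) \<noteq> 0"
    using sys_det_normalized_eq_0_iff[OF ef] triv by blast
  then obtain Q where Q: "poly_sol P m R l M Q" "\<Phi> Q = 1"
    using normalized_solution_iff[OF ef] unfolding \<Phi>_def by blast
  have "\<exists>s. Q' = (\<lambda>i. Polynomial.smult s (Q i))" if Q': "poly_sol P m R l M Q'" for Q'
  proof
    have "\<Phi> (\<lambda>i. Q' i - Polynomial.smult (\<Phi> Q') (Q i)) = \<Phi> Q' - \<Phi> Q' * \<Phi> Q"
      unfolding \<Phi>_def by (simp add: sum_subtractf sum_distrib_left algebra_simps)
    then have "\<Phi> (\<lambda>i. Q' i - Polynomial.smult (\<Phi> Q') (Q i)) = 0" using Q by simp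
    then have "(\<lambda>i. Q' i - Polynomial.smult (\<Phi> Q') (Q i)) = (\<lambda>_. 0)"
      using poly_sol_combine[OF Q' Q(1)] triv unfolding \<Phi>_def by blast
    then show "Q' = (\<lambda>i. Polynomial.smult (\<Phi> Q') (Q i))"
      by (metis (no_types, lifting) ext eq_iff_diff_eq_0)
  qed
  moreover have "Q \<noteq> (\<lambda>_. 0)" using Q(2) by (auto simp: \<Phi>_def)
  ultimately show ?thesis using Q(1) unfolding unique_up_to_scalar_def by blast
qed

text \<open>In the square case the moment matrix and its transpose are singular together. This
  carries the triviality of the kernel from the B-problem over to the A-problem.\<close>

lemma poly_sol_transpose:
  assumes card: "(\<Sum>i<P. m i) = (\<Sum>j<R. l j)"
    and triv: "\<And>Q. poly_sol R l P m (\<lambda>i j. M j i) Q \<Longrightarrow> Q = (\<lambda>_. 0)"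
    and Q: "poly_sol P m R l M Q"
  shows "Q = (\<lambda>_. 0)"
proof (rule ccontr)
  assume nz: "Q \<noteq> (\<lambda>_. 0)"
  define n where "n = card (cells P m)"
  obtain f where f: "bij_betw f {..<n} (cells P m)"
    using ex_bij_betw_nat_finite[OF finite_cells[of P m]] by (auto simp: n_def atLeast0LessThan)
  have "n = card (cells R l)" using card by (simp add: card_cells n_def)
  then obtain e where e: "bij_betw e {..<n} (cells R l)"
    using ex_bij_betw_nat_finite[OF finite_cells[of R l]] by (auto simp: atLeast0LessThan)
  have Qc: "of_cells P m (\<lambda>c. coeff (Q (fst c)) (snd c)) = Q"
    using Q by (intro of_cells_coeff) (simp add: poly_sol_def)
  have "sys_det n e f (moment_entry M) = 0"
    unfolding sys_det_eq_0_iff[OF e f]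
  proof (intro exI[of _ "\<lambda>c. coeff (Q (fst c)) (snd c)"] conjI)
    show "\<exists>c\<in>cells P m. coeff (Q (fst c)) (snd c) \<noteq> 0"
      using nz unfolding of_cells_eq_0_iff[of P m "\<lambda>c. coeff (Q (fst c)) (snd c)", unfolded Qc] by blast
  qed (use Q in \<open>simp add: poly_sol_iff\<close>)
  then have "sys_det n f e (\<lambda>c e. moment_entry M e c) = 0"
    using sys_det_transpose[of n f e "moment_entry M"] by argo
  then obtain y where y: "\<exists>e\<in>cells R l. y e \<noteq> 0"
    "\<forall>c\<in>cells P m. (\<Sum>e\<in>cells R l. moment_entry M e c * y e) = 0"
    unfolding sys_det_eq_0_iff[OF f e] by blast
  have "moment_entry (\<lambda>i j. M j i) c e = moment_entry M e c" for c e
    by (simp add: moment_entry_def add.commute)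
  then have "poly_sol R l P m (\<lambda>i j. M j i) (of_cells R l y)"
    using y by (simp add: poly_sol_of_cells)
  then have "of_cells R l y = (\<lambda>_. 0)" by (rule triv)
  then show False using y(1) of_cells_eq_0_iff by blast
qed

subsection \<open>Limits of normalized solutions\<close>

text \<open>\<open>D\<close> is the bordered determinant and \<open>S\<close> the vector of Cramer
  quotients, both as functions of the whole family of moments. The same pair serves the finite, the
  intermediate and the limiting system, so an iterated limit only needs the continuity
  twice.\<close>

lemma continuous_normalized_solution:
  assumes card: "(\<Sum>i<P. m i) = (\<Sum>j<R. l j) + 1"
    and uniq: "unique_up_to_scalar (poly_sol P m R l M0)"
    and Q0: "poly_sol P m R l M0 Q0" "coeff (Q0 i0) k0 = 1"
  obtains D S where "D M0 \<noteq> (0::real)" and "S M0 = Q0"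
    and "\<forall>M Q. D M \<noteq> 0 \<longrightarrow> (poly_sol P m R l M Q \<and> coeff (Q i0) k0 = 1 \<longleftrightarrow> Q = S M)"
    and "\<forall>M M'. (\<forall>j i v. j < R \<longrightarrow> i < P \<longrightarrow> ((\<lambda>x. M x j i v) \<longlongrightarrow> M' j i v) at_top) \<longrightarrow>
      ((\<lambda>x::real. D (M x)) \<longlongrightarrow> D M') at_top \<and>
      (D M' \<noteq> 0 \<longrightarrow> (\<forall>i k. ((\<lambda>x. coeff (S (M x) i) k) \<longlongrightarrow> coeff (S M' i) k) at_top))"
proof -
  define n where "n = card (cells P m)"
  \<comment> \<open>The bordering row reads off the coefficient that is normalized to one.\<close>
  define \<phi> where "\<phi> c = (if c = (i0, k0) then 1 else 0 :: real)" for c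
  obtain e f where ef: "bij_betw e {..<n} (normalized_rows R l)" "bij_betw f {..<n} (cells P m)"
    using normalized_enumerations[OF card] unfolding n_def .
  define D where "D M = sys_det n e f (normalized_matrix \<phi> M)" for M
  define S where "S M = of_cells P m (\<lambda>c. sys_num n e f (case_option 1 (\<lambda>_. 0)) (normalized_matrix \<phi> M) c / D M)" for M
  \<comment> \<open>Coefficients outside the cells vanish, whereas this one equals 1.\<close>
  have "(i0, k0) \<in> cells P m" using Q0 by (fastforce simp: poly_sol_def deg_vec_iff)
  then have \<phi>: "(\<Sum>c\<in>cells P m. \<phi> c * coeff (Q (fst c)) (snd c)) = coeff (Q i0) k0" for Q
    by (simp add: \<phi>_def if_distrib if_distribR sum.delta cong: if_cong)
  have sol: "poly_sol P m R l M Q \<and> coeff (Q i0) k0 = 1 \<longleftrightarrow> Q = S M" if "D M \<noteq> 0" for M Q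
    using normalized_solution_iff[OF ef that[unfolded D_def]] unfolding \<phi> D_def S_def .
  \<comment> \<open>All solutions are multiples of one vector whose coefficient at
    \<open>(i0, k0)\<close> is nonzero; a solution with coefficient 0 there is the zero
    vector.\<close>
  have D0: "D M0 \<noteq> 0"
  proof -
    have "Q = (\<lambda>_. 0)" if Q: "poly_sol P m R l M0 Q" "coeff (Q i0) k0 = 0" for Q
    proof -
      obtain Q1 where Q1: "\<And>Q. poly_sol P m R l M0 Q \<Longrightarrow> \<exists>s. Q = (\<lambda>i. Polynomial.smult s (Q1 i))"
        using uniq unfolding unique_up_to_scalar_def by blast
      obtain s where s: "Q = (\<lambda>i. Polynomial.smult s (Q1 i))" using Q1[OF Q(1)] by blast
      obtain s0 where s0: "Q0 = (\<lambda>i. Polynomial.smult s0 (Q1 i))" using Q1[OF Q0(1)] by blast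
      have "coeff (Q1 i0) k0 \<noteq> 0" using Q0(2) s0 by auto
      then have "s = 0" using s Q(2) by auto
      then show ?thesis using s by simp
    qed
    then show ?thesis unfolding D_def sys_det_normalized_eq_0_iff[OF ef] \<phi> by blast
  qed
  show thesis
  proof (rule that[of D S])
    show "D M0 \<noteq> 0" by (rule D0)
    show "S M0 = Q0" using sol[OF D0, of Q0] Q0 by simp
    show "\<forall>M Q. D M \<noteq> 0 \<longrightarrow> (poly_sol P m R l M Q \<and> coeff (Q i0) k0 = 1 \<longleftrightarrow> Q = S M)"
      using sol by blast
  next
    show "\<forall>M M'. (\<forall>j i v. j < R \<longrightarrow> i < P \<longrightarrow> ((\<lambda>x. M x j i v) \<longlongrightarrow> M' j i v) at_top) \<longrightarrow>
      ((\<lambda>x::real. D (M x)) \<longlongrightarrow> D M') at_top \<and>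
      (D M' \<noteq> 0 \<longrightarrow> (\<forall>i k. ((\<lambda>x. coeff (S (M x) i) k) \<longlongrightarrow> coeff (S M' i) k) at_top))"
    proof (intro allI impI)
    fix M :: "real \<Rightarrow> nat \<Rightarrow> nat \<Rightarrow> nat \<Rightarrow> real" and M'
    assume M: "\<forall>j i v. j < R \<longrightarrow> i < P \<longrightarrow> ((\<lambda>x. M x j i v) \<longlongrightarrow> M' j i v) at_top"
    have entry: "((\<lambda>x. normalized_matrix \<phi> (M x) e c) \<longlongrightarrow> normalized_matrix \<phi> M' e c) at_top"
      if "e \<in> normalized_rows R l" "c \<in> cells P m" for e c
      using that by (cases e) (auto simp: normalized_matrix_def normalized_rows_def moment_entry_def cells_def M)
    have D: "((\<lambda>x. D (M x)) \<longlongrightarrow> D M') at_top"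
      unfolding D_def by (rule tendsto_sys_det[OF ef entry])
    moreover have "((\<lambda>x. coeff (S (M x) i) k) \<longlongrightarrow> coeff (S M' i) k) at_top" if "D M' \<noteq> 0" for i k
      using that by (auto simp: S_def coeff_of_cells intro!: tendsto_divide tendsto_sys_num[OF ef entry] D)
    ultimately show "((\<lambda>x. D (M x)) \<longlongrightarrow> D M') at_top \<and>
      (D M' \<noteq> 0 \<longrightarrow> (\<forall>i k. ((\<lambda>x. coeff (S (M x) i) k) \<longlongrightarrow> coeff (S M' i) k) at_top))"
      by blast
    qed
  qed
qed

text \<open>The solution property \<open>T\<close> is compared with the moment equations only for
  large \<tau>: the equivalence rests on integrability of the moments, which is available only
  eventually.\<close>

lemma direct_vector_limit_poly_sol:
  assumes card: "(\<Sum>i<P. m i) = (\<Sum>j<R. l j) + 1"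
    and uniq: "unique_up_to_scalar (poly_sol P m R l M0)"
    and Q0: "poly_sol P m R l M0 Q0" "coeff (Q0 i0) k0 = 1"
    and lim: "\<And>j i v. j < R \<Longrightarrow> i < P \<Longrightarrow> ((\<lambda>\<tau>. M \<tau> j i v) \<longlongrightarrow> M0 j i v) at_top"
    and T: "\<forall>\<^sub>F \<tau> in at_top. \<forall>Q. T \<tau> Q \<longleftrightarrow> poly_sol P m R l (M \<tau>) Q"
  shows "direct_vector_limit T i0 k0 Q0"
proof -
  obtain D S where D0: "D M0 \<noteq> (0::real)" and S0: "S M0 = Q0"
    and sol: "\<forall>M Q. D M \<noteq> 0 \<longrightarrow> (poly_sol P m R l M Q \<and> coeff (Q i0) k0 = 1 \<longleftrightarrow> Q = S M)"
    and cont: "\<forall>M M'. (\<forall>j i v. j < R \<longrightarrow> i < P \<longrightarrow> ((\<lambda>x. M x j i v) \<longlongrightarrow> M' j i v) at_top) \<longrightarrow>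
      ((\<lambda>x::real. D (M x)) \<longlongrightarrow> D M') at_top \<and>
      (D M' \<noteq> 0 \<longrightarrow> (\<forall>i k. ((\<lambda>x. coeff (S (M x) i) k) \<longlongrightarrow> coeff (S M' i) k) at_top))"
    by (rule continuous_normalized_solution[OF card uniq Q0])
  note sol = sol[rule_format] and cont = cont[rule_format]
  note lims = cont[of M M0, OF lim]
  have "\<forall>\<^sub>F \<tau> in at_top. D (M \<tau>) \<noteq> 0"
    using tendsto_imp_eventually_ne[OF conjunct1[OF lims] D0] .
  then have ev: "\<forall>\<^sub>F \<tau> in at_top. \<forall>Q. T \<tau> Q \<and> coeff (Q i0) k0 = 1 \<longleftrightarrow> Q = S (M \<tau>)"
    using T
  proof eventually_elim
    case (elim \<tau>)
    show ?case using elim(2) sol[OF elim(1)] by blast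
  qed
  show ?thesis
    unfolding direct_vector_limit_def
  proof (intro conjI allI impI)
    show "\<forall>\<^sub>F \<tau> in at_top. \<exists>!Q. T \<tau> Q \<and> coeff (Q i0) k0 = 1"
      using ev by eventually_elim metis
    fix Q i k
    assume "\<forall>\<^sub>F \<tau> in at_top. T \<tau> (Q \<tau>) \<and> coeff (Q \<tau> i0) k0 = 1"
    with ev have "\<forall>\<^sub>F \<tau> in at_top. coeff (S (M \<tau>) i) k = coeff (Q \<tau> i) k"
      by eventually_elim metis
    moreover have "((\<lambda>\<tau>. coeff (S (M \<tau>) i) k) \<longlongrightarrow> coeff (Q0 i) k) at_top"
      using conjunct2[OF lims] D0 unfolding S0 by blast
    ultimately show "((\<lambda>\<tau>. coeff (Q \<tau> i) k) \<longlongrightarrow> coeff (Q0 i) k) at_top"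
      by (rule Lim_transform_eventually[rotated])
  qed
qed

text \<open>The outer limit makes the intermediate determinant \<open>D (M1 \<tau>)\<close> nonzero
  for large \<tau>; for each such \<tau> the inner limit makes \<open>D (M \<tau> \<kappa>)\<close>
  nonzero beyond a threshold for \<kappa> that depends on \<tau>.\<close>

lemma iterated_vector_limit_poly_sol:
  assumes card: "(\<Sum>i<P. m i) = (\<Sum>j<R. l j) + 1"
    and uniq: "unique_up_to_scalar (poly_sol P m R l M0)"
    and Q0: "poly_sol P m R l M0 Q0" "coeff (Q0 i0) k0 = 1"
    and lim: "\<And>j i v. j < R \<Longrightarrow> i < P \<Longrightarrow> ((\<lambda>\<tau>. M1 \<tau> j i v) \<longlongrightarrow> M0 j i v) at_top"
    and lim': "\<forall>\<^sub>F \<tau> in at_top. \<forall>j<R. \<forall>i<P. \<forall>v. ((\<lambda>\<kappa>. M \<tau> \<kappa> j i v) \<longlongrightarrow> M1 \<tau> j i v) at_top"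
    and T: "\<forall>\<^sub>F \<tau> in at_top. \<forall>\<^sub>F \<kappa> in at_top. \<forall>Q. T \<tau> \<kappa> Q \<longleftrightarrow> poly_sol P m R l (M \<tau> \<kappa>) Q"
  shows "iterated_vector_limit T i0 k0 Q0"
proof -
  obtain D S where D0: "D M0 \<noteq> (0::real)" and S0: "S M0 = Q0"
    and sol: "\<forall>M Q. D M \<noteq> 0 \<longrightarrow> (poly_sol P m R l M Q \<and> coeff (Q i0) k0 = 1 \<longleftrightarrow> Q = S M)"
    and cont: "\<forall>M M'. (\<forall>j i v. j < R \<longrightarrow> i < P \<longrightarrow> ((\<lambda>x. M x j i v) \<longlongrightarrow> M' j i v) at_top) \<longrightarrow>
      ((\<lambda>x::real. D (M x)) \<longlongrightarrow> D M') at_top \<and>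
      (D M' \<noteq> 0 \<longrightarrow> (\<forall>i k. ((\<lambda>x. coeff (S (M x) i) k) \<longlongrightarrow> coeff (S M' i) k) at_top))"
    by (rule continuous_normalized_solution[OF card uniq Q0])
  note sol = sol[rule_format] and cont = cont[rule_format]
  note lims = cont[of M1 M0, OF lim]
  have D1: "\<forall>\<^sub>F \<tau> in at_top. D (M1 \<tau>) \<noteq> 0"
    using tendsto_imp_eventually_ne[OF conjunct1[OF lims] D0] .
  have inner: "\<forall>\<^sub>F \<tau> in at_top. \<forall>\<^sub>F \<kappa> in at_top. D (M \<tau> \<kappa>) \<noteq> 0"
    using D1 lim'
  proof eventually_elim
    case (elim \<tau>)
    then show ?case
      using tendsto_imp_eventually_ne[of "\<lambda>\<kappa>. D (M \<tau> \<kappa>)"] cont[of "M \<tau>" "M1 \<tau>"] by blast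
  qed
  have ev: "\<forall>\<^sub>F \<tau> in at_top. \<forall>\<^sub>F \<kappa> in at_top. \<forall>Q. T \<tau> \<kappa> Q \<and> coeff (Q i0) k0 = 1 \<longleftrightarrow> Q = S (M \<tau> \<kappa>)"
    using inner T
  proof eventually_elim
    case (elim \<tau>)
    from elim show ?case
    proof eventually_elim
      case (elim \<kappa>)
      show ?case using elim(2) sol[OF elim(1)] by blast
    qed
  qed
  show ?thesis
    unfolding iterated_vector_limit_def
  proof (intro conjI allI impI)
    show "\<forall>\<^sub>F \<tau> in at_top. \<forall>\<^sub>F \<kappa> in at_top. \<exists>!Q. T \<tau> \<kappa> Q \<and> coeff (Q i0) k0 = 1"
      using ev
    proof eventually_elim
      case (elim \<tau>)
      then show ?case by eventually_elim metis
    qed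
    fix Q i k
    assume Q: "\<forall>\<^sub>F \<tau> in at_top. \<forall>\<^sub>F \<kappa> in at_top. T \<tau> \<kappa> (Q \<tau> \<kappa>) \<and> coeff (Q \<tau> \<kappa> i0) k0 = 1"
    have "\<forall>\<^sub>F \<tau> in at_top. ((\<lambda>\<kappa>. coeff (Q \<tau> \<kappa> i) k) \<longlongrightarrow> coeff (S (M1 \<tau>) i) k) at_top"
      using ev Q D1 lim'
    proof eventually_elim
      case (elim \<tau>)
      have "\<forall>\<^sub>F \<kappa> in at_top. coeff (S (M \<tau> \<kappa>) i) k = coeff (Q \<tau> \<kappa> i) k"
        using elim(1,2) by eventually_elim metis
      moreover have "((\<lambda>\<kappa>. coeff (S (M \<tau> \<kappa>) i) k) \<longlongrightarrow> coeff (S (M1 \<tau>) i) k) at_top"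
        using elim(3,4) cont[of "M \<tau>" "M1 \<tau>"] by blast
      ultimately show ?case by (rule Lim_transform_eventually[rotated])
    qed
    moreover have "((\<lambda>\<tau>. coeff (S (M1 \<tau>) i) k) \<longlongrightarrow> coeff (Q0 i) k) at_top"
      using conjunct2[OF lims] D0 unfolding S0 by blast
    ultimately show "iterated_limit (\<lambda>\<tau> \<kappa>. coeff (Q \<tau> \<kappa> i) k) (coeff (Q0 i) k)"
      unfolding iterated_limit_def by (intro exI[of _ "\<lambda>\<tau>. coeff (S (M1 \<tau>) i) k"] conjI)
  qed
qed

subsection \<open>The mixed problems as moment equations\<close>

lemma poly_altdef_lessThan:
  fixes Q :: "real poly"
  assumes "Q = 0 \<or> degree Q < n"
  shows "poly Q t = (\<Sum>k<n. coeff Q k * t ^ k)"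
proof -
  have "poly Q t = (\<Sum>k\<le>degree Q. coeff Q k * t ^ k)" by (rule poly_altdef)
  also have "\<dots> = (\<Sum>k<n. coeff Q k * t ^ k)"
  proof (cases "Q = 0")
    case False
    then have "degree Q < n" using assms by blast
    then show ?thesis by (intro sum.mono_neutral_left) (auto intro: coeff_eq_0)
  qed simp
  finally show ?thesis .
qed

lemma integral_poly_combination:
  fixes w :: "nat \<Rightarrow> real \<Rightarrow> real"
  assumes Q: "deg_vec P m Q" and int: "\<And>i v. i < P \<Longrightarrow> integrable lborel (\<lambda>t. t ^ v * w i t)"
  shows "(LINT t|lborel. t ^ k * (\<Sum>i<P. poly (Q i) t * w i t)) =
    (\<Sum>i<P. \<Sum>n<m i. coeff (Q i) n * (LINT t|lborel. t ^ (k + n) * w i t))"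
proof -
  have "t ^ k * (\<Sum>i<P. poly (Q i) t * w i t)
      = (\<Sum>i<P. \<Sum>n<m i. coeff (Q i) n * (t ^ (k + n) * w i t))" for t
  proof -
    have "(\<Sum>i<P. poly (Q i) t * w i t) = (\<Sum>i<P. (\<Sum>n<m i. coeff (Q i) n * t ^ n) * w i t)"
    proof (intro sum.cong refl)
      fix i assume "i \<in> {..<P}"
      then have "Q i = 0 \<or> degree (Q i) < m i" using Q by (simp add: deg_vec_def)
      then show "poly (Q i) t * w i t = (\<Sum>n<m i. coeff (Q i) n * t ^ n) * w i t"
        by (simp only: poly_altdef_lessThan)
    qed
    then show ?thesis
      by (simp add: sum_distrib_left sum_distrib_right power_add mult_ac)
  qed
  then have "(LINT t|lborel. t ^ k * (\<Sum>i<P. poly (Q i) t * w i t)) =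
    (LINT t|lborel. (\<Sum>i<P. \<Sum>n<m i. coeff (Q i) n * (t ^ (k + n) * w i t)))"
    by simp
  also have "\<dots> = (\<Sum>i<P. LINT t|lborel. (\<Sum>n<m i. coeff (Q i) n * (t ^ (k + n) * w i t)))"
    by (rule Bochner_Integration.integral_sum)
       (intro Bochner_Integration.integrable_sum integrable_mult_right int, simp)
  also have "\<dots> = (\<Sum>i<P. \<Sum>n<m i. LINT t|lborel. coeff (Q i) n * (t ^ (k + n) * w i t))"
    by (intro sum.cong refl Bochner_Integration.integral_sum integrable_mult_right int) simp
  also have "\<dots> = (\<Sum>i<P. \<Sum>n<m i. coeff (Q i) n * (LINT t|lborel. t ^ (k + n) * w i t))"
    by simp
  finally show ?thesis .
qed

context
  fixes p r :: nat and U V :: "nat \<Rightarrow> real \<Rightarrow> real"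
  assumes int: "\<And>j i v. j \<le> r \<Longrightarrow> i < p \<Longrightarrow> integrable lborel (\<lambda>t. t ^ v * (U j t * V i t))"
begin

lemma A_solution_iff_poly_sol:
  "A_solution p r m l U V Q \<longleftrightarrow>
    poly_sol p m (Suc r) l (\<lambda>j i v. LINT t|lborel. t ^ v * (U j t * V i t)) Q"
proof -
  have "(LINT t|lborel. t ^ k * U j t * (\<Sum>i<p. poly (Q i) t * V i t)) =
    (\<Sum>i<p. \<Sum>n<m i. coeff (Q i) n * (LINT t|lborel. t ^ (k + n) * (U j t * V i t)))"
    if "deg_vec p m Q" "j \<le> r" for j k
    using integral_poly_combination[OF that(1), of "\<lambda>i t. U j t * V i t" k] that int
    by (simp add: sum_distrib_left mult_ac)
  then have "deg_vec p m Q \<Longrightarrow> ?thesis"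
    by (simp add: A_solution_def poly_sol_def deg_vec_def less_Suc_eq_le)
  then show ?thesis
    by (auto simp: A_solution_def poly_sol_def deg_vec_def)
qed

lemma B_solution_iff_poly_sol:
  "B_solution p r m l U V Q \<longleftrightarrow>
    poly_sol (Suc r) l p m (\<lambda>i j v. LINT t|lborel. t ^ v * (U j t * V i t)) Q"
proof -
  have "(LINT t|lborel. t ^ k * V i t * (\<Sum>j\<le>r. poly (Q j) t * U j t)) =
    (\<Sum>j<Suc r. \<Sum>n<l j. coeff (Q j) n * (LINT t|lborel. t ^ (k + n) * (U j t * V i t)))"
    if "deg_vec (Suc r) l Q" "i < p" for i k
    using integral_poly_combination[OF that(1), of "\<lambda>j t. U j t * V i t" k] that int
    by (simp add: sum_distrib_left mult_ac lessThan_Suc_atMost)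
  then have "deg_vec (Suc r) l Q \<Longrightarrow> ?thesis"
    by (simp add: B_solution_def poly_sol_def deg_vec_def less_Suc_eq_le Suc_le_eq)
  then show ?thesis
    by (auto simp: B_solution_def poly_sol_def deg_vec_def less_Suc_eq_le Suc_le_eq)
qed

end

subsection \<open>Gamma quotients\<close>

text \<open>The increment ln x of \<open>ln_Gamma\<close> over [x, x + 1] is, by the mean value
  theorem, a value of \<open>Digamma\<close> in between; monotonicity and
  \<open>Digamma (x + 1) = Digamma x + 1 / x\<close> enclose it.\<close>

lemma Digamma_le_ln:
  fixes x :: real
  assumes "x > 0"
  shows "Digamma x \<le> ln x" "ln x - 1 / x \<le> Digamma x"
proof -
  obtain z where z: "x < z" "z < x + 1" "ln_Gamma (x + 1) - ln_Gamma x = (x + 1 - x) * Digamma z"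
    using MVT2[of x "x + 1" ln_Gamma Digamma] has_field_derivative_ln_Gamma_real assms
    by (metis less_add_one order_less_le_trans)
  have "ln_Gamma (x + 1) - ln_Gamma x = ln x"
    using assms Gamma_real_pos[OF assms]
    by (simp add: ln_Gamma_real_pos Gamma_plus1 ln_mult_pos nonpos_Ints_def)
  moreover have "Digamma x \<le> Digamma z" "Digamma z \<le> Digamma (x + 1)"
    using z assms by (auto intro!: Polygamma_real_mono)
  moreover have "Digamma (x + 1) = Digamma x + 1 / x" using assms by (intro Digamma_plus1) simp
  ultimately show "Digamma x \<le> ln x" "ln x - 1 / x \<le> Digamma x" using z(3) by auto
qed

text \<open>Stirling's formula in difference form: \<open>t * ln t - t\<close> is an antiderivative
  of \<open>ln\<close>, so the bound 1 / t for the distance of \<open>Digamma\<close> and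
  \<open>ln\<close> integrates to a bound for increments.\<close>

lemma ln_Gamma_diff_bound_aux:
  fixes u v :: real
  assumes "0 < u" "u \<le> v"
  shows "\<bar>ln_Gamma v - ln_Gamma u - ((v * ln v - v) - (u * ln u - u))\<bar> \<le> (v - u) / u"
proof -
  define F where "F t = ln_Gamma t - (t * ln t - t)" for t :: real
  have D: "(F has_real_derivative (Digamma t - ln t)) (at t)" if "t > 0" for t
    unfolding F_def using that by (auto intro!: derivative_eq_intros simp: field_simps)
  show ?thesis
  proof (cases "u = v")
    case False
    then have "u < v" using assms by simp
    then obtain z where z: "u < z" "z < v" "F v - F u = (v - u) * (Digamma z - ln z)"
      using MVT2[of u v F "\<lambda>t. Digamma t - ln t"] D assms by auto
    have "\<bar>Digamma z - ln z\<bar> \<le> 1 / z" using Digamma_le_ln[of z] z assms by auto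
    also have "\<dots> \<le> 1 / u" using z assms by (intro divide_left_mono) auto
    finally have "\<bar>F v - F u\<bar> \<le> (v - u) * (1 / u)"
      unfolding z(3) abs_mult using \<open>u < v\<close> by (intro mult_mono) auto
    then show ?thesis by (simp add: F_def algebra_simps)
  qed simp
qed

lemma ln_Gamma_diff_bound:
  fixes u v :: real
  assumes "0 < u" "0 < v"
  shows "\<bar>ln_Gamma v - ln_Gamma u - ((v * ln v - v) - (u * ln u - u))\<bar> \<le> \<bar>v - u\<bar> / min u v"
proof (cases "u \<le> v")
  case True
  then show ?thesis using ln_Gamma_diff_bound_aux[of u v] assms by simp
next
  case False
  then show ?thesis
    using ln_Gamma_diff_bound_aux[of v u] assms
    by (simp add: abs_minus_commute[of "ln_Gamma v - _"] algebra_simps abs_diff_less_iff)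
qed

text \<open>The source of every Gaussian factor. With y = x / N, the logarithm is N * ((1 + y) ln (1
  + y) - y) up to a vanishing error, and its leading term N y^2 / 2 is half the square of x / sqrt
  N.\<close>

lemma tendsto_Gamma_quotient:
  fixes N x :: "'a \<Rightarrow> real"
  assumes N: "filterlim N at_top F" and x: "((\<lambda>t. x t / sqrt (N t)) \<longlongrightarrow> \<alpha>) F"
  shows "((\<lambda>t. Gamma (N t + x t) / (Gamma (N t) * N t powr x t)) \<longlongrightarrow> exp (\<alpha>\<^sup>2 / 2)) F"
proof -
  define y where "y t = x t / N t" for t
  \<comment> \<open>The continuous extension to y = 0, so that it can be composed with
    \<open>y t\<close>, which may vanish.\<close>
  define h where "h y = (if y = 0 then 1/2 else ((1 + y) * ln (1 + y) - y) / y\<^sup>2)" for y :: real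
  have Npos: "\<forall>\<^sub>F t in F. N t > 0" using N by (auto simp: filterlim_at_top_dense)
  have inv0: "((\<lambda>t. 1 / sqrt (N t)) \<longlongrightarrow> 0) F"
    using filterlim_compose[OF sqrt_at_top N] by (rule real_tendsto_divide_at_top[OF tendsto_const])
  have "((\<lambda>t. x t / sqrt (N t) * (1 / sqrt (N t))) \<longlongrightarrow> \<alpha> * 0) F"
    by (intro tendsto_mult x inv0)
  moreover have "\<forall>\<^sub>F t in F. x t / sqrt (N t) * (1 / sqrt (N t)) = y t"
    using Npos by eventually_elim (simp add: y_def field_simps)
  ultimately have y0: "(y \<longlongrightarrow> 0) F" by (auto intro: Lim_transform_eventually)
  have "((\<lambda>y. ((1 + y) * ln (1 + y) - y) / y\<^sup>2) \<longlongrightarrow> 1/2) (at (0::real))" by real_asymp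
  then have "(h \<longlongrightarrow> 1/2) (at 0)"
    by (rule Lim_transform_eventually) (auto simp: h_def eventually_at_filter)
  then have "isCont h 0" by (simp add: isCont_def h_def)
  then have hy: "((\<lambda>t. h (y t)) \<longlongrightarrow> 1/2) F"
    using isCont_tendsto_compose[of 0 h y F] y0 by (simp add: h_def)
  have g: "(1 + y) * ln (1 + y) - y = y\<^sup>2 * h y" for y by (simp add: h_def)
  \<comment> \<open>This keeps N + x above N / 2, whence the factor 2 in the bound of
    \<open>E\<close>.\<close>
  have y_gt: "\<forall>\<^sub>F t in F. \<bar>y t\<bar> < 1 / 2"
    using tendstoD[OF y0, of "1/2"] by (simp add: dist_real_def)
  define E where "E t = ln_Gamma (N t + x t) - ln_Gamma (N t) - x t * ln (N t) - (x t / sqrt (N t))\<^sup>2 * h (y t)" for t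
  have "\<forall>\<^sub>F t in F. norm (E t) \<le> 2 * \<bar>y t\<bar>"
    using Npos y_gt
  proof eventually_elim
    case (elim t)
    have xy: "x t = N t * y t" using elim by (simp add: y_def)
    have pos: "1 + y t > 0" using elim by linarith
    have v: "N t + x t = N t * (1 + y t)" by (simp add: xy algebra_simps)
    have "N t * (1 + y t) \<ge> N t * (1 / 2)" using elim by (intro mult_left_mono) auto
    then have min: "min (N t) (N t * (1 + y t)) \<ge> N t / 2" using elim by auto
    have "(x t / sqrt (N t))\<^sup>2 = N t * (y t)\<^sup>2"
      using elim by (simp add: xy power_divide power_mult_distrib power2_eq_square)
    then have "(x t / sqrt (N t))\<^sup>2 * h (y t) = N t * ((1 + y t) * ln (1 + y t) - y t)"
      by (simp add: g mult.assoc)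
    also have "\<dots> = (N t * (1 + y t)) * ln (N t * (1 + y t)) - N t * (1 + y t)
        - (N t * ln (N t) - N t) - x t * ln (N t)"
      unfolding ln_mult_pos[OF elim(1) pos] by (simp add: xy algebra_simps)
    finally have "E t = ln_Gamma (N t * (1 + y t)) - ln_Gamma (N t)
        - ((N t * (1 + y t)) * ln (N t * (1 + y t)) - N t * (1 + y t) - (N t * ln (N t) - N t))"
      by (simp add: E_def v)
    then have "\<bar>E t\<bar> \<le> \<bar>N t * (1 + y t) - N t\<bar> / min (N t) (N t * (1 + y t))"
      using ln_Gamma_diff_bound[of "N t" "N t * (1 + y t)"] elim pos by simp
    also have "\<dots> \<le> \<bar>N t * (1 + y t) - N t\<bar> / (N t / 2)"
      using min elim by (intro divide_left_mono) auto
    also have "\<dots> = 2 * \<bar>y t\<bar>" using elim by (simp add: algebra_simps abs_mult)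
    finally show ?case by simp
  qed
  moreover have "((\<lambda>t. 2 * \<bar>y t\<bar>) \<longlongrightarrow> 0) F"
    using tendsto_mult[OF tendsto_const[of 2] tendsto_rabs[OF y0]] by simp
  ultimately have "(E \<longlongrightarrow> 0) F" by (rule Lim_null_comparison)
  then have "((\<lambda>t. exp (E t + (x t / sqrt (N t))\<^sup>2 * h (y t))) \<longlongrightarrow> exp (0 + \<alpha>\<^sup>2 * (1/2))) F"
    by (intro tendsto_exp tendsto_add tendsto_mult tendsto_power x hy)
  moreover have "\<forall>\<^sub>F t in F. exp (E t + (x t / sqrt (N t))\<^sup>2 * h (y t))
      = Gamma (N t + x t) / (Gamma (N t) * N t powr x t)"
    using Npos y_gt
  proof eventually_elim
    case (elim t)
    have "N t + x t = N t * (1 + y t)" using elim by (simp add: y_def algebra_simps)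
    moreover have "1 + y t > 0" using elim by linarith
    ultimately have "N t + x t > 0" using elim by simp
    then show ?case
      using elim by (simp add: E_def exp_diff Gamma_real_pos_exp powr_def)
  qed
  ultimately show ?thesis by (auto intro: Lim_transform_eventually)
qed

lemma tendsto_Gamma_quotient_diff:
  fixes N x y :: "'a \<Rightarrow> real"
  assumes N: "filterlim N at_top F" and x: "((\<lambda>t. x t / sqrt (N t)) \<longlongrightarrow> \<alpha>) F"
    and y: "((\<lambda>t. y t / sqrt (N t)) \<longlongrightarrow> \<beta>) F"
  shows "((\<lambda>t. Gamma (N t + x t) / Gamma (N t + y t) * N t powr (y t - x t)) \<longlongrightarrow> exp ((\<alpha>\<^sup>2 - \<beta>\<^sup>2) / 2)) F"
proof -
  have Npos: "\<forall>\<^sub>F t in F. N t > 0" using N by (auto simp: filterlim_at_top_dense)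
  have "((\<lambda>t. (Gamma (N t + x t) / (Gamma (N t) * N t powr x t)) /
      (Gamma (N t + y t) / (Gamma (N t) * N t powr y t))) \<longlongrightarrow> exp (\<alpha>\<^sup>2 / 2) / exp (\<beta>\<^sup>2 / 2)) F"
    by (intro tendsto_divide tendsto_Gamma_quotient N x y) simp
  moreover have "\<forall>\<^sub>F t in F. (Gamma (N t + x t) / (Gamma (N t) * N t powr x t)) /
      (Gamma (N t + y t) / (Gamma (N t) * N t powr y t)) = Gamma (N t + x t) / Gamma (N t + y t) * N t powr (y t - x t)"
    using Npos
  proof eventually_elim
    case (elim t)
    then have "Gamma (N t) > 0" by (rule Gamma_real_pos)
    then have "Gamma (N t) \<noteq> 0" by linarith
    then show ?case using elim by (simp add: powr_diff)
  qed
  ultimately have "((\<lambda>t. Gamma (N t + x t) / Gamma (N t + y t) * N t powr (y t - x t))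
      \<longlongrightarrow> exp (\<alpha>\<^sup>2 / 2) / exp (\<beta>\<^sup>2 / 2)) F"
    by (rule Lim_transform_eventually)
  moreover have "exp (\<alpha>\<^sup>2 / 2) / exp (\<beta>\<^sup>2 / 2) = exp ((\<alpha>\<^sup>2 - \<beta>\<^sup>2) / 2)"
    by (simp add: exp_diff[symmetric] diff_divide_distrib)
  ultimately show ?thesis by simp
qed

subsection \<open>Exponential polynomials and positive functionals\<close>

text \<open>
  A list of pairs \<open>(c, s)\<close> stands for the exponential polynomial with terms \<open>c * exp (s * x)\<close>, and
  \<open>list_eval cs M\<close> is the value on it of the linear functional sending \<open>exp (s * x)\<close> to \<open>M s\<close>.
\<close>

definition list_eval :: "(real \<times> real) list \<Rightarrow> (real \<Rightarrow> real) \<Rightarrow> real" where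
  "list_eval cs M = (\<Sum>(c, s)\<leftarrow>cs. c * M s)"

abbreviation exp_poly :: "(real \<times> real) list \<Rightarrow> real \<Rightarrow> real" where
  "exp_poly cs x \<equiv> list_eval cs (\<lambda>s. exp (s * x))"

text \<open>Positivity is asked for only on exponents in \<open>J\<close>, because the transforms
  are known to be finite only near the points \<open>\<xi> i\<close>. The exponential polynomials
  themselves have to be nonnegative on the whole line.\<close>

definition exp_positive :: "real set \<Rightarrow> (real \<Rightarrow> real) \<Rightarrow> bool" where
  "exp_positive J M \<longleftrightarrow> (\<forall>cs. snd ` set cs \<subseteq> J \<and> (\<forall>x. 0 \<le> exp_poly cs x) \<longrightarrow> 0 \<le> list_eval cs M)"

text \<open>The exponential polynomial \<open>(c + (exp (\<epsilon> * (x - c)) - 1) / \<epsilon>) ^ v * exp (s * x)\<close>.\<close>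

definition power_list :: "nat \<Rightarrow> real \<Rightarrow> real \<Rightarrow> real \<Rightarrow> (real \<times> real) list" where
  "power_list v \<epsilon> c s =
     map (\<lambda>k. (real (v choose k) * (exp (- \<epsilon> * c) / \<epsilon>) ^ k * (c - 1 / \<epsilon>) ^ (v - k), s + real k * \<epsilon>)) [0..<Suc v]"

lemma list_eval_simps [simp]:
  "list_eval [] M = 0"
  "list_eval ((c, s) # cs) M = c * M s + list_eval cs M"
  "list_eval (cs @ cs') M = list_eval cs M + list_eval cs' M"
  by (simp_all add: list_eval_def)

lemma list_eval_uminus: "list_eval (map (\<lambda>(c, s). (- c, s)) cs) M = - list_eval cs M"
  by (induction cs) auto

lemma tendsto_list_eval:
  assumes "\<And>s. s \<in> snd ` set cs \<Longrightarrow> ((\<lambda>t. M t s) \<longlongrightarrow> N s) F"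
  shows "((\<lambda>t. list_eval cs (M t)) \<longlongrightarrow> list_eval cs N) F"
  using assms
proof (induction cs)
  case (Cons a cs)
  then show ?case by (cases a) (auto intro!: tendsto_intros)
qed auto

lemma list_eval_power_list:
  "list_eval (power_list v \<epsilon> c s) M =
    (\<Sum>k\<le>v. real (v choose k) * (exp (- \<epsilon> * c) / \<epsilon>) ^ k * (c - 1 / \<epsilon>) ^ (v - k) * M (s + real k * \<epsilon>))"
proof -
  have "list_eval (power_list v \<epsilon> c s) M =
    (\<Sum>k\<leftarrow>[0..<Suc v]. real (v choose k) * (exp (- \<epsilon> * c) / \<epsilon>) ^ k * (c - 1 / \<epsilon>) ^ (v - k) * M (s + real k * \<epsilon>))"
    unfolding list_eval_def power_list_def map_map comp_def by simp
  also have "\<dots> = (\<Sum>k\<le>v. real (v choose k) * (exp (- \<epsilon> * c) / \<epsilon>) ^ k * (c - 1 / \<epsilon>) ^ (v - k) * M (s + real k * \<epsilon>))"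
    by (subst sum_list_distinct_conv_sum_set) (auto simp: atLeast0LessThan lessThan_Suc_atMost simp del: upt_Suc)
  finally show ?thesis .
qed

text \<open>The base of the power is the inverse of the substitution
  \<open>x = c + ln (1 + \<epsilon> * (t - c)) / \<epsilon>\<close>, so the list represents t^v
  times an exponential in the new variable. The coefficients come from the binomial theorem.\<close>

lemma exp_poly_power_list:
  assumes "\<epsilon> \<noteq> 0"
  shows "exp_poly (power_list v \<epsilon> c s) x = (c + (exp (\<epsilon> * (x - c)) - 1) / \<epsilon>) ^ v * exp (s * x)"
proof -
  have "exp (- \<epsilon> * c) ^ k * exp ((s + real k * \<epsilon>) * x) = exp (\<epsilon> * (x - c)) ^ k * exp (s * x)" for k
    by (simp add: exp_of_nat_mult[symmetric] exp_add[symmetric] algebra_simps)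
  then have eq: "real (v choose k) * (exp (- \<epsilon> * c) / \<epsilon>) ^ k * (c - 1 / \<epsilon>) ^ (v - k) * exp ((s + real k * \<epsilon>) * x)
    = real (v choose k) * (exp (\<epsilon> * (x - c)) / \<epsilon>) ^ k * (c - 1 / \<epsilon>) ^ (v - k) * exp (s * x)" for k
    by (simp add: power_divide mult_ac)
  have "c + (exp (\<epsilon> * (x - c)) - 1) / \<epsilon> = exp (\<epsilon> * (x - c)) / \<epsilon> + (c - 1 / \<epsilon>)"
    by (simp add: diff_divide_distrib)
  then have "(c + (exp (\<epsilon> * (x - c)) - 1) / \<epsilon>) ^ v
    = (\<Sum>k\<le>v. real (v choose k) * (exp (\<epsilon> * (x - c)) / \<epsilon>) ^ k * (c - 1 / \<epsilon>) ^ (v - k))"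
    by (simp only: binomial_ring)
  then show ?thesis
    unfolding list_eval_power_list eq by (simp only: sum_distrib_right)
qed

lemma snd_power_list: "snd ` set (power_list v \<epsilon> c s) = (\<lambda>k. s + real k * \<epsilon>) ` {..v}"
  unfolding power_list_def by (auto simp: image_image atLeast0LessThan lessThan_Suc_atMost simp del: upt_Suc)

text \<open>The majorant minus the difference of the two lists is again a list with exponents in
  \<open>J\<close> and is pointwise nonnegative; positivity is applied to it and to the version with
  the lists exchanged.\<close>

lemma exp_positive_bound:
  assumes M: "exp_positive J M" and cs: "snd ` set cs \<subseteq> J" "snd ` set cs' \<subseteq> J" and J: "a \<in> J" "b \<in> J"
    and le: "\<And>x. \<bar>exp_poly cs x - exp_poly cs' x\<bar> \<le> B * (exp (a * x) + exp (b * x))"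
  shows "\<bar>list_eval cs M - list_eval cs' M\<bar> \<le> B * (M a + M b)"
proof -
  have 1: "list_eval cs M - list_eval cs' M \<le> B * (M a + M b)"
    if cs: "snd ` set cs \<subseteq> J" "snd ` set cs' \<subseteq> J"
      and le: "\<And>x. \<bar>exp_poly cs x - exp_poly cs' x\<bar> \<le> B * (exp (a * x) + exp (b * x))" for cs cs'
  proof -
    define L where "L = (B, a) # (B, b) # cs' @ map (\<lambda>(c, s). (- c, s)) cs"
    have L: "list_eval L M = B * (M a + M b) + list_eval cs' M - list_eval cs M" for M
      by (simp add: L_def list_eval_uminus algebra_simps)
    have "snd ` set L \<subseteq> J" using cs J by (force simp: L_def)
    moreover have "0 \<le> exp_poly L x" for x
      using le[of x] unfolding L by linarith
    ultimately have "0 \<le> list_eval L M" using M unfolding exp_positive_def by blast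
    then show ?thesis unfolding L by linarith
  qed
  have "\<bar>exp_poly cs' x - exp_poly cs x\<bar> \<le> B * (exp (a * x) + exp (b * x))" for x
    using le[of x] by (simp add: abs_minus_commute)
  from 1[OF cs(2,1) this] 1[OF cs le] show ?thesis by linarith
qed

text \<open>A list involves finitely many exponents, so pointwise convergence of the functionals
  suffices.\<close>

lemma exp_positive_limit:
  assumes F: "F \<noteq> bot" and pos: "\<forall>\<^sub>F t in F. exp_positive J (M t)"
    and lim: "\<And>s. s \<in> J \<Longrightarrow> ((\<lambda>t. M t s) \<longlongrightarrow> N s) F"
  shows "exp_positive J N"
  unfolding exp_positive_def
proof (intro allI impI)
  fix cs assume cs: "snd ` set cs \<subseteq> J \<and> (\<forall>x. 0 \<le> exp_poly cs x)"
  have "((\<lambda>t. list_eval cs (M t)) \<longlongrightarrow> list_eval cs N) F"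
    using cs lim by (intro tendsto_list_eval) auto
  moreover have "\<forall>\<^sub>F t in F. 0 \<le> list_eval cs (M t)"
    using pos by eventually_elim (use cs in \<open>auto simp: exp_positive_def\<close>)
  ultimately show "0 \<le> list_eval cs N" using F by (rule tendsto_lowerbound)
qed

lemma exp_positive_nonneg:
  assumes "exp_positive J M" "s \<in> J"
  shows "0 \<le> M s"
  using assms unfolding exp_positive_def by (elim allE[of _ "[(1, s)]"]) auto

section \<open>Elementary estimates for exponentials and powers\<close>

lemma abs_exp_minus_one_le: "\<bar>exp u - 1\<bar> \<le> \<bar>u\<bar> * exp \<bar>u\<bar>" for u :: real
proof (cases "u = 0")
  case False
  obtain t where t: "\<bar>t\<bar> \<le> \<bar>u\<bar>" "exp u = (\<Sum>m<1. u ^ m / fact m) + exp t / fact 1 * u ^ 1"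
    using Maclaurin_exp_le[of u 1] by auto
  then have "\<bar>exp u - 1\<bar> = exp t * \<bar>u\<bar>" by (simp add: abs_mult)
  also have "\<dots> \<le> exp \<bar>u\<bar> * \<bar>u\<bar>" using t(1) by (intro mult_right_mono) auto
  finally show ?thesis by (simp add: mult.commute)
qed simp

lemma abs_exp_minus_linear_le: "\<bar>exp u - 1 - u\<bar> \<le> u\<^sup>2 * exp \<bar>u\<bar>" for u :: real
proof -
  obtain t where t: "\<bar>t\<bar> \<le> \<bar>u\<bar>" "exp u = (\<Sum>m<2. u ^ m / fact m) + exp t / fact 2 * u ^ 2"
    using Maclaurin_exp_le[of u 2] by auto
  then have "\<bar>exp u - 1 - u\<bar> = exp t / 2 * u\<^sup>2" by (simp add: abs_mult numeral_2_eq_2)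
  also have "\<dots> \<le> exp \<bar>u\<bar> * u\<^sup>2"
  proof (intro mult_right_mono)
    have "exp t \<le> exp \<bar>u\<bar>" using t(1) by simp
    then show "exp t / 2 \<le> exp \<bar>u\<bar>" using exp_gt_zero[of t] by linarith
  qed simp
  finally show ?thesis by (simp add: mult.commute)
qed

lemma abs_power_diff_le:
  fixes x y R :: real
  assumes "\<bar>x\<bar> \<le> R" "\<bar>y\<bar> \<le> R"
  shows "\<bar>y ^ Suc n - x ^ Suc n\<bar> \<le> real (Suc n) * R ^ n * \<bar>y - x\<bar>"
proof -
  have R: "R \<ge> 0" using assms by linarith
  have "\<bar>\<Sum>p<Suc n. y ^ p * x ^ (n - p)\<bar> \<le> (\<Sum>p<Suc n. R ^ n)"
  proof (rule order_trans[OF sum_abs], rule sum_mono)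
    fix p assume "p \<in> {..<Suc n}"
    then have "R ^ n = R ^ p * R ^ (n - p)" by (simp add: power_add[symmetric])
    then show "\<bar>y ^ p * x ^ (n - p)\<bar> \<le> R ^ n"
      unfolding abs_mult power_abs using assms R by (auto intro!: mult_mono power_mono)
  qed
  then have "\<bar>y - x\<bar> * \<bar>\<Sum>p<Suc n. y ^ p * x ^ (n - p)\<bar> \<le> \<bar>y - x\<bar> * (real (Suc n) * R ^ n)"
    by (intro mult_left_mono) auto
  then show ?thesis by (simp only: diff_power_eq_sum abs_mult mult_ac)
qed

text \<open>A single term of the exponential series is at most the whole.\<close>

lemma power_le_fact_exp:
  fixes A \<delta> :: real
  assumes "A \<ge> 0" "\<delta> > 0"
  shows "A ^ n \<le> fact n / \<delta> ^ n * exp (\<delta> * A)"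
proof -
  obtain t where t: "exp (\<delta> * A) = (\<Sum>m<Suc n. (\<delta> * A) ^ m / fact m) + exp t / fact (Suc n) * (\<delta> * A) ^ Suc n"
    using Maclaurin_exp_le by blast
  have "0 \<le> (\<Sum>m<n. (\<delta> * A) ^ m / fact m)" using assms by (intro sum_nonneg) auto
  moreover have "0 \<le> exp t / fact (Suc n) * (\<delta> * A) ^ Suc n"
    using assms by (intro mult_nonneg_nonneg divide_nonneg_nonneg zero_le_power) auto
  ultimately have "(\<delta> * A) ^ n / fact n \<le> exp (\<delta> * A)" unfolding t by simp
  then show ?thesis using assms by (simp add: power_mult_distrib field_simps)
qed

text \<open>\<open>K\<close> is chosen before \<epsilon> and s, and the error is linear in the step
  and in the shift of the exponent. The admissible growth \<delta> is spent in two halves: one for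
  the exponentials caused by \<epsilon> and by s, one for the power of |x|.\<close>

lemma power_list_approx:
  assumes "\<delta> > 0"
  shows "\<exists>K\<ge>0. \<forall>\<epsilon>>0. \<forall>s. real v * \<epsilon> + \<bar>s - \<xi>\<bar> \<le> \<delta> / 2 \<longrightarrow>
    (\<forall>x. \<bar>exp_poly (power_list v \<epsilon> c s) x - x ^ v * exp (\<xi> * x)\<bar>
      \<le> K * (\<epsilon> + \<bar>s - \<xi>\<bar>) * (exp ((\<xi> + \<delta>) * x) + exp ((\<xi> - \<delta>) * x)))"
proof -
  \<comment> \<open>\<open>K1\<close> collects the errors of the power and of the exponential. In
    \<open>K\<close> the factorial comes from absorbing the power v + 1 with rate \<delta> / 2, and
    the last exponential from passing from \<open>A\<close> back to |x|.\<close>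
  define K1 where "K1 = real v * 2 ^ v + 1"
  define K where "K = K1 * (fact (v + 1) / (\<delta> / 2) ^ (v + 1)) * exp (\<delta> * (1 + \<bar>c\<bar>))"
  have K1: "K1 \<ge> 1" by (simp add: K1_def)
  have K: "K \<ge> 0" using assms K1 by (simp add: K_def)
  have main: "\<bar>exp_poly (power_list v \<epsilon> c s) x - x ^ v * exp (\<xi> * x)\<bar>
      \<le> K * (\<epsilon> + \<bar>s - \<xi>\<bar>) * (exp ((\<xi> + \<delta>) * x) + exp ((\<xi> - \<delta>) * x))"
    if \<epsilon>: "\<epsilon> > 0" and small: "real v * \<epsilon> + \<bar>s - \<xi>\<bar> \<le> \<delta> / 2" for \<epsilon> s x
  proof -
    \<comment> \<open>\<open>A\<close> is at least 1 and dominates |x|, |c| and |x - c|, so that all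
      polynomial factors become powers of \<open>A\<close>.\<close>
    define A where "A = 1 + \<bar>c\<bar> + \<bar>x\<bar>"
    define y where "y = c + (exp (\<epsilon> * (x - c)) - 1) / \<epsilon>"
    define \<sigma> where "\<sigma> = \<bar>s - \<xi>\<bar>"
    have A: "A \<ge> 1" "\<bar>x - c\<bar> \<le> A" "\<bar>x\<bar> \<le> A" "\<bar>c\<bar> \<le> A" by (auto simp: A_def)
    have expA: "1 \<le> exp (\<epsilon> * A)" using \<epsilon> A by simp
    have exc: "exp \<bar>\<epsilon> * (x - c)\<bar> \<le> exp (\<epsilon> * A)"
      using \<epsilon> A by (simp add: abs_mult)
    have "\<bar>y - x\<bar> = \<bar>exp (\<epsilon> * (x - c)) - 1 - \<epsilon> * (x - c)\<bar> / \<epsilon>"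
      using \<epsilon> by (simp add: y_def field_simps flip: abs_divide[where b = \<epsilon>])
    also have "\<dots> \<le> ((\<epsilon> * (x - c))\<^sup>2 * exp \<bar>\<epsilon> * (x - c)\<bar>) / \<epsilon>"
      using \<epsilon> by (intro divide_right_mono abs_exp_minus_linear_le) auto
    also have "\<dots> = \<epsilon> * (\<bar>x - c\<bar>\<^sup>2 * exp \<bar>\<epsilon> * (x - c)\<bar>)"
      using \<epsilon> by (simp add: power_mult_distrib power2_eq_square)
    also have "\<dots> \<le> \<epsilon> * (A\<^sup>2 * exp (\<epsilon> * A))"
      using \<epsilon> A exc by (intro mult_left_mono mult_mono power_mono) auto
    finally have yx: "\<bar>y - x\<bar> \<le> \<epsilon> * (A\<^sup>2 * exp (\<epsilon> * A))" .
    have "\<bar>y - c\<bar> = \<bar>exp (\<epsilon> * (x - c)) - 1\<bar> / \<epsilon>" using \<epsilon> by (simp add: y_def)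
    also have "\<dots> \<le> (\<bar>\<epsilon> * (x - c)\<bar> * exp \<bar>\<epsilon> * (x - c)\<bar>) / \<epsilon>"
      using \<epsilon> by (intro divide_right_mono abs_exp_minus_one_le) auto
    also have "\<dots> = \<bar>x - c\<bar> * exp \<bar>\<epsilon> * (x - c)\<bar>" using \<epsilon> by (simp add: abs_mult)
    also have "\<dots> \<le> A * exp (\<epsilon> * A)" using A exc by (intro mult_mono) auto
    finally have yc: "\<bar>y - c\<bar> \<le> A * exp (\<epsilon> * A)" .
    have AE: "A \<le> A * exp (\<epsilon> * A)" using A expA mult_left_mono[of 1 "exp (\<epsilon> * A)" A] by simp
    define R where "R = 2 * A * exp (\<epsilon> * A)"
    have R: "\<bar>y\<bar> \<le> R" "\<bar>x\<bar> \<le> R" using yc A AE unfolding R_def by linarith+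
    have pow: "\<bar>y ^ v - x ^ v\<bar> \<le> real v * 2 ^ v * \<epsilon> * A ^ (v + 1) * exp (real v * \<epsilon> * A)"
    proof (cases v)
      case (Suc n)
      have "\<bar>y ^ v - x ^ v\<bar> \<le> real v * R ^ n * \<bar>y - x\<bar>"
        unfolding Suc by (rule abs_power_diff_le) (use R in auto)
      also have "\<dots> \<le> real v * R ^ n * (\<epsilon> * (A\<^sup>2 * exp (\<epsilon> * A)))"
        using A by (intro mult_left_mono yx) (auto simp: R_def)
      also have "\<dots> = real v * 2 ^ n * \<epsilon> * A ^ (v + 1) * exp (real v * \<epsilon> * A)"
      proof -
        have "exp (real v * \<epsilon> * A) = exp (\<epsilon> * A) ^ n * exp (\<epsilon> * A)"
          by (simp add: Suc exp_of_nat_mult[symmetric] exp_add[symmetric] algebra_simps)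
        then show ?thesis
          by (simp add: R_def power_mult_distrib Suc power2_eq_square mult_ac)
      qed
      also have "\<dots> \<le> real v * 2 ^ v * \<epsilon> * A ^ (v + 1) * exp (real v * \<epsilon> * A)"
        using \<epsilon> A by (intro mult_right_mono mult_left_mono power_increasing) (auto simp: Suc)
      finally show ?thesis .
    qed simp
    have es: "exp (s * x) \<le> exp (\<xi> * x) * exp (\<sigma> * A)"
    proof -
      have "(s - \<xi>) * x \<le> \<bar>s - \<xi>\<bar> * \<bar>x\<bar>" by (metis abs_ge_self abs_mult)
      also have "\<dots> \<le> \<sigma> * A" using A by (auto simp: \<sigma>_def intro!: mult_mono)
      finally show ?thesis by (simp add: exp_add[symmetric] algebra_simps)
    qed
    have "\<bar>exp (s * x) - exp (\<xi> * x)\<bar> = exp (\<xi> * x) * \<bar>exp ((s - \<xi>) * x) - 1\<bar>"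
    proof -
      have "exp (s * x) - exp (\<xi> * x) = exp (\<xi> * x) * (exp ((s - \<xi>) * x) - 1)"
        by (simp add: right_diff_distrib exp_add[symmetric] algebra_simps)
      then show ?thesis by (simp add: abs_mult)
    qed
    also have "\<dots> \<le> exp (\<xi> * x) * (\<bar>(s - \<xi>) * x\<bar> * exp \<bar>(s - \<xi>) * x\<bar>)"
      by (intro mult_left_mono abs_exp_minus_one_le) auto
    also have "\<dots> \<le> exp (\<xi> * x) * ((\<sigma> * A) * exp (\<sigma> * A))"
    proof -
      have "\<bar>(s - \<xi>) * x\<bar> \<le> \<sigma> * A" using A by (auto simp: \<sigma>_def abs_mult intro!: mult_mono)
      then show ?thesis by (intro mult_left_mono mult_mono) auto
    qed
    finally have ed: "\<bar>exp (s * x) - exp (\<xi> * x)\<bar> \<le> exp (\<xi> * x) * ((\<sigma> * A) * exp (\<sigma> * A))" .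
    have \<sigma>: "\<sigma> \<ge> 0" by (simp add: \<sigma>_def)
    \<comment> \<open>The first half of \<delta>: this is what the smallness condition on \<epsilon>
      and s is for.\<close>
    have big: "exp (real v * \<epsilon> * A) * exp (\<sigma> * A) \<le> exp (\<delta> / 2 * A)"
    proof -
      have "(real v * \<epsilon> + \<sigma>) * A \<le> \<delta> / 2 * A" using small A by (intro mult_right_mono) (auto simp: \<sigma>_def)
      then show ?thesis by (simp add: exp_add[symmetric] algebra_simps)
    qed
    have big': "exp (\<sigma> * A) \<le> exp (\<delta> / 2 * A)"
    proof -
      have "0 \<le> real v * \<epsilon>" using \<epsilon> by simp
      then have "\<sigma> \<le> \<delta> / 2" using small by (simp add: \<sigma>_def)
      then show ?thesis using A by (simp add: mult_right_mono)
    qed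
    have "\<bar>exp_poly (power_list v \<epsilon> c s) x - x ^ v * exp (\<xi> * x)\<bar>
        = \<bar>(y ^ v - x ^ v) * exp (s * x) + x ^ v * (exp (s * x) - exp (\<xi> * x))\<bar>"
      using \<epsilon> by (simp add: exp_poly_power_list y_def algebra_simps)
    also have "\<dots> \<le> \<bar>y ^ v - x ^ v\<bar> * exp (s * x) + \<bar>x\<bar> ^ v * \<bar>exp (s * x) - exp (\<xi> * x)\<bar>"
      by (rule order_trans[OF abs_triangle_ineq]) (simp add: abs_mult power_abs)
    also have "\<dots> \<le> (real v * 2 ^ v * \<epsilon> * A ^ (v + 1) * exp (real v * \<epsilon> * A)) * (exp (\<xi> * x) * exp (\<sigma> * A))
        + A ^ v * (exp (\<xi> * x) * ((\<sigma> * A) * exp (\<sigma> * A)))"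
      using A \<epsilon> by (intro add_mono mult_mono pow es ed power_mono) auto
    also have "\<dots> = A ^ (v + 1) * exp (\<xi> * x) *
        (real v * 2 ^ v * \<epsilon> * (exp (real v * \<epsilon> * A) * exp (\<sigma> * A)) + \<sigma> * exp (\<sigma> * A))"
      by (simp add: algebra_simps)
    also have "\<dots> \<le> A ^ (v + 1) * exp (\<xi> * x) *
        (real v * 2 ^ v * \<epsilon> * exp (\<delta> / 2 * A) + \<sigma> * exp (\<delta> / 2 * A))"
      using A \<epsilon> \<sigma> by (intro mult_left_mono add_mono big big') auto
    also have "\<dots> \<le> A ^ (v + 1) * exp (\<xi> * x) * (K1 * (\<epsilon> + \<sigma>) * exp (\<delta> / 2 * A))"
    proof -
      have "real v * 2 ^ v * \<epsilon> + \<sigma> \<le> K1 * (\<epsilon> + \<sigma>)"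
        using \<epsilon> \<sigma> by (simp add: K1_def algebra_simps)
      then have "(real v * 2 ^ v * \<epsilon> + \<sigma>) * exp (\<delta> / 2 * A) \<le> K1 * (\<epsilon> + \<sigma>) * exp (\<delta> / 2 * A)"
        by (intro mult_right_mono) auto
      then show ?thesis using A by (intro mult_left_mono) (auto simp: algebra_simps)
    qed
    also have "\<dots> \<le> (fact (v + 1) / (\<delta> / 2) ^ (v + 1) * exp (\<delta> / 2 * A)) * exp (\<xi> * x) *
        (K1 * (\<epsilon> + \<sigma>) * exp (\<delta> / 2 * A))"
      using A assms K1 \<epsilon> \<sigma> by (intro mult_right_mono power_le_fact_exp) auto
    also have "\<dots> = K1 * (fact (v + 1) / (\<delta> / 2) ^ (v + 1)) * (\<epsilon> + \<sigma>) * exp (\<xi> * x) * exp (\<delta> * A)"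
      by (simp add: mult_ac flip: exp_add[of "\<delta> / 2 * A" "\<delta> / 2 * A", simplified])
    also have "\<dots> = K * (\<epsilon> + \<sigma>) * (exp (\<xi> * x) * exp (\<delta> * \<bar>x\<bar>))"
    proof -
      have "exp (\<delta> * A) = exp (\<delta> * (1 + \<bar>c\<bar>)) * exp (\<delta> * \<bar>x\<bar>)"
        by (simp add: A_def exp_add[symmetric] algebra_simps)
      then show ?thesis by (simp add: K_def)
    qed
    also have "\<dots> \<le> K * (\<epsilon> + \<sigma>) * (exp ((\<xi> + \<delta>) * x) + exp ((\<xi> - \<delta>) * x))"
    proof (intro mult_left_mono)
      show "exp (\<xi> * x) * exp (\<delta> * \<bar>x\<bar>) \<le> exp ((\<xi> + \<delta>) * x) + exp ((\<xi> - \<delta>) * x)"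
        by (cases "x \<ge> 0") (simp_all add: exp_add[symmetric] algebra_simps)
    qed (use K \<epsilon> \<sigma> in auto)
    finally show ?thesis by (simp add: \<sigma>_def)
  qed
  show ?thesis using K main by blast
qed

text \<open>
  For the transform \<open>N\<close> of a measure this is the \<open>v\<close>-th derivative of \<open>N\<close> at \<open>\<xi>\<close>; the limit of
  difference quotients also makes sense when only the positivity of \<open>N\<close> is known.
\<close>

definition exp_moment :: "nat \<Rightarrow> (real \<Rightarrow> real) \<Rightarrow> real \<Rightarrow> real" where
  "exp_moment v N \<xi> = lim (\<lambda>n. list_eval (power_list v (1 / real (Suc n)) 0 \<xi>) N)"

lemma power_list_in_interval:
  assumes "\<epsilon> > 0" "real v * \<epsilon> + \<bar>s - \<xi>\<bar> \<le> \<delta>"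
  shows "snd ` set (power_list v \<epsilon> c s) \<subseteq> {\<xi> - \<delta>..\<xi> + \<delta>}"
  unfolding snd_power_list
proof (rule image_subsetI)
  fix k assume "k \<in> {..v}"
  then have "real k * \<epsilon> \<le> real v * \<epsilon>" using assms by (intro mult_right_mono) auto
  moreover have "0 \<le> real k * \<epsilon>" using assms by simp
  ultimately show "s + real k * \<epsilon> \<in> {\<xi> - \<delta>..\<xi> + \<delta>}" using assms(2) by auto
qed

text \<open>Both lists are close to x^v exp (\<xi> x), and positivity turns this into closeness of
  the values. The constant is the same for all functionals \<open>M\<close>; without this uniformity
  the limit in the parameter and the limit in the step could not be exchanged.\<close>

lemma list_eval_power_list_diff:
  assumes \<delta>: "\<delta> > 0"
  shows "\<exists>K\<ge>0. \<forall>M \<epsilon> s \<epsilon>'. exp_positive {\<xi> - \<delta>..\<xi> + \<delta>} M \<longrightarrow> \<epsilon> > 0 \<longrightarrow> \<epsilon>' > 0 \<longrightarrow>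
    real v * \<epsilon> + \<bar>s - \<xi>\<bar> \<le> \<delta> / 2 \<longrightarrow> real v * \<epsilon>' \<le> \<delta> / 2 \<longrightarrow>
    \<bar>list_eval (power_list v \<epsilon> c s) M - list_eval (power_list v \<epsilon>' 0 \<xi>) M\<bar>
      \<le> K * (\<epsilon> + \<bar>s - \<xi>\<bar> + \<epsilon>') * (M (\<xi> + \<delta>) + M (\<xi> - \<delta>))"
proof -
  obtain K1 where K1: "K1 \<ge> 0" "\<And>\<epsilon> s x. \<epsilon> > 0 \<Longrightarrow> real v * \<epsilon> + \<bar>s - \<xi>\<bar> \<le> \<delta> / 2 \<Longrightarrow>
    \<bar>exp_poly (power_list v \<epsilon> c s) x - x ^ v * exp (\<xi> * x)\<bar>
      \<le> K1 * (\<epsilon> + \<bar>s - \<xi>\<bar>) * (exp ((\<xi> + \<delta>) * x) + exp ((\<xi> - \<delta>) * x))"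
    using power_list_approx[OF \<delta>, of v \<xi> c] by blast
  obtain K2 where K2: "K2 \<ge> 0" "\<And>\<epsilon> s x. \<epsilon> > 0 \<Longrightarrow> real v * \<epsilon> + \<bar>s - \<xi>\<bar> \<le> \<delta> / 2 \<Longrightarrow>
    \<bar>exp_poly (power_list v \<epsilon> 0 s) x - x ^ v * exp (\<xi> * x)\<bar>
      \<le> K2 * (\<epsilon> + \<bar>s - \<xi>\<bar>) * (exp ((\<xi> + \<delta>) * x) + exp ((\<xi> - \<delta>) * x))"
    using power_list_approx[OF \<delta>, of v \<xi> 0] by blast
  have "\<bar>list_eval (power_list v \<epsilon> c s) M - list_eval (power_list v \<epsilon>' 0 \<xi>) M\<bar>
      \<le> (K1 + K2) * (\<epsilon> + \<bar>s - \<xi>\<bar> + \<epsilon>') * (M (\<xi> + \<delta>) + M (\<xi> - \<delta>))"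
    if M: "exp_positive {\<xi> - \<delta>..\<xi> + \<delta>} M" and \<epsilon>: "\<epsilon> > 0" "\<epsilon>' > 0"
      and s: "real v * \<epsilon> + \<bar>s - \<xi>\<bar> \<le> \<delta> / 2" "real v * \<epsilon>' \<le> \<delta> / 2" for M \<epsilon> s \<epsilon>'
  proof (rule exp_positive_bound[OF M])
    show "snd ` set (power_list v \<epsilon> c s) \<subseteq> {\<xi> - \<delta>..\<xi> + \<delta>}"
      using \<epsilon> s \<delta> by (intro power_list_in_interval) auto
    show "snd ` set (power_list v \<epsilon>' 0 \<xi>) \<subseteq> {\<xi> - \<delta>..\<xi> + \<delta>}"
      using \<epsilon> s \<delta> by (intro power_list_in_interval) auto
    fix x
    let ?E = "exp ((\<xi> + \<delta>) * x) + exp ((\<xi> - \<delta>) * x)"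
    have "\<bar>exp_poly (power_list v \<epsilon> c s) x - exp_poly (power_list v \<epsilon>' 0 \<xi>) x\<bar>
      \<le> K1 * (\<epsilon> + \<bar>s - \<xi>\<bar>) * ?E + K2 * \<epsilon>' * ?E"
      using K1(2)[OF \<epsilon>(1) s(1), of x] K2(2)[of \<epsilon>' \<xi> x] \<epsilon> s by simp
    also have "\<dots> = (K1 * (\<epsilon> + \<bar>s - \<xi>\<bar>) + K2 * \<epsilon>') * ?E" by (simp add: algebra_simps)
    also have "\<dots> \<le> ((K1 + K2) * (\<epsilon> + \<bar>s - \<xi>\<bar> + \<epsilon>')) * ?E"
      using K1(1) K2(1) \<epsilon> by (intro mult_right_mono) (auto simp: algebra_simps)
    finally show "\<bar>exp_poly (power_list v \<epsilon> c s) x - exp_poly (power_list v \<epsilon>' 0 \<xi>) x\<bar>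
      \<le> (K1 + K2) * (\<epsilon> + \<bar>s - \<xi>\<bar> + \<epsilon>') * ?E" .
  qed (use \<delta> in auto)
  then show ?thesis using K1(1) K2(1) by (intro exI[of _ "K1 + K2"]) auto
qed

text \<open>The values for the steps 1 / (n + 1) form a Cauchy sequence by the uniform comparison,
  so the \<open>lim\<close> in \<open>exp_moment\<close> is a true limit; letting one of the two
  compared steps tend to 0 leaves an error linear in the other.\<close>

lemma exp_moment_approx:
  assumes \<delta>: "\<delta> > 0"
  shows "\<exists>K\<ge>0. \<forall>M \<epsilon>. exp_positive {\<xi> - \<delta>..\<xi> + \<delta>} M \<longrightarrow> \<epsilon> > 0 \<longrightarrow> real v * \<epsilon> \<le> \<delta> / 2 \<longrightarrow>
    \<bar>exp_moment v M \<xi> - list_eval (power_list v \<epsilon> 0 \<xi>) M\<bar> \<le> K * \<epsilon> * (M (\<xi> + \<delta>) + M (\<xi> - \<delta>))"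
proof -
  obtain K where K: "K \<ge> 0" "\<And>M \<epsilon> s \<epsilon>'. exp_positive {\<xi> - \<delta>..\<xi> + \<delta>} M \<Longrightarrow> \<epsilon> > 0 \<Longrightarrow> \<epsilon>' > 0 \<Longrightarrow>
    real v * \<epsilon> + \<bar>s - \<xi>\<bar> \<le> \<delta> / 2 \<Longrightarrow> real v * \<epsilon>' \<le> \<delta> / 2 \<Longrightarrow>
    \<bar>list_eval (power_list v \<epsilon> 0 s) M - list_eval (power_list v \<epsilon>' 0 \<xi>) M\<bar>
      \<le> K * (\<epsilon> + \<bar>s - \<xi>\<bar> + \<epsilon>') * (M (\<xi> + \<delta>) + M (\<xi> - \<delta>))"
    using list_eval_power_list_diff[OF \<delta>, of \<xi> v 0] by blast
  have "\<bar>exp_moment v M \<xi> - list_eval (power_list v \<epsilon> 0 \<xi>) M\<bar> \<le> K * \<epsilon> * (M (\<xi> + \<delta>) + M (\<xi> - \<delta>))"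
    if M: "exp_positive {\<xi> - \<delta>..\<xi> + \<delta>} M" and \<epsilon>: "\<epsilon> > 0" "real v * \<epsilon> \<le> \<delta> / 2" for M \<epsilon>
  proof -
    define C where "C = M (\<xi> + \<delta>) + M (\<xi> - \<delta>)"
    have C: "C \<ge> 0" using exp_positive_nonneg[OF M] \<delta> by (simp add: C_def)
    define a where "a n = list_eval (power_list v (1 / real (Suc n)) 0 \<xi>) M" for n
    have close: "\<bar>a n - list_eval (power_list v \<epsilon>' 0 \<xi>) M\<bar> \<le> K * (1 / real (Suc n) + \<epsilon>') * C"
      if "real v * (1 / real (Suc n)) \<le> \<delta> / 2" "\<epsilon>' > 0" "real v * \<epsilon>' \<le> \<delta> / 2" for n \<epsilon>'
      using K(2)[OF M, of "1 / real (Suc n)" \<epsilon>' \<xi>] that by (simp add: a_def C_def)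
    have comb: "K * (x + y) * C = (2 * K * C * x + 2 * K * C * y) / 2" for x y
      by (simp add: algebra_simps)
    have inv: "(\<lambda>n. 1 / real (Suc n)) \<longlonglongrightarrow> 0" by (rule lim_1_over_n[THEN LIMSEQ_Suc])
    have "(\<lambda>n. real v * (1 / real (Suc n))) \<longlonglongrightarrow> real v * 0" by (intro tendsto_mult inv tendsto_const)
    then have small: "\<forall>\<^sub>F n in sequentially. real v * (1 / real (Suc n)) < \<delta> / 2"
      by (rule order_tendstoD(2)) (use \<delta> in simp)
    have "Cauchy a"
    proof (rule CauchyI)
      fix e :: real assume e: "0 < e"
      have "(\<lambda>n. 2 * K * C * (1 / real (Suc n))) \<longlonglongrightarrow> 2 * K * C * 0" by (intro tendsto_mult inv tendsto_const)
      then have "\<forall>\<^sub>F n in sequentially. 2 * K * C * (1 / real (Suc n)) < e"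
        by (rule order_tendstoD(2)) (use e in simp)
      then have "\<forall>\<^sub>F n in sequentially. 2 * K * C * (1 / real (Suc n)) < e \<and> real v * (1 / real (Suc n)) < \<delta> / 2"
        using small by (rule eventually_conj)
      then obtain n0 where n0: "\<And>n. n \<ge> n0 \<Longrightarrow> 2 * K * C * (1 / real (Suc n)) < e \<and> real v * (1 / real (Suc n)) < \<delta> / 2"
        unfolding eventually_sequentially by metis
      have "norm (a m - a n) < e" if "m \<ge> n0" "n \<ge> n0" for m n
      proof -
        have "\<bar>a m - a n\<bar> \<le> K * (1 / real (Suc m) + 1 / real (Suc n)) * C"
          using close[of m "1 / real (Suc n)"] n0[OF that(1)] n0[OF that(2)]
          by (simp add: a_def[of n])
        also have "\<dots> = (2 * K * C * (1 / real (Suc m)) + 2 * K * C * (1 / real (Suc n))) / 2"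
          by (rule comb)
        also have "\<dots> < (e + e) / 2" using n0[OF that(1)] n0[OF that(2)] by (intro divide_strict_right_mono add_strict_mono) auto
        finally show ?thesis by simp
      qed
      then show "\<exists>n0. \<forall>m\<ge>n0. \<forall>n\<ge>n0. norm (a m - a n) < e" by blast
    qed
    then have "a \<longlonglongrightarrow> lim a" by (simp add: Cauchy_convergent_iff convergent_LIMSEQ_iff)
    then have a: "a \<longlonglongrightarrow> exp_moment v M \<xi>" by (simp add: exp_moment_def a_def[abs_def])
    have "(\<lambda>n. \<bar>a n - list_eval (power_list v \<epsilon> 0 \<xi>) M\<bar>) \<longlonglongrightarrow> \<bar>exp_moment v M \<xi> - list_eval (power_list v \<epsilon> 0 \<xi>) M\<bar>"
      by (intro tendsto_intros a)
    moreover have "(\<lambda>n. K * (1 / real (Suc n) + \<epsilon>) * C) \<longlonglongrightarrow> K * (0 + \<epsilon>) * C"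
      by (intro tendsto_mult tendsto_add inv tendsto_const)
    moreover have "\<forall>\<^sub>F n in sequentially. \<bar>a n - list_eval (power_list v \<epsilon> 0 \<xi>) M\<bar> \<le> K * (1 / real (Suc n) + \<epsilon>) * C"
      using small by eventually_elim (intro close, use \<epsilon> in auto)
    ultimately show ?thesis
      unfolding C_def[symmetric] by (auto intro: tendsto_le[OF sequentially_bot])
  qed
  then show ?thesis using K(1) by blast
qed

text \<open>A three-term estimate through a fixed step \<epsilon>: \<Lambda> is close to the list
  value under \<open>M t\<close>, that value converges to the list value under \<open>N\<close>, and
  the latter is close to the moment of \<open>N\<close>. \<Lambda> is arbitrary, so the lemma
  applies to list values with shrinking step, to moments of functionals, and to a constant that is
  to be identified.\<close>

lemma tendsto_exp_moment_aux:
  fixes M :: "'a \<Rightarrow> real \<Rightarrow> real"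
  assumes F: "F \<noteq> bot" and \<delta>: "\<delta> > 0"
    and pos: "\<forall>\<^sub>F t in F. exp_positive {\<xi> - \<delta>..\<xi> + \<delta>} (M t)"
    and lim: "\<And>s. s \<in> {\<xi> - \<delta>..\<xi> + \<delta>} \<Longrightarrow> ((\<lambda>t. M t s) \<longlongrightarrow> N s) F"
    and K: "K \<ge> 0" and e: "(e \<longlongrightarrow> 0) F"
    and approx: "\<forall>\<^sub>F t in F. \<forall>\<epsilon>>0. real v * \<epsilon> \<le> \<delta> / 2 \<longrightarrow>
      \<bar>\<Lambda> t - list_eval (power_list v \<epsilon> 0 \<xi>) (M t)\<bar> \<le> K * (e t + \<epsilon>) * (M t (\<xi> + \<delta>) + M t (\<xi> - \<delta>))"
  shows "(\<Lambda> \<longlongrightarrow> exp_moment v N \<xi>) F"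
proof (rule tendstoI)
  fix \<eta> :: real assume \<eta>: "\<eta> > 0"
  have N: "exp_positive {\<xi> - \<delta>..\<xi> + \<delta>} N" by (rule exp_positive_limit[OF F pos lim])
  obtain K' where K': "K' \<ge> 0" "\<And>\<epsilon>. \<epsilon> > 0 \<Longrightarrow> real v * \<epsilon> \<le> \<delta> / 2 \<Longrightarrow>
    \<bar>exp_moment v N \<xi> - list_eval (power_list v \<epsilon> 0 \<xi>) N\<bar> \<le> K' * \<epsilon> * (N (\<xi> + \<delta>) + N (\<xi> - \<delta>))"
    using exp_moment_approx[OF \<delta>, of \<xi> v] N by blast
  \<comment> \<open>The summand 1 leaves room for the masses of \<open>M t\<close>, which lie below
    \<open>C\<close> only eventually.\<close>
  define C where "C = N (\<xi> + \<delta>) + N (\<xi> - \<delta>) + 1"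
  have N0: "N (\<xi> + \<delta>) \<ge> 0" "N (\<xi> - \<delta>) \<ge> 0" using exp_positive_nonneg[OF N] \<delta> by auto
  have C: "C \<ge> 1" using N0 by (simp add: C_def)
  have cancel: "w * (x / (n * w)) = x / n" if "w > 0" for w x n :: real
    using that by simp
  \<comment> \<open>The first bound keeps the exponents in the interval; the second makes each of
    the two errors linear in \<epsilon> at most \<eta> / 8. Two further errors below \<eta> / 4
    bring the total to less than 3 \<eta> / 4.\<close>
  define \<epsilon> where "\<epsilon> = min (\<delta> / (2 * (real v + 1))) (\<eta> / (8 * (K + K' + 1) * C))"
  have \<epsilon>: "\<epsilon> > 0" using \<delta> \<eta> K K'(1) C by (simp add: \<epsilon>_def)
  have "real v * \<epsilon> \<le> (real v + 1) * (\<delta> / (2 * (real v + 1)))"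
    using \<epsilon> by (intro mult_mono) (auto simp: \<epsilon>_def)
  also have "\<dots> = \<delta> / 2" using cancel[of "real v + 1" \<delta> 2] by simp
  finally have v\<epsilon>: "real v * \<epsilon> \<le> \<delta> / 2" .
  have "(K + K' + 1) * C * \<epsilon> \<le> (K + K' + 1) * C * (\<eta> / (8 * (K + K' + 1) * C))"
    using K K'(1) C by (intro mult_left_mono) (auto simp: \<epsilon>_def)
  also have "\<dots> = \<eta> / 8"
    using cancel[of "(K + K' + 1) * C" \<eta> 8] K K'(1) C unfolding mult.assoc[of 8] by simp
  finally have "(K + K' + 1) * C * \<epsilon> \<le> \<eta> / 8" .
  moreover have "K * \<epsilon> * C \<le> (K + K' + 1) * C * \<epsilon>" "K' * \<epsilon> * C \<le> (K + K' + 1) * C * \<epsilon>"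
    using K K'(1) C \<epsilon> by (auto simp: algebra_simps)
  ultimately have small: "K * \<epsilon> * C \<le> \<eta> / 8" "K' * \<epsilon> * C \<le> \<eta> / 8" by linarith+
  have "((\<lambda>t. M t (\<xi> + \<delta>) + M t (\<xi> - \<delta>)) \<longlongrightarrow> N (\<xi> + \<delta>) + N (\<xi> - \<delta>)) F"
    using \<delta> by (intro tendsto_add lim) auto
  then have ev1: "\<forall>\<^sub>F t in F. M t (\<xi> + \<delta>) + M t (\<xi> - \<delta>) < C"
    by (rule order_tendstoD(2)) (simp add: C_def)
  have "((\<lambda>t. K * \<bar>e t\<bar> * C) \<longlongrightarrow> K * \<bar>0\<bar> * C) F" by (intro tendsto_intros e)
  then have ev2: "\<forall>\<^sub>F t in F. K * \<bar>e t\<bar> * C < \<eta> / 4"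
    by (rule order_tendstoD(2)) (use \<eta> in simp)
  have "((\<lambda>t. list_eval (power_list v \<epsilon> 0 \<xi>) (M t)) \<longlongrightarrow> list_eval (power_list v \<epsilon> 0 \<xi>) N) F"
  proof (rule tendsto_list_eval)
    fix s assume "s \<in> snd ` set (power_list v \<epsilon> 0 \<xi>)"
    then have "s \<in> {\<xi> - \<delta>..\<xi> + \<delta>}"
      using power_list_in_interval[of \<epsilon> v \<xi> \<xi> \<delta> 0] \<epsilon> v\<epsilon> \<delta> by auto
    then show "((\<lambda>t. M t s) \<longlongrightarrow> N s) F" by (rule lim)
  qed
  from tendstoD[OF this, of "\<eta> / 4"] have ev3: "\<forall>\<^sub>F t in F. \<bar>list_eval (power_list v \<epsilon> 0 \<xi>) (M t) - list_eval (power_list v \<epsilon> 0 \<xi>) N\<bar> < \<eta> / 4"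
    using \<eta> by (simp add: dist_real_def)
  show "\<forall>\<^sub>F t in F. dist (\<Lambda> t) (exp_moment v N \<xi>) < \<eta>"
    using pos approx ev1 ev2 ev3
  proof eventually_elim
    case (elim t)
    have M0: "M t (\<xi> + \<delta>) \<ge> 0" "M t (\<xi> - \<delta>) \<ge> 0" using exp_positive_nonneg[OF elim(1)] \<delta> by auto
    have "\<bar>\<Lambda> t - list_eval (power_list v \<epsilon> 0 \<xi>) (M t)\<bar> \<le> K * (e t + \<epsilon>) * (M t (\<xi> + \<delta>) + M t (\<xi> - \<delta>))"
      using elim(2) \<epsilon> v\<epsilon> by blast
    also have "\<dots> \<le> K * (\<bar>e t\<bar> + \<epsilon>) * C"
      using K \<epsilon> M0 elim(3) by (intro mult_mono[of "K * _"] mult_left_mono) auto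
    also have "\<dots> = K * \<bar>e t\<bar> * C + K * \<epsilon> * C" by (simp add: algebra_simps)
    finally have 1: "\<bar>\<Lambda> t - list_eval (power_list v \<epsilon> 0 \<xi>) (M t)\<bar> \<le> K * \<bar>e t\<bar> * C + K * \<epsilon> * C" .
    have "\<bar>exp_moment v N \<xi> - list_eval (power_list v \<epsilon> 0 \<xi>) N\<bar> \<le> K' * \<epsilon> * (N (\<xi> + \<delta>) + N (\<xi> - \<delta>))"
      by (rule K'(2)[OF \<epsilon> v\<epsilon>])
    also have "\<dots> \<le> K' * \<epsilon> * C" using K'(1) \<epsilon> N0 by (intro mult_left_mono) (auto simp: C_def)
    finally show ?case
      using 1 elim(4,5) small \<eta> unfolding dist_real_def by linarith
  qed
qed

text \<open>For limits in which the step shrinks with the parameter and the exponent only tends to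
  \<xi>, as \<open>sqrt (2 / \<tau>) * \<beta> \<tau> i\<close> does.\<close>

lemma tendsto_power_list_moment:
  fixes M :: "'a \<Rightarrow> real \<Rightarrow> real"
  assumes F: "F \<noteq> bot" and \<delta>: "\<delta> > 0"
    and pos: "\<forall>\<^sub>F t in F. exp_positive {\<xi> - \<delta>..\<xi> + \<delta>} (M t)"
    and lim: "\<And>s. s \<in> {\<xi> - \<delta>..\<xi> + \<delta>} \<Longrightarrow> ((\<lambda>t. M t s) \<longlongrightarrow> N s) F"
    and \<epsilon>: "\<forall>\<^sub>F t in F. \<epsilon> t > 0" "(\<epsilon> \<longlongrightarrow> 0) F" and s: "(s \<longlongrightarrow> \<xi>) F"
  shows "((\<lambda>t. list_eval (power_list v (\<epsilon> t) c (s t)) (M t)) \<longlongrightarrow> exp_moment v N \<xi>) F"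
proof -
  obtain K where K: "K \<ge> 0" "\<And>M \<epsilon> s \<epsilon>'. exp_positive {\<xi> - \<delta>..\<xi> + \<delta>} M \<Longrightarrow> \<epsilon> > 0 \<Longrightarrow> \<epsilon>' > 0 \<Longrightarrow>
    real v * \<epsilon> + \<bar>s - \<xi>\<bar> \<le> \<delta> / 2 \<Longrightarrow> real v * \<epsilon>' \<le> \<delta> / 2 \<Longrightarrow>
    \<bar>list_eval (power_list v \<epsilon> c s) M - list_eval (power_list v \<epsilon>' 0 \<xi>) M\<bar>
      \<le> K * (\<epsilon> + \<bar>s - \<xi>\<bar> + \<epsilon>') * (M (\<xi> + \<delta>) + M (\<xi> - \<delta>))"
    using list_eval_power_list_diff[OF \<delta>, of \<xi> v c] by blast
  have e: "((\<lambda>t. \<epsilon> t + \<bar>s t - \<xi>\<bar>) \<longlongrightarrow> 0) F"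
    using tendsto_add[OF \<epsilon>(2) tendsto_rabs[OF tendsto_diff[OF s tendsto_const[of \<xi>]]]] by simp
  have "((\<lambda>t. real v * \<epsilon> t + \<bar>s t - \<xi>\<bar>) \<longlongrightarrow> real v * 0 + \<bar>\<xi> - \<xi>\<bar>) F"
    by (intro tendsto_intros \<epsilon>(2) s)
  then have small: "\<forall>\<^sub>F t in F. real v * \<epsilon> t + \<bar>s t - \<xi>\<bar> < \<delta> / 2"
    by (rule order_tendstoD(2)) (use \<delta> in simp)
  show ?thesis
  proof (rule tendsto_exp_moment_aux[OF F \<delta> pos lim K(1) e])
    show "\<forall>\<^sub>F t in F. \<forall>\<epsilon>'>0. real v * \<epsilon>' \<le> \<delta> / 2 \<longrightarrow>
      \<bar>list_eval (power_list v (\<epsilon> t) c (s t)) (M t) - list_eval (power_list v \<epsilon>' 0 \<xi>) (M t)\<bar>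
        \<le> K * (\<epsilon> t + \<bar>s t - \<xi>\<bar> + \<epsilon>') * (M t (\<xi> + \<delta>) + M t (\<xi> - \<delta>))"
      using pos \<epsilon>(1) small by eventually_elim (intro allI impI K(2), auto)
  qed
qed

text \<open>For an outer limit after an inner one that has already replaced list values by moments
  of a functional.\<close>

lemma tendsto_exp_moment:
  fixes M :: "'a \<Rightarrow> real \<Rightarrow> real"
  assumes F: "F \<noteq> bot" and \<delta>: "\<delta> > 0"
    and pos: "\<forall>\<^sub>F t in F. exp_positive {\<xi> - \<delta>..\<xi> + \<delta>} (M t)"
    and lim: "\<And>s. s \<in> {\<xi> - \<delta>..\<xi> + \<delta>} \<Longrightarrow> ((\<lambda>t. M t s) \<longlongrightarrow> N s) F"
  shows "((\<lambda>t. exp_moment v (M t) \<xi>) \<longlongrightarrow> exp_moment v N \<xi>) F"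
proof -
  obtain K where K: "K \<ge> 0" "\<And>M \<epsilon>. exp_positive {\<xi> - \<delta>..\<xi> + \<delta>} M \<Longrightarrow> \<epsilon> > 0 \<Longrightarrow> real v * \<epsilon> \<le> \<delta> / 2 \<Longrightarrow>
    \<bar>exp_moment v M \<xi> - list_eval (power_list v \<epsilon> 0 \<xi>) M\<bar> \<le> K * \<epsilon> * (M (\<xi> + \<delta>) + M (\<xi> - \<delta>))"
    using exp_moment_approx[OF \<delta>, of \<xi> v] by blast
  show ?thesis
  proof (rule tendsto_exp_moment_aux[OF F \<delta> pos lim K(1) tendsto_const[of 0]])
    show "\<forall>\<^sub>F t in F. \<forall>\<epsilon>>0. real v * \<epsilon> \<le> \<delta> / 2 \<longrightarrow>
      \<bar>exp_moment v (M t) \<xi> - list_eval (power_list v \<epsilon> 0 \<xi>) (M t)\<bar> \<le> K * (0 + \<epsilon>) * (M t (\<xi> + \<delta>) + M t (\<xi> - \<delta>))"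
      using pos
    proof eventually_elim
      case (elim t)
      show ?case using K(2)[OF elim] by simp
    qed
  qed
qed

subsection \<open>Mellin and Laplace transforms\<close>

text \<open>Tonelli's theorem with a Bochner integral inside, which is 0 by convention where it
  diverges. Finiteness of the double integral confines divergence at points with
  \<open>W x \<noteq> 0\<close> to a null set; where \<open>W x = 0\<close> both integrands
  vanish.\<close>

lemma nn_integral_weighted_LINT:
  fixes W :: "real \<Rightarrow> real" and G :: "real \<Rightarrow> real \<Rightarrow> real"
  assumes W [measurable]: "W \<in> borel_measurable borel" and W0: "\<And>x. W x \<ge> 0"
    and G [measurable]: "(\<lambda>(x, u). G x u) \<in> borel_measurable (borel \<Otimes>\<^sub>M borel)" and G0: "\<And>x u. G x u \<ge> 0"
    and fin: "(\<integral>\<^sup>+u. \<integral>\<^sup>+x. ennreal (W x * G x u) \<partial>lborel \<partial>lborel) < \<infinity>"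
  shows "(\<integral>\<^sup>+x. ennreal (W x * (LINT u|lborel. G x u)) \<partial>lborel)
    = (\<integral>\<^sup>+u. \<integral>\<^sup>+x. ennreal (W x * G x u) \<partial>lborel \<partial>lborel)"
proof -
  have G' [measurable]: "G x \<in> borel_measurable borel" for x
    using measurable_compose[OF measurable_Pair1' G, of x] by (simp add: comp_def)
  have sw: "(\<integral>\<^sup>+u. \<integral>\<^sup>+x. ennreal (W x * G x u) \<partial>lborel \<partial>lborel)
      = (\<integral>\<^sup>+x. \<integral>\<^sup>+u. ennreal (W x * G x u) \<partial>lborel \<partial>lborel)"
    by (rule lborel_pair.Fubini') measurable
  have meas: "(\<lambda>x. \<integral>\<^sup>+u. ennreal (W x * G x u) \<partial>lborel) \<in> borel_measurable lborel"
    by measurable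
  have "AE x in lborel. (\<integral>\<^sup>+u. ennreal (W x * G x u) \<partial>lborel) \<noteq> \<infinity>"
    by (rule nn_integral_PInf_AE[OF meas]) (use fin sw in simp)
  then have "AE x in lborel. ennreal (W x * (LINT u|lborel. G x u)) = (\<integral>\<^sup>+u. ennreal (W x * G x u) \<partial>lborel)"
  proof eventually_elim
    case (elim x)
    have split: "(\<integral>\<^sup>+u. ennreal (W x * G x u) \<partial>lborel) = ennreal (W x) * (\<integral>\<^sup>+u. ennreal (G x u) \<partial>lborel)"
      using W0 by (subst nn_integral_cmult[symmetric]) (auto simp: ennreal_mult G0)
    show ?case
    proof (cases "W x = 0")
      case False
      then have "(\<integral>\<^sup>+u. ennreal (G x u) \<partial>lborel) \<noteq> \<infinity>"
        using elim W0[of x] unfolding split by (auto simp: ennreal_mult_eq_top_iff)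
      then have int: "integrable lborel (G x)"
        by (intro integrableI_nonneg) (auto simp: G0 top.not_eq_extremum)
      show ?thesis
        unfolding split nn_integral_eq_integral[OF int AE_I2[OF G0]]
        using W0 G0 by (simp add: ennreal_mult)
    qed (simp add: split)
  qed
  then show ?thesis unfolding sw by (rule nn_integral_cong_AE)
qed

section \<open>Mellin transforms of Beta kernels and Jacobi weights\<close>

lemma nn_integral_beta_kernel:
  assumes "a < b" "a + s + 1 > 0"
  shows "(\<integral>\<^sup>+x. ennreal (x powr s * beta_kernel a b x) \<partial>lborel) = ennreal (Gamma (a + s + 1) / Gamma (b + s + 1))"
proof -
  have G: "Gamma (b - a) > 0" using assms by (intro Gamma_real_pos) simp
  have "((\<lambda>x. x powr (a + s + 1 - 1) * (1 - x) powr (b - a - 1)) has_integral Beta (a + s + 1) (b - a)) {0<..<1}"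
    using has_integral_Beta_real[of "a + s + 1" "b - a"] assms by (simp add: has_integral_Icc_iff_Ioo)
  then have "((\<lambda>x. x powr (a + s) * (1 - x) powr (b - a - 1) * (1 / Gamma (b - a)))
      has_integral Beta (a + s + 1) (b - a) * (1 / Gamma (b - a))) {0<..<1}"
    by (intro has_integral_mult_left) simp
  then have "(\<integral>\<^sup>+x. ennreal (indicator {0<..<1} x * (x powr (a + s) * (1 - x) powr (b - a - 1) * (1 / Gamma (b - a)))) \<partial>lborel)
      = ennreal (Beta (a + s + 1) (b - a) * (1 / Gamma (b - a)))"
    using G by (intro nn_integral_has_integral_lebesgue) auto
  moreover have "indicator {0<..<1} x * (x powr (a + s) * (1 - x) powr (b - a - 1) * (1 / Gamma (b - a)))
      = x powr s * beta_kernel a b x" for x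
    by (auto simp: beta_kernel_def indicator_def powr_add mult_ac)
  moreover have "Beta (a + s + 1) (b - a) * (1 / Gamma (b - a)) = Gamma (a + s + 1) / Gamma (b + s + 1)"
    using G by (simp add: Beta_def add_ac)
  ultimately show ?thesis by simp
qed

lemma beta_kernel_nonneg: "a < b \<Longrightarrow> 0 \<le> beta_kernel a b x"
  using Gamma_real_pos[of "b - a"] by (auto simp: beta_kernel_def)

lemma beta_kernel_measurable [measurable]: "beta_kernel a b \<in> borel_measurable borel"
  unfolding beta_kernel_def[abs_def] by measurable

lemma mellin_conv_measurable [measurable]:
  assumes [measurable]: "f \<in> borel_measurable borel" "g \<in> borel_measurable borel"
  shows "mellin_conv f g \<in> borel_measurable borel"
  unfolding mellin_conv_def[abs_def] set_lebesgue_integral_def by measurable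

lemma mellin_conv_nonneg:
  assumes "\<And>x. 0 \<le> f x" "\<And>x. 0 \<le> g x"
  shows "0 \<le> mellin_conv f g x"
  unfolding mellin_conv_def set_lebesgue_integral_def
  by (rule Bochner_Integration.integral_nonneg) (auto simp: indicator_def assms)

lemma mellin_conv_support:
  assumes f: "\<And>x. x \<notin> {0<..<1} \<Longrightarrow> f x = 0" and g: "\<And>x. x \<notin> {0<..<1} \<Longrightarrow> g x = 0"
    and x: "x \<notin> {0<..<1}"
  shows "mellin_conv f g x = 0"
proof -
  have "indicator {0<..} u *\<^sub>R (f u * g (x / u) / u) = 0" for u
  proof (cases "0 < u \<and> u < 1")
    case True
    then have "x / u \<notin> {0<..<1}"
      using x by (auto simp: field_simps not_less)
    then show ?thesis using g by simp
  next
    case False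
    then show ?thesis using f by (auto simp: indicator_def)
  qed
  then show ?thesis unfolding mellin_conv_def set_lebesgue_integral_def by (simp only: integral_zero)
qed

text \<open>The Mellin transform is multiplicative: x = u * y splits the power of x, as both
  functions live on the positive half-line.\<close>

lemma nn_integral_mellin_conv:
  assumes [measurable]: "f \<in> borel_measurable borel" "g \<in> borel_measurable borel"
    and f0: "\<And>x. 0 \<le> f x" and g0: "\<And>x. 0 \<le> g x"
    and f: "\<And>x. x \<le> 0 \<Longrightarrow> f x = 0" and g: "\<And>x. x \<le> 0 \<Longrightarrow> g x = 0"
    and A: "(\<integral>\<^sup>+x. ennreal (x powr s * f x) \<partial>lborel) = ennreal A"
    and B: "(\<integral>\<^sup>+x. ennreal (x powr s * g x) \<partial>lborel) = ennreal B" and AB: "0 \<le> A" "0 \<le> B"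
  shows "(\<integral>\<^sup>+x. ennreal (x powr s * mellin_conv f g x) \<partial>lborel) = ennreal (A * B)"
proof -
  define G where "G x u = indicator {0<..} u *\<^sub>R (f u * g (x / u) / u)" for x u :: real
  have G0: "G x u \<ge> 0" for x u by (auto simp: G_def indicator_def f0 g0)
  have "(\<integral>\<^sup>+x. ennreal (x powr s * G x u) \<partial>lborel) = ennreal (u powr s * f u) * ennreal B" for u
  proof (cases "u > 0")
    case True
    \<comment> \<open>The Jacobian u of the substitution cancels the division by u in the
      convolution.\<close>
    have "(\<integral>\<^sup>+x. ennreal (x powr s * G x u) \<partial>lborel)
        = ennreal \<bar>u\<bar> * (\<integral>\<^sup>+y. ennreal ((0 + u * y) powr s * G (0 + u * y) u) \<partial>lborel)"
      by (rule nn_integral_real_affine) (use True in \<open>auto simp: G_def\<close>)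
    also have "\<dots> = (\<integral>\<^sup>+y. ennreal \<bar>u\<bar> * ennreal ((0 + u * y) powr s * G (0 + u * y) u) \<partial>lborel)"
      by (rule nn_integral_cmult[symmetric]) (simp add: G_def)
    also have "\<dots> = (\<integral>\<^sup>+y. ennreal (u powr s * f u) * ennreal (y powr s * g y) \<partial>lborel)"
    proof (rule nn_integral_cong)
      fix y :: real
      have "u * ((u * y) powr s * G (u * y) u) = (u powr s * f u) * (y powr s * g y)"
        using True g[of y] by (cases "y > 0") (auto simp: G_def powr_mult)
      moreover have "0 \<le> (u * y) powr s * G (u * y) u" using G0 by simp
      ultimately show "ennreal \<bar>u\<bar> * ennreal ((0 + u * y) powr s * G (0 + u * y) u)
          = ennreal (u powr s * f u) * ennreal (y powr s * g y)"
        using True f0 g0 by (simp flip: ennreal_mult)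
    qed
    also have "\<dots> = ennreal (u powr s * f u) * (\<integral>\<^sup>+y. ennreal (y powr s * g y) \<partial>lborel)"
      by (rule nn_integral_cmult) simp
    finally show ?thesis unfolding B .
  next
    case False
    then show ?thesis by (simp add: G_def f)
  qed
  then have eq: "(\<integral>\<^sup>+u. \<integral>\<^sup>+x. ennreal (x powr s * G x u) \<partial>lborel \<partial>lborel) = ennreal (A * B)"
    using AB by (simp add: nn_integral_multc A ennreal_mult)
  have "(\<integral>\<^sup>+x. ennreal (x powr s * (LINT u|lborel. G x u)) \<partial>lborel) = ennreal (A * B)"
    unfolding eq[symmetric] by (rule nn_integral_weighted_LINT) (auto simp: eq G0, simp add: G_def)
  then show ?thesis by (simp add: mellin_conv_def set_lebesgue_integral_def G_def)
qed

lemma mellin_conv_upto_basic: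
  assumes "\<And>h. h \<le> n \<Longrightarrow> f h \<in> borel_measurable borel" "\<And>h x. h \<le> n \<Longrightarrow> 0 \<le> f h x"
    and "\<And>h x. h \<le> n \<Longrightarrow> x \<notin> {0<..<1} \<Longrightarrow> f h x = 0"
  shows "mellin_conv_upto f n \<in> borel_measurable borel" "0 \<le> mellin_conv_upto f n x"
    "x \<notin> {0<..<1} \<Longrightarrow> mellin_conv_upto f n x = 0"
proof -
  have "mellin_conv_upto f n \<in> borel_measurable borel \<and> (\<forall>x. 0 \<le> mellin_conv_upto f n x) \<and>
    (\<forall>x. x \<notin> {0<..<1} \<longrightarrow> mellin_conv_upto f n x = 0)"
    using assms
  proof (induction n)
    case (Suc n)
    then have IH: "mellin_conv_upto f n \<in> borel_measurable borel" "\<And>x. 0 \<le> mellin_conv_upto f n x"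
      "\<And>x. x \<notin> {0<..<1} \<Longrightarrow> mellin_conv_upto f n x = 0" by auto
    show ?case
      using mellin_conv_measurable[OF IH(1) Suc.prems(1)[of "Suc n"]]
        mellin_conv_nonneg[OF IH(2) Suc.prems(2)[of "Suc n"]]
        mellin_conv_support[OF IH(3) Suc.prems(3)[of "Suc n"]] by simp
  qed simp
  then show "mellin_conv_upto f n \<in> borel_measurable borel" "0 \<le> mellin_conv_upto f n x"
    "x \<notin> {0<..<1} \<Longrightarrow> mellin_conv_upto f n x = 0" by blast+
qed

lemma nn_integral_mellin_conv_upto:
  assumes "\<And>h. h \<le> n \<Longrightarrow> f h \<in> borel_measurable borel" "\<And>h x. h \<le> n \<Longrightarrow> 0 \<le> f h x"
    and "\<And>h x. h \<le> n \<Longrightarrow> x \<notin> {0<..<1} \<Longrightarrow> f h x = 0"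
    and "\<And>h. h \<le> n \<Longrightarrow> (\<integral>\<^sup>+x. ennreal (x powr s * f h x) \<partial>lborel) = ennreal (A h)"
    and "\<And>h. h \<le> n \<Longrightarrow> 0 \<le> A h"
  shows "(\<integral>\<^sup>+x. ennreal (x powr s * mellin_conv_upto f n x) \<partial>lborel) = ennreal (\<Prod>h\<le>n. A h)"
  using assms
proof (induction n)
  case (Suc n)
  note basic = mellin_conv_upto_basic[of n f]
  have "(\<integral>\<^sup>+x. ennreal (x powr s * mellin_conv (mellin_conv_upto f n) (f (Suc n)) x) \<partial>lborel)
      = ennreal ((\<Prod>h\<le>n. A h) * A (Suc n))"
  proof (rule nn_integral_mellin_conv)
    show "(\<integral>\<^sup>+x. ennreal (x powr s * mellin_conv_upto f n x) \<partial>lborel) = ennreal (\<Prod>h\<le>n. A h)"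
      by (rule Suc.IH) (use Suc.prems in auto)
    show "0 \<le> (\<Prod>h\<le>n. A h)" using Suc.prems(5) by (intro prod_nonneg) auto
  qed (use Suc.prems basic in auto)
  then show ?case by (simp add: mult.commute)
qed simp

text \<open>The moment of real order s of the Jacobi weight, that is, its Mellin transform at s + 1;
  each Beta kernel contributes one Gamma quotient.\<close>

definition jacobi_mellin :: "nat \<Rightarrow> nat \<Rightarrow> (nat \<Rightarrow> real) \<Rightarrow> (nat \<Rightarrow> real) \<Rightarrow> real \<Rightarrow> real" where
  "jacobi_mellin r j a b s = (\<Prod>h\<le>r. Gamma (a h + s + 1) / Gamma (b h + (if h = j then 1 else 0) + s + 1))"

context
  fixes r j :: nat and a b :: "nat \<Rightarrow> real"
  assumes ab: "\<And>h. h \<le> r \<Longrightarrow> a h < b h"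
begin

lemma jacobi_weight_measurable: "jacobi_weight r j a b \<in> borel_measurable borel"
  and jacobi_weight_nonneg: "0 \<le> jacobi_weight r j a b x"
  and jacobi_weight_support: "x \<notin> {0<..<1} \<Longrightarrow> jacobi_weight r j a b x = 0"
proof -
  have ab': "a h < b h + (if h = j then 1 else 0)" if "h \<le> r" for h using ab[OF that] by auto
  note basic = mellin_conv_upto_basic[of r "\<lambda>h. beta_kernel (a h) (b h + (if h = j then 1 else 0))"]
  show "jacobi_weight r j a b \<in> borel_measurable borel" "0 \<le> jacobi_weight r j a b x"
    "x \<notin> {0<..<1} \<Longrightarrow> jacobi_weight r j a b x = 0"
    unfolding jacobi_weight_def
    by (rule basic; use ab' in \<open>auto simp: beta_kernel_nonneg beta_kernel_def[of _ _ x] beta_kernel_def\<close>)+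
qed

lemma nn_integral_jacobi_weight:
  assumes "\<And>h. h \<le> r \<Longrightarrow> a h + s + 1 > 0"
  shows "(\<integral>\<^sup>+x. ennreal (x powr s * jacobi_weight r j a b x) \<partial>lborel) = ennreal (jacobi_mellin r j a b s)"
  unfolding jacobi_weight_def jacobi_mellin_def
proof (rule nn_integral_mellin_conv_upto)
  fix h assume h: "h \<le> r"
  have ab': "a h < b h + (if h = j then 1 else 0)" using ab[OF h] by auto
  show "(\<integral>\<^sup>+x. ennreal (x powr s * beta_kernel (a h) (b h + (if h = j then 1 else 0)) x) \<partial>lborel)
      = ennreal (Gamma (a h + s + 1) / Gamma (b h + (if h = j then 1 else 0) + s + 1))"
    by (rule nn_integral_beta_kernel[OF ab' assms[OF h]])
  show "0 \<le> Gamma (a h + s + 1) / Gamma (b h + (if h = j then 1 else 0) + s + 1)"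
    using assms[OF h] ab' by (intro divide_nonneg_nonneg Gamma_real_nonneg) auto
  show "0 \<le> beta_kernel (a h) (b h + (if h = j then 1 else 0)) x" for x
    by (rule beta_kernel_nonneg[OF ab'])
qed (auto simp: beta_kernel_def)

lemma jacobi_mellin_pos:
  assumes "\<And>h. h \<le> r \<Longrightarrow> a h + s + 1 > 0"
  shows "jacobi_mellin r j a b s > 0"
  unfolding jacobi_mellin_def
proof (rule prod_pos)
  fix h assume "h \<in> {..r}"
  then have "h \<le> r" by simp
  then show "0 < Gamma (a h + s + 1) / Gamma (b h + (if h = j then 1 else 0) + s + 1)"
    using assms[of h] ab[of h] by (intro divide_pos_pos Gamma_real_pos) auto
qed

end

section \<open>Laplace transforms of the Hermite rows\<close>

lemma nn_integral_gauss_density: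
  "(\<integral>\<^sup>+t. ennreal (exp (s * t) * gauss_density a t) \<partial>lborel) = ennreal (exp (a * s + s\<^sup>2 / 4))"
proof -
  have nd: "gauss_density m t = normal_density m (1 / sqrt 2) t" for m t
    by (simp add: gauss_density_def normal_density_def power_divide)
  have eq: "exp (s * t) * gauss_density a t = exp (a * s + s\<^sup>2 / 4) * normal_density (a + s / 2) (1 / sqrt 2) t" for t
  proof -
    have "s * t + - ((t - a)\<^sup>2) = (a * s + s\<^sup>2 / 4) + - ((t - (a + s / 2))\<^sup>2)"
      by (simp add: power2_eq_square field_simps)
    then have "exp (s * t) * exp (- ((t - a)\<^sup>2)) = exp (a * s + s\<^sup>2 / 4) * exp (- ((t - (a + s / 2))\<^sup>2))"
      by (simp only: exp_add[symmetric])
    then show ?thesis by (simp add: gauss_density_def flip: nd)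
  qed
  have "(\<integral>\<^sup>+t. ennreal (normal_density (a + s / 2) (1 / sqrt 2) t) \<partial>lborel) = ennreal 1"
    using nn_integral_eq_integral[OF integrable_normal_density[of "1 / sqrt 2" "a + s / 2"]] by simp
  then show ?thesis
    unfolding eq by (simp add: ennreal_mult nn_integral_cmult)
qed

lemma gamma_op_measurable [measurable]:
  assumes [measurable]: "f \<in> borel_measurable borel"
  shows "gamma_op \<rho> d f \<in> borel_measurable borel"
  unfolding gamma_op_def[abs_def] set_lebesgue_integral_def by measurable

lemma gamma_op_nonneg:
  assumes "d > 0" "\<And>x. 0 \<le> f x"
  shows "0 \<le> gamma_op \<rho> d f x"
  unfolding gamma_op_def set_lebesgue_integral_def
  using Gamma_real_pos[OF assms(1)]
  by (intro Bochner_Integration.integral_nonneg) (auto simp: indicator_def assms(2))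

lemma nn_integral_gamma_kernel:
  assumes "d > 0" "\<rho> > 0" "\<rho> + s > 0"
  shows "(\<integral>\<^sup>+u. ennreal (indicator {0<..} u * (\<rho> powr d / Gamma d * u powr (d - 1) * exp (- \<rho> * u)) * exp (- s * u)) \<partial>lborel)
    = ennreal ((\<rho> / (\<rho> + s)) powr d)"
proof -
  \<comment> \<open>The two exponentials combine to the rate \<rho> + s; its positivity makes the
    transform finite, and rescaling by it leads back to Euler's integral.\<close>
  define c where "c = \<rho> + s"
  have c: "c > 0" using assms by (simp add: c_def)
  have G: "Gamma d > 0" by (rule Gamma_real_pos) fact
  then have G': "Gamma d \<noteq> 0" by linarith
  have "ennreal (Gamma d) = ennreal \<bar>c\<bar> * (\<integral>\<^sup>+u. ennreal (indicator {0..} (0 + c * u) * (0 + c * u) powr (d - 1) / exp (0 + c * u)) \<partial>lborel)"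
    unfolding Gamma_conv_nn_integral_real[OF assms(1)]
    by (rule nn_integral_real_affine) (use c in auto)
  also have "\<dots> = (\<integral>\<^sup>+u. ennreal (c powr d) * ennreal (indicator {0<..} u * (u powr (d - 1) * exp (- c * u))) \<partial>lborel)"
  proof (subst nn_integral_cmult[symmetric], simp, rule nn_integral_cong)
    fix u :: real
    have "c * (indicator {0..} (0 + c * u) * (0 + c * u) powr (d - 1) / exp (0 + c * u))
        = c powr d * (indicator {0<..} u * (u powr (d - 1) * exp (- c * u)))"
    proof (cases "u > 0")
      case True
      have "c * (c powr (d - 1)) = c powr d" using c by (simp add: powr_diff)
      then show ?thesis
        using True c by (simp add: powr_mult exp_minus divide_inverse mult_ac indicator_def)
    next
      case False
      \<comment> \<open>At u = 0 the two indicators differ, but \<open>0 powr (d - 1)\<close> is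
        0.\<close>
      then show ?thesis using c by (cases "u = 0") (auto simp: indicator_def zero_le_mult_iff)
    qed
    then show "ennreal \<bar>c\<bar> * ennreal (indicator {0..} (0 + c * u) * (0 + c * u) powr (d - 1) / exp (0 + c * u))
        = ennreal (c powr d) * ennreal (indicator {0<..} u * (u powr (d - 1) * exp (- c * u)))"
      using c by (simp flip: ennreal_mult)
  qed
  finally have 1: "ennreal (Gamma d) = ennreal (c powr d) * (\<integral>\<^sup>+u. ennreal (indicator {0<..} u * (u powr (d - 1) * exp (- c * u))) \<partial>lborel)"
    by (simp add: nn_integral_cmult)
  define k where "k = \<rho> powr d / Gamma d / c powr d"
  have k: "k \<ge> 0" using G by (simp add: k_def)
  have "(\<integral>\<^sup>+u. ennreal (indicator {0<..} u * (\<rho> powr d / Gamma d * u powr (d - 1) * exp (- \<rho> * u)) * exp (- s * u)) \<partial>lborel)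
    = (\<integral>\<^sup>+u. ennreal (k * c powr d) * ennreal (indicator {0<..} u * (u powr (d - 1) * exp (- c * u))) \<partial>lborel)"
  proof (rule nn_integral_cong)
    fix u :: real
    have "exp (- \<rho> * u) * exp (- s * u) = exp (- c * u)" by (simp add: c_def exp_add[symmetric] algebra_simps)
    then have "indicator {0<..} u * (\<rho> powr d / Gamma d * u powr (d - 1) * exp (- \<rho> * u)) * exp (- s * u)
      = (k * c powr d) * (indicator {0<..} u * (u powr (d - 1) * exp (- c * u)))"
      using c by (simp add: k_def mult_ac)
    then show "ennreal (indicator {0<..} u * (\<rho> powr d / Gamma d * u powr (d - 1) * exp (- \<rho> * u)) * exp (- s * u))
      = ennreal (k * c powr d) * ennreal (indicator {0<..} u * (u powr (d - 1) * exp (- c * u)))"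
      using k by (simp flip: ennreal_mult)
  qed
  also have "\<dots> = ennreal k * (ennreal (c powr d) * (\<integral>\<^sup>+u. ennreal (indicator {0<..} u * (u powr (d - 1) * exp (- c * u))) \<partial>lborel))"
    using k by (simp add: nn_integral_cmult ennreal_mult mult.assoc)
  also have "\<dots> = ennreal (k * Gamma d)"
    unfolding 1[symmetric] using k G by (simp add: ennreal_mult)
  also have "k * Gamma d = (\<rho> / (\<rho> + s)) powr d"
    using G' assms c by (simp add: k_def c_def powr_divide)
  finally show ?thesis .
qed

text \<open>The operator averages shifts of \<open>f\<close>; a shift by u multiplies the transform
  by exp (- s u), and the average of these factors under the Gamma law is the multiplier (\<rho> /
  (\<rho> + s))^d.\<close>

lemma nn_integral_gamma_op:
  assumes "d > 0" "\<rho> > 0" "\<rho> + s > 0" and [measurable]: "f \<in> borel_measurable borel"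
    and f0: "\<And>x. 0 \<le> f x" and A: "(\<integral>\<^sup>+t. ennreal (exp (s * t) * f t) \<partial>lborel) = ennreal A" "0 \<le> A"
  shows "(\<integral>\<^sup>+t. ennreal (exp (s * t) * gamma_op \<rho> d f t) \<partial>lborel) = ennreal ((\<rho> / (\<rho> + s)) powr d * A)"
proof -
  define k where "k u = indicator {0<..} u * (\<rho> powr d / Gamma d * u powr (d - 1) * exp (- \<rho> * u))" for u
  have k0: "k u \<ge> 0" for u using Gamma_real_pos[OF assms(1)] by (simp add: k_def)
  have [measurable]: "k \<in> borel_measurable borel" by (simp add: k_def[abs_def])
  have "(\<integral>\<^sup>+t. ennreal (exp (s * t) * (k u * f (t + u))) \<partial>lborel) = ennreal (k u * exp (- s * u)) * ennreal A" for u
  proof -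
    have "(\<integral>\<^sup>+t. ennreal (exp (s * t) * (k u * f (t + u))) \<partial>lborel)
        = ennreal \<bar>1\<bar> * (\<integral>\<^sup>+t. ennreal (exp (s * (- u + 1 * t)) * (k u * f ((- u + 1 * t) + u))) \<partial>lborel)"
      by (rule nn_integral_real_affine) auto
    also have "\<dots> = (\<integral>\<^sup>+t. ennreal (k u * exp (- s * u)) * ennreal (exp (s * t) * f t) \<partial>lborel)"
    proof (simp, rule nn_integral_cong)
      fix t
      have "exp (s * (t - u)) = exp (- s * u) * exp (s * t)" by (simp add: exp_add[symmetric] algebra_simps)
      then have "exp (s * (t - u)) * (k u * f t) = (k u * exp (- s * u)) * (exp (s * t) * f t)"
        by simp
      then show "ennreal (exp (s * (t - u)) * (k u * f t)) = ennreal (k u * exp (- (s * u))) * ennreal (exp (s * t) * f t)"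
        using k0 f0 by (simp flip: ennreal_mult)
    qed
    also have "\<dots> = ennreal (k u * exp (- s * u)) * ennreal A"
      by (simp add: nn_integral_cmult A)
    finally show ?thesis .
  qed
  then have "(\<integral>\<^sup>+u. \<integral>\<^sup>+t. ennreal (exp (s * t) * (k u * f (t + u))) \<partial>lborel \<partial>lborel)
      = (\<integral>\<^sup>+u. ennreal (k u * exp (- s * u)) \<partial>lborel) * ennreal A"
    by (simp add: nn_integral_multc)
  also have "(\<integral>\<^sup>+u. ennreal (k u * exp (- s * u)) \<partial>lborel) = ennreal ((\<rho> / (\<rho> + s)) powr d)"
    unfolding k_def by (rule nn_integral_gamma_kernel) fact+
  finally have eq: "(\<integral>\<^sup>+u. \<integral>\<^sup>+t. ennreal (exp (s * t) * (k u * f (t + u))) \<partial>lborel \<partial>lborel)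
      = ennreal ((\<rho> / (\<rho> + s)) powr d * A)"
    using A(2) by (simp add: ennreal_mult)
  have "(\<integral>\<^sup>+t. ennreal (exp (s * t) * (LINT u|lborel. k u * f (t + u))) \<partial>lborel)
      = ennreal ((\<rho> / (\<rho> + s)) powr d * A)"
    unfolding eq[symmetric] by (rule nn_integral_weighted_LINT) (auto simp: eq k0 f0)
  moreover have "gamma_op \<rho> d f t = (LINT u|lborel. k u * f (t + u))" for t
    by (simp only: gamma_op_def set_lebesgue_integral_def k_def real_scaleR_def mult.assoc)
  ultimately show ?thesis by simp
qed

definition hermite_laplace ::
  "nat \<Rightarrow> (nat \<Rightarrow> real) \<Rightarrow> (nat \<Rightarrow> real) \<Rightarrow> real \<Rightarrow> nat \<Rightarrow> real \<Rightarrow> real" where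
  "hermite_laplace r \<rho> d ah j s =
     (if j < r then \<rho> j / (\<rho> j + s) else 1) * ((\<Prod>h<r. (\<rho> h / (\<rho> h + s)) powr d h) * exp (ah * s + s\<^sup>2 / 4))"

lemma foldr_gamma_op:
  fixes \<rho> d :: "nat \<Rightarrow> real"
  assumes "\<And>h. h \<in> set hs \<Longrightarrow> d h > 0"
  shows "foldr (\<lambda>h. gamma_op (\<rho> h) (d h)) hs (gauss_density ah) \<in> borel_measurable borel"
    and "0 \<le> foldr (\<lambda>h. gamma_op (\<rho> h) (d h)) hs (gauss_density ah) t"
proof -
  have "foldr (\<lambda>h. gamma_op (\<rho> h) (d h)) hs (gauss_density ah) \<in> borel_measurable borel \<and>
    (\<forall>t. 0 \<le> foldr (\<lambda>h. gamma_op (\<rho> h) (d h)) hs (gauss_density ah) t)"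
    using assms
  proof (induction hs)
    case Nil
    have "gauss_density ah \<in> borel_measurable borel" unfolding gauss_density_def[abs_def] by measurable
    then show ?case by (simp add: gauss_density_def)
  next
    case (Cons h hs)
    then show ?case by (auto intro!: gamma_op_measurable gamma_op_nonneg)
  qed
  then show "foldr (\<lambda>h. gamma_op (\<rho> h) (d h)) hs (gauss_density ah) \<in> borel_measurable borel"
    and "0 \<le> foldr (\<lambda>h. gamma_op (\<rho> h) (d h)) hs (gauss_density ah) t" by auto
qed

lemma nn_integral_foldr_gamma_op:
  fixes \<rho> d :: "nat \<Rightarrow> real"
  assumes "\<And>h. h \<in> set hs \<Longrightarrow> d h > 0" "\<And>h. h \<in> set hs \<Longrightarrow> \<rho> h > 0" "\<And>h. h \<in> set hs \<Longrightarrow> \<rho> h + s > 0"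
  shows "(\<integral>\<^sup>+t. ennreal (exp (s * t) * foldr (\<lambda>h. gamma_op (\<rho> h) (d h)) hs (gauss_density ah) t) \<partial>lborel)
    = ennreal ((\<Prod>h\<leftarrow>hs. (\<rho> h / (\<rho> h + s)) powr d h) * exp (ah * s + s\<^sup>2 / 4))"
  using assms
proof (induction hs)
  case Nil
  then show ?case by (simp add: nn_integral_gauss_density)
next
  case (Cons h hs)
  have "0 \<le> (\<Prod>h\<leftarrow>hs. (\<rho> h / (\<rho> h + s)) powr d h)" by (induction hs) auto
  then have "(\<integral>\<^sup>+t. ennreal (exp (s * t) * gamma_op (\<rho> h) (d h) (foldr (\<lambda>h. gamma_op (\<rho> h) (d h)) hs (gauss_density ah)) t) \<partial>lborel)
    = ennreal ((\<rho> h / (\<rho> h + s)) powr d h * ((\<Prod>h\<leftarrow>hs. (\<rho> h / (\<rho> h + s)) powr d h) * exp (ah * s + s\<^sup>2 / 4)))"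
    using Cons foldr_gamma_op[of hs d \<rho> ah] by (intro nn_integral_gamma_op) auto
  then show ?case by (simp add: mult.assoc)
qed

context
  fixes r :: nat and \<rho> d :: "nat \<Rightarrow> real" and ah :: real
  assumes d_pos: "\<And>h. h < r \<Longrightarrow> d h > 0" and \<rho>_pos: "\<And>h. h < r \<Longrightarrow> \<rho> h > 0"
begin

lemma hermite_row_measurable: "hermite_row r \<rho> d ah j \<in> borel_measurable borel"
  and hermite_row_nonneg: "0 \<le> hermite_row r \<rho> d ah j t"
proof -
  have base: "hermite_base r \<rho> d ah \<in> borel_measurable borel" "0 \<le> hermite_base r \<rho> d ah t" for t
    unfolding hermite_base_def by (rule foldr_gamma_op; use d_pos in simp)+
  show "hermite_row r \<rho> d ah j \<in> borel_measurable borel"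
    using base(1) gamma_op_measurable[OF base(1)] by (simp add: hermite_row_def[abs_def])
  show "0 \<le> hermite_row r \<rho> d ah j t"
    using base(2) by (auto simp: hermite_row_def intro!: gamma_op_nonneg)
qed

lemma nn_integral_hermite_row:
  assumes s: "\<And>h. h < r \<Longrightarrow> \<rho> h + s > 0"
  shows "(\<integral>\<^sup>+t. ennreal (exp (s * t) * hermite_row r \<rho> d ah j t) \<partial>lborel) = ennreal (hermite_laplace r \<rho> d ah j s)"
proof -
  have base: "hermite_base r \<rho> d ah \<in> borel_measurable borel" "0 \<le> hermite_base r \<rho> d ah t" for t
    unfolding hermite_base_def by (rule foldr_gamma_op; use d_pos in simp)+
  define P where "P = (\<Prod>h<r. (\<rho> h / (\<rho> h + s)) powr d h) * exp (ah * s + s\<^sup>2 / 4)"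
  have P: "P \<ge> 0" unfolding P_def by (intro mult_nonneg_nonneg prod_nonneg) auto
  have "(\<Prod>h\<leftarrow>[0..<r]. (\<rho> h / (\<rho> h + s)) powr d h) = (\<Prod>h<r. (\<rho> h / (\<rho> h + s)) powr d h)"
    by (subst prod.distinct_set_conv_list[symmetric]) (auto simp: atLeast0LessThan)
  then have 1: "(\<integral>\<^sup>+t. ennreal (exp (s * t) * hermite_base r \<rho> d ah t) \<partial>lborel) = ennreal P"
    unfolding hermite_base_def P_def
    using nn_integral_foldr_gamma_op[of "[0..<r]" d \<rho> s ah] d_pos \<rho>_pos s by simp
  show ?thesis
  proof (cases "j < r")
    case True
    have "(\<integral>\<^sup>+t. ennreal (exp (s * t) * gamma_op (\<rho> j) 1 (hermite_base r \<rho> d ah) t) \<partial>lborel)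
      = ennreal ((\<rho> j / (\<rho> j + s)) powr 1 * P)"
      by (rule nn_integral_gamma_op) (use base 1 P \<rho>_pos s True in auto)
    then show ?thesis using True \<rho>_pos[OF True] s[OF True] by (simp add: hermite_row_def hermite_laplace_def P_def)
  next
    case False
    then show ?thesis using 1 by (simp add: hermite_row_def hermite_laplace_def P_def)
  qed
qed

lemma hermite_laplace_nonneg:
  assumes s: "\<And>h. h < r \<Longrightarrow> \<rho> h + s > 0"
  shows "0 \<le> hermite_laplace r \<rho> d ah j s"
  unfolding hermite_laplace_def
  using \<rho>_pos s by (intro mult_nonneg_nonneg prod_nonneg) (auto simp: less_imp_le)

end

subsection \<open>Transforms of rows as positive functionals\<close>

text \<open>
  \<open>M\<close> is the Laplace transform of the image of \<open>U t dt\<close> under \<open>T\<close>.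
\<close>

lemma list_eval_eq_integral:
  fixes U T :: "real \<Rightarrow> real"
  assumes "\<And>s. s \<in> snd ` set cs \<Longrightarrow> has_bochner_integral lborel (\<lambda>t. exp (s * T t) * U t) (M s)"
  shows "has_bochner_integral lborel (\<lambda>t. exp_poly cs (T t) * U t) (list_eval cs M)"
  using assms
proof (induction cs)
  case (Cons a cs)
  obtain c s where a: "a = (c, s)" by (cases a)
  have "has_bochner_integral lborel (\<lambda>t. c * (exp (s * T t) * U t) + exp_poly cs (T t) * U t) (c * M s + list_eval cs M)"
    using Cons a by (intro has_bochner_integral_add has_bochner_integral_mult_right Cons.IH) auto
  then show ?case by (simp add: a algebra_simps)
qed (simp add: has_bochner_integral_zero)

lemma exp_positive_transform:
  fixes U T :: "real \<Rightarrow> real"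
  assumes U: "\<And>t. 0 \<le> U t"
    and M: "\<And>s. s \<in> J \<Longrightarrow> has_bochner_integral lborel (\<lambda>t. exp (s * T t) * U t) (M s)"
  shows "exp_positive J M"
  unfolding exp_positive_def
proof (intro allI impI)
  fix cs assume cs: "snd ` set cs \<subseteq> J \<and> (\<forall>x. 0 \<le> exp_poly cs x)"
  then have "has_bochner_integral lborel (\<lambda>t. exp_poly cs (T t) * U t) (list_eval cs M)"
    by (intro list_eval_eq_integral[where T = T and U = U] M) auto
  then have "list_eval cs M = (LINT t|lborel. exp_poly cs (T t) * U t)"
    by (simp add: has_bochner_integral_integral_eq)
  also have "\<dots> \<ge> 0" using cs U by (intro Bochner_Integration.integral_nonneg) auto
  finally show "0 \<le> list_eval cs M" .
qed

lemma has_bochner_integral_hermite_row: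
  assumes "\<And>h. h < r \<Longrightarrow> d h > 0" "\<And>h. h < r \<Longrightarrow> \<rho> h > 0" "\<And>h. h < r \<Longrightarrow> \<rho> h + s > 0"
  shows "has_bochner_integral lborel (\<lambda>t. exp (s * t) * hermite_row r \<rho> d ah j t) (hermite_laplace r \<rho> d ah j s)"
proof (rule has_bochner_integral_nn_integral)
  show "(\<lambda>t. exp (s * t) * hermite_row r \<rho> d ah j t) \<in> borel_measurable lborel"
    using hermite_row_measurable[where r = r and d = d] assms by measurable
qed (use assms nn_integral_hermite_row hermite_row_nonneg hermite_laplace_nonneg in auto)

text \<open>For a genuine density the integral and \<open>exp_moment\<close> agree: the integral
  differs from the list values by an error linear in the step, so the constant sequence of its value
  converges to \<open>exp_moment\<close>.\<close>

lemma has_bochner_integral_power_exp: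
  fixes U :: "real \<Rightarrow> real"
  assumes \<delta>: "\<delta> > 0" and U0: "\<And>t. 0 \<le> U t" and [measurable]: "U \<in> borel_measurable borel"
    and M: "\<And>s. s \<in> {\<xi> - \<delta>..\<xi> + \<delta>} \<Longrightarrow> has_bochner_integral lborel (\<lambda>t. exp (s * t) * U t) (M s)"
  shows "has_bochner_integral lborel (\<lambda>t. t ^ v * (U t * exp (\<xi> * t))) (exp_moment v M \<xi>)"
proof -
  obtain K where K: "K \<ge> 0" "\<And>\<epsilon> x. \<epsilon> > 0 \<Longrightarrow> real v * \<epsilon> \<le> \<delta> / 2 \<Longrightarrow>
    \<bar>exp_poly (power_list v \<epsilon> 0 \<xi>) x - x ^ v * exp (\<xi> * x)\<bar>
      \<le> K * \<epsilon> * (exp ((\<xi> + \<delta>) * x) + exp ((\<xi> - \<delta>) * x))"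
  proof -
    obtain K where K: "K\<ge>0" "\<forall>\<epsilon>>0. \<forall>s. real v * \<epsilon> + \<bar>s - \<xi>\<bar> \<le> \<delta> / 2 \<longrightarrow>
      (\<forall>x. \<bar>exp_poly (power_list v \<epsilon> 0 s) x - x ^ v * exp (\<xi> * x)\<bar>
        \<le> K * (\<epsilon> + \<bar>s - \<xi>\<bar>) * (exp ((\<xi> + \<delta>) * x) + exp ((\<xi> - \<delta>) * x)))"
      using power_list_approx[OF \<delta>, of v \<xi> 0] by blast
    show ?thesis
    proof (rule that[OF K(1)])
      fix \<epsilon> x :: real assume "\<epsilon> > 0" "real v * \<epsilon> \<le> \<delta> / 2"
      then show "\<bar>exp_poly (power_list v \<epsilon> 0 \<xi>) x - x ^ v * exp (\<xi> * x)\<bar>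
        \<le> K * \<epsilon> * (exp ((\<xi> + \<delta>) * x) + exp ((\<xi> - \<delta>) * x))"
        using K(2)[rule_format, of \<epsilon> \<xi> x] by simp
    qed
  qed
  have bnd: "has_bochner_integral lborel (\<lambda>t. (exp ((\<xi> + \<delta>) * t) + exp ((\<xi> - \<delta>) * t)) * U t) (M (\<xi> + \<delta>) + M (\<xi> - \<delta>))"
    unfolding distrib_right[of "exp _" "exp _"] using \<delta> by (intro has_bochner_integral_add M) auto
  have poly: "has_bochner_integral lborel (\<lambda>t. exp_poly (power_list v \<epsilon> 0 \<xi>) t * U t) (list_eval (power_list v \<epsilon> 0 \<xi>) M)"
    if "\<epsilon> > 0" "real v * \<epsilon> \<le> \<delta> / 2" for \<epsilon>
  proof (rule list_eval_eq_integral[where T = "\<lambda>t. t"])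
    fix s assume "s \<in> snd ` set (power_list v \<epsilon> 0 \<xi>)"
    then have "s \<in> {\<xi> - \<delta>..\<xi> + \<delta>}" using power_list_in_interval[of \<epsilon> v \<xi> \<xi> \<delta> 0] that \<delta> by auto
    then show "has_bochner_integral lborel (\<lambda>t. exp (s * t) * U t) (M s)" by (rule M)
  qed
  define I where "I = (LINT t|lborel. t ^ v * (U t * exp (\<xi> * t)))"
  have diff: "\<bar>exp_poly (power_list v \<epsilon> 0 \<xi>) t * U t - t ^ v * (U t * exp (\<xi> * t))\<bar>
      \<le> K * \<epsilon> * ((exp ((\<xi> + \<delta>) * t) + exp ((\<xi> - \<delta>) * t)) * U t)"
    if "\<epsilon> > 0" "real v * \<epsilon> \<le> \<delta> / 2" for \<epsilon> t
  proof -
    have "\<bar>exp_poly (power_list v \<epsilon> 0 \<xi>) t * U t - t ^ v * (U t * exp (\<xi> * t))\<bar>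
      = \<bar>exp_poly (power_list v \<epsilon> 0 \<xi>) t - t ^ v * exp (\<xi> * t)\<bar> * U t"
    proof -
      have "exp_poly (power_list v \<epsilon> 0 \<xi>) t * U t - t ^ v * (U t * exp (\<xi> * t))
        = (exp_poly (power_list v \<epsilon> 0 \<xi>) t - t ^ v * exp (\<xi> * t)) * U t" by (simp add: algebra_simps)
      then show ?thesis using U0 by (simp add: abs_mult)
    qed
    also have "\<dots> \<le> (K * \<epsilon> * (exp ((\<xi> + \<delta>) * t) + exp ((\<xi> - \<delta>) * t))) * U t"
      by (rule mult_right_mono[OF K(2)[OF that] U0])
    finally show ?thesis by (simp only: mult.assoc)
  qed
  have int: "integrable lborel (\<lambda>t. t ^ v * (U t * exp (\<xi> * t)))"
  proof -
    \<comment> \<open>One admissible step suffices: the integrand is an integrable list combination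
      minus an error dominated by \<open>bnd\<close>. The denominator v + 1 covers v = 0.\<close>
    define \<epsilon> where "\<epsilon> = \<delta> / (2 * (real v + 1))"
    have \<epsilon>: "\<epsilon> > 0" using \<delta> by (simp add: \<epsilon>_def)
    have "real v * \<epsilon> \<le> (real v + 1) * \<epsilon>" using \<epsilon> by simp
    also have "\<dots> = \<delta> / 2"
      using nonzero_mult_divide_mult_cancel_left[of "real v + 1" \<delta> 2] by (simp add: \<epsilon>_def mult.commute)
    finally have v\<epsilon>: "real v * \<epsilon> \<le> \<delta> / 2" .
    have "integrable lborel (\<lambda>t. exp_poly (power_list v \<epsilon> 0 \<xi>) t * U t - t ^ v * (U t * exp (\<xi> * t)))"
    proof (rule Bochner_Integration.integrable_bound)
      show "integrable lborel (\<lambda>t. K * \<epsilon> * ((exp ((\<xi> + \<delta>) * t) + exp ((\<xi> - \<delta>) * t)) * U t))"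
        using bnd by (intro integrable_mult_right) (simp add: has_bochner_integral_iff)
      show "(\<lambda>t. exp_poly (power_list v \<epsilon> 0 \<xi>) t * U t - t ^ v * (U t * exp (\<xi> * t))) \<in> borel_measurable lborel"
        using borel_measurable_has_bochner_integral[OF poly[OF \<epsilon> v\<epsilon>]] by measurable
      show "AE t in lborel. norm (exp_poly (power_list v \<epsilon> 0 \<xi>) t * U t - t ^ v * (U t * exp (\<xi> * t)))
        \<le> norm (K * \<epsilon> * ((exp ((\<xi> + \<delta>) * t) + exp ((\<xi> - \<delta>) * t)) * U t))"
        unfolding real_norm_def by (intro AE_I2 order_trans[OF diff[OF \<epsilon> v\<epsilon>] abs_ge_self])
    qed
    moreover have "integrable lborel (\<lambda>t. exp_poly (power_list v \<epsilon> 0 \<xi>) t * U t)"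
      using poly[OF \<epsilon> v\<epsilon>] by (simp add: has_bochner_integral_iff)
    ultimately have "integrable lborel (\<lambda>t. exp_poly (power_list v \<epsilon> 0 \<xi>) t * U t
      - (exp_poly (power_list v \<epsilon> 0 \<xi>) t * U t - t ^ v * (U t * exp (\<xi> * t))))"
      by (rule Bochner_Integration.integrable_diff[rotated])
    then show ?thesis by simp
  qed
  have pos: "exp_positive {\<xi> - \<delta>..\<xi> + \<delta>} M"
    by (rule exp_positive_transform[where T = "\<lambda>t. t", OF U0 M])
  have "((\<lambda>n::nat. I) \<longlonglongrightarrow> exp_moment v M \<xi>)"
  proof (rule tendsto_exp_moment_aux[where M = "\<lambda>_. M" and N = M and e = "\<lambda>_. 0" and K = K and \<delta> = \<delta>])
    have "\<bar>I - list_eval (power_list v \<epsilon> 0 \<xi>) M\<bar> \<le> K * (0 + \<epsilon>) * (M (\<xi> + \<delta>) + M (\<xi> - \<delta>))"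
      if \<epsilon>: "\<epsilon> > 0" "real v * \<epsilon> \<le> \<delta> / 2" for \<epsilon>
    proof -
      have eq: "list_eval (power_list v \<epsilon> 0 \<xi>) M - I
        = (LINT t|lborel. exp_poly (power_list v \<epsilon> 0 \<xi>) t * U t - t ^ v * (U t * exp (\<xi> * t)))"
        using poly[OF \<epsilon>] int unfolding I_def by (simp add: has_bochner_integral_iff)
      have "\<bar>list_eval (power_list v \<epsilon> 0 \<xi>) M - I\<bar> \<le> (LINT t|lborel. \<bar>exp_poly (power_list v \<epsilon> 0 \<xi>) t * U t - t ^ v * (U t * exp (\<xi> * t))\<bar>)"
        unfolding eq by (rule integral_abs_bound)
      also have "\<dots> \<le> (LINT t|lborel. K * \<epsilon> * ((exp ((\<xi> + \<delta>) * t) + exp ((\<xi> - \<delta>) * t)) * U t))"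
        using poly[OF \<epsilon>] int bnd diff[OF \<epsilon>]
        by (intro integral_mono integrable_abs Bochner_Integration.integrable_diff integrable_mult_right)
           (auto simp: has_bochner_integral_iff)
      also have "\<dots> = K * \<epsilon> * (M (\<xi> + \<delta>) + M (\<xi> - \<delta>))"
        using bnd by (simp add: has_bochner_integral_iff)
      finally show ?thesis by (simp add: abs_minus_commute)
    qed
    then show "\<forall>\<^sub>F t in sequentially. \<forall>\<epsilon>>0. real v * \<epsilon> \<le> \<delta> / 2 \<longrightarrow>
      \<bar>I - list_eval (power_list v \<epsilon> 0 \<xi>) M\<bar> \<le> K * (0 + \<epsilon>) * (M (\<xi> + \<delta>) + M (\<xi> - \<delta>))"
      by (intro always_eventually allI impI) auto
  qed (use pos \<delta> K(1) in simp_all)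
  then have "I = exp_moment v M \<xi>" by (simp add: LIMSEQ_const_iff)
  then show ?thesis using int by (simp add: has_bochner_integral_iff I_def)
qed

subsection \<open>Moments of scaled Jacobi rows\<close>

text \<open>The row is \<open>C0 * w (x0 * (1 + \<epsilon> * (t - c)))\<close>, so \<open>x0\<close>
  is the argument of the weight at t = c. With x = x0 exp (\<epsilon> (T - c)) the measure dt is dx
  / (x0 \<epsilon>) and exp (s T) is exp (s c) (x / x0)^(s / \<epsilon>), which leaves the Mellin
  transform at s / \<epsilon>.\<close>

definition scaled_transform ::
  "nat \<Rightarrow> nat \<Rightarrow> (nat \<Rightarrow> real) \<Rightarrow> (nat \<Rightarrow> real) \<Rightarrow> real \<Rightarrow> real \<Rightarrow> real \<Rightarrow> real \<Rightarrow> real \<Rightarrow> real" where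
  "scaled_transform r j a b C0 x0 \<epsilon> c s =
     C0 / (x0 * \<epsilon>) * exp (s * c) * x0 powr (- (s / \<epsilon>)) * jacobi_mellin r j a b (s / \<epsilon>)"

lemma has_bochner_integral_scaled_row:
  assumes ab: "\<And>h. h \<le> r \<Longrightarrow> a h < b h" and s: "\<And>h. h \<le> r \<Longrightarrow> a h + s / \<epsilon> + 1 > 0"
    and C0: "C0 \<ge> 0" and x0: "x0 > 0" and \<epsilon>: "\<epsilon> > 0"
  shows "has_bochner_integral lborel
    (\<lambda>t. exp (s * (c + ln (1 + \<epsilon> * (t - c)) / \<epsilon>)) * (C0 * jacobi_weight r j a b (x0 * (1 + \<epsilon> * (t - c)))))
    (scaled_transform r j a b C0 x0 \<epsilon> c s)"
proof (rule has_bochner_integral_nn_integral)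
  note [measurable] = jacobi_weight_measurable[of r a b, OF ab]
  note w0 = jacobi_weight_nonneg[of r a b, OF ab] and supp = jacobi_weight_support[of r a b, OF ab]
  let ?w = "jacobi_weight r j a b"
  show "(\<lambda>t. exp (s * (c + ln (1 + \<epsilon> * (t - c)) / \<epsilon>)) * (C0 * ?w (x0 * (1 + \<epsilon> * (t - c))))) \<in> borel_measurable lborel"
    by measurable
  show "AE t in lborel. 0 \<le> exp (s * (c + ln (1 + \<epsilon> * (t - c)) / \<epsilon>)) * (C0 * ?w (x0 * (1 + \<epsilon> * (t - c))))"
    using C0 w0 by (intro AE_I2) simp
  have m0: "jacobi_mellin r j a b (s / \<epsilon>) \<ge> 0"
    using jacobi_mellin_pos[of r a b "s / \<epsilon>", OF ab s] less_imp_le by blast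
  show "0 \<le> scaled_transform r j a b C0 x0 \<epsilon> c s"
    using C0 x0 \<epsilon> m0 by (simp add: scaled_transform_def)
  define k where "k = C0 / (x0 * \<epsilon>) * exp (s * c) * x0 powr (- (s / \<epsilon>))"
  have k: "k \<ge> 0" using C0 x0 \<epsilon> by (simp add: k_def)
  have "(\<integral>\<^sup>+t. ennreal (exp (s * (c + ln (1 + \<epsilon> * (t - c)) / \<epsilon>)) * (C0 * ?w (x0 * (1 + \<epsilon> * (t - c))))) \<partial>lborel)
    = ennreal \<bar>1 / (x0 * \<epsilon>)\<bar> * (\<integral>\<^sup>+x. ennreal (exp (s * (c + ln (1 + \<epsilon> * (((c - 1 / \<epsilon>) + 1 / (x0 * \<epsilon>) * x) - c)) / \<epsilon>))
        * (C0 * ?w (x0 * (1 + \<epsilon> * (((c - 1 / \<epsilon>) + 1 / (x0 * \<epsilon>) * x) - c))))) \<partial>lborel)"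
    by (rule nn_integral_real_affine) (use x0 \<epsilon> in auto)
  also have "\<dots> = (\<integral>\<^sup>+x. ennreal k * ennreal (x powr (s / \<epsilon>) * ?w x) \<partial>lborel)"
  proof (subst nn_integral_cmult[symmetric], measurable, rule nn_integral_cong)
    fix x :: real
    have arg: "1 + \<epsilon> * (((c - 1 / \<epsilon>) + 1 / (x0 * \<epsilon>) * x) - c) = x / x0"
      using x0 \<epsilon> by (simp add: field_simps)
    have "1 / (x0 * \<epsilon>) * (exp (s * (c + ln (x / x0) / \<epsilon>)) * (C0 * ?w (x0 * (x / x0)))) = k * (x powr (s / \<epsilon>) * ?w x)"
    proof (cases "x > 0")
      case True
      have "exp (s * (c + ln (x / x0) / \<epsilon>)) = exp (s * c) * (x / x0) powr (s / \<epsilon>)"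
        using True x0 by (simp add: powr_def exp_add[symmetric] algebra_simps)
      also have "(x / x0) powr (s / \<epsilon>) = x powr (s / \<epsilon>) * x0 powr (- (s / \<epsilon>))"
        using True x0 powr_divide[of x x0 "s / \<epsilon>"] powr_minus_divide[of x0 "s / \<epsilon>"] by simp
      finally show ?thesis using x0 by (simp add: k_def)
    next
      case False
      \<comment> \<open>Here the logarithm carries no meaning, but the weight vanishes.\<close>
      then have "x \<notin> {0<..<1}" by auto
      then have "?w x = 0" by (rule supp[rotated])
      then show ?thesis using x0 by simp
    qed
    then show "ennreal \<bar>1 / (x0 * \<epsilon>)\<bar> * ennreal (exp (s * (c + ln (1 + \<epsilon> * (((c - 1 / \<epsilon>) + 1 / (x0 * \<epsilon>) * x) - c)) / \<epsilon>))
        * (C0 * ?w (x0 * (1 + \<epsilon> * (((c - 1 / \<epsilon>) + 1 / (x0 * \<epsilon>) * x) - c)))))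
      = ennreal k * ennreal (x powr (s / \<epsilon>) * ?w x)"
      unfolding arg using x0 \<epsilon> k C0 w0 by (simp flip: ennreal_mult)
  qed
  also have "\<dots> = ennreal k * ennreal (jacobi_mellin r j a b (s / \<epsilon>))"
  proof -
    have "(\<integral>\<^sup>+x. ennreal (x powr (s / \<epsilon>) * ?w x) \<partial>lborel) = ennreal (jacobi_mellin r j a b (s / \<epsilon>))"
      by (rule nn_integral_jacobi_weight) (use ab s in auto)
    then show ?thesis by (simp add: nn_integral_cmult)
  qed
  also have "\<dots> = ennreal (scaled_transform r j a b C0 x0 \<epsilon> c s)"
    using k m0 by (simp add: scaled_transform_def k_def flip: ennreal_mult)
  finally show "(\<integral>\<^sup>+t. ennreal (exp (s * (c + ln (1 + \<epsilon> * (t - c)) / \<epsilon>)) * (C0 * ?w (x0 * (1 + \<epsilon> * (t - c))))) \<partial>lborel)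
    = ennreal (scaled_transform r j a b C0 x0 \<epsilon> c s)" .
qed

lemma exp_positive_scaled_transform:
  assumes ab: "\<And>h. h \<le> r \<Longrightarrow> a h < b h" and s: "\<And>h s. h \<le> r \<Longrightarrow> s \<in> J \<Longrightarrow> a h + s / \<epsilon> + 1 > 0"
    and C0: "C0 \<ge> 0" and x0: "x0 > 0" and \<epsilon>: "\<epsilon> > 0"
  shows "exp_positive J (scaled_transform r j a b C0 x0 \<epsilon> c)"
proof (rule exp_positive_transform[where T = "\<lambda>t. c + ln (1 + \<epsilon> * (t - c)) / \<epsilon>"
    and U = "\<lambda>t. C0 * jacobi_weight r j a b (x0 * (1 + \<epsilon> * (t - c)))"])
  show "0 \<le> C0 * jacobi_weight r j a b (x0 * (1 + \<epsilon> * (t - c)))" for t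
    using C0 jacobi_weight_nonneg[of r a b, OF ab] by simp
qed (rule has_bochner_integral_scaled_row[OF ab s C0 x0 \<epsilon>])

text \<open>Since t is recovered exactly from \<open>T\<close>, the moment of order v at finite
  parameters is exactly a list value of the transform.\<close>

lemma has_bochner_integral_scaled_moment:
  assumes ab: "\<And>h. h \<le> r \<Longrightarrow> a h < b h" and s: "\<And>h. h \<le> r \<Longrightarrow> a h + s / \<epsilon> + 1 > 0"
    and C0: "C0 \<ge> 0" and x0: "x0 > 0" and \<epsilon>: "\<epsilon> > 0"
    and U: "\<And>t. U t = C0 * jacobi_weight r j a b (x0 * (1 + \<epsilon> * (t - c)))"
    and V: "\<And>t. 1 + \<epsilon> * (t - c) > 0 \<Longrightarrow> V t = exp (s * (c + ln (1 + \<epsilon> * (t - c)) / \<epsilon>))"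
  shows "has_bochner_integral lborel (\<lambda>t. t ^ v * (U t * V t))
    (list_eval (power_list v \<epsilon> c s) (scaled_transform r j a b C0 x0 \<epsilon> c))"
proof -
  have "has_bochner_integral lborel
    (\<lambda>t. exp_poly (power_list v \<epsilon> c s) (c + ln (1 + \<epsilon> * (t - c)) / \<epsilon>) * (C0 * jacobi_weight r j a b (x0 * (1 + \<epsilon> * (t - c)))))
    (list_eval (power_list v \<epsilon> c s) (scaled_transform r j a b C0 x0 \<epsilon> c))"
  proof (rule list_eval_eq_integral)
    fix s' assume "s' \<in> snd ` set (power_list v \<epsilon> c s)"
    then obtain k where s': "s' = s + real k * \<epsilon>" unfolding snd_power_list by auto
    \<comment> \<open>A step \<epsilon> in the exponent is a step 1 in the Mellin variable, so Gamma
      arguments only grow and stay positive.\<close>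
    have "s' / \<epsilon> = s / \<epsilon> + real k" using \<epsilon> by (simp add: s' field_simps)
    have pos: "a h + s' / \<epsilon> + 1 > 0" if "h \<le> r" for h
      using s[OF that] unfolding \<open>s' / \<epsilon> = s / \<epsilon> + real k\<close> by linarith
    show "has_bochner_integral lborel
      (\<lambda>t. exp (s' * (c + ln (1 + \<epsilon> * (t - c)) / \<epsilon>)) * (C0 * jacobi_weight r j a b (x0 * (1 + \<epsilon> * (t - c)))))
      (scaled_transform r j a b C0 x0 \<epsilon> c s')"
      by (rule has_bochner_integral_scaled_row[OF ab pos C0 x0 \<epsilon>])
  qed
  moreover have "exp_poly (power_list v \<epsilon> c s) (c + ln (1 + \<epsilon> * (t - c)) / \<epsilon>) * (C0 * jacobi_weight r j a b (x0 * (1 + \<epsilon> * (t - c))))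
    = t ^ v * (U t * V t)" for t
  proof (cases "1 + \<epsilon> * (t - c) > 0")
    case True
    have "c + (exp (\<epsilon> * (c + ln (1 + \<epsilon> * (t - c)) / \<epsilon> - c)) - 1) / \<epsilon> = t"
      using \<epsilon> True by simp
    then show ?thesis using \<epsilon> by (simp add: exp_poly_power_list U V[OF True])
  next
    case False
    then have "x0 * (1 + \<epsilon> * (t - c)) \<le> 0" using x0 by (simp add: mult_le_0_iff)
    then have "jacobi_weight r j a b (x0 * (1 + \<epsilon> * (t - c))) = 0"
      by (intro jacobi_weight_support ab) auto
    then show ?thesis by (simp add: U)
  qed
  ultimately show ?thesis by simp
qed

subsection \<open>Limits of Gamma products\<close>

text \<open>The case of bounded shifts, negligible on the scale of the square root, so that the
  Gaussian factor is 1.\<close>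

lemma tendsto_Gamma_shift:
  fixes A D :: "'a \<Rightarrow> real"
  assumes A: "filterlim A at_top F" and D: "(D \<longlongrightarrow> D0) F"
  shows "((\<lambda>t. Gamma (A t) / Gamma (A t + D t) * A t powr D t) \<longlongrightarrow> 1) F"
    and "((\<lambda>t. Gamma (A t + D t) / Gamma (A t) * A t powr (- D t)) \<longlongrightarrow> 1) F"
proof -
  have "((\<lambda>t. 1 / sqrt (A t)) \<longlongrightarrow> 0) F"
    using filterlim_compose[OF sqrt_at_top A] by (rule real_tendsto_divide_at_top[OF tendsto_const])
  from tendsto_mult[OF D this] have D': "((\<lambda>t. D t / sqrt (A t)) \<longlongrightarrow> 0) F" by simp
  have Z: "((\<lambda>t. 0 / sqrt (A t)) \<longlongrightarrow> 0) F" by simp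
  show "((\<lambda>t. Gamma (A t) / Gamma (A t + D t) * A t powr D t) \<longlongrightarrow> 1) F"
    using tendsto_Gamma_quotient_diff[OF A Z D'] by simp
  show "((\<lambda>t. Gamma (A t + D t) / Gamma (A t) * A t powr (- D t)) \<longlongrightarrow> 1) F"
    using tendsto_Gamma_quotient_diff[OF A D' Z] by simp
qed

text \<open>Each of the two shifts by \<open>D\<close> leaves a power of its base point; together
  these are (B / A)^D. With bases proportional to \<rho> + s and \<rho> this is the origin of the
  multipliers (\<rho> / (\<rho> + s))^d.\<close>

lemma tendsto_Gamma_pair:
  fixes A B D :: "'a \<Rightarrow> real"
  assumes A: "filterlim A at_top F" and B: "filterlim B at_top F"
    and q: "((\<lambda>t. B t / A t) \<longlongrightarrow> q) F" "q > 0" and D: "(D \<longlongrightarrow> D0) F"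
  shows "((\<lambda>t. Gamma (A t) / Gamma (A t + D t) * (Gamma (B t + D t) / Gamma (B t))) \<longlongrightarrow> q powr D0) F"
proof -
  have "((\<lambda>t. (Gamma (A t) / Gamma (A t + D t) * A t powr D t) * (Gamma (B t + D t) / Gamma (B t) * B t powr (- D t))
      * (B t / A t) powr D t) \<longlongrightarrow> 1 * 1 * q powr D0) F"
    using q by (intro tendsto_mult tendsto_Gamma_shift[OF A D] tendsto_Gamma_shift[OF B D] tendsto_powr D) auto
  moreover have "\<forall>\<^sub>F t in F. A t > 0" using A by (auto simp: filterlim_at_top_dense)
  moreover have "\<forall>\<^sub>F t in F. B t > 0" using B by (auto simp: filterlim_at_top_dense)
  then have "\<forall>\<^sub>F t in F. (Gamma (A t) / Gamma (A t + D t) * A t powr D t) * (Gamma (B t + D t) / Gamma (B t) * B t powr (- D t))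
      * (B t / A t) powr D t = Gamma (A t) / Gamma (A t + D t) * (Gamma (B t + D t) / Gamma (B t))"
    using \<open>\<forall>\<^sub>F t in F. A t > 0\<close>
  proof eventually_elim
    case (elim t)
    have "A t powr D t * B t powr (- D t) * (B t / A t) powr D t = 1"
      using elim by (simp add: powr_divide powr_minus)
    then have "X * A t powr D t * (Y * B t powr (- D t)) * (B t / A t) powr D t = X * Y" for X Y
      by (simp add: algebra_simps)
    then show ?case by blast
  qed
  ultimately show ?thesis by (auto intro: Lim_transform_eventually)
qed

lemma obtain_interval:
  fixes \<rho> :: "nat \<Rightarrow> real"
  assumes "\<And>h. h < r \<Longrightarrow> \<xi> + \<rho> h > 0"
  obtains \<delta> where "\<delta> > 0" "\<And>h s. h < r \<Longrightarrow> s \<in> {\<xi> - \<delta>..\<xi> + \<delta>} \<Longrightarrow> \<rho> h + s > 0"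
proof
  \<comment> \<open>Half of the smallest gap; the inserted 1 keeps the set nonempty for r =
    0.\<close>
  define \<delta> where "\<delta> = Min (insert 1 ((\<lambda>h. \<xi> + \<rho> h) ` {..<r})) / 2"
  show "\<delta> > 0" using assms by (simp add: \<delta>_def)
  fix h s assume h: "h < r" and s: "s \<in> {\<xi> - \<delta>..\<xi> + \<delta>}"
  have "Min (insert 1 ((\<lambda>h. \<xi> + \<rho> h) ` {..<r})) \<le> \<xi> + \<rho> h" using h by (intro Min_le) auto
  then have "2 * \<delta> \<le> \<xi> + \<rho> h" by (simp add: \<delta>_def)
  then show "\<rho> h + s > 0" using s \<open>\<delta> > 0\<close> by auto
qed

text \<open>Writing the extra factor of row j as an increment of the exponent matches the increment
  of \<open>b j\<close> in the Jacobi weight; for j = r it does not touch the product over h <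
  r.\<close>

lemma hermite_laplace_prod:
  assumes "\<And>h. h < r \<Longrightarrow> \<rho> h > 0" "\<And>h. h < r \<Longrightarrow> \<rho> h + s > 0"
  shows "hermite_laplace r \<rho> d ah j s =
    (\<Prod>h<r. (\<rho> h / (\<rho> h + s)) powr (d h + (if h = j then 1 else 0))) * exp (ah * s + s\<^sup>2 / 4)"
proof -
  have "(\<Prod>h<r. (\<rho> h / (\<rho> h + s)) powr (d h + (if h = j then 1 else 0)))
    = (\<Prod>h<r. (\<rho> h / (\<rho> h + s)) powr d h * (if h = j then \<rho> h / (\<rho> h + s) else 1))"
  proof (rule prod.cong)
    fix h assume "h \<in> {..<r}"
    then have "\<rho> h / (\<rho> h + s) > 0" using assms by simp
    moreover have "x powr (d h + (if h = j then 1 else 0)) = x powr d h * (if h = j then x else 1)" if "x > 0" for x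
      using that by (simp add: powr_add)
    ultimately show "(\<rho> h / (\<rho> h + s)) powr (d h + (if h = j then 1 else 0))
      = (\<rho> h / (\<rho> h + s)) powr d h * (if h = j then \<rho> h / (\<rho> h + s) else 1)"
      by blast
  qed simp
  also have "\<dots> = (\<Prod>h<r. (\<rho> h / (\<rho> h + s)) powr d h) * (if j < r then \<rho> j / (\<rho> j + s) else 1)"
    by (simp add: prod.distrib prod.delta)
  finally show ?thesis by (simp add: hermite_laplace_def)
qed

lemma prod_atMost_split: "(\<Prod>h\<le>(r::nat). f h) = (\<Prod>h<r. f h) * (f r :: real)"
  by (metis lessThan_Suc_atMost prod.lessThan_Suc)

lemma has_bochner_integral_hermite_moment:
  assumes "\<And>h. h < r \<Longrightarrow> d h > 0" "\<And>h. h < r \<Longrightarrow> \<rho> h > 0" "\<And>h. h < r \<Longrightarrow> \<xi> i + \<rho> h > 0"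
  shows "has_bochner_integral lborel (\<lambda>t. t ^ v * (hermite_row r \<rho> d ah j t * hermite_col \<xi> i t))
    (exp_moment v (hermite_laplace r \<rho> d ah j) (\<xi> i))"
proof -
  obtain \<delta> where \<delta>: "\<delta> > 0" "\<And>h s. h < r \<Longrightarrow> s \<in> {\<xi> i - \<delta>..\<xi> i + \<delta>} \<Longrightarrow> \<rho> h + s > 0"
    using obtain_interval[of r "\<xi> i" \<rho>] assms(3) by blast
  show ?thesis
    unfolding hermite_col_def
    by (rule has_bochner_integral_power_exp[OF \<delta>(1)])
       (use assms \<delta> hermite_row_nonneg hermite_row_measurable in \<open>auto intro!: has_bochner_integral_hermite_row\<close>)
qed

subsection \<open>Direct route\<close>

lemma LINT_jacobi_weight:
  assumes ab: "\<And>h. h \<le> r \<Longrightarrow> a h < b h" and a: "\<And>h. h \<le> r \<Longrightarrow> a h + 1 > 0"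
  shows "(LINT x:{0<..<1}|lborel. jacobi_weight r j a b x) = jacobi_mellin r j a b 0"
proof -
  have a': "\<And>h. h \<le> r \<Longrightarrow> a h + 0 + 1 > 0" using a by simp
  note [measurable] = jacobi_weight_measurable[of r a b, OF ab]
  have "has_bochner_integral lborel (\<lambda>x. x powr 0 * jacobi_weight r j a b x) (jacobi_mellin r j a b 0)"
  proof (rule has_bochner_integral_nn_integral)
    show "(\<integral>\<^sup>+x. ennreal (x powr 0 * jacobi_weight r j a b x) \<partial>lborel) = ennreal (jacobi_mellin r j a b 0)"
      by (rule nn_integral_jacobi_weight) (use ab a' in auto)
    show "0 \<le> jacobi_mellin r j a b 0"
      using jacobi_mellin_pos[of r a b 0 j, OF ab a'] by simp
    show "AE x in lborel. 0 \<le> x powr 0 * jacobi_weight r j a b x"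
      using jacobi_weight_nonneg[of r a b, OF ab] by (intro AE_I2) simp
  qed measurable
  moreover have "x powr 0 * jacobi_weight r j a b x = indicator {0<..<1} x *\<^sub>R jacobi_weight r j a b x" for x
  proof (cases "x \<in> {0<..<1}")
    case False
    then have "jacobi_weight r j a b x = 0" by (intro jacobi_weight_support ab) auto
    then show ?thesis by simp
  qed simp
  ultimately show ?thesis
    by (simp only: set_lebesgue_integral_def has_bochner_integral_iff)
qed

text \<open>The factors h < r are Gamma pairs. The last one gives exp (ah s + s^2 / 2) from its
  numerators near \<tau> and exp (- s^2 / 4) from its denominators near 2 \<tau>, which multiply to
  the Gaussian transform.\<close>

lemma tendsto_direct_transform:
  assumes d: "\<And>h. h < r \<Longrightarrow> d h > 0" and \<rho>: "\<And>h. h < r \<Longrightarrow> \<rho> h > 0" and s: "\<And>h. h < r \<Longrightarrow> \<rho> h + s > 0"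
    and j: "j \<le> r"
  shows "((\<lambda>\<tau>. scaled_transform r j (direct_a r \<rho> ah \<tau>) (direct_b r \<rho> d ah \<tau>)
      (1 / (2 * jacobi_mellin r j (direct_a r \<rho> ah \<tau>) (direct_b r \<rho> d ah \<tau>) 0 * sqrt \<tau>)) (1 / 2) (1 / sqrt \<tau>) 0 s)
    \<longlongrightarrow> hermite_laplace r \<rho> d ah j s) at_top"
proof -
  define \<Delta> where "\<Delta> h = (if h = j then 1 else 0 :: real)" for h
  define P where "P \<tau> h = Gamma ((\<rho> h + s) * sqrt \<tau>) / Gamma ((\<rho> h + s) * sqrt \<tau> + (d h + \<Delta> h)) *
    (Gamma (\<rho> h * sqrt \<tau> + (d h + \<Delta> h)) / Gamma (\<rho> h * sqrt \<tau>))" for \<tau> h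
  define Q1 where "Q1 \<tau> = Gamma (\<tau> + (ah + s) * sqrt \<tau>) / Gamma (\<tau> + ah * sqrt \<tau>) * \<tau> powr (ah * sqrt \<tau> - (ah + s) * sqrt \<tau>)" for \<tau>
  define Q2 where "Q2 \<tau> = Gamma (2 * \<tau> + \<Delta> r) / Gamma (2 * \<tau> + (\<Delta> r + s * sqrt \<tau>)) * (2 * \<tau>) powr (\<Delta> r + s * sqrt \<tau> - \<Delta> r)" for \<tau>
  have P: "((\<lambda>\<tau>. P \<tau> h) \<longlongrightarrow> (\<rho> h / (\<rho> h + s)) powr (d h + \<Delta> h)) at_top" if h: "h < r" for h
    unfolding P_def
  proof (rule tendsto_Gamma_pair)
    show "filterlim (\<lambda>\<tau>. (\<rho> h + s) * sqrt \<tau>) at_top at_top"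
      by (rule filterlim_tendsto_pos_mult_at_top[OF tendsto_const s[OF h] sqrt_at_top])
    show "filterlim (\<lambda>\<tau>. \<rho> h * sqrt \<tau>) at_top at_top"
      by (rule filterlim_tendsto_pos_mult_at_top[OF tendsto_const \<rho>[OF h] sqrt_at_top])
    show "((\<lambda>\<tau>. \<rho> h * sqrt \<tau> / ((\<rho> h + s) * sqrt \<tau>)) \<longlongrightarrow> \<rho> h / (\<rho> h + s)) at_top"
      by (rule tendsto_eventually) (use eventually_gt_at_top[of 0] in \<open>eventually_elim, simp\<close>)
    show "0 < \<rho> h / (\<rho> h + s)" using \<rho>[OF h] s[OF h] by simp
  qed simp
  have Q1: "(Q1 \<longlongrightarrow> exp (((ah + s)\<^sup>2 - ah\<^sup>2) / 2)) at_top"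
    unfolding Q1_def
  proof (rule tendsto_Gamma_quotient_diff)
    show "((\<lambda>\<tau>. (ah + s) * sqrt \<tau> / sqrt \<tau>) \<longlongrightarrow> ah + s) at_top"
      by (rule tendsto_eventually) (use eventually_gt_at_top[of 0] in \<open>eventually_elim, simp\<close>)
    show "((\<lambda>\<tau>. ah * sqrt \<tau> / sqrt \<tau>) \<longlongrightarrow> ah) at_top"
      by (rule tendsto_eventually) (use eventually_gt_at_top[of 0] in \<open>eventually_elim, simp\<close>)
  qed (rule filterlim_ident)
  have Q2: "(Q2 \<longlongrightarrow> exp ((0\<^sup>2 - (s / sqrt 2)\<^sup>2) / 2)) at_top"
    unfolding Q2_def
  proof (rule tendsto_Gamma_quotient_diff)
    show "filterlim (\<lambda>\<tau>::real. 2 * \<tau>) at_top at_top" by real_asymp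
    show "((\<lambda>\<tau>. \<Delta> r / sqrt (2 * \<tau>)) \<longlongrightarrow> 0) at_top" by real_asymp
    show "((\<lambda>\<tau>. (\<Delta> r + s * sqrt \<tau>) / sqrt (2 * \<tau>)) \<longlongrightarrow> s / sqrt 2) at_top"
    proof (rule Lim_transform_eventually)
      have "((\<lambda>\<tau>. \<Delta> r / sqrt (2 * \<tau>)) \<longlongrightarrow> 0) at_top" by real_asymp
      from tendsto_add[OF this tendsto_const[of "s / sqrt 2"]]
      show "((\<lambda>\<tau>. \<Delta> r / sqrt (2 * \<tau>) + s / sqrt 2) \<longlongrightarrow> s / sqrt 2) at_top" by simp
      show "\<forall>\<^sub>F \<tau> in at_top. \<Delta> r / sqrt (2 * \<tau>) + s / sqrt 2 = (\<Delta> r + s * sqrt \<tau>) / sqrt (2 * \<tau>)"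
        using eventually_gt_at_top[of 0] by eventually_elim (simp add: add_divide_distrib real_sqrt_mult)
    qed
  qed
  have "((\<lambda>\<tau>. (\<Prod>h<r. P \<tau> h) * (Q1 \<tau> * Q2 \<tau>)) \<longlongrightarrow>
      (\<Prod>h<r. (\<rho> h / (\<rho> h + s)) powr (d h + \<Delta> h)) *
      (exp (((ah + s)\<^sup>2 - ah\<^sup>2) / 2) * exp ((0\<^sup>2 - (s / sqrt 2)\<^sup>2) / 2))) at_top"
    by (intro tendsto_mult tendsto_prod P Q1 Q2) simp
  moreover have "exp (((ah + s)\<^sup>2 - ah\<^sup>2) / 2) * exp ((0\<^sup>2 - (s / sqrt 2)\<^sup>2) / 2) = exp (ah * s + s\<^sup>2 / 4)"
    by (simp add: exp_add[symmetric] power_divide power2_eq_square field_simps)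
  ultimately have lim: "((\<lambda>\<tau>. (\<Prod>h<r. P \<tau> h) * (Q1 \<tau> * Q2 \<tau>)) \<longlongrightarrow> hermite_laplace r \<rho> d ah j s) at_top"
    using \<rho> s by (simp add: hermite_laplace_prod \<Delta>_def)
  show ?thesis
  proof (rule Lim_transform_eventually[OF lim])
    show "\<forall>\<^sub>F \<tau> in at_top. (\<Prod>h<r. P \<tau> h) * (Q1 \<tau> * Q2 \<tau>) =
      scaled_transform r j (direct_a r \<rho> ah \<tau>) (direct_b r \<rho> d ah \<tau>)
      (1 / (2 * jacobi_mellin r j (direct_a r \<rho> ah \<tau>) (direct_b r \<rho> d ah \<tau>) 0 * sqrt \<tau>)) (1 / 2) (1 / sqrt \<tau>) 0 s"
      using eventually_gt_at_top[of 0]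
    proof eventually_elim
      case (elim \<tau>)
      let ?a = "direct_a r \<rho> ah \<tau>" and ?b = "direct_b r \<rho> d ah \<tau>"
      define f where "f \<sigma> h = Gamma (?a h + \<sigma> + 1) / Gamma (?b h + \<Delta> h + \<sigma> + 1)" for \<sigma> h
      have mellin: "jacobi_mellin r j ?a ?b \<sigma> = (\<Prod>h\<le>r. f \<sigma> h)" for \<sigma>
        by (simp add: jacobi_mellin_def f_def \<Delta>_def)
      have "f (s * sqrt \<tau>) h / f 0 h = P \<tau> h" if "h < r" for h
        using that by (simp add: f_def P_def direct_a_def direct_b_def algebra_simps)
      then have prod: "(\<Prod>h<r. P \<tau> h) = (\<Prod>h<r. f (s * sqrt \<tau>) h / f 0 h)" by simp
      \<comment> \<open>The powers of \<tau> and 2 \<tau> left over by the two quotients combine to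
        2^(s sqrt \<tau>), the factor produced by the centre x0 = 1 / 2.\<close>
      have pw: "(1 / 2) powr (- (s * sqrt \<tau>)) = \<tau> powr (ah * sqrt \<tau> - (ah + s) * sqrt \<tau>) * (2 * \<tau>) powr (\<Delta> r + s * sqrt \<tau> - \<Delta> r)"
      proof -
        have "\<tau> powr (- (s * sqrt \<tau>)) * (2 * \<tau>) powr (s * sqrt \<tau>) = 2 powr (s * sqrt \<tau>)"
          using elim by (simp add: powr_mult powr_minus)
        moreover have "(1 / 2) powr (- (s * sqrt \<tau>)) = 2 powr (s * sqrt \<tau>)"
          by (simp add: powr_divide powr_minus)
        ultimately show ?thesis by (simp add: algebra_simps)
      qed
      have last: "(1 / 2) powr (- (s * sqrt \<tau>)) * (f (s * sqrt \<tau>) r / f 0 r) = Q1 \<tau> * Q2 \<tau>"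
        unfolding pw by (simp add: f_def Q1_def Q2_def direct_a_def direct_b_def algebra_simps)
      have "(\<Prod>h<r. P \<tau> h) * (Q1 \<tau> * Q2 \<tau>)
        = (1 / 2) powr (- (s * sqrt \<tau>)) * ((\<Prod>h\<le>r. f (s * sqrt \<tau>) h) / (\<Prod>h\<le>r. f 0 h))"
        unfolding prod prod_atMost_split prod_dividef last[symmetric] by simp
      also have "\<dots> = scaled_transform r j ?a ?b (1 / (2 * jacobi_mellin r j ?a ?b 0 * sqrt \<tau>)) (1 / 2) (1 / sqrt \<tau>) 0 s"
        using elim by (simp add: scaled_transform_def mellin)
      finally show ?case .
    qed
  qed
qed

lemma direct_route:
  assumes d: "\<And>h. h < r \<Longrightarrow> d h > 0" and \<rho>: "\<And>h. h < r \<Longrightarrow> \<rho> h > 0" and \<xi>: "\<And>h. h < r \<Longrightarrow> \<xi> i + \<rho> h > 0"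
    and j: "j \<le> r"
  shows "\<forall>\<^sub>F \<tau> in at_top. \<forall>v. integrable lborel (\<lambda>t. t ^ v * (direct_row r \<rho> d ah \<tau> j t * direct_col \<xi> \<tau> i t))"
    and "((\<lambda>\<tau>. LINT t|lborel. t ^ v * (direct_row r \<rho> d ah \<tau> j t * direct_col \<xi> \<tau> i t)) \<longlongrightarrow>
      exp_moment v (hermite_laplace r \<rho> d ah j) (\<xi> i)) at_top"
proof -
  obtain \<delta> where \<delta>: "\<delta> > 0" "\<And>h s. h < r \<Longrightarrow> s \<in> {\<xi> i - \<delta>..\<xi> i + \<delta>} \<Longrightarrow> \<rho> h + s > 0"
    using obtain_interval[of r "\<xi> i" \<rho>] \<xi> by blast
  let ?a = "direct_a r \<rho> ah" and ?b = "direct_b r \<rho> d ah"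
  define M where "M \<tau> = scaled_transform r j (?a \<tau>) (?b \<tau>)
    (1 / (2 * jacobi_mellin r j (?a \<tau>) (?b \<tau>) 0 * sqrt \<tau>)) (1 / 2) (1 / sqrt \<tau>) 0" for \<tau>
  have large: "\<forall>\<^sub>F \<tau> in at_top. \<tau> + k * sqrt \<tau> > 0" for k :: real by real_asymp
  have "\<forall>\<^sub>F \<tau> in at_top. 0 < \<tau> \<and> (\<forall>h\<le>r. ?a \<tau> h < ?b \<tau> h) \<and> (\<forall>h\<le>r. ?a \<tau> h + 1 > 0) \<and>
      (\<forall>h\<le>r. \<forall>s\<in>{\<xi> i - \<delta>..\<xi> i + \<delta>}. ?a \<tau> h + s / (1 / sqrt \<tau>) + 1 > 0)"
    \<comment> \<open>The instances give, for the last index, positivity of \<open>a + 1\<close>,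
      positivity after adding the smallest admissible exponent, and a < b, in this order.\<close>
    using eventually_gt_at_top[of 0] large[of "ah"] large[of "ah + (\<xi> i - \<delta>)"] large[of "- ah"]
  proof eventually_elim
    case (elim \<tau>)
    have last: "\<tau> + ah * sqrt \<tau> + s * sqrt \<tau> > 0" if "s \<in> {\<xi> i - \<delta>..\<xi> i + \<delta>}" for s
    proof -
      have "(\<xi> i - \<delta>) * sqrt \<tau> \<le> s * sqrt \<tau>" using that elim(1) by (intro mult_right_mono) auto
      then show ?thesis using elim(3) by (simp add: algebra_simps)
    qed
    have first: "\<rho> h * sqrt \<tau> + s * sqrt \<tau> > 0" if "h < r" "s \<in> {\<xi> i - \<delta>..\<xi> i + \<delta>}" for h s
      using mult_pos_pos[OF \<delta>(2)[OF that], of "sqrt \<tau>"] elim(1) by (simp add: algebra_simps)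
    show ?case
    proof (intro conjI allI impI ballI)
      fix h assume "h \<le> r"
      show "?a \<tau> h < ?b \<tau> h" using d[of h] elim(4) by (simp add: direct_a_def direct_b_def)
      show "?a \<tau> h + 1 > 0" using \<rho>[of h] elim(1,2) by (simp add: direct_a_def)
      fix s assume "s \<in> {\<xi> i - \<delta>..\<xi> i + \<delta>}"
      then show "?a \<tau> h + s / (1 / sqrt \<tau>) + 1 > 0"
        using last[of s] first[of h s] by (simp add: direct_a_def)
    qed (rule elim)
  qed
  then have ev: "\<forall>\<^sub>F \<tau> in at_top. exp_positive {\<xi> i - \<delta>..\<xi> i + \<delta>} (M \<tau>) \<and>
    (\<forall>v. has_bochner_integral lborel (\<lambda>t. t ^ v * (direct_row r \<rho> d ah \<tau> j t * direct_col \<xi> \<tau> i t))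
      (list_eval (power_list v (1 / sqrt \<tau>) 0 (\<xi> i)) (M \<tau>)))"
  proof eventually_elim
    case (elim \<tau>)
    then have \<tau>: "\<tau> > 0" and ab: "\<And>h. h \<le> r \<Longrightarrow> ?a \<tau> h < ?b \<tau> h" and a: "\<And>h. h \<le> r \<Longrightarrow> ?a \<tau> h + 1 > 0"
      and s: "\<And>h s. h \<le> r \<Longrightarrow> s \<in> {\<xi> i - \<delta>..\<xi> i + \<delta>} \<Longrightarrow> ?a \<tau> h + s / (1 / sqrt \<tau>) + 1 > 0" by auto
    define Z where "Z = jacobi_mellin r j (?a \<tau>) (?b \<tau>) 0"
    have Z: "Z > 0" unfolding Z_def by (rule jacobi_mellin_pos) (use ab a in auto)
    have C0: "0 \<le> 1 / (2 * Z * sqrt \<tau>)" using Z \<tau> by simp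
    have row: "direct_row r \<rho> d ah \<tau> j t
      = 1 / (2 * Z * sqrt \<tau>) * jacobi_weight r j (?a \<tau>) (?b \<tau>) (1 / 2 * (1 + 1 / sqrt \<tau> * (t - 0)))" for t
    proof (cases "\<bar>t\<bar> < sqrt \<tau>")
      case True
      then show ?thesis
        by (simp add: direct_row_def Let_def LINT_jacobi_weight[OF ab a] Z_def)
    next
      case False
      then have "1 / 2 * (1 + 1 / sqrt \<tau> * (t - 0)) \<notin> {0<..<1}"
        using \<tau> by (auto simp: field_simps abs_if split: if_splits)
      then have "jacobi_weight r j (?a \<tau>) (?b \<tau>) (1 / 2 * (1 + 1 / sqrt \<tau> * (t - 0))) = 0"
        by (rule jacobi_weight_support[rotated]) (rule ab)
      then show ?thesis using False by (simp add: direct_row_def Let_def)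
    qed
    have col: "direct_col \<xi> \<tau> i t = exp (\<xi> i * (0 + ln (1 + 1 / sqrt \<tau> * (t - 0)) / (1 / sqrt \<tau>)))"
      if "1 + 1 / sqrt \<tau> * (t - 0) > 0" for t
      using that by (simp add: direct_col_def powr_def mult_ac)
    have "exp_positive {\<xi> i - \<delta>..\<xi> i + \<delta>} (M \<tau>)"
      unfolding M_def Z_def[symmetric] by (rule exp_positive_scaled_transform[OF ab s C0]) (use \<tau> in auto)
    moreover have "has_bochner_integral lborel (\<lambda>t. t ^ v * (direct_row r \<rho> d ah \<tau> j t * direct_col \<xi> \<tau> i t))
      (list_eval (power_list v (1 / sqrt \<tau>) 0 (\<xi> i)) (M \<tau>))" for v
      unfolding M_def Z_def[symmetric]
      by (rule has_bochner_integral_scaled_moment[OF ab s C0 _ _ row col]) (use \<tau> \<delta> in auto)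
    ultimately show ?case by blast
  qed
  show "\<forall>\<^sub>F \<tau> in at_top. \<forall>v. integrable lborel (\<lambda>t. t ^ v * (direct_row r \<rho> d ah \<tau> j t * direct_col \<xi> \<tau> i t))"
    using ev by eventually_elim (auto simp: has_bochner_integral_iff)
  have pos: "\<forall>\<^sub>F \<tau> in at_top. exp_positive {\<xi> i - \<delta>..\<xi> i + \<delta>} (M \<tau>)"
    using ev by eventually_elim blast
  have lim: "((\<lambda>\<tau>. M \<tau> s) \<longlongrightarrow> hermite_laplace r \<rho> d ah j s) at_top" if "s \<in> {\<xi> i - \<delta>..\<xi> i + \<delta>}" for s
    unfolding M_def by (rule tendsto_direct_transform) (use d \<rho> \<delta> that j in auto)
  have "((\<lambda>\<tau>. list_eval (power_list v (1 / sqrt \<tau>) 0 (\<xi> i)) (M \<tau>)) \<longlongrightarrow>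
    exp_moment v (hermite_laplace r \<rho> d ah j) (\<xi> i)) at_top"
  proof (rule tendsto_power_list_moment[OF _ \<delta>(1) pos lim])
    show "((\<lambda>\<tau>. 1 / sqrt \<tau>) \<longlongrightarrow> 0) at_top" by real_asymp
    show "\<forall>\<^sub>F \<tau> in at_top. 0 < 1 / sqrt \<tau>" by real_asymp
  qed auto
  then show "((\<lambda>\<tau>. LINT t|lborel. t ^ v * (direct_row r \<rho> d ah \<tau> j t * direct_col \<xi> \<tau> i t)) \<longlongrightarrow>
      exp_moment v (hermite_laplace r \<rho> d ah j) (\<xi> i)) at_top"
  proof (rule Lim_transform_eventually)
    show "\<forall>\<^sub>F \<tau> in at_top. list_eval (power_list v (1 / sqrt \<tau>) 0 (\<xi> i)) (M \<tau>) =
      (LINT t|lborel. t ^ v * (direct_row r \<rho> d ah \<tau> j t * direct_col \<xi> \<tau> i t))"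
      using ev by eventually_elim (simp add: has_bochner_integral_iff)
  qed
qed

subsection \<open>Route through Laguerre of the first kind\<close>

text \<open>What remains of \<open>scaled_transform\<close> for infinite \<kappa>: the growing
  constant has absorbed the last Gamma denominator, so the last parameter enters through a single
  Gamma factor, as in the Mellin transform of a Laguerre weight.\<close>

definition laguerre1_transform ::
  "nat \<Rightarrow> (nat \<Rightarrow> real) \<Rightarrow> (nat \<Rightarrow> real) \<Rightarrow> real \<Rightarrow> nat \<Rightarrow> real \<Rightarrow> real" where
  "laguerre1_transform r a b \<tau> j s =
     \<tau> powr (- (s / sqrt (2 / \<tau>))) * (if j < r then b j + 1 else 1) /
     ((\<Prod>\<nu>\<le>r. Gamma (a \<nu> + 1)) / (\<Prod>h<r. Gamma (b h + 1))) *
     ((\<Prod>h<r. Gamma (a h + s / sqrt (2 / \<tau>) + 1) / Gamma (b h + (if h = j then 1 else 0) + s / sqrt (2 / \<tau>) + 1)) *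
      Gamma (a r + s / sqrt (2 / \<tau>) + 1))"

context
  fixes r j :: nat and a b :: "nat \<Rightarrow> real" and \<omega> \<tau> :: real
  assumes a: "\<And>h. h \<le> r \<Longrightarrow> a h > -1" and ab: "\<And>h. h < r \<Longrightarrow> a h < b h"
    and \<omega>: "\<omega> > 0" and \<tau>: "\<tau> > 0" and j: "j \<le> r"
begin

definition laguerre1_C :: "real \<Rightarrow> real" where
  "laguerre1_C \<kappa> = \<kappa> * \<omega> - a r - 1"

definition laguerre1_Z :: real where
  "laguerre1_Z = (\<Prod>\<nu>\<le>r. Gamma (a \<nu> + 1)) / (\<Prod>h<r. Gamma (b h + 1))"

definition laguerre1_const :: "real \<Rightarrow> real" where
  "laguerre1_const \<kappa> = \<tau> * sqrt (2 / \<tau>) * (if j < r then b j + 1 else \<kappa> * \<omega>) / laguerre1_Z *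
     (laguerre1_C \<kappa> powr a r * Gamma (laguerre1_C \<kappa> + 1))"

definition laguerre1_finite :: "real \<Rightarrow> real \<Rightarrow> real" where
  "laguerre1_finite \<kappa> = scaled_transform r j a (b(r := \<kappa> * \<omega>)) (laguerre1_const \<kappa>) (\<tau> / laguerre1_C \<kappa>) (sqrt (2 / \<tau>)) 0"

lemma filterlim_laguerre1_C: "filterlim laguerre1_C at_top at_top"
proof -
  have "filterlim (\<lambda>\<kappa>. \<omega> * \<kappa>) at_top at_top"
    by (rule filterlim_tendsto_pos_mult_at_top[OF tendsto_const \<omega> filterlim_ident])
  then have "filterlim (\<lambda>\<kappa>. (- a r - 1) + \<omega> * \<kappa>) at_top at_top"
    by (rule filterlim_tendsto_add_at_top[OF tendsto_const])
  moreover have "(\<lambda>\<kappa>. (- a r - 1) + \<omega> * \<kappa>) = laguerre1_C"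
    by (auto simp: laguerre1_C_def algebra_simps)
  ultimately show ?thesis by simp
qed

lemma laguerre1_Z_pos: "laguerre1_Z > 0"
  unfolding laguerre1_Z_def
proof (intro divide_pos_pos prod_pos Gamma_real_pos)
  show "0 < a h + 1" if "h \<in> {..r}" for h using a[of h] that by simp
  show "0 < b h + 1" if "h \<in> {..<r}" for h using a[of h] ab[of h] that by simp
qed

lemma laguerre1_eventually:
  "\<forall>\<^sub>F \<kappa> in at_top. laguerre1_C \<kappa> > 0 \<and> laguerre1_const \<kappa> \<ge> 0 \<and> (\<forall>h\<le>r. a h < (b(r := \<kappa> * \<omega>)) h)"
proof -
  have "\<forall>\<^sub>F \<kappa> in at_top. laguerre1_C \<kappa> > 0"
    using filterlim_laguerre1_C by (auto simp: filterlim_at_top_dense)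
  then show ?thesis
    using eventually_gt_at_top[of 0]
  proof eventually_elim
    case (elim \<kappa>)
    have "0 \<le> (if j < r then b j + 1 else \<kappa> * \<omega>)" using a[of j] ab[of j] elim \<omega> by (cases "j < r") auto
    moreover have "0 < Gamma (laguerre1_C \<kappa> + 1)" using elim by (intro Gamma_real_pos) simp
    ultimately have "laguerre1_const \<kappa> \<ge> 0"
      unfolding laguerre1_const_def using \<tau> laguerre1_Z_pos
      by (intro mult_nonneg_nonneg divide_nonneg_nonneg) auto
    moreover have "a h < (b(r := \<kappa> * \<omega>)) h" if "h \<le> r" for h
      using elim that ab[of h] by (simp add: laguerre1_C_def)
    ultimately show ?case using elim by blast
  qed
qed

lemma exp_positive_laguerre1_finite:
  assumes "\<And>h s. h \<le> r \<Longrightarrow> s \<in> J \<Longrightarrow> a h + s / sqrt (2 / \<tau>) + 1 > 0"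
  shows "\<forall>\<^sub>F \<kappa> in at_top. exp_positive J (laguerre1_finite \<kappa>)"
  using laguerre1_eventually
proof eventually_elim
  case (elim \<kappa>)
  show ?case
    unfolding laguerre1_finite_def
    by (rule exp_positive_scaled_transform) (use elim assms \<tau> in auto)
qed

lemma has_bochner_integral_laguerre1:
  assumes \<beta>: "\<And>h. h \<le> r \<Longrightarrow> a h + \<beta> i + 1 > 0"
  shows "\<forall>\<^sub>F \<kappa> in at_top. \<forall>v. has_bochner_integral lborel
    (\<lambda>t. t ^ v * (laguerre1_row r a b \<omega> \<tau> \<kappa> j t * laguerre1_col \<beta> \<tau> i t))
    (list_eval (power_list v (sqrt (2 / \<tau>)) 0 (sqrt (2 / \<tau>) * \<beta> i)) (laguerre1_finite \<kappa>))"
  using laguerre1_eventually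
proof eventually_elim
  case (elim \<kappa>)
  then have C: "laguerre1_C \<kappa> > 0" and ab': "\<And>h. h \<le> r \<Longrightarrow> a h < (b(r := \<kappa> * \<omega>)) h"
    and C0: "laguerre1_const \<kappa> \<ge> 0" by auto
  have x: "\<tau> / laguerre1_C \<kappa> * (1 + sqrt (2 / \<tau>) * (t - 0)) = \<tau> * (1 + sqrt (2 / \<tau>) * t) / laguerre1_C \<kappa>" for t
    by simp
  have row: "laguerre1_row r a b \<omega> \<tau> \<kappa> j t = laguerre1_const \<kappa> *
      jacobi_weight r j a (b(r := \<kappa> * \<omega>)) (\<tau> / laguerre1_C \<kappa> * (1 + sqrt (2 / \<tau>) * (t - 0)))" for t
  proof (cases "0 < \<tau> * (1 + sqrt (2 / \<tau>) * t) \<and> \<tau> * (1 + sqrt (2 / \<tau>) * t) < laguerre1_C \<kappa>")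
    case True
    then show ?thesis
      unfolding x by (simp add: laguerre1_row_def Let_def laguerre1_const_def laguerre1_Z_def flip: laguerre1_C_def)
  next
    case False
    then have "\<tau> * (1 + sqrt (2 / \<tau>) * t) / laguerre1_C \<kappa> \<notin> {0<..<1}"
      using C by (auto simp: zero_less_divide_iff)
    then have "jacobi_weight r j a (b(r := \<kappa> * \<omega>)) (\<tau> * (1 + sqrt (2 / \<tau>) * t) / laguerre1_C \<kappa>) = 0"
      by (rule jacobi_weight_support[rotated]) (rule ab')
    then show ?thesis
      using False unfolding x by (simp add: laguerre1_row_def Let_def flip: laguerre1_C_def)
  qed
  have eps: "sqrt (2 / \<tau>) > 0" using \<tau> by simp
  have col: "laguerre1_col \<beta> \<tau> i t = exp (sqrt (2 / \<tau>) * \<beta> i * (0 + ln (1 + sqrt (2 / \<tau>) * (t - 0)) / sqrt (2 / \<tau>)))"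
    if "1 + sqrt (2 / \<tau>) * (t - 0) > 0" for t
    using that eps by (simp add: laguerre1_col_def powr_def)
  have s: "a h + sqrt (2 / \<tau>) * \<beta> i / sqrt (2 / \<tau>) + 1 > 0" if "h \<le> r" for h
    using \<beta>[OF that] eps by simp
  show ?case
    unfolding laguerre1_finite_def
    by (intro allI has_bochner_integral_scaled_moment[OF ab' s C0 _ eps row col]) (use C \<tau> in simp_all)
qed

text \<open>All dependence on \<kappa> is collected in the quotient \<open>R\<close> of the finite
  by the limiting transform: a bounded Gamma shift at C + 1 and, for j = r, the ratio of \<kappa>
  \<omega> and C.\<close>

lemma tendsto_laguerre1_finite:
  assumes s: "\<And>h. h \<le> r \<Longrightarrow> a h + s / sqrt (2 / \<tau>) + 1 > 0"
  shows "((\<lambda>\<kappa>. laguerre1_finite \<kappa> s) \<longlongrightarrow> laguerre1_transform r a b \<tau> j s) at_top"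
proof -
  define g where "g = s / sqrt (2 / \<tau>)"
  define \<Delta> where "\<Delta> = (if r = j then 1 else 0 :: real)"
  \<comment> \<open>The total power of C: 1 from dividing by x0 = \<tau> / C, \<open>a r\<close>
    from the normalizing constant, g from the power of x0, and one more from the prefactor \<kappa>
    \<omega> if j = r.\<close>
  define D where "D = a r + 1 + g + \<Delta>"
  define R where "R x = (Gamma (x + 1) / Gamma (x + 1 + D) * (x + 1) powr D) * (x / (x + 1)) powr D *
    (if j < r then 1 else (x + a r + 1) / x)" for x
  have "((\<lambda>x. Gamma (x + 1) / Gamma (x + 1 + D) * (x + 1) powr D) \<longlongrightarrow> 1) at_top"
    by (rule tendsto_Gamma_shift(1)[OF _ tendsto_const]) real_asymp
  moreover have "((\<lambda>x::real. x / (x + 1)) \<longlongrightarrow> 1) at_top" by real_asymp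
  then have "((\<lambda>x::real. (x / (x + 1)) powr D) \<longlongrightarrow> 1 powr D) at_top" by (intro tendsto_intros) auto
  moreover have "((\<lambda>x. if j < r then 1 else (x + a r + 1) / x) \<longlongrightarrow> 1) at_top"
    by (cases "j < r") (simp_all, real_asymp)
  ultimately have "(R \<longlongrightarrow> 1 * 1 powr D * 1) at_top"
    unfolding R_def by (intro tendsto_mult)
  then have "((\<lambda>\<kappa>. R (laguerre1_C \<kappa>)) \<longlongrightarrow> 1) at_top"
    using filterlim_laguerre1_C by (auto intro: filterlim_compose)
  from tendsto_mult[OF tendsto_const[of "laguerre1_transform r a b \<tau> j s"] this]
  have lim: "((\<lambda>\<kappa>. laguerre1_transform r a b \<tau> j s * R (laguerre1_C \<kappa>)) \<longlongrightarrow> laguerre1_transform r a b \<tau> j s) at_top"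
    by simp
  show ?thesis
  proof (rule Lim_transform_eventually[OF lim])
    show "\<forall>\<^sub>F \<kappa> in at_top. laguerre1_transform r a b \<tau> j s * R (laguerre1_C \<kappa>) = laguerre1_finite \<kappa> s"
      using laguerre1_eventually
    proof eventually_elim
      case (elim \<kappa>)
      define C where "C = laguerre1_C \<kappa>"
      have C: "C > 0" using elim by (simp add: C_def)
      have \<kappa>: "\<kappa> * \<omega> = C + a r + 1" by (simp add: C_def laguerre1_C_def)
      have eps: "sqrt (2 / \<tau>) > 0" using \<tau> by simp
      define P where "P = (\<Prod>h<r. Gamma (a h + g + 1) / Gamma (b h + (if h = j then 1 else 0) + g + 1))"
      have mellin: "jacobi_mellin r j a (b(r := \<kappa> * \<omega>)) g = P * (Gamma (a r + g + 1) / Gamma (C + 1 + D))"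
        by (simp add: jacobi_mellin_def prod_atMost_split P_def \<kappa> D_def \<Delta>_def add_ac)
      have pw: "(\<tau> / C) powr (- g) = \<tau> powr (- g) * C powr g"
        using C \<tau> by (simp add: powr_divide powr_minus field_simps)
      have X: "C * (if j < r then b j + 1 else \<kappa> * \<omega>) * C powr a r * C powr g
        = (if j < r then b j + 1 else 1) * (C powr D * (if j < r then 1 else (C + a r + 1) / C))"
      proof -
        have "C powr D = C * C powr a r * C powr g * (if j < r then 1 else C)"
          using C j by (simp add: D_def powr_add \<Delta>_def)
        then show ?thesis using C by (simp add: \<kappa>)
      qed
      have Y: "(C + 1) powr D * (C / (C + 1)) powr D = C powr D"
        using C by (simp add: powr_divide)
      have "laguerre1_finite \<kappa> s = C * (if j < r then b j + 1 else \<kappa> * \<omega>) / laguerre1_Z *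
          (C powr a r * Gamma (C + 1)) * ((\<tau> / C) powr (- g)) * (P * (Gamma (a r + g + 1) / Gamma (C + 1 + D)))"
        using C \<tau> eps
        by (simp add: laguerre1_finite_def scaled_transform_def laguerre1_const_def mellin flip: g_def C_def)
      also have "\<dots> = (C * (if j < r then b j + 1 else \<kappa> * \<omega>) * C powr a r * C powr g) * \<tau> powr (- g) / laguerre1_Z *
          (Gamma (C + 1) / Gamma (C + 1 + D)) * (P * Gamma (a r + g + 1))"
        unfolding pw by simp
      also have "\<dots> = laguerre1_transform r a b \<tau> j s * R C"
        unfolding X Y[symmetric]
        by (simp add: R_def laguerre1_transform_def P_def flip: g_def laguerre1_Z_def)
      finally show ?case by (simp add: C_def)
    qed
  qed
qed

end

text \<open>On the scale sqrt \<tau> the last parameter deviates by sqrt 2 * ah without and by sqrt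
  2 * ah + s / sqrt 2 with the exponent; half the difference of the squares is ah s + s^2 / 4. The
  normalizing product provides the second half of each Gamma pair.\<close>

lemma tendsto_laguerre1_transform:
  fixes a b :: "real \<Rightarrow> nat \<Rightarrow> real"
  assumes a_gt: "\<forall>\<^sub>F \<tau> in at_top. \<forall>\<nu>\<le>r. a \<tau> \<nu> > -1" and b_gt: "\<forall>\<^sub>F \<tau> in at_top. \<forall>h<r. b \<tau> h > a \<tau> h"
    and a_last: "((\<lambda>\<tau>. (a \<tau> r + 1 - \<tau>) / sqrt \<tau>) \<longlongrightarrow> sqrt 2 * ah) at_top"
    and a_lim: "\<And>h. h < r \<Longrightarrow> ((\<lambda>\<tau>. sqrt (2 / \<tau>) * (a \<tau> h + 1)) \<longlongrightarrow> \<rho> h) at_top"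
    and b_lim: "\<And>h. h < r \<Longrightarrow> ((\<lambda>\<tau>. b \<tau> h - a \<tau> h) \<longlongrightarrow> d h) at_top"
    and \<rho>: "\<And>h. h < r \<Longrightarrow> \<rho> h > 0" and s: "\<And>h. h < r \<Longrightarrow> \<rho> h + s > 0"
  shows "((\<lambda>\<tau>. laguerre1_transform r (a \<tau>) (b \<tau>) \<tau> j s) \<longlongrightarrow> hermite_laplace r \<rho> d ah j s) at_top"
proof -
  define \<Delta> where "\<Delta> h = (if h = j then 1 else 0 :: real)" for h
  define g where "g \<tau> = s / sqrt (2 / \<tau>)" for \<tau>
  define P where "P \<tau> h = Gamma (a \<tau> h + 1 + g \<tau>) / Gamma (a \<tau> h + 1 + g \<tau> + (b \<tau> h - a \<tau> h + \<Delta> h)) *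
    (Gamma (a \<tau> h + 1 + (b \<tau> h - a \<tau> h + \<Delta> h)) / Gamma (a \<tau> h + 1))" for \<tau> h
  define Q where "Q \<tau> = Gamma (\<tau> + (a \<tau> r + 1 - \<tau> + g \<tau>)) / Gamma (\<tau> + (a \<tau> r + 1 - \<tau>)) *
    \<tau> powr ((a \<tau> r + 1 - \<tau>) - (a \<tau> r + 1 - \<tau> + g \<tau>))" for \<tau>
  have inv: "filterlim (\<lambda>\<tau>::real. 1 / sqrt (2 / \<tau>)) at_top at_top" by real_asymp
  have P: "((\<lambda>\<tau>. P \<tau> h) \<longlongrightarrow> (\<rho> h / (\<rho> h + s)) powr (d h + \<Delta> h)) at_top" if h: "h < r" for h
    unfolding P_def
  proof (rule tendsto_Gamma_pair)
    have lim: "((\<lambda>\<tau>. sqrt (2 / \<tau>) * (a \<tau> h + 1) + s) \<longlongrightarrow> \<rho> h + s) at_top"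
      by (intro tendsto_intros a_lim h)
    have "filterlim (\<lambda>\<tau>. (sqrt (2 / \<tau>) * (a \<tau> h + 1) + s) * (1 / sqrt (2 / \<tau>))) at_top at_top"
      by (rule filterlim_tendsto_pos_mult_at_top[OF lim s[OF h] inv])
    moreover have "\<forall>\<^sub>F \<tau> in at_top. (sqrt (2 / \<tau>) * (a \<tau> h + 1) + s) * (1 / sqrt (2 / \<tau>)) = a \<tau> h + 1 + g \<tau>"
      using eventually_gt_at_top[of 0] by eventually_elim (simp add: g_def distrib_right add_divide_distrib)
    ultimately show "filterlim (\<lambda>\<tau>. a \<tau> h + 1 + g \<tau>) at_top at_top"
      by (simp cong: filterlim_cong)
    have "filterlim (\<lambda>\<tau>. (sqrt (2 / \<tau>) * (a \<tau> h + 1)) * (1 / sqrt (2 / \<tau>))) at_top at_top"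
      by (rule filterlim_tendsto_pos_mult_at_top[OF a_lim[OF h] \<rho>[OF h] inv])
    moreover have "\<forall>\<^sub>F \<tau> in at_top. (sqrt (2 / \<tau>) * (a \<tau> h + 1)) * (1 / sqrt (2 / \<tau>)) = a \<tau> h + 1"
      using eventually_gt_at_top[of 0] by eventually_elim simp
    ultimately show "filterlim (\<lambda>\<tau>. a \<tau> h + 1) at_top at_top"
      by (simp cong: filterlim_cong)
    have "((\<lambda>\<tau>. (sqrt (2 / \<tau>) * (a \<tau> h + 1)) / (sqrt (2 / \<tau>) * (a \<tau> h + 1) + s)) \<longlongrightarrow> \<rho> h / (\<rho> h + s)) at_top"
      using s[OF h] by (intro tendsto_divide a_lim[OF h] lim) simp
    moreover have "\<forall>\<^sub>F \<tau> in at_top. (sqrt (2 / \<tau>) * (a \<tau> h + 1)) / (sqrt (2 / \<tau>) * (a \<tau> h + 1) + s)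
        = (a \<tau> h + 1) / (a \<tau> h + 1 + g \<tau>)"
      using eventually_gt_at_top[of 0]
    proof eventually_elim
      case (elim \<tau>)
      define \<epsilon> where "\<epsilon> = sqrt (2 / \<tau>)"
      have "\<epsilon> > 0" using elim by (simp add: \<epsilon>_def)
      then have "\<epsilon> * (a \<tau> h + 1) + s = \<epsilon> * (a \<tau> h + 1 + g \<tau>)" by (simp add: g_def \<epsilon>_def[symmetric] distrib_left)
      then show ?case using \<open>\<epsilon> > 0\<close> by (simp flip: \<epsilon>_def)
    qed
    ultimately show "((\<lambda>\<tau>. (a \<tau> h + 1) / (a \<tau> h + 1 + g \<tau>)) \<longlongrightarrow> \<rho> h / (\<rho> h + s)) at_top"
      by (rule Lim_transform_eventually)
    show "0 < \<rho> h / (\<rho> h + s)" using \<rho>[OF h] s[OF h] by simp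
    show "((\<lambda>\<tau>. b \<tau> h - a \<tau> h + \<Delta> h) \<longlongrightarrow> d h + \<Delta> h) at_top"
      by (intro tendsto_intros b_lim h)
  qed
  have Q: "(Q \<longlongrightarrow> exp (((sqrt 2 * ah + s / sqrt 2)\<^sup>2 - (sqrt 2 * ah)\<^sup>2) / 2)) at_top"
    unfolding Q_def
  proof (rule tendsto_Gamma_quotient_diff)
    have "((\<lambda>\<tau>. (a \<tau> r + 1 - \<tau>) / sqrt \<tau> + s / sqrt 2) \<longlongrightarrow> sqrt 2 * ah + s / sqrt 2) at_top"
      by (intro tendsto_intros a_last)
    moreover have "\<forall>\<^sub>F \<tau> in at_top. (a \<tau> r + 1 - \<tau>) / sqrt \<tau> + s / sqrt 2 = (a \<tau> r + 1 - \<tau> + g \<tau>) / sqrt \<tau>"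
      using eventually_gt_at_top[of 0] by eventually_elim (simp add: g_def add_divide_distrib real_sqrt_divide)
    ultimately show "((\<lambda>\<tau>. (a \<tau> r + 1 - \<tau> + g \<tau>) / sqrt \<tau>) \<longlongrightarrow> sqrt 2 * ah + s / sqrt 2) at_top"
      by (rule Lim_transform_eventually)
  qed (rule filterlim_ident a_last)+
  have "((\<lambda>\<tau>. (\<Prod>h<r. P \<tau> h) * Q \<tau>) \<longlongrightarrow> (\<Prod>h<r. (\<rho> h / (\<rho> h + s)) powr (d h + \<Delta> h)) *
      exp (((sqrt 2 * ah + s / sqrt 2)\<^sup>2 - (sqrt 2 * ah)\<^sup>2) / 2)) at_top"
    by (intro tendsto_mult tendsto_prod P Q) simp
  moreover have "((sqrt 2 * ah + s / sqrt 2)\<^sup>2 - (sqrt 2 * ah)\<^sup>2) / 2 = ah * s + s\<^sup>2 / 4"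
    by (simp add: power2_sum power_divide field_simps)
  ultimately have lim: "((\<lambda>\<tau>. (\<Prod>h<r. P \<tau> h) * Q \<tau>) \<longlongrightarrow> hermite_laplace r \<rho> d ah j s) at_top"
    using \<rho> s by (simp add: hermite_laplace_prod \<Delta>_def)
  show ?thesis
  proof (rule Lim_transform_eventually[OF lim])
    show "\<forall>\<^sub>F \<tau> in at_top. (\<Prod>h<r. P \<tau> h) * Q \<tau> = laguerre1_transform r (a \<tau>) (b \<tau>) \<tau> j s"
      using eventually_gt_at_top[of 0] a_gt b_gt
    proof eventually_elim
      case (elim \<tau>)
      have bpos: "b \<tau> h + 1 > 0" if "h < r" for h using elim(2,3) that by (smt (verit) less_imp_le_nat)
      define A where "A = (\<Prod>h<r. Gamma (a \<tau> h + g \<tau> + 1) / Gamma (b \<tau> h + \<Delta> h + g \<tau> + 1))"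
      have "P \<tau> h = (Gamma (a \<tau> h + g \<tau> + 1) / Gamma (b \<tau> h + \<Delta> h + g \<tau> + 1)) *
        (Gamma (b \<tau> h + 1) * (if h = j then b \<tau> h + 1 else 1) / Gamma (a \<tau> h + 1))" if "h < r" for h
      proof -
        \<comment> \<open>The factor \<open>b j + 1\<close> of the row raises Gamma (b j + 1) to
          Gamma (b j + 2), the increment that the pair for h = j requires.\<close>
        have "b \<tau> h + 1 \<notin> \<int>\<^sub>\<le>\<^sub>0" using bpos[OF that] by (auto elim!: nonpos_Ints_cases)
        then have "Gamma (b \<tau> h + 1 + \<Delta> h) = Gamma (b \<tau> h + 1) * (if h = j then b \<tau> h + 1 else 1)"
          using Gamma_plus1[of "b \<tau> h + 1"] by (auto simp: \<Delta>_def mult.commute)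
        then show ?thesis by (simp add: P_def add_ac)
      qed
      then have "(\<Prod>h<r. P \<tau> h) = A * ((\<Prod>h<r. Gamma (b \<tau> h + 1)) * (\<Prod>h<r. if h = j then b \<tau> h + 1 else 1) /
          (\<Prod>h<r. Gamma (a \<tau> h + 1)))"
        by (simp add: A_def prod.distrib prod_dividef)
      moreover have "(\<Prod>h<r. if h = j then b \<tau> h + 1 else 1) = (if j < r then b \<tau> j + 1 else 1)"
        by (simp add: prod.delta)
      moreover have "Q \<tau> = Gamma (a \<tau> r + g \<tau> + 1) / Gamma (a \<tau> r + 1) * \<tau> powr (- g \<tau>)"
        by (simp add: Q_def add_ac)
      ultimately have "(\<Prod>h<r. P \<tau> h) * Q \<tau> = \<tau> powr (- g \<tau>) * (if j < r then b \<tau> j + 1 else 1) /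
        (((\<Prod>h<r. Gamma (a \<tau> h + 1)) * Gamma (a \<tau> r + 1)) / (\<Prod>h<r. Gamma (b \<tau> h + 1))) * (A * Gamma (a \<tau> r + g \<tau> + 1))"
        by simp
      then show ?case
        by (simp add: laguerre1_transform_def A_def \<Delta>_def prod_atMost_split flip: g_def)
    qed
  qed
qed

text \<open>In the inner limit the lists are independent of \<kappa>, so the intermediate values are
  finite combinations of limiting transforms. In the outer limit the step shrinks and the exponent
  drifts to \<open>\<xi> i\<close>.\<close>

lemma laguerre1_route:
  fixes a b \<beta> :: "real \<Rightarrow> nat \<Rightarrow> real"
  assumes a_gt: "\<forall>\<^sub>F \<tau> in at_top. \<forall>\<nu>\<le>r. a \<tau> \<nu> > -1" and b_gt: "\<forall>\<^sub>F \<tau> in at_top. \<forall>h<r. b \<tau> h > a \<tau> h"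
    and a_last: "((\<lambda>\<tau>. (a \<tau> r + 1 - \<tau>) / sqrt \<tau>) \<longlongrightarrow> sqrt 2 * ah) at_top"
    and a_lim: "\<And>h. h < r \<Longrightarrow> ((\<lambda>\<tau>. sqrt (2 / \<tau>) * (a \<tau> h + 1)) \<longlongrightarrow> \<rho> h) at_top"
    and b_lim: "\<And>h. h < r \<Longrightarrow> ((\<lambda>\<tau>. b \<tau> h - a \<tau> h) \<longlongrightarrow> d h) at_top"
    and \<beta>_lim: "((\<lambda>\<tau>. sqrt (2 / \<tau>) * \<beta> \<tau> i) \<longlongrightarrow> \<xi> i) at_top"
    and \<rho>: "\<And>h. h < r \<Longrightarrow> \<rho> h > 0" and \<xi>: "\<And>h. h < r \<Longrightarrow> \<xi> i + \<rho> h > 0"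
    and \<omega>: "\<omega> > 0" and j: "j \<le> r"
  defines "g \<equiv> \<lambda>\<tau> v. list_eval (power_list v (sqrt (2 / \<tau>)) 0 (sqrt (2 / \<tau>) * \<beta> \<tau> i)) (laguerre1_transform r (a \<tau>) (b \<tau>) \<tau> j)"
  shows "\<forall>\<^sub>F \<tau> in at_top. (\<forall>\<^sub>F \<kappa> in at_top. \<forall>v. integrable lborel
      (\<lambda>t. t ^ v * (laguerre1_row r (a \<tau>) (b \<tau>) \<omega> \<tau> \<kappa> j t * laguerre1_col (\<beta> \<tau>) \<tau> i t))) \<and>
    (\<forall>v. ((\<lambda>\<kappa>. LINT t|lborel. t ^ v * (laguerre1_row r (a \<tau>) (b \<tau>) \<omega> \<tau> \<kappa> j t * laguerre1_col (\<beta> \<tau>) \<tau> i t))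
      \<longlongrightarrow> g \<tau> v) at_top)"
    and "((\<lambda>\<tau>. g \<tau> v) \<longlongrightarrow> exp_moment v (hermite_laplace r \<rho> d ah j) (\<xi> i)) at_top"
proof -
  obtain \<delta> where \<delta>: "\<delta> > 0" "\<And>h s. h < r \<Longrightarrow> s \<in> {\<xi> i - \<delta>..\<xi> i + \<delta>} \<Longrightarrow> \<rho> h + s > 0"
    using obtain_interval[of r "\<xi> i" \<rho>] \<xi> by blast
  define J where "J = {\<xi> i - \<delta>..\<xi> i + \<delta>}"
  have first: "\<forall>\<^sub>F \<tau> in at_top. 0 < sqrt (2 / \<tau>) * (a \<tau> h + 1) + (\<xi> i - \<delta>)" if "h < r" for h
  proof (rule order_tendstoD(1))
    show "((\<lambda>\<tau>. sqrt (2 / \<tau>) * (a \<tau> h + 1) + (\<xi> i - \<delta>)) \<longlongrightarrow> \<rho> h + (\<xi> i - \<delta>)) at_top"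
      by (intro tendsto_intros a_lim that)
    show "0 < \<rho> h + (\<xi> i - \<delta>)" using \<delta> that by auto
  qed
  have last: "\<forall>\<^sub>F \<tau> in at_top. 0 < sqrt (2 / \<tau>) * (a \<tau> r + 1) + (\<xi> i - \<delta>)"
  proof -
    \<comment> \<open>Splitting off sqrt 2 * sqrt \<tau> leaves a convergent part, so the quantity
      tends to infinity and the last row restricts no exponent.\<close>
    have "((\<lambda>\<tau>. sqrt 2 * ((a \<tau> r + 1 - \<tau>) / sqrt \<tau>) + (\<xi> i - \<delta>)) \<longlongrightarrow> sqrt 2 * (sqrt 2 * ah) + (\<xi> i - \<delta>)) at_top"
      by (intro tendsto_intros a_last)
    moreover have "filterlim (\<lambda>\<tau>. sqrt 2 * sqrt \<tau>) at_top at_top" by real_asymp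
    ultimately have "filterlim (\<lambda>\<tau>. (sqrt 2 * ((a \<tau> r + 1 - \<tau>) / sqrt \<tau>) + (\<xi> i - \<delta>)) + sqrt 2 * sqrt \<tau>) at_top at_top"
      by (rule filterlim_tendsto_add_at_top)
    then have "\<forall>\<^sub>F \<tau> in at_top. 0 < (sqrt 2 * ((a \<tau> r + 1 - \<tau>) / sqrt \<tau>) + (\<xi> i - \<delta>)) + sqrt 2 * sqrt \<tau>"
      by (auto simp: filterlim_at_top_dense)
    then show ?thesis
      using eventually_gt_at_top[of 0]
    proof eventually_elim
      case (elim \<tau>)
      have "sqrt 2 * ((a \<tau> r + 1 - \<tau>) / sqrt \<tau>) + sqrt 2 * sqrt \<tau> = sqrt (2 / \<tau>) * (a \<tau> r + 1)"
        using elim by (simp add: real_sqrt_divide diff_divide_distrib right_diff_distrib real_div_sqrt)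
      then show ?case using elim by linarith
    qed
  qed
  have all: "\<forall>\<^sub>F \<tau> in at_top. \<forall>h\<in>{..<r}. 0 < sqrt (2 / \<tau>) * (a \<tau> h + 1) + (\<xi> i - \<delta>)"
    by (intro eventually_ball_finite ballI first) auto
  have "\<forall>\<^sub>F \<tau> in at_top. sqrt (2 / \<tau>) * \<beta> \<tau> i > \<xi> i - \<delta>"
    by (rule order_tendstoD(1)[OF \<beta>_lim]) (use \<delta> in simp)
  then have ev: "\<forall>\<^sub>F \<tau> in at_top. \<tau> > 0 \<and> (\<forall>h\<le>r. a \<tau> h > -1) \<and> (\<forall>h<r. b \<tau> h > a \<tau> h) \<and>
     (\<forall>h\<le>r. \<forall>s\<in>J. a \<tau> h + s / sqrt (2 / \<tau>) + 1 > 0) \<and> (\<forall>h\<le>r. a \<tau> h + \<beta> \<tau> i + 1 > 0)"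
    using all last a_gt b_gt eventually_gt_at_top[of 0]
  proof eventually_elim
    case (elim \<tau>)
    define \<epsilon> where "\<epsilon> = sqrt (2 / \<tau>)"
    have \<epsilon>: "\<epsilon> > 0" using elim by (simp add: \<epsilon>_def)
    have le: "0 < \<epsilon> * (a \<tau> h + 1) + (\<xi> i - \<delta>)" if "h \<le> r" for h
      using elim(2,3) that unfolding \<epsilon>_def by (cases "h = r") auto
    have *: "a \<tau> h + s / \<epsilon> + 1 > 0" if "h \<le> r" "s \<ge> \<xi> i - \<delta>" for h s
    proof -
      have "0 < (\<epsilon> * (a \<tau> h + 1) + s) / \<epsilon>" using le[OF that(1)] that(2) \<epsilon> by simp
      also have "\<dots> = a \<tau> h + s / \<epsilon> + 1" using \<epsilon> by (simp add: add_divide_distrib)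
      finally show ?thesis .
    qed
    have "a \<tau> h + \<beta> \<tau> i + 1 > 0" if "h \<le> r" for h
      using *[OF that, of "\<epsilon> * \<beta> \<tau> i"] elim(1) \<epsilon> by (simp add: \<epsilon>_def)
    then show ?case using elim * by (simp add: J_def flip: \<epsilon>_def)
  qed
  show "\<forall>\<^sub>F \<tau> in at_top. (\<forall>\<^sub>F \<kappa> in at_top. \<forall>v. integrable lborel
      (\<lambda>t. t ^ v * (laguerre1_row r (a \<tau>) (b \<tau>) \<omega> \<tau> \<kappa> j t * laguerre1_col (\<beta> \<tau>) \<tau> i t))) \<and>
    (\<forall>v. ((\<lambda>\<kappa>. LINT t|lborel. t ^ v * (laguerre1_row r (a \<tau>) (b \<tau>) \<omega> \<tau> \<kappa> j t * laguerre1_col (\<beta> \<tau>) \<tau> i t))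
      \<longlongrightarrow> g \<tau> v) at_top)"
    using ev
  proof eventually_elim
    case (elim \<tau>)
    then have \<tau>: "\<tau> > 0" and aa: "\<And>h. h \<le> r \<Longrightarrow> a \<tau> h > -1" and bb: "\<And>h. h < r \<Longrightarrow> a \<tau> h < b \<tau> h"
      and \<beta>: "\<And>h. h \<le> r \<Longrightarrow> a \<tau> h + \<beta> \<tau> i + 1 > 0" by auto
    have mom: "\<forall>\<^sub>F \<kappa> in at_top. \<forall>v. has_bochner_integral lborel
      (\<lambda>t. t ^ v * (laguerre1_row r (a \<tau>) (b \<tau>) \<omega> \<tau> \<kappa> j t * laguerre1_col (\<beta> \<tau>) \<tau> i t))
      (list_eval (power_list v (sqrt (2 / \<tau>)) 0 (sqrt (2 / \<tau>) * \<beta> \<tau> i)) (laguerre1_finite r j (a \<tau>) (b \<tau>) \<omega> \<tau> \<kappa>))"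
      by (rule has_bochner_integral_laguerre1) (use aa bb \<omega> \<tau> j \<beta> in auto)
    have \<epsilon>: "sqrt (2 / \<tau>) > 0" using \<tau> by simp
    have "((\<lambda>\<kappa>. LINT t|lborel. t ^ v * (laguerre1_row r (a \<tau>) (b \<tau>) \<omega> \<tau> \<kappa> j t * laguerre1_col (\<beta> \<tau>) \<tau> i t))
      \<longlongrightarrow> g \<tau> v) at_top" for v
    proof (rule Lim_transform_eventually)
      show "((\<lambda>\<kappa>. list_eval (power_list v (sqrt (2 / \<tau>)) 0 (sqrt (2 / \<tau>) * \<beta> \<tau> i)) (laguerre1_finite r j (a \<tau>) (b \<tau>) \<omega> \<tau> \<kappa>))
        \<longlongrightarrow> g \<tau> v) at_top"
        unfolding g_def
      proof (rule tendsto_list_eval)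
        fix s assume "s \<in> snd ` set (power_list v (sqrt (2 / \<tau>)) 0 (sqrt (2 / \<tau>) * \<beta> \<tau> i))"
        then obtain k where s: "s = sqrt (2 / \<tau>) * \<beta> \<tau> i + real k * sqrt (2 / \<tau>)" unfolding snd_power_list by auto
        have "s / sqrt (2 / \<tau>) = \<beta> \<tau> i + real k" using \<epsilon> unfolding s by (simp add: add_divide_distrib)
        then have "a \<tau> h + s / sqrt (2 / \<tau>) + 1 > 0" if "h \<le> r" for h using \<beta>[OF that] by simp
        then show "((\<lambda>\<kappa>. laguerre1_finite r j (a \<tau>) (b \<tau>) \<omega> \<tau> \<kappa> s) \<longlongrightarrow> laguerre1_transform r (a \<tau>) (b \<tau>) \<tau> j s) at_top"
          by (intro tendsto_laguerre1_finite[OF aa bb \<omega> \<tau> j])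
      qed
      show "\<forall>\<^sub>F \<kappa> in at_top. list_eval (power_list v (sqrt (2 / \<tau>)) 0 (sqrt (2 / \<tau>) * \<beta> \<tau> i)) (laguerre1_finite r j (a \<tau>) (b \<tau>) \<omega> \<tau> \<kappa>)
        = (LINT t|lborel. t ^ v * (laguerre1_row r (a \<tau>) (b \<tau>) \<omega> \<tau> \<kappa> j t * laguerre1_col (\<beta> \<tau>) \<tau> i t))"
        using mom by eventually_elim (simp add: has_bochner_integral_iff)
    qed
    moreover have "\<forall>\<^sub>F \<kappa> in at_top. \<forall>v. integrable lborel
      (\<lambda>t. t ^ v * (laguerre1_row r (a \<tau>) (b \<tau>) \<omega> \<tau> \<kappa> j t * laguerre1_col (\<beta> \<tau>) \<tau> i t))"
      using mom by eventually_elim (simp add: has_bochner_integral_iff)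
    ultimately show ?case by blast
  qed
  have pos: "\<forall>\<^sub>F \<tau> in at_top. exp_positive {\<xi> i - \<delta>..\<xi> i + \<delta>} (laguerre1_transform r (a \<tau>) (b \<tau>) \<tau> j)"
    using ev
  proof eventually_elim
    case (elim \<tau>)
    then have \<tau>: "\<tau> > 0" and aa: "\<And>h. h \<le> r \<Longrightarrow> a \<tau> h > -1" and bb: "\<And>h. h < r \<Longrightarrow> a \<tau> h < b \<tau> h"
      and s: "\<And>h s. h \<le> r \<Longrightarrow> s \<in> {\<xi> i - \<delta>..\<xi> i + \<delta>} \<Longrightarrow> a \<tau> h + s / sqrt (2 / \<tau>) + 1 > 0"
      by (auto simp: J_def)
    \<comment> \<open>Positivity at the intermediate stage is inherited from finite
      \<kappa>.\<close>
    show ?case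
    proof (rule exp_positive_limit)
      show "\<forall>\<^sub>F \<kappa> in at_top. exp_positive {\<xi> i - \<delta>..\<xi> i + \<delta>} (laguerre1_finite r j (a \<tau>) (b \<tau>) \<omega> \<tau> \<kappa>)"
        by (rule exp_positive_laguerre1_finite[OF aa bb \<omega> \<tau> j s])
      show "((\<lambda>\<kappa>. laguerre1_finite r j (a \<tau>) (b \<tau>) \<omega> \<tau> \<kappa> s) \<longlongrightarrow> laguerre1_transform r (a \<tau>) (b \<tau>) \<tau> j s) at_top"
        if "s \<in> {\<xi> i - \<delta>..\<xi> i + \<delta>}" for s
        by (rule tendsto_laguerre1_finite[OF aa bb \<omega> \<tau> j s]) (use that in auto)
    qed simp
  qed
  show "((\<lambda>\<tau>. g \<tau> v) \<longlongrightarrow> exp_moment v (hermite_laplace r \<rho> d ah j) (\<xi> i)) at_top"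
    unfolding g_def
  proof (rule tendsto_power_list_moment[OF _ \<delta>(1) pos])
    show "((\<lambda>\<tau>. laguerre1_transform r (a \<tau>) (b \<tau>) \<tau> j s) \<longlongrightarrow> hermite_laplace r \<rho> d ah j s) at_top"
      if "s \<in> {\<xi> i - \<delta>..\<xi> i + \<delta>}" for s
      by (rule tendsto_laguerre1_transform[OF a_gt b_gt a_last a_lim b_lim \<rho>]) (use that \<delta> in auto)
    show "((\<lambda>\<tau>::real. sqrt (2 / \<tau>)) \<longlongrightarrow> 0) at_top" by real_asymp
    show "\<forall>\<^sub>F \<tau> in at_top. 0 < sqrt (2 / \<tau>)" using eventually_gt_at_top[of 0] by eventually_elim simp
  qed (use \<beta>_lim in auto)
qed

subsection \<open>Route through Laguerre of the second kind\<close>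

text \<open>With y = \<tau> + h (ah - t), the factor exp (s t) is exp (s (\<tau> / h + ah)) exp (-
  (s / h) y). The product is the transform at s / h of independent Gamma laws, the last of shape
  \<tau>, with shape raised by one in row j.\<close>

definition laguerre2_transform ::
  "nat \<Rightarrow> (nat \<Rightarrow> real) \<Rightarrow> (nat \<Rightarrow> real) \<Rightarrow> real \<Rightarrow> real \<Rightarrow> nat \<Rightarrow> real \<Rightarrow> real" where
  "laguerre2_transform r \<rho> d ah \<tau> j s = exp (s * (\<tau> / sqrt (2 * \<tau>) + ah)) *
     (\<Prod>h\<le>r. (laguerre2_rate r \<rho> \<tau> h / (laguerre2_rate r \<rho> \<tau> h + s / sqrt (2 * \<tau>))) powr
        ((d(r := \<tau>)) h + (if h = j then 1 else 0)))"

context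
  fixes r j :: nat and \<rho> d :: "nat \<Rightarrow> real" and ah \<tau> :: real
  assumes d: "\<And>h. h < r \<Longrightarrow> d h > 0" and \<rho>: "\<And>h. h < r \<Longrightarrow> \<rho> h > 0" and \<tau>: "\<tau> > 0" and j: "j \<le> r"
begin

definition laguerre2_const :: "real \<Rightarrow> real" where
  "laguerre2_const \<kappa> = sqrt (2 * \<tau>) *
     (laguerre2_rate r \<rho> \<tau> j * (\<Prod>h\<le>r. laguerre2_rate r \<rho> \<tau> h powr (d(r := \<tau>)) h)) *
     \<kappa> powr (\<Sum>h\<le>r. (d(r := \<tau>)) h)"

definition laguerre2_finite :: "real \<Rightarrow> real \<Rightarrow> real" where
  "laguerre2_finite \<kappa> = scaled_transform r j (\<lambda>h. \<kappa> * laguerre2_rate r \<rho> \<tau> h - 1)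
     (\<lambda>h. \<kappa> * laguerre2_rate r \<rho> \<tau> h - 1 + (d(r := \<tau>)) h) (laguerre2_const \<kappa>) 1 (sqrt (2 * \<tau>) / \<kappa>) (\<tau> / sqrt (2 * \<tau>) + ah)"

lemma laguerre2_rate_pos: "h \<le> r \<Longrightarrow> laguerre2_rate r \<rho> \<tau> h > 0"
  using \<rho>[of h] \<tau> by (simp add: laguerre2_rate_def)

lemma laguerre2_d_pos: "h \<le> r \<Longrightarrow> (d(r := \<tau>)) h > 0"
  using d[of h] \<tau> by simp

lemma laguerre2_const_nonneg: "laguerre2_const \<kappa> \<ge> 0"
  unfolding laguerre2_const_def using laguerre2_rate_pos[OF j] \<tau>
  by (intro mult_nonneg_nonneg prod_nonneg) auto

lemma laguerre2_arg_pos: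
  assumes "laguerre2_rate r \<rho> \<tau> h + s / sqrt (2 * \<tau>) > 0" "\<kappa> > 0"
  shows "\<kappa> * laguerre2_rate r \<rho> \<tau> h - 1 + s / (sqrt (2 * \<tau>) / \<kappa>) + 1 > 0"
proof -
  have "0 < \<kappa> * (laguerre2_rate r \<rho> \<tau> h + s / sqrt (2 * \<tau>))" using assms by simp
  also have "\<dots> = \<kappa> * laguerre2_rate r \<rho> \<tau> h - 1 + s / (sqrt (2 * \<tau>) / \<kappa>) + 1"
    by (simp add: algebra_simps)
  finally show ?thesis .
qed

lemma exp_positive_laguerre2_finite:
  assumes s: "\<And>h s. h \<le> r \<Longrightarrow> s \<in> J \<Longrightarrow> laguerre2_rate r \<rho> \<tau> h + s / sqrt (2 * \<tau>) > 0" and \<kappa>: "\<kappa> > 0"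
  shows "exp_positive J (laguerre2_finite \<kappa>)"
  unfolding laguerre2_finite_def
  by (rule exp_positive_scaled_transform)
     (use laguerre2_d_pos laguerre2_const_nonneg \<tau> \<kappa> laguerre2_arg_pos s in auto)

lemma has_bochner_integral_laguerre2:
  assumes s: "\<And>h. h \<le> r \<Longrightarrow> laguerre2_rate r \<rho> \<tau> h + \<xi> i / sqrt (2 * \<tau>) > 0" and \<kappa>: "\<kappa> > 0"
  shows "has_bochner_integral lborel (\<lambda>t. t ^ v * (laguerre2_row r \<rho> d ah \<tau> \<kappa> j t * laguerre2_col \<xi> ah \<tau> \<kappa> i t))
    (list_eval (power_list v (sqrt (2 * \<tau>) / \<kappa>) (\<tau> / sqrt (2 * \<tau>) + ah) (\<xi> i)) (laguerre2_finite \<kappa>))"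
proof -
  define H where "H = sqrt (2 * \<tau>)"
  have H: "H > 0" using \<tau> by (simp add: H_def)
  \<comment> \<open>The point at which y vanishes, so that 1 - y / \<kappa> has the form 1 +
    \<epsilon> (t - c) with \<epsilon> = H / \<kappa>.\<close>
  define c where "c = \<tau> / H + ah"
  let ?a = "\<lambda>h. \<kappa> * laguerre2_rate r \<rho> \<tau> h - 1"
  let ?b = "\<lambda>h. \<kappa> * laguerre2_rate r \<rho> \<tau> h - 1 + (d(r := \<tau>)) h"
  have ab: "?a h < ?b h" if "h \<le> r" for h using laguerre2_d_pos[OF that] by linarith
  have arg: "1 * (1 + H / \<kappa> * (t - c)) = 1 - (\<tau> + H * (ah - t)) / \<kappa>" for t
    using H \<kappa> by (simp add: c_def field_simps)
  have row: "laguerre2_row r \<rho> d ah \<tau> \<kappa> j t = laguerre2_const \<kappa> * jacobi_weight r j ?a ?b (1 * (1 + H / \<kappa> * (t - c)))" for t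
  proof (cases "0 < \<tau> + H * (ah - t) \<and> \<tau> + H * (ah - t) < \<kappa>")
    case True
    then show ?thesis unfolding arg by (simp add: laguerre2_row_def Let_def laguerre2_const_def flip: H_def)
  next
    case False
    then have "1 - (\<tau> + H * (ah - t)) / \<kappa> \<notin> {0<..<1}"
      using \<kappa> by (auto simp: zero_less_divide_iff)
    then have "jacobi_weight r j ?a ?b (1 - (\<tau> + H * (ah - t)) / \<kappa>) = 0"
      by (rule jacobi_weight_support[rotated]) (rule ab)
    then show ?thesis using False unfolding arg by (simp add: laguerre2_row_def Let_def flip: H_def)
  qed
  have col: "laguerre2_col \<xi> ah \<tau> \<kappa> i t = exp (\<xi> i * (c + ln (1 + H / \<kappa> * (t - c)) / (H / \<kappa>)))"
    if "1 + H / \<kappa> * (t - c) > 0" for t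
  proof -
    define L where "L = ln (1 + H / \<kappa> * (t - c))"
    have e: "1 - (\<tau> + H * (ah - t)) / \<kappa> = 1 + H / \<kappa> * (t - c)" using arg[of t] by simp
    have "laguerre2_col \<xi> ah \<tau> \<kappa> i t = exp (\<xi> i * c) * exp (\<kappa> * \<xi> i / H * L)"
      using that unfolding laguerre2_col_def Let_def H_def[symmetric] c_def[symmetric] e powr_def L_def by simp
    also have "\<dots> = exp (\<xi> i * (c + L / (H / \<kappa>)))"
      unfolding exp_add[symmetric] by (simp add: distrib_left)
    finally show ?thesis by (simp add: L_def)
  qed
  have s': "?a h + \<xi> i / (H / \<kappa>) + 1 > 0" if "h \<le> r" for h
    using laguerre2_arg_pos[OF s[OF that] \<kappa>] by (simp add: H_def)
  have "has_bochner_integral lborel (\<lambda>t. t ^ v * (laguerre2_row r \<rho> d ah \<tau> \<kappa> j t * laguerre2_col \<xi> ah \<tau> \<kappa> i t))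
    (list_eval (power_list v (H / \<kappa>) c (\<xi> i)) (scaled_transform r j ?a ?b (laguerre2_const \<kappa>) 1 (H / \<kappa>) c))"
    by (rule has_bochner_integral_scaled_moment[OF ab s' laguerre2_const_nonneg _ _ row col]) (use H \<kappa> in simp_all)
  then show ?thesis by (simp add: laguerre2_finite_def c_def H_def)
qed

text \<open>Every Gamma quotient is a fixed shift at an argument linear in \<kappa>. The powers of
  \<kappa> and of the rates left by the shifts are those in \<open>laguerre2_const\<close>, together
  with one power of \<kappa> from dividing by the step.\<close>

lemma tendsto_laguerre2_finite:
  assumes s: "\<And>h. h \<le> r \<Longrightarrow> laguerre2_rate r \<rho> \<tau> h + s / sqrt (2 * \<tau>) > 0"
  shows "((\<lambda>\<kappa>. laguerre2_finite \<kappa> s) \<longlongrightarrow> laguerre2_transform r \<rho> d ah \<tau> j s) at_top"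
proof -
  define H where "H = sqrt (2 * \<tau>)"
  have H: "H > 0" using \<tau> by (simp add: H_def)
  define c where "c = \<tau> / H + ah"
  define R where "R h = laguerre2_rate r \<rho> \<tau> h" for h
  define D where "D h = (d(r := \<tau>)) h + (if h = j then 1 else 0)" for h
  have Rs: "R h + s / H > 0" if "h \<le> r" for h using s[OF that] by (simp add: R_def H_def)
  have R0: "R h > 0" if "h \<le> r" for h using laguerre2_rate_pos[OF that] by (simp add: R_def)
  define P where "P \<kappa> h = Gamma ((R h + s / H) * \<kappa>) / Gamma ((R h + s / H) * \<kappa> + D h) *
    ((R h + s / H) * \<kappa>) powr D h * (R h / (R h + s / H)) powr D h" for \<kappa> h
  have "((\<lambda>\<kappa>. P \<kappa> h) \<longlongrightarrow> 1 * (R h / (R h + s / H)) powr D h) at_top" if h: "h \<le> r" for h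
    unfolding P_def
    by (intro tendsto_mult[OF _ tendsto_const] tendsto_Gamma_shift(1)[OF _ tendsto_const]
        filterlim_tendsto_pos_mult_at_top[OF tendsto_const Rs[OF h]] filterlim_ident)
  then have "((\<lambda>\<kappa>. exp (s * c) * (\<Prod>h\<le>r. P \<kappa> h)) \<longlongrightarrow> exp (s * c) * (\<Prod>h\<le>r. (R h / (R h + s / H)) powr D h)) at_top"
    by (intro tendsto_mult[OF tendsto_const] tendsto_prod) auto
  then have lim: "((\<lambda>\<kappa>. exp (s * c) * (\<Prod>h\<le>r. P \<kappa> h)) \<longlongrightarrow> laguerre2_transform r \<rho> d ah \<tau> j s) at_top"
    by (simp add: laguerre2_transform_def c_def H_def R_def D_def)
  show ?thesis
  proof (rule Lim_transform_eventually[OF lim])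
    show "\<forall>\<^sub>F \<kappa> in at_top. exp (s * c) * (\<Prod>h\<le>r. P \<kappa> h) = laguerre2_finite \<kappa> s"
      using eventually_gt_at_top[of 0]
    proof eventually_elim
      case (elim \<kappa>)
      define f where "f h = Gamma ((R h + s / H) * \<kappa>) / Gamma ((R h + s / H) * \<kappa> + D h)" for h
      have P: "P \<kappa> h = f h * (R h powr D h * \<kappa> powr D h)" if "h \<le> r" for h
        using Rs[OF that] R0[OF that] elim by (simp add: P_def f_def powr_mult powr_divide)
      have sumD: "(\<Sum>h\<le>r. D h) = (\<Sum>h\<le>r. (d(r := \<tau>)) h) + 1"
        using j by (simp add: D_def sum.distrib)
      have R: "(\<Prod>h\<le>r. R h powr D h) = R j * (\<Prod>h\<le>r. R h powr (d(r := \<tau>)) h)"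
      proof -
        have "R h powr D h = (if h = j then R h else 1) * R h powr (d(r := \<tau>)) h" if "h \<le> r" for h
        proof -
          have "x powr (u + (if h = j then 1 else 0)) = (if h = j then x else 1) * x powr u" if "x > 0" for x u :: real
            using that by (simp add: powr_add)
          from this[OF R0[OF that]] show ?thesis unfolding D_def .
        qed
        then have "(\<Prod>h\<le>r. R h powr D h) = (\<Prod>h\<le>r. (if h = j then R h else 1) * R h powr (d(r := \<tau>)) h)"
          by (intro prod.cong) auto
        also have "\<dots> = R j * (\<Prod>h\<le>r. R h powr (d(r := \<tau>)) h)"
          using j by (simp only: prod.distrib prod.delta finite_atMost atMost_iff if_True)
        finally show ?thesis .
      qed
      have k: "(\<Prod>h\<le>r. \<kappa> powr D h) = \<kappa> * \<kappa> powr (\<Sum>h\<le>r. (d(r := \<tau>)) h)"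
        using elim sumD by (simp add: powr_sum[symmetric] powr_add del: fun_upd_apply)
      have mellin: "jacobi_mellin r j (\<lambda>h. \<kappa> * R h - 1) (\<lambda>h. \<kappa> * R h - 1 + (d(r := \<tau>)) h) (s / (H / \<kappa>)) = (\<Prod>h\<le>r. f h)"
        unfolding jacobi_mellin_def by (rule prod.cong) (simp_all add: f_def D_def algebra_simps)
      have "(\<Prod>h\<le>r. P \<kappa> h) = (\<Prod>h\<le>r. f h * (R h powr D h * \<kappa> powr D h))"
        by (rule prod.cong) (simp_all add: P)
      also have "\<dots> = (\<Prod>h\<le>r. f h) * ((R j * (\<Prod>h\<le>r. R h powr (d(r := \<tau>)) h)) * (\<kappa> * \<kappa> powr (\<Sum>h\<le>r. (d(r := \<tau>)) h)))"
        by (simp only: prod.distrib R k)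
      also have "\<dots> = laguerre2_const \<kappa> / (H / \<kappa>) * (\<Prod>h\<le>r. f h)"
        using H by (simp add: laguerre2_const_def flip: H_def R_def del: fun_upd_apply)
      finally show ?case
        unfolding laguerre2_finite_def scaled_transform_def H_def[symmetric] R_def[symmetric] c_def[symmetric] mellin
        by simp
    qed
  qed
qed

end

text \<open>A central limit theorem for the Gamma law of shape \<tau>: the second-order term of the
  logarithm gives \<tau> (s / h)^2 / 2 = s^2 / 4. In the factors h < r the scaling by h cancels, so
  they already have their limiting values.\<close>

lemma tendsto_laguerre2_transform:
  assumes \<rho>: "\<And>h. h < r \<Longrightarrow> \<rho> h > 0" and s: "\<And>h. h < r \<Longrightarrow> \<rho> h + s > 0" and j: "j \<le> r"
  shows "((\<lambda>\<tau>. laguerre2_transform r \<rho> d ah \<tau> j s) \<longlongrightarrow> hermite_laplace r \<rho> d ah j s) at_top"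
proof -
  define \<Delta> where "\<Delta> h = (if h = j then 1 else 0 :: real)" for h
  define P where "P = (\<Prod>h<r. (\<rho> h / (\<rho> h + s)) powr (d h + \<Delta> h))"
  define E where "E \<tau> = s * (\<tau> / sqrt (2 * \<tau>)) - \<tau> * ln (1 + s / sqrt (2 * \<tau>))" for \<tau>
  have E: "(E \<longlongrightarrow> s\<^sup>2 / 4) at_top"
  proof -
    have 1: "((\<lambda>y. (y - ln (1 + y)) / y\<^sup>2) \<longlongrightarrow> 1 / 2) (at (0::real))" by real_asymp
    show ?thesis
    \<comment> \<open>For s = 0 the argument of the quotient is identically 0, where the punctured
      limit says nothing.\<close>
    proof (cases "s = 0")
      case False
      have "((\<lambda>\<tau>. s / sqrt (2 * \<tau>)) \<longlongrightarrow> 0) at_top" by real_asymp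
      moreover have "\<forall>\<^sub>F \<tau> in at_top. s / sqrt (2 * \<tau>) \<noteq> 0"
        using eventually_gt_at_top[of 0] by eventually_elim (use False in simp)
      ultimately have "filterlim (\<lambda>\<tau>. s / sqrt (2 * \<tau>)) (at 0) at_top" by (simp add: filterlim_at)
      from filterlim_compose[OF 1 this]
      have "((\<lambda>\<tau>. s\<^sup>2 / 2 * ((s / sqrt (2 * \<tau>) - ln (1 + s / sqrt (2 * \<tau>))) / (s / sqrt (2 * \<tau>))\<^sup>2)) \<longlongrightarrow> s\<^sup>2 / 2 * (1 / 2)) at_top"
        by (intro tendsto_mult tendsto_const)
      moreover have "\<forall>\<^sub>F \<tau> in at_top. s\<^sup>2 / 2 * ((s / sqrt (2 * \<tau>) - ln (1 + s / sqrt (2 * \<tau>))) / (s / sqrt (2 * \<tau>))\<^sup>2) = E \<tau>"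
        using eventually_gt_at_top[of 0]
      proof eventually_elim
        case (elim \<tau>)
        have "(s / sqrt (2 * \<tau>))\<^sup>2 = s\<^sup>2 / (2 * \<tau>)" using elim by (simp add: power_divide)
        then have *: "s\<^sup>2 / 2 * (X / (s / sqrt (2 * \<tau>))\<^sup>2) = \<tau> * X" for X using elim False by simp
        have "E \<tau> = \<tau> * (s / sqrt (2 * \<tau>) - ln (1 + s / sqrt (2 * \<tau>)))"
          by (simp add: E_def right_diff_distrib)
        then show ?case by (simp only: *)
      qed
      ultimately show ?thesis by (auto intro: Lim_transform_eventually)
    qed (simp add: E_def[abs_def])
  qed
  have L: "((\<lambda>\<tau>. (1 + s / sqrt (2 * \<tau>)) powr (- \<Delta> r)) \<longlongrightarrow> 1) at_top"
  proof -
    have "((\<lambda>\<tau>. 1 + s / sqrt (2 * \<tau>)) \<longlongrightarrow> 1) at_top" by real_asymp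
    then have "((\<lambda>\<tau>. (1 + s / sqrt (2 * \<tau>)) powr (- \<Delta> r)) \<longlongrightarrow> 1 powr (- \<Delta> r)) at_top"
      by (intro tendsto_powr tendsto_const) auto
    then show ?thesis by simp
  qed
  have "((\<lambda>\<tau>. P * (exp (ah * s + E \<tau>) * (1 + s / sqrt (2 * \<tau>)) powr (- \<Delta> r))) \<longlongrightarrow> P * (exp (ah * s + s\<^sup>2 / 4) * 1)) at_top"
    by (intro tendsto_intros E L)
  then have lim: "((\<lambda>\<tau>. P * (exp (ah * s + E \<tau>) * (1 + s / sqrt (2 * \<tau>)) powr (- \<Delta> r))) \<longlongrightarrow> hermite_laplace r \<rho> d ah j s) at_top"
    using \<rho> s by (simp add: hermite_laplace_prod P_def \<Delta>_def)
  have pos: "\<forall>\<^sub>F \<tau> in at_top. 1 + s / sqrt (2 * \<tau>) > 0"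
  proof (rule order_tendstoD(1))
    show "((\<lambda>\<tau>. 1 + s / sqrt (2 * \<tau>)) \<longlongrightarrow> 1) at_top" by real_asymp
  qed simp
  show ?thesis
  proof (rule Lim_transform_eventually[OF lim])
    show "\<forall>\<^sub>F \<tau> in at_top. P * (exp (ah * s + E \<tau>) * (1 + s / sqrt (2 * \<tau>)) powr (- \<Delta> r)) = laguerre2_transform r \<rho> d ah \<tau> j s"
      using eventually_gt_at_top[of 0] pos
    proof eventually_elim
      case (elim \<tau>)
      define H where "H = sqrt (2 * \<tau>)"
      have H: "H > 0" using elim by (simp add: H_def)
      have first: "(laguerre2_rate r \<rho> \<tau> h / (laguerre2_rate r \<rho> \<tau> h + s / H)) = \<rho> h / (\<rho> h + s)" if "h < r" for h
        using H that by (simp add: laguerre2_rate_def add_divide_distrib[symmetric] flip: H_def)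
      have "(\<Prod>h<r. (laguerre2_rate r \<rho> \<tau> h / (laguerre2_rate r \<rho> \<tau> h + s / H)) powr ((d(r := \<tau>)) h + \<Delta> h)) = P"
        unfolding P_def by (rule prod.cong) (auto simp: first)
      moreover have "(laguerre2_rate r \<rho> \<tau> r / (laguerre2_rate r \<rho> \<tau> r + s / H)) powr ((d(r := \<tau>)) r + \<Delta> r)
        = exp (- (\<tau> * ln (1 + s / H))) * (1 + s / H) powr (- \<Delta> r)"
        using elim by (simp add: laguerre2_rate_def powr_divide powr_def exp_add[symmetric] exp_minus[symmetric] divide_inverse algebra_simps ln_inverse flip: H_def)
      moreover have "exp (s * (\<tau> / H + ah)) * exp (- (\<tau> * ln (1 + s / H))) = exp (ah * s + E \<tau>)"
        unfolding E_def H_def[symmetric] by (simp add: exp_add[symmetric] algebra_simps)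
      ultimately show ?case
        unfolding laguerre2_transform_def prod_atMost_split H_def[symmetric] \<Delta>_def[symmetric]
        by (simp del: fun_upd_apply)
    qed
  qed
qed

text \<open>The step shrinks with \<kappa>, so the inner limit produces moments of the intermediate
  functional; the outer limit is one of such moments.\<close>

lemma laguerre2_route:
  fixes ah :: real
  assumes d: "\<And>h. h < r \<Longrightarrow> d h > 0" and \<rho>: "\<And>h. h < r \<Longrightarrow> \<rho> h > 0" and \<xi>: "\<And>h. h < r \<Longrightarrow> \<xi> i + \<rho> h > 0"
    and j: "j \<le> r"
  defines "g \<equiv> \<lambda>\<tau> v. exp_moment v (laguerre2_transform r \<rho> d ah \<tau> j) (\<xi> i)"
  shows "\<forall>\<^sub>F \<tau> in at_top. (\<forall>\<^sub>F \<kappa> in at_top. \<forall>v. integrable lborel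
      (\<lambda>t. t ^ v * (laguerre2_row r \<rho> d ah \<tau> \<kappa> j t * laguerre2_col \<xi> ah \<tau> \<kappa> i t))) \<and>
    (\<forall>v. ((\<lambda>\<kappa>. LINT t|lborel. t ^ v * (laguerre2_row r \<rho> d ah \<tau> \<kappa> j t * laguerre2_col \<xi> ah \<tau> \<kappa> i t)) \<longlongrightarrow> g \<tau> v) at_top)"
    and "((\<lambda>\<tau>. g \<tau> v) \<longlongrightarrow> exp_moment v (hermite_laplace r \<rho> d ah j) (\<xi> i)) at_top"
proof -
  obtain \<delta> where \<delta>: "\<delta> > 0" "\<And>h s. h < r \<Longrightarrow> s \<in> {\<xi> i - \<delta>..\<xi> i + \<delta>} \<Longrightarrow> \<rho> h + s > 0"
    using obtain_interval[of r "\<xi> i" \<rho>] \<xi> by blast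
  define J where "J = {\<xi> i - \<delta>..\<xi> i + \<delta>}"
  have "((\<lambda>\<tau>. 1 + (\<xi> i - \<delta>) / sqrt (2 * \<tau>)) \<longlongrightarrow> 1) at_top" by real_asymp
  then have "\<forall>\<^sub>F \<tau> in at_top. 0 < 1 + (\<xi> i - \<delta>) / sqrt (2 * \<tau>)"
    by (rule order_tendstoD(1)) simp
  then have ev: "\<forall>\<^sub>F \<tau> in at_top. \<tau> > 0 \<and> (\<forall>h\<le>r. \<forall>s\<in>J. laguerre2_rate r \<rho> \<tau> h + s / sqrt (2 * \<tau>) > 0)"
    using eventually_gt_at_top[of 0]
  proof eventually_elim
    case (elim \<tau>)
    define H where "H = sqrt (2 * \<tau>)"
    have H: "H > 0" using elim by (simp add: H_def)
    have "laguerre2_rate r \<rho> \<tau> h + s / H > 0" if "h \<le> r" "s \<in> J" for h s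
    proof (cases "h < r")
      case True
      then have "laguerre2_rate r \<rho> \<tau> h + s / H = (\<rho> h + s) / H" by (simp add: laguerre2_rate_def add_divide_distrib flip: H_def)
      then show ?thesis using \<delta>(2)[OF True, of s] that H by (simp add: J_def)
    next
      case False
      have "(\<xi> i - \<delta>) / H \<le> s / H" using that H by (intro divide_right_mono) (auto simp: J_def)
      then show ?thesis using elim False by (simp add: laguerre2_rate_def flip: H_def)
    qed
    then show ?case using elim by (simp add: H_def)
  qed
  have \<xi>J: "\<xi> i \<in> J" using \<delta> by (simp add: J_def)
  have inner: "(\<forall>\<^sub>F \<kappa> in at_top. exp_positive {\<xi> i - \<delta>..\<xi> i + \<delta>} (laguerre2_finite r j \<rho> d ah \<tau> \<kappa>)) \<and>
     (\<forall>s\<in>{\<xi> i - \<delta>..\<xi> i + \<delta>}. ((\<lambda>\<kappa>. laguerre2_finite r j \<rho> d ah \<tau> \<kappa> s) \<longlongrightarrow> laguerre2_transform r \<rho> d ah \<tau> j s) at_top)"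
    if \<tau>: "\<tau> > 0" and s: "\<And>h s. h \<le> r \<Longrightarrow> s \<in> J \<Longrightarrow> laguerre2_rate r \<rho> \<tau> h + s / sqrt (2 * \<tau>) > 0" for \<tau>
  proof
    show "\<forall>\<^sub>F \<kappa> in at_top. exp_positive {\<xi> i - \<delta>..\<xi> i + \<delta>} (laguerre2_finite r j \<rho> d ah \<tau> \<kappa>)"
      using eventually_gt_at_top[of 0]
      by eventually_elim (rule exp_positive_laguerre2_finite[OF d \<rho> \<tau> j s], auto simp: J_def)
    show "\<forall>s\<in>{\<xi> i - \<delta>..\<xi> i + \<delta>}. ((\<lambda>\<kappa>. laguerre2_finite r j \<rho> d ah \<tau> \<kappa> s) \<longlongrightarrow> laguerre2_transform r \<rho> d ah \<tau> j s) at_top"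
      by (intro ballI tendsto_laguerre2_finite[OF d \<rho> \<tau> j s]) (auto simp: J_def)
  qed
  show "\<forall>\<^sub>F \<tau> in at_top. (\<forall>\<^sub>F \<kappa> in at_top. \<forall>v. integrable lborel
      (\<lambda>t. t ^ v * (laguerre2_row r \<rho> d ah \<tau> \<kappa> j t * laguerre2_col \<xi> ah \<tau> \<kappa> i t))) \<and>
    (\<forall>v. ((\<lambda>\<kappa>. LINT t|lborel. t ^ v * (laguerre2_row r \<rho> d ah \<tau> \<kappa> j t * laguerre2_col \<xi> ah \<tau> \<kappa> i t)) \<longlongrightarrow> g \<tau> v) at_top)"
    using ev
  proof eventually_elim
    case (elim \<tau>)
    then have \<tau>: "\<tau> > 0" and s: "\<And>h s. h \<le> r \<Longrightarrow> s \<in> J \<Longrightarrow> laguerre2_rate r \<rho> \<tau> h + s / sqrt (2 * \<tau>) > 0" by auto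
    note inn = inner[OF \<tau> s]
    have mom: "has_bochner_integral lborel (\<lambda>t. t ^ v * (laguerre2_row r \<rho> d ah \<tau> \<kappa> j t * laguerre2_col \<xi> ah \<tau> \<kappa> i t))
      (list_eval (power_list v (sqrt (2 * \<tau>) / \<kappa>) (\<tau> / sqrt (2 * \<tau>) + ah) (\<xi> i)) (laguerre2_finite r j \<rho> d ah \<tau> \<kappa>))"
      if "\<kappa> > 0" for \<kappa> v
      by (rule has_bochner_integral_laguerre2) (use d \<rho> \<tau> j s \<xi>J that in auto)
    have "((\<lambda>\<kappa>. LINT t|lborel. t ^ v * (laguerre2_row r \<rho> d ah \<tau> \<kappa> j t * laguerre2_col \<xi> ah \<tau> \<kappa> i t)) \<longlongrightarrow> g \<tau> v) at_top" for v
    proof (rule Lim_transform_eventually)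
      show "((\<lambda>\<kappa>. list_eval (power_list v (sqrt (2 * \<tau>) / \<kappa>) (\<tau> / sqrt (2 * \<tau>) + ah) (\<xi> i)) (laguerre2_finite r j \<rho> d ah \<tau> \<kappa>))
        \<longlongrightarrow> g \<tau> v) at_top"
        unfolding g_def
      proof (rule tendsto_power_list_moment[OF _ \<delta>(1)])
        show "\<forall>\<^sub>F \<kappa> in at_top. exp_positive {\<xi> i - \<delta>..\<xi> i + \<delta>} (laguerre2_finite r j \<rho> d ah \<tau> \<kappa>)"
          using inn by blast
        show "((\<lambda>\<kappa>. laguerre2_finite r j \<rho> d ah \<tau> \<kappa> s) \<longlongrightarrow> laguerre2_transform r \<rho> d ah \<tau> j s) at_top"
          if "s \<in> {\<xi> i - \<delta>..\<xi> i + \<delta>}" for s using inn that by blast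
        show "\<forall>\<^sub>F \<kappa> in at_top. 0 < sqrt (2 * \<tau>) / \<kappa>"
          using eventually_gt_at_top[of 0] by eventually_elim (use \<tau> in simp)
        show "((\<lambda>\<kappa>. sqrt (2 * \<tau>) / \<kappa>) \<longlongrightarrow> 0) at_top"
          by (rule real_tendsto_divide_at_top[OF tendsto_const filterlim_ident])
      qed auto
      show "\<forall>\<^sub>F \<kappa> in at_top. list_eval (power_list v (sqrt (2 * \<tau>) / \<kappa>) (\<tau> / sqrt (2 * \<tau>) + ah) (\<xi> i)) (laguerre2_finite r j \<rho> d ah \<tau> \<kappa>)
        = (LINT t|lborel. t ^ v * (laguerre2_row r \<rho> d ah \<tau> \<kappa> j t * laguerre2_col \<xi> ah \<tau> \<kappa> i t))"
        using eventually_gt_at_top[of 0] by eventually_elim (use mom in \<open>simp add: has_bochner_integral_iff\<close>)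
    qed
    moreover have "\<forall>\<^sub>F \<kappa> in at_top. \<forall>v. integrable lborel
      (\<lambda>t. t ^ v * (laguerre2_row r \<rho> d ah \<tau> \<kappa> j t * laguerre2_col \<xi> ah \<tau> \<kappa> i t))"
      using eventually_gt_at_top[of 0] by eventually_elim (use mom in \<open>simp add: has_bochner_integral_iff\<close>)
    ultimately show ?case by blast
  qed
  have pos: "\<forall>\<^sub>F \<tau> in at_top. exp_positive {\<xi> i - \<delta>..\<xi> i + \<delta>} (laguerre2_transform r \<rho> d ah \<tau> j)"
    using ev
  proof eventually_elim
    case (elim \<tau>)
    then have "\<tau> > 0" and "\<And>h s. h \<le> r \<Longrightarrow> s \<in> J \<Longrightarrow> laguerre2_rate r \<rho> \<tau> h + s / sqrt (2 * \<tau>) > 0" by auto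
    note inn = inner[OF this]
    show ?case by (rule exp_positive_limit[where F = at_top]) (use inn in auto)
  qed
  show "((\<lambda>\<tau>. g \<tau> v) \<longlongrightarrow> exp_moment v (hermite_laplace r \<rho> d ah j) (\<xi> i)) at_top"
    unfolding g_def
  proof (rule tendsto_exp_moment[OF _ \<delta>(1) pos])
    show "((\<lambda>\<tau>. laguerre2_transform r \<rho> d ah \<tau> j s) \<longlongrightarrow> hermite_laplace r \<rho> d ah j s) at_top"
      if "s \<in> {\<xi> i - \<delta>..\<xi> i + \<delta>}" for s
      by (rule tendsto_laguerre2_transform) (use \<rho> \<delta> that j in auto)
  qed simp
qed


subsection \<open>Polynomials of bounded degree and their top coefficients\<close>

text \<open>A formal degree with its coefficient, which may be 0: cancellation of leading terms
  needs no case distinction.\<close>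

definition poly_top :: "nat \<Rightarrow> real \<Rightarrow> real poly \<Rightarrow> bool" where
  "poly_top n c P \<longleftrightarrow> degree P \<le> n \<and> coeff P n = c"

lemma poly_top_mult:
  assumes "poly_top m c P" "poly_top n e Q"
  shows "poly_top (m + n) (c * e) (P * Q)"
proof -
  have "coeff (P * Q) (m + n) = (\<Sum>i\<le>m + n. coeff P i * coeff Q (m + n - i))"
    by (rule coeff_mult)
  also have "\<dots> = (\<Sum>i\<in>{m}. coeff P i * coeff Q (m + n - i))"
  proof (rule sum.mono_neutral_right)
    show "\<forall>i\<in>{..m + n} - {m}. coeff P i * coeff Q (m + n - i) = 0"
    proof
      fix i assume i: "i \<in> {..m + n} - {m}"
      show "coeff P i * coeff Q (m + n - i) = 0"
      proof (cases "i < m")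
        case True
        then have "coeff Q (m + n - i) = 0" using assms by (intro coeff_eq_0) (auto simp: poly_top_def)
        then show ?thesis by simp
      next
        case False
        then have "coeff P i = 0" using assms i by (intro coeff_eq_0) (auto simp: poly_top_def)
        then show ?thesis by simp
      qed
    qed
  qed auto
  finally show ?thesis
    using assms degree_mult_le[of P Q] by (auto simp: poly_top_def)
qed

lemma poly_top_add: "poly_top n c P \<Longrightarrow> poly_top n e Q \<Longrightarrow> poly_top n (c + e) (P + Q)"
  by (auto simp: poly_top_def degree_add_le)

lemma poly_top_diff: "poly_top n c P \<Longrightarrow> poly_top n e Q \<Longrightarrow> poly_top n (c - e) (P - Q)"
  by (auto simp: poly_top_def degree_diff_le)

lemma poly_top_smult: "poly_top n c P \<Longrightarrow> poly_top n (s * c) (Polynomial.smult s P)"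
  by (auto simp: poly_top_def intro: order_trans[OF degree_smult_le])

lemma poly_top_degree_less: "degree P < n \<Longrightarrow> poly_top n 0 P"
  by (auto simp: poly_top_def coeff_eq_0)

lemma poly_top_less: "poly_top m c P \<Longrightarrow> m < n \<Longrightarrow> poly_top n 0 P"
  by (auto simp: poly_top_def coeff_eq_0)

lemma poly_top_sum: "(\<And>i. i \<in> A \<Longrightarrow> poly_top n (c i) (P i)) \<Longrightarrow> poly_top n (\<Sum>i\<in>A. c i) (\<Sum>i\<in>A. P i)"
proof (induction A rule: infinite_finite_induct)
  case (insert x F)
  then show ?case by (auto intro!: poly_top_add)
qed (simp_all add: poly_top_def)

lemma poly_top_power: "poly_top m c P \<Longrightarrow> poly_top (k * m) (c ^ k) (P ^ k)"
proof (induction k)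
  case 0
  then show ?case by (simp add: poly_top_def)
next
  case (Suc k)
  then show ?case using poly_top_mult[of m c P "k * m" "c ^ k" "P ^ k"] by simp
qed

lemma poly_top_prod:
  "(\<And>i. i \<in> A \<Longrightarrow> poly_top (n i) (c i) (P i)) \<Longrightarrow> finite A \<Longrightarrow> poly_top (\<Sum>i\<in>A. n i) (\<Prod>i\<in>A. c i) (\<Prod>i\<in>A. P i)"
proof (induction A rule: infinite_finite_induct)
  case empty
  then show ?case by (simp add: poly_top_def)
next
  case (insert x F)
  then show ?case by (auto intro!: poly_top_mult)
qed simp

subsection \<open>The rational functions behind the Hermite moments\<close>

context
  fixes r :: nat and \<rho> d :: "nat \<Rightarrow> real" and ah :: real
begin

definition rate_prod :: "real poly" where
  "rate_prod = (\<Prod>h<r. [:\<rho> h, 1:])"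

text \<open>The quotient of \<open>rate_prod\<close> by its factor j. The value 0 for the last row
  expresses that its transform has no extra denominator to differentiate.\<close>

definition rate_cofactor :: "nat \<Rightarrow> real poly" where
  "rate_cofactor j = (if j < r then \<Prod>h\<in>{..<r} - {j}. [:\<rho> h, 1:] else 0)"

text \<open>
  With \<open>\<Phi>\<close> the transform of the last Hermite row, \<open>log_num / rate_prod\<close> is the logarithmic
  derivative of \<open>\<Phi>\<close>, and the \<open>n\<close>-th derivative of the transform of row \<open>j\<close> is
  \<open>\<Phi> * moment_num j n / rate_prod ^ n\<close>, divided by \<open>s + \<rho> j\<close> if \<open>j < r\<close>.
\<close>

definition log_num :: "real poly" where
  "log_num = rate_prod * [:ah, 1 / 2:] - (\<Sum>h<r. Polynomial.smult (d h) (rate_cofactor h))"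

primrec moment_num :: "nat \<Rightarrow> nat \<Rightarrow> real poly" where
  "moment_num j 0 = [:if j < r then \<rho> j else 1:]"
| "moment_num j (Suc n) = (log_num - Polynomial.smult (real n) (pderiv rate_prod) - rate_cofactor j) * moment_num j n
    + rate_prod * pderiv (moment_num j n)"

lemma pderiv_linear_factor: "pderiv [:c, 1:] = (1 :: real poly)"
  by (simp add: pderiv_pCons one_pCons)

lemma pderiv_rate_prod: "pderiv rate_prod = (\<Sum>h<r. rate_cofactor h)"
  unfolding rate_prod_def pderiv_prod
  by (rule sum.cong) (auto simp: rate_cofactor_def pderiv_linear_factor)

lemma rate_prod_factor: "j < r \<Longrightarrow> rate_prod = [:\<rho> j, 1:] * rate_cofactor j"
  unfolding rate_prod_def rate_cofactor_def by (simp add: prod.remove)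

lemma poly_top_linear: "poly_top 1 1 [:c, 1:]"
  by (simp add: poly_top_def)

lemma poly_top_rate_prod: "poly_top r 1 rate_prod"
  using poly_top_prod[of "{..<r}" "\<lambda>_. 1" "\<lambda>_. 1" "\<lambda>h. [:\<rho> h, 1:]"] poly_top_linear
  by (simp add: rate_prod_def)

lemma poly_top_rate_cofactor: "poly_top r 0 (rate_cofactor j)"
proof (cases "j < r")
  case True
  have "poly_top (r - 1) 1 (rate_cofactor j)"
    using poly_top_prod[of "{..<r} - {j}" "\<lambda>_. 1" "\<lambda>_. 1" "\<lambda>h. [:\<rho> h, 1:]"] poly_top_linear True
    by (simp add: rate_cofactor_def)
  then show ?thesis using True by (auto intro: poly_top_less)
qed (simp add: rate_cofactor_def poly_top_def)

lemma poly_top_log_num: "poly_top (Suc r) (1 / 2) log_num"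
proof -
  have "poly_top (r + 1) (1 * (1 / 2)) (rate_prod * [:ah, 1 / 2:])"
    by (rule poly_top_mult[OF poly_top_rate_prod]) (simp add: poly_top_def)
  moreover have "poly_top (Suc r) (\<Sum>h<r. d h * 0) (\<Sum>h<r. Polynomial.smult (d h) (rate_cofactor h))"
    by (intro poly_top_sum poly_top_smult poly_top_less[OF poly_top_rate_cofactor]) simp
  ultimately show ?thesis
    unfolding log_num_def using poly_top_diff by fastforce
qed

text \<open>In the recursion only \<open>log_num\<close> attains degree r + 1, with coefficient 1 /
  2 from the derivative of s^2 / 4; every differentiation multiplies the top coefficient by 1 /
  2.\<close>

lemma poly_top_moment_num: "poly_top (n * Suc r) ((1 / 2) ^ n * (if j < r then \<rho> j else 1)) (moment_num j n)"
proof (induction n)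
  case 0
  then show ?case by (simp add: poly_top_def)
next
  case (Suc n)
  let ?c = "(1 / 2) ^ n * (if j < r then \<rho> j else 1)"
  have deg: "degree (pderiv rate_prod) \<le> r"
    using poly_top_rate_prod by (auto simp: poly_top_def degree_pderiv)
  have 1: "poly_top (Suc r) 0 (Polynomial.smult (real n) (pderiv rate_prod))"
    by (rule poly_top_degree_less) (use deg in \<open>auto intro: le_less_trans[OF degree_smult_le]\<close>)
  have 2: "poly_top (Suc r) 0 (rate_cofactor j)"
    by (rule poly_top_less[OF poly_top_rate_cofactor]) simp
  have 3: "poly_top (Suc r) (1 / 2) (log_num - Polynomial.smult (real n) (pderiv rate_prod) - rate_cofactor j)"
    using poly_top_diff[OF poly_top_diff[OF poly_top_log_num 1] 2] by simp
  have 4: "poly_top (Suc r + n * Suc r) (1 / 2 * ?c)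
      ((log_num - Polynomial.smult (real n) (pderiv rate_prod) - rate_cofactor j) * moment_num j n)"
    by (rule poly_top_mult[OF 3 Suc.IH])
  have 5: "poly_top (Suc r + n * Suc r) 0 (rate_prod * pderiv (moment_num j n))"
  proof (rule poly_top_degree_less)
    have "degree (rate_prod * pderiv (moment_num j n)) \<le> r + n * Suc r"
      using degree_mult_le[of rate_prod "pderiv (moment_num j n)"] poly_top_rate_prod Suc.IH
      by (auto simp: poly_top_def degree_pderiv)
    then show "degree (rate_prod * pderiv (moment_num j n)) < Suc r + n * Suc r" by simp
  qed
  show ?case using poly_top_add[OF 4 5] by (simp del: mult_Suc_right)
qed

text \<open>At - \<rho> j all terms containing \<open>rate_prod\<close> or another cofactor vanish,
  and the recursion is multiplication by - (d j + n + 1) times the cofactor j. For n = 0 the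
  cofactor may vanish, which admits coinciding rates.\<close>

lemma moment_num_at_rate:
  assumes j: "j < r" "\<rho> j > 0" "d j > 0" and E: "n = 0 \<or> poly (rate_cofactor j) (- \<rho> j) \<noteq> 0"
  shows "poly (moment_num j n) (- \<rho> j) \<noteq> 0"
  using E
proof (induction n)
  case 0
  then show ?case using j by simp
next
  case (Suc n)
  define x where "x = - \<rho> j"
  have cof: "poly (rate_cofactor h) x = 0" if "h < r" "h \<noteq> j" for h
    using that j by (auto simp: rate_cofactor_def poly_prod x_def intro!: bexI[of _ j])
  have sum: "(\<Sum>h<r. c h * poly (rate_cofactor h) x) = c j * poly (rate_cofactor j) x" for c :: "nat \<Rightarrow> real"
  proof -
    have "(\<Sum>h<r. c h * poly (rate_cofactor h) x) = (\<Sum>h\<in>{j}. c h * poly (rate_cofactor h) x)"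
      by (rule sum.mono_neutral_right) (use j cof in auto)
    then show ?thesis by simp
  qed
  have D: "poly rate_prod x = 0" using rate_prod_factor[OF j(1)] by (simp add: x_def)
  have "poly log_num x = - d j * poly (rate_cofactor j) x"
    using sum[of d] by (simp add: log_num_def D poly_sum)
  moreover have "poly (pderiv rate_prod) x = poly (rate_cofactor j) x"
    using sum[of "\<lambda>_. 1"] by (simp add: pderiv_rate_prod poly_sum)
  ultimately have "poly (moment_num j (Suc n)) x
    = - (d j + real n + 1) * poly (rate_cofactor j) x * poly (moment_num j n) x"
    by (simp add: D algebra_simps)
  moreover have "d j + real n + 1 \<noteq> 0" using j(3) by linarith
  ultimately show ?case using Suc unfolding x_def[symmetric] by simp
qed

end

subsection \<open>Counting zeros\<close>

text \<open>The recursion is the quotient rule for numerators of successive derivatives of one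
  function over denominators that do not vanish at x; m vanishing derivatives then mean a zero of
  order m.\<close>

lemma power_dvd_of_recursion:
  fixes P :: "nat \<Rightarrow> real poly"
  assumes D: "poly D x \<noteq> 0" and rec: "\<And>k. P (Suc k) = D * pderiv (P k) + V k * P k"
    and zero: "\<And>k. k < m \<Longrightarrow> poly (P k) x = 0"
  shows "[:- x, 1:] ^ m dvd P 0"
  using rec zero
proof (induction m arbitrary: P V)
  case 0
  then show ?case by simp
next
  case (Suc m)
  have IH: "[:- x, 1:] ^ m dvd P (Suc 0)"
    by (rule Suc.IH[of "\<lambda>k. P (Suc k)" "\<lambda>k. V (Suc k)"]) (rule Suc.prems, use Suc.prems(2) in blast)
  show ?case
  proof (cases "P 0 = 0")
    case False
    define e where "e = order x (P 0)"
    have "poly (P 0) x = 0" using Suc.prems(2)[of 0] by simp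
    then have e: "e \<noteq> 0" using False by (simp add: e_def order_root)
    have nz: "pderiv (P 0) \<noteq> 0"
    proof
      assume "pderiv (P 0) = 0"
      then obtain c where "P 0 = [:c:]" using pderiv_iszero by blast
      then show False using \<open>poly (P 0) x = 0\<close> False by simp
    qed
    have oe: "order x (P 0) = Suc (order x (pderiv (P 0)))"
      by (rule order_pderiv) fact+
    \<comment> \<open>Otherwise the power e divides \<open>P 0\<close> and \<open>P (Suc 0)\<close>,
      hence also \<open>D * pderiv (P 0)\<close>, whose order at x is only e - 1.\<close>
    have "m < e"
    proof (rule ccontr)
      assume "\<not> m < e"
      then have "[:- x, 1:] ^ e dvd P (Suc 0)" using IH by (meson dvd_trans le_imp_power_dvd not_less)
      moreover have "[:- x, 1:] ^ e dvd V 0 * P 0" by (simp add: e_def order_1)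
      ultimately have "[:- x, 1:] ^ e dvd D * pderiv (P 0)"
        using Suc.prems(1)[of 0] by (metis dvd_add_left_iff)
      moreover have D0: "D * pderiv (P 0) \<noteq> 0" using D nz by auto
      ultimately have "e \<le> order x (D * pderiv (P 0))" by (simp add: order_divides)
      also have "\<dots> = order x (pderiv (P 0))"
        using order_mult[OF D0] D by (simp add: order_0I)
      finally show False using oe by (simp add: e_def)
    qed
    then show ?thesis unfolding e_def by (meson Suc_leI dvd_trans le_imp_power_dvd order_1)
  qed simp
qed

lemma poly_eq_0_of_power_dvd:
  fixes P :: "real poly" and p :: nat
  assumes inj: "inj_on \<xi> {..<p}" and dvd: "\<And>i. i < p \<Longrightarrow> [:- \<xi> i, 1:] ^ m i dvd P"
    and deg: "degree P < (\<Sum>i<p. m i)"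
  shows "P = 0"
proof (rule ccontr)
  assume nz: "P \<noteq> 0"
  have "(\<Sum>i<p. m i) \<le> (\<Sum>i<p. order (\<xi> i) P)"
    using dvd nz by (intro sum_mono) (simp add: order_divides)
  also have "\<dots> = (\<Sum>x\<in>\<xi> ` {..<p}. order x P)"
    using inj by (simp add: sum.reindex)
  also have "\<dots> = (\<Sum>x\<in>\<xi> ` {..<p} \<inter> {x. poly P x = 0}. order x P)"
    by (intro sum.mono_neutral_right finite_imageI) (auto simp: order_0I)
  also have "\<dots> \<le> (\<Sum>x | poly P x = 0. order x P)"
    using nz by (intro sum_mono2) (auto simp: poly_roots_finite)
  also have "\<dots> \<le> degree P" using nz by (rule sum_order_le_degree)
  finally show False using deg by simp
qed


subsection \<open>Derivatives of the Hermite moments\<close>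

text \<open>Differentiation under the integral, with the quadratic remainder of exp (h t) as the
  quantitative input.\<close>

lemma exp_moment_has_derivative:
  fixes U :: "real \<Rightarrow> real"
  assumes \<delta>: "\<delta> > 0" and U0: "\<And>t. 0 \<le> U t" and [measurable]: "U \<in> borel_measurable borel"
    and M: "\<And>s. s \<in> {\<xi> - \<delta>..\<xi> + \<delta>} \<Longrightarrow> has_bochner_integral lborel (\<lambda>t. exp (s * t) * U t) (M s)"
  shows "((\<lambda>s. exp_moment v M s) has_real_derivative exp_moment (Suc v) M \<xi>) (at \<xi>)"
proof -
  \<comment> \<open>One half of \<delta> pays for the power v + 2 of |t|, the other for exp |h
    t|.\<close>
  define \<eta> where "\<eta> = \<delta> / 2"
  have \<eta>: "\<eta> > 0" using \<delta> by (simp add: \<eta>_def)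
  have m: "has_bochner_integral lborel (\<lambda>t. t ^ n * (U t * exp (s * t))) (exp_moment n M s)"
    if "\<bar>s - \<xi>\<bar> \<le> \<eta>" for s n
  proof (rule has_bochner_integral_power_exp[OF \<eta> U0])
    fix s' assume "s' \<in> {s - \<eta>..s + \<eta>}"
    then have "s' \<in> {\<xi> - \<delta>..\<xi> + \<delta>}" using that unfolding \<eta>_def abs_le_iff by auto
    then show "has_bochner_integral lborel (\<lambda>t. exp (s' * t) * U t) (M s')" by (rule M)
  qed measurable
  define K where "K = fact (v + 2) / \<eta> ^ (v + 2)"
  have K: "\<bar>t\<bar> ^ (v + 2) \<le> K * exp (\<eta> * \<bar>t\<bar>)" for t
    using power_le_fact_exp[of "\<bar>t\<bar>" \<eta> "v + 2"] \<eta> by (simp add: K_def)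
  define C where "C = K * (M (\<xi> + \<delta>) + M (\<xi> - \<delta>))"
  have bnd: "\<bar>exp_moment v M (\<xi> + h) - exp_moment v M \<xi> - h * exp_moment (Suc v) M \<xi>\<bar> \<le> C * h\<^sup>2"
    if h: "\<bar>h\<bar> \<le> \<eta>" for h
  proof -
    let ?f = "\<lambda>t. t ^ v * (U t * exp ((\<xi> + h) * t)) - t ^ v * (U t * exp (\<xi> * t)) - h * (t ^ Suc v * (U t * exp (\<xi> * t)))"
    let ?g = "\<lambda>t. h\<^sup>2 * K * (exp ((\<xi> + \<delta>) * t) * U t + exp ((\<xi> - \<delta>) * t) * U t)"
    have f: "has_bochner_integral lborel ?f (exp_moment v M (\<xi> + h) - exp_moment v M \<xi> - h * exp_moment (Suc v) M \<xi>)"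
      by (intro has_bochner_integral_diff has_bochner_integral_mult_right m) (use h \<eta> in auto)
    have g: "has_bochner_integral lborel ?g (h\<^sup>2 * K * (M (\<xi> + \<delta>) + M (\<xi> - \<delta>)))"
      by (intro has_bochner_integral_add has_bochner_integral_mult_right M) (use \<delta> in auto)
    have le: "\<bar>?f t\<bar> \<le> ?g t" for t
    proof -
      have "?f t = U t * exp (\<xi> * t) * (t ^ v * (exp (h * t) - 1 - h * t))"
        by (simp add: algebra_simps exp_add)
      then have "\<bar>?f t\<bar> = U t * exp (\<xi> * t) * (\<bar>t\<bar> ^ v * \<bar>exp (h * t) - 1 - h * t\<bar>)"
        using U0[of t] by (simp add: abs_mult power_abs)
      also have "\<dots> \<le> U t * exp (\<xi> * t) * (\<bar>t\<bar> ^ v * ((h * t)\<^sup>2 * exp \<bar>h * t\<bar>))"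
        by (intro mult_left_mono abs_exp_minus_linear_le) (use U0 in auto)
      also have "\<dots> = U t * exp (\<xi> * t) * (h\<^sup>2 * (\<bar>t\<bar> ^ (v + 2) * exp (\<bar>h\<bar> * \<bar>t\<bar>)))"
        by (simp add: power_add power_mult_distrib abs_mult power2_eq_square mult_ac)
      also have "\<dots> \<le> U t * exp (\<xi> * t) * (h\<^sup>2 * ((K * exp (\<eta> * \<bar>t\<bar>)) * exp (\<eta> * \<bar>t\<bar>)))"
        by (intro mult_left_mono mult_mono K) (use U0 h in \<open>auto intro!: mult_right_mono simp: K_def \<eta> less_imp_le\<close>)
      also have "\<dots> = U t * (h\<^sup>2 * (K * exp (\<xi> * t + \<delta> * \<bar>t\<bar>)))"
        by (simp add: \<eta>_def exp_add[symmetric] mult_ac)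
      also have "\<dots> \<le> U t * (h\<^sup>2 * (K * (exp ((\<xi> + \<delta>) * t) + exp ((\<xi> - \<delta>) * t))))"
        by (intro mult_left_mono) (use U0 \<eta> in \<open>auto simp: K_def abs_if algebra_simps\<close>)
      finally show ?thesis by (simp add: algebra_simps)
    qed
    have "\<bar>LINT t|lborel. ?f t\<bar> \<le> (LINT t|lborel. ?g t)"
      unfolding real_norm_def[symmetric]
      by (rule Bochner_Integration.integral_norm_bound_integral) (use f g le in \<open>auto simp only: has_bochner_integral_iff real_norm_def\<close>)
    also have "\<dots> = C * h\<^sup>2"
      using has_bochner_integral_integral_eq[OF g] by (simp add: C_def)
    finally show ?thesis
      using has_bochner_integral_integral_eq[OF f] by simp
  qed
  show ?thesis
    unfolding DERIV_def
  proof (rule LIM_zero_cancel, rule Lim_null_comparison)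
    show "((\<lambda>h. C * \<bar>h\<bar>) \<longlongrightarrow> 0) (at 0)"
      by (auto intro!: tendsto_eq_intros)
    have "\<forall>\<^sub>F h in at 0. \<bar>h\<bar> < \<eta> \<and> h \<noteq> 0"
      using \<eta> unfolding eventually_at by (intro exI[of _ \<eta>]) auto
    then show "\<forall>\<^sub>F h in at 0. norm ((exp_moment v M (\<xi> + h) - exp_moment v M \<xi>) / h - exp_moment (Suc v) M \<xi>) \<le> C * \<bar>h\<bar>"
    proof eventually_elim
      case (elim h)
      have "norm ((exp_moment v M (\<xi> + h) - exp_moment v M \<xi>) / h - exp_moment (Suc v) M \<xi>)
        = \<bar>exp_moment v M (\<xi> + h) - exp_moment v M \<xi> - h * exp_moment (Suc v) M \<xi>\<bar> / \<bar>h\<bar>"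
        using elim by (simp add: abs_divide[symmetric] field_simps del: abs_divide)
      also have "\<dots> \<le> C * h\<^sup>2 / \<bar>h\<bar>"
        using bnd[of h] elim by (intro divide_right_mono) auto
      also have "\<dots> = C * \<bar>h\<bar>"
        using elim by (simp add: power2_eq_square abs_if)
      finally show ?case .
    qed
  qed
qed

text \<open>The quotient rule for \<Phi> Q / (D^n X) with \<Phi>' = \<Phi> W / D and X' / X = E / D;
  the left side has the shape that the derivative rules produce. It is the reason for the recursion
  of \<open>moment_num\<close>.\<close>

lemma moment_quotient_identity:
  fixes D X :: real
  assumes "D > 0" "X > 0" "E * X = X' * D"
  shows "((\<Phi> * W / D * Q + Q' * \<Phi>) * (D ^ n * X) - \<Phi> * Q * (real n * (D' * D ^ (n - Suc 0)) * X + X' * D ^ n))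
      / ((D ^ n * X) * (D ^ n * X)) = \<Phi> * ((W - real n * D' - E) * Q + D * Q') / (D ^ Suc n * X)"
proof -
  define Y where "Y = D ^ n"
  have Y: "Y > 0" using assms by (simp add: Y_def)
  have "real n * D ^ (n - Suc 0) = real n * Y / D"
    using assms by (cases n) (auto simp: Y_def)
  then have 1: "real n * (D' * D ^ (n - Suc 0)) = D' * (real n * Y / D)" by (simp add: mult_ac)
  have 2: "E = X' * D / X" using assms by (simp add: field_simps)
  show ?thesis
    unfolding power_Suc 1 2 Y_def[symmetric]
    using assms(1,2) Y by (simp add: divide_simps) (simp add: algebra_simps)
qed

context
  fixes r :: nat and \<rho> d :: "nat \<Rightarrow> real" and ah :: real
  assumes d: "\<And>h. h < r \<Longrightarrow> d h > 0" and \<rho>: "\<And>h. h < r \<Longrightarrow> \<rho> h > 0"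
begin

abbreviation (input) "hmom j v \<equiv> exp_moment v (hermite_laplace r \<rho> d ah j)"

lemma hermite_moment_has_derivative:
  assumes "\<And>h. h < r \<Longrightarrow> \<rho> h + s > 0"
  shows "(hmom j v has_real_derivative hmom j (Suc v) s) (at s)"
proof -
  obtain \<delta> where \<delta>: "\<delta> > 0" "\<And>h s'. h < r \<Longrightarrow> s' \<in> {s - \<delta>..s + \<delta>} \<Longrightarrow> \<rho> h + s' > 0"
    using obtain_interval[of r s \<rho>] assms by (metis add.commute)
  show ?thesis
    by (rule exp_moment_has_derivative[OF \<delta>(1), where U = "hermite_row r \<rho> d ah j"])
       (use d \<rho> \<delta> hermite_row_nonneg hermite_row_measurable in \<open>auto intro!: has_bochner_integral_hermite_row\<close>)
qed

lemma hermite_moment_0: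
  assumes "\<And>h. h < r \<Longrightarrow> \<rho> h + s > 0"
  shows "hmom j 0 s = hermite_laplace r \<rho> d ah j s"
proof -
  have "has_bochner_integral lborel (\<lambda>t. t ^ 0 * (hermite_row r \<rho> d ah j t * hermite_col (\<lambda>_. s) 0 t)) (hmom j 0 s)"
    by (rule has_bochner_integral_hermite_moment[where \<xi> = "\<lambda>_. s"]) (use d \<rho> assms in \<open>auto simp: add.commute\<close>)
  moreover have "has_bochner_integral lborel (\<lambda>t. exp (s * t) * hermite_row r \<rho> d ah j t) (hermite_laplace r \<rho> d ah j s)"
    by (rule has_bochner_integral_hermite_row) (use d \<rho> assms in auto)
  ultimately show ?thesis
    by (simp add: hermite_col_def has_bochner_integral_iff mult.commute)
qed

text \<open>The transform of the last row.\<close>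

definition hermite_phi :: "real \<Rightarrow> real" where
  "hermite_phi s = (\<Prod>h<r. (\<rho> h / (\<rho> h + s)) powr d h) * exp (ah * s + s\<^sup>2 / 4)"

lemma hermite_phi_pos:
  assumes "\<And>h. h < r \<Longrightarrow> \<rho> h + s > 0"
  shows "hermite_phi s > 0"
proof -
  have "(\<rho> h / (\<rho> h + s)) powr d h > 0" if "h < r" for h
    using \<rho>[OF that] assms[OF that] by simp
  then show ?thesis
    unfolding hermite_phi_def by (intro mult_pos_pos prod_pos) auto
qed

lemma rate_prod_pos:
  assumes "\<And>h. h < r \<Longrightarrow> \<rho> h + s > 0"
  shows "poly (rate_prod r \<rho>) s > 0"
  unfolding rate_prod_def poly_prod by (intro prod_pos) (use assms in \<open>auto simp: add.commute\<close>)

lemma rate_prod_cofactor_quotient: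
  assumes "h < r" "\<rho> h + s > 0"
  shows "poly (rate_cofactor r \<rho> h) s = poly (rate_prod r \<rho>) s / (\<rho> h + s)"
  using rate_prod_factor[OF assms(1)] assms(2) by (simp add: field_simps)

lemma hermite_phi_has_derivative:
  assumes s: "\<And>h. h < r \<Longrightarrow> \<rho> h + s > 0"
  shows "(hermite_phi has_real_derivative hermite_phi s * poly (log_num r \<rho> d ah) s / poly (rate_prod r \<rho>) s) (at s)"
proof -
  define L where "L = (\<lambda>s. (\<Sum>h<r. d h * (ln (\<rho> h) - ln (\<rho> h + s))) + (ah * s + s\<^sup>2 / 4))"
  define S where "S = (\<Sum>h<r. d h * (- 1 / (\<rho> h + s))) + (ah + s / 2)"
  have "(L has_real_derivative S) (at s)"
    unfolding L_def S_def
    by (auto intro!: derivative_eq_intros DERIV_sum simp: s)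
  then have "((\<lambda>s. exp (L s)) has_real_derivative exp (L s) * S) (at s)"
    by (auto intro!: derivative_eq_intros)
  moreover have eq: "hermite_phi x = exp (L x)" if "\<And>h. h < r \<Longrightarrow> \<rho> h + x > 0" for x
  proof -
    have "(\<Prod>h<r. (\<rho> h / (\<rho> h + x)) powr d h) = (\<Prod>h<r. exp (d h * (ln (\<rho> h) - ln (\<rho> h + x))))"
    proof (rule prod.cong)
      fix h assume "h \<in> {..<r}"
      then have "\<rho> h > 0" "\<rho> h + x > 0" using \<rho> that by auto
      then show "(\<rho> h / (\<rho> h + x)) powr d h = exp (d h * (ln (\<rho> h) - ln (\<rho> h + x)))"
        by (simp add: powr_def ln_div)
    qed simp
    then show ?thesis by (simp add: hermite_phi_def L_def exp_add exp_sum)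
  qed
  moreover have "\<forall>\<^sub>F x in nhds s. hermite_phi x = exp (L x)"
  proof -
    obtain \<delta> where \<delta>: "\<delta> > 0" "\<And>h s'. h < r \<Longrightarrow> s' \<in> {s - \<delta>..s + \<delta>} \<Longrightarrow> \<rho> h + s' > 0"
      using obtain_interval[of r s \<rho>] s by (metis add.commute)
    show ?thesis
      unfolding eventually_nhds_metric
    proof (intro exI[of _ \<delta>] conjI allI impI)
      fix x assume "dist x s < \<delta>"
      then show "hermite_phi x = exp (L x)" by (intro eq \<delta>(2)) (auto simp: dist_real_def abs_if split: if_splits)
    qed (rule \<delta>(1))
  qed
  moreover have "S = poly (log_num r \<rho> d ah) s / poly (rate_prod r \<rho>) s"
  proof -
    have "(\<Sum>h<r. d h * poly (rate_cofactor r \<rho> h) s) = (\<Sum>h<r. poly (rate_prod r \<rho>) s * (d h * (1 / (\<rho> h + s))))"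
      by (rule sum.cong) (auto simp: rate_prod_cofactor_quotient s)
    then have "poly (log_num r \<rho> d ah) s = poly (rate_prod r \<rho>) s * S"
      by (simp add: log_num_def S_def poly_sum sum_distrib_left[symmetric] sum_negf right_diff_distrib distrib_left)
         (simp add: sum_distrib_left mult_ac)
    then show ?thesis using rate_prod_pos[OF s] by simp
  qed
  ultimately show ?thesis
    by (subst DERIV_cong_ev[OF refl _ refl]) (auto simp: eq s)
qed

text \<open>The formula holds in a neighbourhood of s, so differentiating its right side must give
  the next moment.\<close>

lemma hermite_moment_eq:
  assumes "\<And>h. h < r \<Longrightarrow> \<rho> h + s > 0"
  shows "hmom j n s = hermite_phi s * poly (moment_num r \<rho> d ah j n) s /
    (poly (rate_prod r \<rho>) s ^ n * (if j < r then \<rho> j + s else 1))"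
  using assms
proof (induction n arbitrary: s)
  case 0
  show ?case
    using hermite_moment_0[OF 0, of j] unfolding hermite_laplace_def[of r \<rho> d ah j s] by (simp add: hermite_phi_def)
next
  case (Suc n)
  let ?\<Phi> = hermite_phi and ?D = "poly (rate_prod r \<rho>)" and ?Q = "poly (moment_num r \<rho> d ah j n)"
    and ?X = "\<lambda>s. if j < r then \<rho> j + s else 1" and ?W = "poly (log_num r \<rho> d ah)"
    and ?E = "poly (rate_cofactor r \<rho> j)"
  have D: "?D s > 0" by (rule rate_prod_pos) (rule Suc.prems)
  have X: "?X s > 0" using Suc.prems by auto
  define X' where "X' = (if j < r then 1 else 0 :: real)"
  have E: "?E s * ?X s = X' * ?D s"
    using Suc.prems[of j] rate_prod_cofactor_quotient[of j s]
    by (cases "j < r") (simp_all add: X'_def rate_cofactor_def[of r \<rho> j])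
  have DX: "(?X has_real_derivative X') (at s)"
    by (cases "j < r") (auto simp: X'_def intro!: derivative_eq_intros)
  have "((\<lambda>s. ?\<Phi> s * ?Q s / (?D s ^ n * ?X s)) has_real_derivative
      ((?\<Phi> s * ?W s / ?D s * ?Q s + poly (pderiv (moment_num r \<rho> d ah j n)) s * ?\<Phi> s) * (?D s ^ n * ?X s) -
        ?\<Phi> s * ?Q s * (real n * (poly (pderiv (rate_prod r \<rho>)) s * ?D s ^ (n - Suc 0)) * ?X s + X' * ?D s ^ n))
      / ((?D s ^ n * ?X s) * (?D s ^ n * ?X s))) (at s)"
    by (intro DERIV_divide DERIV_mult' DERIV_mult DERIV_power poly_DERIV DX hermite_phi_has_derivative Suc.prems)
      (use D X in \<open>auto\<close>)
  moreover have "(hmom j n has_real_derivative hmom j (Suc n) s) (at s)"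
    by (rule hermite_moment_has_derivative) (rule Suc.prems)
  moreover have "\<forall>\<^sub>F x in nhds s. hmom j n x = ?\<Phi> x * ?Q x / (?D x ^ n * ?X x)"
  proof -
    obtain \<delta> where \<delta>: "\<delta> > 0" "\<And>h s'. h < r \<Longrightarrow> s' \<in> {s - \<delta>..s + \<delta>} \<Longrightarrow> \<rho> h + s' > 0"
      using obtain_interval[of r s \<rho>] Suc.prems by (metis add.commute)
    show ?thesis
      unfolding eventually_nhds_metric
    proof (intro exI[of _ \<delta>] conjI allI impI)
      fix x assume "dist x s < \<delta>"
      then show "hmom j n x = ?\<Phi> x * ?Q x / (?D x ^ n * ?X x)"
        by (intro Suc.IH \<delta>(2)) (auto simp: dist_real_def abs_if split: if_splits)
    qed (rule \<delta>(1))
  qed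
  ultimately have "hmom j (Suc n) s = 
      ((?\<Phi> s * ?W s / ?D s * ?Q s + poly (pderiv (moment_num r \<rho> d ah j n)) s * ?\<Phi> s) * (?D s ^ n * ?X s) -
        ?\<Phi> s * ?Q s * (real n * (poly (pderiv (rate_prod r \<rho>)) s * ?D s ^ (n - Suc 0)) * ?X s + X' * ?D s ^ n))
      / ((?D s ^ n * ?X s) * (?D s ^ n * ?X s))"
    using DERIV_unique DERIV_cong_ev[OF refl _ refl, of "hmom j n" _ s "hmom j (Suc n) s"] by meson
  also have "\<dots> = ?\<Phi> s * poly (moment_num r \<rho> d ah j (Suc n)) s / (?D s ^ Suc n * ?X s)"
    unfolding moment_num.simps poly_add poly_mult poly_diff poly_smult
    by (rule moment_quotient_identity[OF D X E])
  finally show ?case .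
qed

end


subsection \<open>Trivial kernel of the Hermite problem\<close>

text \<open>A vanishing top coefficient lowers the index by one without changing the equations; this
  is how coefficients are peeled off.\<close>

lemma poly_sol_decrement:
  assumes Q: "poly_sol P m R l M Q" and 0: "coeff (Q i) (m i - 1) = 0" and pos: "m i \<noteq> 0"
  shows "poly_sol P (m(i := m i - 1)) R l M Q"
proof -
  define m' where "m' = m(i := m i - 1)"
  have deg: "deg_vec P m Q" using Q by (simp add: poly_sol_def)
  have split: "(\<Sum>n<m i'. coeff (Q i') n * g n) = (\<Sum>n<m' i'. coeff (Q i') n * g n)" for i' g
  proof (cases "i' = i")
    case True
    then have "{..<m i'} = insert (m i - 1) {..<m' i'}" using pos by (auto simp: m'_def)
    then show ?thesis using True 0 by (simp add: m'_def)
  qed (simp add: m'_def)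
  have "deg_vec P m' Q"
    unfolding deg_vec_iff
  proof (intro allI impI)
    fix i' n assume "(i', n) \<notin> cells P m'"
    then have "i' = i \<and> n = m i - 1" if "(i', n) \<in> cells P m"
      using that by (auto simp: cells_def m'_def split: if_splits)
    then show "coeff (Q i') n = 0" using deg 0 by (cases "(i', n) \<in> cells P m") (auto simp: deg_vec_iff)
  qed
  then show ?thesis
    using Q unfolding poly_sol_def split m'_def[symmetric] by blast
qed

lemma sum_decrement:
  fixes m :: "nat \<Rightarrow> nat"
  assumes "i < P" "m i \<noteq> 0"
  shows "(\<Sum>k<P. (m(i := m i - 1)) k) + 1 = (\<Sum>k<P. m k)"
proof -
  have "(\<Sum>k\<in>{..<P} - {i}. (m(i := m i - 1)) k) = (\<Sum>k\<in>{..<P} - {i}. m k)"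
    by (intro sum.cong) auto
  then show ?thesis
    using assms by (simp add: sum.remove[of "{..<P}" i])
qed

text \<open>Lowering a largest entry keeps all entries within one of each other; lowering another
  entry might not.\<close>

lemma near_decrement:
  fixes l :: "nat \<Rightarrow> nat"
  assumes near: "\<And>i i'. i \<le> r \<Longrightarrow> i' \<le> r \<Longrightarrow> l i \<le> l i' + 1"
    and max: "\<And>h. h \<le> r \<Longrightarrow> l h \<le> l j" and j: "j \<le> r" and "i \<le> r" "i' \<le> r"
  shows "(l(j := l j - 1)) i \<le> (l(j := l j - 1)) i' + 1"
  using near[of i i'] near[of j i'] near[of i j] max[of i] assms(3-) by auto

lemma obtain_max:
  fixes l :: "nat \<Rightarrow> nat"
  assumes nz: "(\<Sum>j<Suc r. l j) \<noteq> 0"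
  obtains j where "j \<le> r" "l j \<noteq> 0" "\<And>h. h \<le> r \<Longrightarrow> l h \<le> l j"
proof -
  have "Max (l ` {..r}) \<in> l ` {..r}" by (rule Max_in) auto
  then obtain j where j: "j \<in> {..r}" "Max (l ` {..r}) = l j" by (rule imageE)
  have max: "l h \<le> l j" if "h \<le> r" for h using that j(2)[symmetric] by simp
  have "l j \<noteq> 0"
  proof
    assume "l j = 0"
    then have "\<forall>h\<in>{..<Suc r}. l h = 0" using max by (auto simp: less_Suc_eq_le)
    then show False using nz by simp
  qed
  then show ?thesis using j(1) max that by auto
qed

section \<open>The numerator of the transform of a kernel element\<close>

context
  fixes r :: nat and \<rho> d :: "nat \<Rightarrow> real" and ah :: real
  assumes d: "\<And>h. h < r \<Longrightarrow> d h > 0" and \<rho>: "\<And>h. h < r \<Longrightarrow> \<rho> h > 0"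
begin

context
  fixes l :: "nat \<Rightarrow> nat"
  assumes near: "\<And>j j'. j \<le> r \<Longrightarrow> j' \<le> r \<Longrightarrow> l j \<le> l j' + 1"
begin

text \<open>
  The common denominator \<open>\<Prod>h<r. (s + \<rho> h) ^ l h\<close> divided by that of row \<open>j\<close> and degree \<open>n\<close>;
  no truncation occurs in the exponents for \<open>n < l j\<close>, because the entries of \<open>l\<close> differ by at most one.
\<close>

definition cofactor :: "nat \<Rightarrow> nat \<Rightarrow> real poly" where
  "cofactor j n = (\<Prod>h<r. [:\<rho> h, 1:] ^ (l h - (n + (if h = j then 1 else 0))))"

text \<open>With \<open>b j n\<close> the coefficients of a vector \<open>B\<close>, this is the
  k-th derivative of the transform of \<open>\<Sum>j\<le>r. B j * U j\<close>, multiplied by the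
  k-th power of \<open>rate_prod\<close> and by the product of all (s + \<rho> h)^(l h), and divided
  by \<open>hermite_phi\<close>.\<close>

definition kernel_num :: "(nat \<Rightarrow> nat \<Rightarrow> real) \<Rightarrow> nat \<Rightarrow> real poly" where
  "kernel_num b k = (\<Sum>j<Suc r. \<Sum>n<l j. Polynomial.smult (b j n) (moment_num r \<rho> d ah j (n + k) * cofactor j n))"

lemma exponent_le: "j < Suc r \<Longrightarrow> n < l j \<Longrightarrow> h < r \<Longrightarrow> n + (if h = j then 1 else 0) \<le> l h"
  using near[of j h] by auto

lemma smult_sum_right: "Polynomial.smult c (\<Sum>i\<in>A. f i) = (\<Sum>i\<in>A. Polynomial.smult c (f i))"
  by (induction A rule: infinite_finite_induct) (simp_all add: smult_add_right)

lemma pderiv_sum: "pderiv (\<Sum>i\<in>A. f i) = (\<Sum>i\<in>A. pderiv (f i))"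
  using higher_pderiv_sum[of 1 f A] by simp

lemma pderiv_prod_powers:
  "rate_prod r \<rho> * pderiv (\<Prod>h<r. [:\<rho> h, 1:] ^ e h)
    = (\<Prod>h<r. [:\<rho> h, 1:] ^ e h) * (\<Sum>h<r. Polynomial.smult (real (e h)) (rate_cofactor r \<rho> h))"
proof -
  have "rate_prod r \<rho> * ((\<Prod>g\<in>{..<r} - {h}. [:\<rho> g, 1:] ^ e g) * pderiv ([:\<rho> h, 1:] ^ e h))
      = (\<Prod>h<r. [:\<rho> h, 1:] ^ e h) * Polynomial.smult (real (e h)) (rate_cofactor r \<rho> h)" if "h < r" for h
  proof -
    have 1: "[:\<rho> h, 1:] * pderiv ([:\<rho> h, 1:] ^ e h) = Polynomial.smult (real (e h)) ([:\<rho> h, 1:] ^ e h)"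
    proof (cases "e h")
      case (Suc n)
      show ?thesis
        unfolding Suc pderiv_power_Suc pderiv_linear_factor by (simp only: mult_smult_right mult_1_right power_Suc)
    qed simp
    have "rate_prod r \<rho> * ((\<Prod>g\<in>{..<r} - {h}. [:\<rho> g, 1:] ^ e g) * pderiv ([:\<rho> h, 1:] ^ e h))
      = rate_cofactor r \<rho> h * (\<Prod>g\<in>{..<r} - {h}. [:\<rho> g, 1:] ^ e g) * ([:\<rho> h, 1:] * pderiv ([:\<rho> h, 1:] ^ e h))"
      unfolding rate_prod_factor[OF that] by (simp only: mult_ac)
    also have "\<dots> = Polynomial.smult (real (e h)) (rate_cofactor r \<rho> h) * ([:\<rho> h, 1:] ^ e h * (\<Prod>g\<in>{..<r} - {h}. [:\<rho> g, 1:] ^ e g))"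
      unfolding 1 by (simp only: mult_smult_left mult_smult_right mult_ac)
    also have "[:\<rho> h, 1:] ^ e h * (\<Prod>g\<in>{..<r} - {h}. [:\<rho> g, 1:] ^ e g) = (\<Prod>h<r. [:\<rho> h, 1:] ^ e h)"
      using that by (subst (2) prod.remove[of _ h]) auto
    finally show ?thesis by (simp only: mult_ac)
  qed
  then show ?thesis
    unfolding pderiv_prod sum_distrib_left by (intro sum.cong) auto
qed

text \<open>The multiplier of the undifferentiated term is the same for all (j, n): the logarithmic
  derivative of \<open>cofactor j n\<close> cancels what depends on j and n in the recursion of
  \<open>moment_num\<close>. Hence the whole sum obeys one recursion.\<close>

lemma kernel_num_Suc:
  "kernel_num b (Suc k) = rate_prod r \<rho> * pderiv (kernel_num b k) +
    (log_num r \<rho> d ah - Polynomial.smult (real k) (pderiv (rate_prod r \<rho>))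
      - (\<Sum>h<r. Polynomial.smult (real (l h)) (rate_cofactor r \<rho> h))) * kernel_num b k"
proof -
  let ?D = "rate_prod r \<rho>" and ?Q = "moment_num r \<rho> d ah" and ?E = "rate_cofactor r \<rho>"
  define T where "T = (\<Sum>h<r. Polynomial.smult (real (l h)) (?E h))"
  define V where "V = log_num r \<rho> d ah - Polynomial.smult (real k) (pderiv ?D) - T"
  have "Polynomial.smult (b j n) (?Q j (n + Suc k) * cofactor j n) =
      ?D * pderiv (Polynomial.smult (b j n) (?Q j (n + k) * cofactor j n)) + V * Polynomial.smult (b j n) (?Q j (n + k) * cofactor j n)"
    if jn: "j < Suc r" "n < l j" for j n
  proof -
    have "(\<Sum>h<r. Polynomial.smult (real (l h - (n + (if h = j then 1 else 0)))) (?E h))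
      = (\<Sum>h<r. Polynomial.smult (real (l h)) (?E h) - Polynomial.smult (real n) (?E h) - (if h = j then ?E h else 0))"
      by (intro sum.cong) (auto simp: of_nat_diff exponent_le[OF jn] smult_diff_left smult_add_left)
    also have "\<dots> = T - Polynomial.smult (real n) (pderiv ?D) - (if j < r then ?E j else 0)"
      by (simp add: T_def sum_subtractf pderiv_rate_prod smult_sum_right)
    also have "(if j < r then ?E j else 0) = ?E j"
      by (simp add: rate_cofactor_def)
    finally have "?D * pderiv (cofactor j n) = cofactor j n * (T - Polynomial.smult (real n) (pderiv ?D) - ?E j)"
      unfolding cofactor_def pderiv_prod_powers by simp
    then have "?D * pderiv (?Q j (n + k) * cofactor j n) = 
      ?D * pderiv (?Q j (n + k)) * cofactor j n
        + ?Q j (n + k) * (cofactor j n * (T - Polynomial.smult (real n) (pderiv ?D) - ?E j))"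
      by (simp add: pderiv_mult distrib_left mult_ac) 
    then have "?Q j (n + Suc k) * cofactor j n = ?D * pderiv (?Q j (n + k) * cofactor j n) + V * (?Q j (n + k) * cofactor j n)"
      unfolding V_def by (simp add: algebra_simps smult_add_left)
    then show ?thesis
      by (simp add: pderiv_smult smult_add_right)
  qed
  then have "kernel_num b (Suc k) = (\<Sum>j<Suc r. \<Sum>n<l j.
      ?D * pderiv (Polynomial.smult (b j n) (?Q j (n + k) * cofactor j n)) + V * Polynomial.smult (b j n) (?Q j (n + k) * cofactor j n))"
    unfolding kernel_num_def by (intro sum.cong) (auto simp del: moment_num.simps)
  also have "\<dots> = ?D * pderiv (kernel_num b k) + V * kernel_num b k"
    unfolding kernel_num_def by (simp only: pderiv_sum sum_distrib_left sum.distrib)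
  finally show ?thesis by (simp only: V_def T_def)
qed

lemma poly_kernel_num_eq_0:
  assumes s: "\<And>h. h < r \<Longrightarrow> \<rho> h + s > 0"
    and 0: "(\<Sum>j<Suc r. \<Sum>n<l j. b j n * exp_moment (n + k) (hermite_laplace r \<rho> d ah j) s) = 0"
  shows "poly (kernel_num b k) s = 0"
proof -
  let ?D = "poly (rate_prod r \<rho>) s" and ?\<Phi> = "hermite_phi r \<rho> d ah s"
  define Den where "Den = (\<Prod>h<r. (\<rho> h + s) ^ l h)"
  have pos: "?D > 0" "?\<Phi> > 0"
    using rate_prod_pos[of r d \<rho> s] hermite_phi_pos[of r d \<rho> s ah] s \<rho> d by auto
  have "b j n * (poly (moment_num r \<rho> d ah j (n + k)) s * poly (cofactor j n) s)
      = ?D ^ k * Den / ?\<Phi> * (b j n * exp_moment (n + k) (hermite_laplace r \<rho> d ah j) s)"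
    if jn: "j < Suc r" "n < l j" for j n
  proof -
    define X where "X = (if j < r then \<rho> j + s else 1)"
    have X: "X > 0" using s by (auto simp: X_def)
    have "?D = (\<Prod>h<r. \<rho> h + s)" by (simp add: rate_prod_def poly_prod)
    moreover have "X = (\<Prod>h<r. (\<rho> h + s) ^ (if h = j then 1 else 0))"
      unfolding X_def by (simp add: if_distrib[of "power _"] prod.delta cong: if_cong)
    ultimately have "poly (cofactor j n) s * (?D ^ n * X)
      = (\<Prod>h<r. (\<rho> h + s) ^ (l h - (n + (if h = j then 1 else 0)) + (n + (if h = j then 1 else 0))))"
      by (simp only: cofactor_def poly_prod power_add prod.distrib prod_power_distrib) (simp add: poly_power add.commute)
    also have "\<dots> = Den"
      unfolding Den_def by (intro prod.cong) (auto simp: exponent_le[OF jn] simp del: add_diff_inverse_nat)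
    finally have C: "Den = poly (cofactor j n) s * (?D ^ n * X)" ..
    have M: "exp_moment (n + k) (hermite_laplace r \<rho> d ah j) s =
        ?\<Phi> * poly (moment_num r \<rho> d ah j (n + k)) s / (?D ^ (n + k) * X)"
      unfolding X_def by (rule hermite_moment_eq) (use d \<rho> s in auto)
    show ?thesis
      unfolding C M using pos X by (simp add: field_simps power_add)
  qed
  then have "poly (kernel_num b k) s = (\<Sum>j<Suc r. \<Sum>n<l j.
      ?D ^ k * Den / ?\<Phi> * (b j n * exp_moment (n + k) (hermite_laplace r \<rho> d ah j) s))"
    unfolding kernel_num_def poly_sum poly_smult poly_mult by (intro sum.cong) auto
  also have "\<dots> = 0" using 0 unfolding sum_distrib_left[symmetric] by simp
  finally show ?thesis .
qed

text \<open>The numerator contributes n (r + 1), while the cofactor misses n from each of the r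
  exponents and one more for h = j; the net gain over the sum of the \<open>l h\<close> is n, or n -
  1 if j < r.\<close>

lemma poly_top_kernel_term:
  assumes jn: "j < Suc r" "n < l j"
  shows "poly_top ((\<Sum>h<r. l h) + n - (if j < r then 1 else 0)) ((1 / 2) ^ n * (if j < r then \<rho> j else 1))
    (moment_num r \<rho> d ah j n * cofactor j n)"
proof -
  let ?e = "\<lambda>h. l h - (n + (if h = j then 1 else 0))"
  have lin: "poly_top (?e h * 1) (1 ^ ?e h) ([:\<rho> h, 1:] ^ ?e h)" for h
    by (rule poly_top_power[OF poly_top_linear])
  have "poly_top (\<Sum>h<r. ?e h * 1) (\<Prod>h<r. 1 ^ ?e h) (cofactor j n)"
    unfolding cofactor_def by (rule poly_top_prod) (use lin in auto)
  then have "poly_top (n * Suc r + (\<Sum>h<r. ?e h)) ((1 / 2) ^ n * (if j < r then \<rho> j else 1))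
    (moment_num r \<rho> d ah j n * cofactor j n)"
    using poly_top_mult[OF poly_top_moment_num, of "\<Sum>h<r. ?e h" 1 "cofactor j n"] by fastforce
  moreover have "(\<Sum>h<r. l h) = (\<Sum>h<r. ?e h) + r * n + (if j < r then 1 else 0)"
  proof -
    have "(\<Sum>h<r. l h) = (\<Sum>h<r. ?e h + (n + (if h = j then 1 else 0)))"
      by (intro sum.cong) (auto simp: exponent_le[OF jn] simp del: add_diff_inverse_nat)
    then show ?thesis by (simp add: sum.distrib)
  qed
  then have "n * Suc r + (\<Sum>h<r. ?e h) = (\<Sum>h<r. l h) + n - (if j < r then 1 else 0)"
    by (simp add: algebra_simps)
  ultimately show ?thesis by simp
qed

lemma kernel_num_0: "kernel_num b 0 = (\<Sum>j<Suc r. \<Sum>n<l j. Polynomial.smult (b j n) (moment_num r \<rho> d ah j n * cofactor j n))"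
  by (simp add: kernel_num_def)

text \<open>For j < r the net gain n - 1 is below \<open>l r\<close> because \<open>l j\<close>
  exceeds \<open>l r\<close> by at most one.\<close>

lemma degree_kernel_num:
  assumes nz: "(\<Sum>h<r. l h) + l r \<noteq> 0"
  shows "degree (kernel_num b 0) < (\<Sum>h<r. l h) + l r"
proof -
  have pos: "0 < (\<Sum>h<r. l h) + l r" using nz by (simp only: neq0_conv)
  show ?thesis
    unfolding kernel_num_0
  proof (intro degree_sum_less)
    fix j n assume jn: "j \<in> {..<Suc r}" "n \<in> {..<l j}"
    have "degree (moment_num r \<rho> d ah j n * cofactor j n) \<le> (\<Sum>h<r. l h) + n - (if j < r then 1 else 0)"
      using poly_top_kernel_term[of j n] jn by (auto simp: poly_top_def)
    also have "\<dots> < (\<Sum>h<r. l h) + l r"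
    proof (cases "j < r")
      case True
      have "l j \<le> (\<Sum>h<r. l h)" using True by (intro member_le_sum) auto
      then show ?thesis using jn near[of j r] True by simp
    next
      case False
      then show ?thesis using jn by (simp add: less_Suc_eq)
    qed
    finally show "degree (Polynomial.smult (b j n) (moment_num r \<rho> d ah j n * cofactor j n)) < (\<Sum>h<r. l h) + l r"
      by (rule le_less_trans[OF degree_smult_le])
  qed (rule pos)+
qed

text \<open>If \<open>l r\<close> is largest, the formal degree \<open>N\<close> is attained only by
  the term j = r, n = l r - 1, whose top coefficient is a power of 1 / 2. The top coefficient of the
  zero polynomial isolates it.\<close>

lemma kernel_num_at_infinity:
  assumes max: "\<And>h. h \<le> r \<Longrightarrow> l h \<le> l r" and nz: "l r \<noteq> 0" and 0: "kernel_num b 0 = 0"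
  shows "b r (l r - 1) = 0"
proof -
  define N where "N = (\<Sum>h<r. l h) + (l r - 1)"
  have "poly_top N (if j = r \<and> n = l r - 1 then (1 / 2) ^ n else 0) (moment_num r \<rho> d ah j n * cofactor j n)"
    if jn: "j < Suc r" "n < l j" for j n
  proof (cases "j = r \<and> n = l r - 1")
    case True
    then show ?thesis using poly_top_kernel_term[OF jn] by (auto simp: N_def)
  next
    case False
    have "(\<Sum>h<r. l h) + n - (if j < r then 1 else 0) < N"
    proof (cases "j < r")
      case True
      have "l j \<le> (\<Sum>h<r. l h)" using True by (intro member_le_sum) auto
      then show ?thesis using jn max[of j] True nz by (simp add: N_def)
    next
      case f: False
      then have "j = r" using jn by simp
      then show ?thesis using jn False nz by (simp add: N_def)
    qed
    then have "poly_top N 0 (moment_num r \<rho> d ah j n * cofactor j n)"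
      by (rule poly_top_less[OF poly_top_kernel_term[OF jn]])
    then show ?thesis unfolding if_not_P[OF False] .
  qed
  then have "poly_top N (\<Sum>j<Suc r. \<Sum>n<l j. b j n * (if j = r \<and> n = l r - 1 then (1 / 2) ^ n else 0)) (kernel_num b 0)"
    unfolding kernel_num_0 by (intro poly_top_sum poly_top_smult) auto
  then have "(\<Sum>j<Suc r. \<Sum>n<l j. b j n * (if j = r \<and> n = l r - 1 then (1 / 2) ^ n else 0)) = 0"
    by (simp add: poly_top_def 0)
  moreover have "(\<Sum>n<l j. b j n * (if j = r \<and> n = l r - 1 then (1 / 2) ^ n else 0))
      = (if j = r then b r (l r - 1) * (1 / 2) ^ (l r - 1) else 0)" for j
    using nz by (simp add: if_distrib[of "(*) _"] cong: if_cong)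
  ultimately have "(\<Sum>j<Suc r. if j = r then b r (l r - 1) * (1 / 2) ^ (l r - 1) else 0) = 0"
    by (simp only:)
  then show ?thesis by simp
qed

text \<open>If \<open>l j\<close> is largest for some j < r, every cofactor except the one at (j, l
  j - 1) keeps a factor s + \<rho> j. Evaluation at - \<rho> j isolates that term; the distinct
  rates make its remaining factors nonzero.\<close>

lemma kernel_num_at_rate:
  assumes max: "\<And>h. h \<le> r \<Longrightarrow> l h \<le> l j" and j: "j < r" "l j \<noteq> 0"
    and inj: "inj_on \<rho> {h. h < r \<and> l h > 0}" and 0: "kernel_num b 0 = 0"
  shows "b j (l j - 1) = 0"
proof -
  define x where "x = - \<rho> j"
  have ne: "\<rho> h + x \<noteq> 0" if "h < r" "l h > 0" "h \<noteq> j" for h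
    using inj_onD[OF inj, of h j] that j by (auto simp: x_def)
  have zero: "poly (cofactor i n) x = 0" if "i < Suc r" "n < l i" "i \<noteq> j \<or> n \<noteq> l j - 1" for i n
  proof -
    \<comment> \<open>For i = j because n is not the top degree, for other i because
      \<open>l i\<close> is at most \<open>l j\<close>.\<close>
    have "n + (if j = i then 1 else 0) < l j"
      using that max[of i] j by auto
    then have "poly ([:\<rho> j, 1:] ^ (l j - (n + (if j = i then 1 else 0)))) x = 0"
      by (simp add: x_def)
    then show ?thesis
      unfolding cofactor_def poly_prod using j(1) by (intro prod_zero) auto
  qed
  have "(\<Sum>i<Suc r. \<Sum>n<l i. b i n * (poly (moment_num r \<rho> d ah i n) x * poly (cofactor i n) x)) = 0"
    using arg_cong[OF 0, of "\<lambda>P. poly P x"] unfolding kernel_num_0 by (simp add: poly_sum)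
  moreover have "(\<Sum>n<l i. b i n * (poly (moment_num r \<rho> d ah i n) x * poly (cofactor i n) x))
      = (if i = j then b j (l j - 1) * (poly (moment_num r \<rho> d ah j (l j - 1)) x * poly (cofactor j (l j - 1)) x) else 0)"
    if "i < Suc r" for i
  proof -
    have "(\<Sum>n<l i. b i n * (poly (moment_num r \<rho> d ah i n) x * poly (cofactor i n) x))
      = (\<Sum>n<l i. if n = l j - 1 then (if i = j then b j (l j - 1) * (poly (moment_num r \<rho> d ah j (l j - 1)) x * poly (cofactor j (l j - 1)) x) else 0) else 0)"
      by (intro sum.cong) (use zero that in auto)
    then show ?thesis using j(2) by simp
  qed
  ultimately have "b j (l j - 1) * (poly (moment_num r \<rho> d ah j (l j - 1)) x * poly (cofactor j (l j - 1)) x) = 0"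
    using j(1) by simp
  moreover have "poly (cofactor j (l j - 1)) x \<noteq> 0"
  proof -
    have "poly ([:\<rho> h, 1:] ^ (l h - (l j - 1 + (if h = j then 1 else 0)))) x \<noteq> 0" if "h < r" for h
      using ne[OF that] j by (cases "h = j") (auto simp: add.commute)
    then show ?thesis unfolding cofactor_def poly_prod by auto
  qed
  moreover have "poly (moment_num r \<rho> d ah j (l j - 1)) x \<noteq> 0"
    unfolding x_def
  proof (rule moment_num_at_rate)
    \<comment> \<open>If \<open>l j\<close> is at least 2, all entries of \<open>l\<close> are
      positive, so all rates are distinct and the cofactor does not vanish.\<close>
    show "l j - 1 = 0 \<or> poly (rate_cofactor r \<rho> j) (- \<rho> j) \<noteq> 0"
    proof (cases "l j - 1 = 0")
      case False
      have "poly [:\<rho> h, 1:] x \<noteq> 0" if "h \<in> {..<r} - {j}" for h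
        using ne[of h] that near[of j h] j False by (auto simp: add.commute)
      then show ?thesis using j(1) unfolding rate_cofactor_def x_def[symmetric] by (auto simp: poly_prod)
    qed simp
  qed (use j d \<rho> in auto)
  ultimately show ?thesis by simp
qed

end

text \<open>Induction on the total of \<open>l\<close>, always lowering a largest entry. The totals
  are compared by an inequality because \<open>l\<close> shrinks in the induction while the
  conditions counted by \<open>m\<close> stay.\<close>

lemma hermite_kernel_trivial:
  fixes l m :: "nat \<Rightarrow> nat" and p :: nat
  assumes "\<And>j j'. j \<le> r \<Longrightarrow> j' \<le> r \<Longrightarrow> l j \<le> l j' + 1" and "inj_on \<rho> {h. h < r \<and> l h > 0}"
    and inj: "inj_on \<xi> {..<p}" and \<xi>: "\<And>i h. i < p \<Longrightarrow> h < r \<Longrightarrow> \<xi> i + \<rho> h > 0"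
    and "(\<Sum>j<Suc r. l j) \<le> (\<Sum>i<p. m i)"
    and "poly_sol (Suc r) l p m (\<lambda>i j v. exp_moment v (hermite_laplace r \<rho> d ah j) (\<xi> i)) B"
  shows "B = (\<lambda>_. 0)"
  using assms(1,2,5,6)
proof (induction "\<Sum>j<Suc r. l j" arbitrary: l rule: less_induct)
  case less
  let ?b = "\<lambda>j n. coeff (B j) n"
  have deg: "deg_vec (Suc r) l B"
    and sol: "\<And>i k. i < p \<Longrightarrow> k < m i \<Longrightarrow>
      (\<Sum>j<Suc r. \<Sum>n<l j. ?b j n * exp_moment (k + n) (hermite_laplace r \<rho> d ah j) (\<xi> i)) = 0"
    using less.prems(4) by (auto simp: poly_sol_def)
  show ?case
  proof (cases "(\<Sum>j<Suc r. l j) = 0")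
    case True
    then have "cells (Suc r) l = {}" by (auto simp: cells_def less_Suc_eq)
    then show ?thesis using deg by (intro ext poly_eqI) (simp add: deg_vec_iff)
  next
    case nz: False
    then obtain j where j: "j \<le> r" and pos: "l j \<noteq> 0" and max: "\<And>h. h \<le> r \<Longrightarrow> l h \<le> l j"
      using obtain_max by blast
    have P: "kernel_num l ?b 0 = 0"
    proof (rule poly_eq_0_of_power_dvd[OF inj])
      show "degree (kernel_num l ?b 0) < (\<Sum>i<p. m i)"
        using degree_kernel_num[of l ?b] less.prems(1,3) nz by simp
      fix i assume i: "i < p"
      have s: "\<rho> h + \<xi> i > 0" if "h < r" for h using \<xi>[OF i that] by (simp add: add.commute)
      show "[:- \<xi> i, 1:] ^ m i dvd kernel_num l ?b 0"
      proof (rule power_dvd_of_recursion)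
        show "poly (rate_prod r \<rho>) (\<xi> i) \<noteq> 0" using rate_prod_pos[of r d \<rho> "\<xi> i"] d \<rho> s by auto
        show "poly (kernel_num l ?b k) (\<xi> i) = 0" if "k < m i" for k
          by (rule poly_kernel_num_eq_0) (use less.prems(1) s sol[OF i that] in \<open>auto simp: add.commute\<close>)
      qed (rule kernel_num_Suc, use less.prems(1) in auto)
    qed
    have 0: "?b j (l j - 1) = 0"
    proof (cases "j = r")
      case True
      then show ?thesis using kernel_num_at_infinity[of l ?b] less.prems(1) max pos P by auto
    next
      case False
      then show ?thesis using kernel_num_at_rate[of l j ?b] less.prems(1,2) max pos P j by auto
    qed
    let ?l = "l(j := l j - 1)"
    have sum: "(\<Sum>i<Suc r. ?l i) + 1 = (\<Sum>i<Suc r. l i)"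
      by (rule sum_decrement) (use j pos in auto)
    show ?thesis
    proof (rule less.hyps[of ?l])
      show "?l i \<le> ?l i' + 1" if "i \<le> r" "i' \<le> r" for i i'
        by (rule near_decrement) (use less.prems(1) max j that in auto)
      show "inj_on \<rho> {h. h < r \<and> ?l h > 0}"
        by (rule inj_on_subset[OF less.prems(2)]) (auto split: if_splits)
      show "poly_sol (Suc r) ?l p m (\<lambda>i j v. exp_moment v (hermite_laplace r \<rho> d ah j) (\<xi> i)) B"
        using less.prems(4) 0 pos by (rule poly_sol_decrement)
    qed (use sum less.prems(3) in linarith)+
  qed
qed

end


text \<open>The functional is a top coefficient: a solution on which it vanishes solves the square
  problem with that entry lowered. For A any nonzero entry of \<open>m\<close> will do and the
  square kernel is transposed; for B a largest entry of \<open>l\<close> is lowered, so that the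
  entries stay within one of each other.\<close>

lemma
  fixes r p :: nat and \<rho> d \<xi> :: "nat \<Rightarrow> real" and ah :: real and l m :: "nat \<Rightarrow> nat"
  assumes d: "\<And>h. h < r \<Longrightarrow> d h > 0" and \<rho>: "\<And>h. h < r \<Longrightarrow> \<rho> h > 0"
    and inj: "inj_on \<xi> {..<p}" and \<xi>: "\<And>i h. i < p \<Longrightarrow> h < r \<Longrightarrow> \<xi> i + \<rho> h > 0"
    and near: "\<And>j j'. j \<le> r \<Longrightarrow> j' \<le> r \<Longrightarrow> l j \<le> l j' + 1"
    and inj\<rho>: "inj_on \<rho> {h. h < r \<and> l h > 0}"
  defines "M \<equiv> \<lambda>j i v. exp_moment v (hermite_laplace r \<rho> d ah j) (\<xi> i)"
  shows hermite_unique_A: "(\<Sum>i<p. m i) = (\<Sum>j<Suc r. l j) + 1 \<Longrightarrow> unique_up_to_scalar (poly_sol p m (Suc r) l M)"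
    and hermite_unique_B: "(\<Sum>j<Suc r. l j) = (\<Sum>i<p. m i) + 1 \<Longrightarrow> unique_up_to_scalar (poly_sol (Suc r) l p m (\<lambda>i j. M j i))"
proof -
  have delta: "(\<Sum>c\<in>cells P k. (if c = c0 then 1 else 0) * f c) = f c0"
    if "c0 \<in> cells P k" for P k and c0 :: "nat \<times> nat" and f :: "nat \<times> nat \<Rightarrow> real"
  proof -
    have "(\<Sum>c\<in>cells P k. (if c = c0 then 1 else 0) * f c) = (\<Sum>c\<in>cells P k. if c = c0 then f c else 0)"
      by (intro sum.cong) auto
    then show ?thesis using that by simp
  qed
  {
    assume card: "(\<Sum>i<p. m i) = (\<Sum>j<Suc r. l j) + 1"
    then obtain i where i: "i < p" "m i \<noteq> 0" by (metis (no_types, lifting) add_is_0 lessThan_iff one_neq_zero sum.neutral)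
    let ?m = "m(i := m i - 1)"
    have sum: "(\<Sum>k<p. ?m k) = (\<Sum>j<Suc r. l j)"
      using sum_decrement[of i p m] i card by linarith
    show "unique_up_to_scalar (poly_sol p m (Suc r) l M)"
    proof (rule unique_up_to_scalar_poly_sol[OF card, where \<phi> = "\<lambda>c. if c = (i, m i - 1) then 1 else 0"])
      fix Q assume Q: "poly_sol p m (Suc r) l M Q"
        and 0: "(\<Sum>c\<in>cells p m. (if c = (i, m i - 1) then 1 else 0) * coeff (Q (fst c)) (snd c)) = 0"
      have "(i, m i - 1) \<in> cells p m" using i by (simp add: cells_def)
      then have "coeff (Q i) (m i - 1) = 0"
        using 0 delta[of "(i, m i - 1)" p m "\<lambda>c. coeff (Q (fst c)) (snd c)"] by simp
      then have "poly_sol p ?m (Suc r) l M Q" by (rule poly_sol_decrement[OF Q]) (rule i)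
      then show "Q = (\<lambda>_. 0)"
      proof (rule poly_sol_transpose[OF sum, rotated])
        fix B assume "poly_sol (Suc r) l p ?m (\<lambda>i j. M j i) B"
        then show "B = (\<lambda>_. 0)"
          unfolding M_def
          by (intro hermite_kernel_trivial[where r = r and l = l and m = ?m and p = p and d = d and \<rho> = \<rho> and \<xi> = \<xi> and ah = ah])
             (use assms sum in auto)
      qed
    qed
  next
    assume card: "(\<Sum>j<Suc r. l j) = (\<Sum>i<p. m i) + 1"
    then obtain j where j: "j \<le> r" "l j \<noteq> 0" and max: "\<And>h. h \<le> r \<Longrightarrow> l h \<le> l j"
      using obtain_max[of l r] by (metis add_is_0 one_neq_zero)
    let ?l = "l(j := l j - 1)"
    have jr: "j < Suc r" using j by simp
    have sum: "(\<Sum>k<Suc r. ?l k) = (\<Sum>i<p. m i)"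
      using sum_decrement[of j "Suc r" l] jr j(2) card by linarith
    show "unique_up_to_scalar (poly_sol (Suc r) l p m (\<lambda>i j. M j i))"
    proof (rule unique_up_to_scalar_poly_sol[OF card, where \<phi> = "\<lambda>c. if c = (j, l j - 1) then 1 else 0"])
      fix Q assume Q: "poly_sol (Suc r) l p m (\<lambda>i j. M j i) Q"
        and 0: "(\<Sum>c\<in>cells (Suc r) l. (if c = (j, l j - 1) then 1 else 0) * coeff (Q (fst c)) (snd c)) = 0"
      have "(j, l j - 1) \<in> cells (Suc r) l" using j by (simp add: cells_def)
      then have "coeff (Q j) (l j - 1) = 0"
        using 0 delta[of "(j, l j - 1)" "Suc r" l "\<lambda>c. coeff (Q (fst c)) (snd c)"] by simp
      then have "poly_sol (Suc r) ?l p m (\<lambda>i j. M j i) Q" by (rule poly_sol_decrement[OF Q]) (rule j)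
      then show "Q = (\<lambda>_. 0)"
      proof (intro hermite_kernel_trivial[where r = r and l = ?l and m = m and p = p and d = d and \<rho> = \<rho> and \<xi> = \<xi> and ah = ah])
        show "?l k \<le> ?l k' + 1" if "k \<le> r" "k' \<le> r" for k k'
          by (rule near_decrement) (use near max j that in auto)
        show "inj_on \<rho> {h. h < r \<and> ?l h > 0}"
          by (rule inj_on_subset[OF inj\<rho>]) (auto split: if_splits)
      qed (use d \<rho> inj \<xi> sum in \<open>auto simp: M_def\<close>)
    qed
  }
qed

subsection \<open>Convergence of solution vectors\<close>

definition pair_moment :: "(nat \<Rightarrow> real \<Rightarrow> real) \<Rightarrow> (nat \<Rightarrow> real \<Rightarrow> real) \<Rightarrow> nat \<Rightarrow> nat \<Rightarrow> nat \<Rightarrow> real" where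
  "pair_moment U V j i v = (LINT t|lborel. t ^ v * (U j t * V i t))"

definition pair_integrable :: "nat \<Rightarrow> nat \<Rightarrow> (nat \<Rightarrow> real \<Rightarrow> real) \<Rightarrow> (nat \<Rightarrow> real \<Rightarrow> real) \<Rightarrow> bool" where
  "pair_integrable p r U V \<longleftrightarrow> (\<forall>j\<le>r. \<forall>i<p. \<forall>v. integrable lborel (\<lambda>t. t ^ v * (U j t * V i t)))"

lemma A_solution_iff_pair:
  "pair_integrable p r U V \<Longrightarrow> A_solution p r m l U V Q \<longleftrightarrow> poly_sol p m (Suc r) l (pair_moment U V) Q"
  unfolding pair_moment_def[abs_def] by (rule A_solution_iff_poly_sol) (simp add: pair_integrable_def)

lemma B_solution_iff_pair:
  "pair_integrable p r U V \<Longrightarrow> B_solution p r m l U V Q \<longleftrightarrow> poly_sol (Suc r) l p m (\<lambda>i j. pair_moment U V j i) Q"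
  unfolding pair_moment_def[abs_def] by (rule B_solution_iff_poly_sol) (simp add: pair_integrable_def)

context
  fixes p r :: nat and U0 V0 :: "nat \<Rightarrow> real \<Rightarrow> real"
  assumes int0: "pair_integrable p r U0 V0"
begin

lemma direct_vector_limits:
  fixes U V :: "real \<Rightarrow> nat \<Rightarrow> real \<Rightarrow> real"
  assumes int: "\<forall>\<^sub>F \<tau> in at_top. pair_integrable p r (U \<tau>) (V \<tau>)"
    and lim: "\<And>j i v. j \<le> r \<Longrightarrow> i < p \<Longrightarrow> ((\<lambda>\<tau>. pair_moment (U \<tau>) (V \<tau>) j i v) \<longlongrightarrow> pair_moment U0 V0 j i v) at_top"
  shows "\<lbrakk>(\<Sum>i<p. m i) = (\<Sum>j<Suc r. l j) + 1; unique_up_to_scalar (A_solution p r m l U0 V0);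
      A_solution p r m l U0 V0 P; coeff (P i0) k0 = 1\<rbrakk> \<Longrightarrow>
      direct_vector_limit (\<lambda>\<tau>. A_solution p r m l (U \<tau>) (V \<tau>)) i0 k0 P"
    and "\<lbrakk>(\<Sum>j<Suc r. l j) = (\<Sum>i<p. m i) + 1; unique_up_to_scalar (B_solution p r m l U0 V0);
      B_solution p r m l U0 V0 P; coeff (P i0) k0 = 1\<rbrakk> \<Longrightarrow>
      direct_vector_limit (\<lambda>\<tau>. B_solution p r m l (U \<tau>) (V \<tau>)) i0 k0 P"
proof -
  show "direct_vector_limit (\<lambda>\<tau>. A_solution p r m l (U \<tau>) (V \<tau>)) i0 k0 P"
    if "(\<Sum>i<p. m i) = (\<Sum>j<Suc r. l j) + 1" "unique_up_to_scalar (A_solution p r m l U0 V0)"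
      "A_solution p r m l U0 V0 P" "coeff (P i0) k0 = 1"
  proof (rule direct_vector_limit_poly_sol[where P = p and m = m and R = "Suc r" and l = l and ?M0.0 = "pair_moment U0 V0" and M = "\<lambda>\<tau>. pair_moment (U \<tau>) (V \<tau>)"])
    show "\<forall>\<^sub>F \<tau> in at_top. \<forall>Q. A_solution p r m l (U \<tau>) (V \<tau>) Q \<longleftrightarrow> poly_sol p m (Suc r) l (pair_moment (U \<tau>) (V \<tau>)) Q"
      using int by (rule eventually_mono) (simp add: A_solution_iff_pair)
  qed (use that lim A_solution_iff_pair[OF int0, abs_def] in auto)
  show "direct_vector_limit (\<lambda>\<tau>. B_solution p r m l (U \<tau>) (V \<tau>)) i0 k0 P"
    if "(\<Sum>j<Suc r. l j) = (\<Sum>i<p. m i) + 1" "unique_up_to_scalar (B_solution p r m l U0 V0)"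
      "B_solution p r m l U0 V0 P" "coeff (P i0) k0 = 1"
  proof (rule direct_vector_limit_poly_sol[where P = "Suc r" and m = l and R = p and l = m and ?M0.0 = "\<lambda>i j. pair_moment U0 V0 j i" and M = "\<lambda>\<tau> i j. pair_moment (U \<tau>) (V \<tau>) j i"])
    show "\<forall>\<^sub>F \<tau> in at_top. \<forall>Q. B_solution p r m l (U \<tau>) (V \<tau>) Q \<longleftrightarrow>
        poly_sol (Suc r) l p m (\<lambda>i j. pair_moment (U \<tau>) (V \<tau>) j i) Q"
      using int by (rule eventually_mono) (simp add: B_solution_iff_pair)
  qed (use that lim B_solution_iff_pair[OF int0, abs_def] in auto)
qed

lemma iterated_vector_limits:
  fixes U V :: "real \<Rightarrow> real \<Rightarrow> nat \<Rightarrow> real \<Rightarrow> real"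
  assumes int: "\<forall>\<^sub>F \<tau> in at_top. \<forall>\<^sub>F \<kappa> in at_top. pair_integrable p r (U \<tau> \<kappa>) (V \<tau> \<kappa>)"
    and lim': "\<forall>\<^sub>F \<tau> in at_top. \<forall>j\<le>r. \<forall>i<p. \<forall>v. ((\<lambda>\<kappa>. pair_moment (U \<tau> \<kappa>) (V \<tau> \<kappa>) j i v) \<longlongrightarrow> g \<tau> j i v) at_top"
    and lim: "\<And>j i v. j \<le> r \<Longrightarrow> i < p \<Longrightarrow> ((\<lambda>\<tau>. g \<tau> j i v) \<longlongrightarrow> pair_moment U0 V0 j i v) at_top"
  shows "\<lbrakk>(\<Sum>i<p. m i) = (\<Sum>j<Suc r. l j) + 1; unique_up_to_scalar (A_solution p r m l U0 V0);
      A_solution p r m l U0 V0 P; coeff (P i0) k0 = 1\<rbrakk> \<Longrightarrow>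
      iterated_vector_limit (\<lambda>\<tau> \<kappa>. A_solution p r m l (U \<tau> \<kappa>) (V \<tau> \<kappa>)) i0 k0 P"
    and "\<lbrakk>(\<Sum>j<Suc r. l j) = (\<Sum>i<p. m i) + 1; unique_up_to_scalar (B_solution p r m l U0 V0);
      B_solution p r m l U0 V0 P; coeff (P i0) k0 = 1\<rbrakk> \<Longrightarrow>
      iterated_vector_limit (\<lambda>\<tau> \<kappa>. B_solution p r m l (U \<tau> \<kappa>) (V \<tau> \<kappa>)) i0 k0 P"
proof -
  show "iterated_vector_limit (\<lambda>\<tau> \<kappa>. A_solution p r m l (U \<tau> \<kappa>) (V \<tau> \<kappa>)) i0 k0 P"
    if "(\<Sum>i<p. m i) = (\<Sum>j<Suc r. l j) + 1" "unique_up_to_scalar (A_solution p r m l U0 V0)"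
      "A_solution p r m l U0 V0 P" "coeff (P i0) k0 = 1"
  proof (rule iterated_vector_limit_poly_sol[where P = p and m = m and R = "Suc r" and l = l and ?M0.0 = "pair_moment U0 V0" and M = "\<lambda>\<tau> \<kappa>. pair_moment (U \<tau> \<kappa>) (V \<tau> \<kappa>)" and ?M1.0 = g])
    show "\<forall>\<^sub>F \<tau> in at_top. \<forall>\<^sub>F \<kappa> in at_top. \<forall>Q. A_solution p r m l (U \<tau> \<kappa>) (V \<tau> \<kappa>) Q \<longleftrightarrow>
        poly_sol p m (Suc r) l (pair_moment (U \<tau> \<kappa>) (V \<tau> \<kappa>)) Q"
      using int by (rule eventually_mono) (erule eventually_mono, simp add: A_solution_iff_pair)
    show "\<forall>\<^sub>F \<tau> in at_top. \<forall>j<Suc r. \<forall>i<p. \<forall>v. ((\<lambda>\<kappa>. pair_moment (U \<tau> \<kappa>) (V \<tau> \<kappa>) j i v) \<longlongrightarrow> g \<tau> j i v) at_top"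
      using lim' by (simp add: less_Suc_eq_le)
  qed (use that lim A_solution_iff_pair[OF int0, abs_def] in auto)
  show "iterated_vector_limit (\<lambda>\<tau> \<kappa>. B_solution p r m l (U \<tau> \<kappa>) (V \<tau> \<kappa>)) i0 k0 P"
    if "(\<Sum>j<Suc r. l j) = (\<Sum>i<p. m i) + 1" "unique_up_to_scalar (B_solution p r m l U0 V0)"
      "B_solution p r m l U0 V0 P" "coeff (P i0) k0 = 1"
  proof (rule iterated_vector_limit_poly_sol[where P = "Suc r" and m = l and R = p and l = m and ?M0.0 = "\<lambda>i j. pair_moment U0 V0 j i" and M = "\<lambda>\<tau> \<kappa> i j. pair_moment (U \<tau> \<kappa>) (V \<tau> \<kappa>) j i" and ?M1.0 = "\<lambda>\<tau> i j. g \<tau> j i"])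
    show "\<forall>\<^sub>F \<tau> in at_top. \<forall>\<^sub>F \<kappa> in at_top. \<forall>Q. B_solution p r m l (U \<tau> \<kappa>) (V \<tau> \<kappa>) Q \<longleftrightarrow>
        poly_sol (Suc r) l p m (\<lambda>i j. pair_moment (U \<tau> \<kappa>) (V \<tau> \<kappa>) j i) Q"
      using int by (rule eventually_mono) (erule eventually_mono, simp add: B_solution_iff_pair)
    show "\<forall>\<^sub>F \<tau> in at_top. \<forall>i<p. \<forall>j<Suc r. \<forall>v. ((\<lambda>\<kappa>. pair_moment (U \<tau> \<kappa>) (V \<tau> \<kappa>) j i v) \<longlongrightarrow> g \<tau> j i v) at_top"
      using lim' by (rule eventually_mono) (simp add: less_Suc_eq_le)
  qed (use that lim B_solution_iff_pair[OF int0, abs_def] in auto)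
qed

end

lemma eventually_all_pairs:
  fixes p r :: nat
  assumes "\<And>j i. j \<le> r \<Longrightarrow> i < p \<Longrightarrow> \<forall>\<^sub>F x in F. R j i x"
  shows "\<forall>\<^sub>F x in F. \<forall>j\<le>r. \<forall>i<p. R j i x"
proof -
  have "\<forall>\<^sub>F x in F. \<forall>j\<in>{..r}. \<forall>i\<in>{..<p}. R j i x"
    using assms by (intro eventually_ball_finite ballI) auto
  then show ?thesis by (simp add: Ball_def)
qed

lemma direct_integral_limit_pair:
  fixes U V :: "real \<Rightarrow> nat \<Rightarrow> real \<Rightarrow> real"
  assumes int: "\<forall>\<^sub>F \<tau> in at_top. pair_integrable p r (U \<tau>) (V \<tau>)" and ji: "j \<le> r" "i < p"
    and lim: "((\<lambda>\<tau>. pair_moment (U \<tau>) (V \<tau>) j i v) \<longlongrightarrow> L) at_top"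
  shows "direct_integral_limit (\<lambda>\<tau> t. t ^ v * (U \<tau> j t * V \<tau> i t)) L"
  unfolding direct_integral_limit_def
proof
  show "\<forall>\<^sub>F \<tau> in at_top. integrable lborel (\<lambda>t. t ^ v * (U \<tau> j t * V \<tau> i t))"
    using int by (rule eventually_mono) (use ji in \<open>simp add: pair_integrable_def\<close>)
qed (use lim in \<open>simp add: pair_moment_def\<close>)

lemma iterated_integral_limit_pair:
  fixes U V :: "real \<Rightarrow> real \<Rightarrow> nat \<Rightarrow> real \<Rightarrow> real"
  assumes int: "\<forall>\<^sub>F \<tau> in at_top. \<forall>\<^sub>F \<kappa> in at_top. pair_integrable p r (U \<tau> \<kappa>) (V \<tau> \<kappa>)" and ji: "j \<le> r" "i < p"
    and lim': "\<forall>\<^sub>F \<tau> in at_top. \<forall>j\<le>r. \<forall>i<p. \<forall>v. ((\<lambda>\<kappa>. pair_moment (U \<tau> \<kappa>) (V \<tau> \<kappa>) j i v) \<longlongrightarrow> g \<tau> j i v) at_top"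
    and lim: "((\<lambda>\<tau>. g \<tau> j i v) \<longlongrightarrow> L) at_top"
  shows "iterated_integral_limit (\<lambda>\<tau> \<kappa> t. t ^ v * (U \<tau> \<kappa> j t * V \<tau> \<kappa> i t)) L"
  unfolding iterated_integral_limit_def iterated_limit_def
proof (intro conjI exI)
  show "\<forall>\<^sub>F \<tau> in at_top. \<forall>\<^sub>F \<kappa> in at_top. integrable lborel (\<lambda>t. t ^ v * (U \<tau> \<kappa> j t * V \<tau> \<kappa> i t))"
    using int by (rule eventually_mono) (erule eventually_mono, use ji in \<open>simp add: pair_integrable_def\<close>)
  show "\<forall>\<^sub>F \<tau> in at_top. ((\<lambda>\<kappa>. LINT t|lborel. t ^ v * (U \<tau> \<kappa> j t * V \<tau> \<kappa> i t)) \<longlongrightarrow> g \<tau> j i v) at_top"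
    using lim' by (rule eventually_mono) (use ji in \<open>simp add: pair_moment_def\<close>)
qed (rule lim)

lemma eventually_pair_integrable:
  fixes p r :: nat
  assumes "\<And>j i. j \<le> r \<Longrightarrow> i < p \<Longrightarrow> \<forall>\<^sub>F x in F. \<forall>v. integrable lborel (\<lambda>t. t ^ v * (U x j t * V x i t))"
  shows "\<forall>\<^sub>F x in F. pair_integrable p r (U x) (V x)"
proof -
  have "\<forall>\<^sub>F x in F. \<forall>j\<in>{..r}. \<forall>i\<in>{..<p}. \<forall>v. integrable lborel (\<lambda>t. t ^ v * (U x j t * V x i t))"
    using assms by (intro eventually_ball_finite ballI) auto
  then show ?thesis by (simp add: Ball_def pair_integrable_def)
qed

lemma iterated_pair_facts:
  fixes U V :: "real \<Rightarrow> real \<Rightarrow> nat \<Rightarrow> real \<Rightarrow> real"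
  assumes "\<And>j i. j \<le> r \<Longrightarrow> i < p \<Longrightarrow> \<forall>\<^sub>F \<tau> in at_top.
      (\<forall>\<^sub>F \<kappa> in at_top. \<forall>v. integrable lborel (\<lambda>t. t ^ v * (U \<tau> \<kappa> j t * V \<tau> \<kappa> i t))) \<and>
      (\<forall>v. ((\<lambda>\<kappa>. LINT t|lborel. t ^ v * (U \<tau> \<kappa> j t * V \<tau> \<kappa> i t)) \<longlongrightarrow> g \<tau> j i v) at_top)"
  shows "\<forall>\<^sub>F \<tau> in at_top. \<forall>\<^sub>F \<kappa> in at_top. pair_integrable p r (U \<tau> \<kappa>) (V \<tau> \<kappa>)"
    and "\<forall>\<^sub>F \<tau> in at_top. \<forall>j\<le>r. \<forall>i<p. \<forall>v. ((\<lambda>\<kappa>. pair_moment (U \<tau> \<kappa>) (V \<tau> \<kappa>) j i v) \<longlongrightarrow> g \<tau> j i v) at_top"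
proof -
  have *: "\<forall>\<^sub>F \<tau> in at_top. \<forall>j\<le>r. \<forall>i<p.
      (\<forall>\<^sub>F \<kappa> in at_top. \<forall>v. integrable lborel (\<lambda>t. t ^ v * (U \<tau> \<kappa> j t * V \<tau> \<kappa> i t))) \<and>
      (\<forall>v. ((\<lambda>\<kappa>. LINT t|lborel. t ^ v * (U \<tau> \<kappa> j t * V \<tau> \<kappa> i t)) \<longlongrightarrow> g \<tau> j i v) at_top)"
    by (rule eventually_all_pairs) (rule assms)
  show "\<forall>\<^sub>F \<tau> in at_top. \<forall>\<^sub>F \<kappa> in at_top. pair_integrable p r (U \<tau> \<kappa>) (V \<tau> \<kappa>)"
    using * by (rule eventually_mono) (rule eventually_pair_integrable, simp)
  show "\<forall>\<^sub>F \<tau> in at_top. \<forall>j\<le>r. \<forall>i<p. \<forall>v. ((\<lambda>\<kappa>. pair_moment (U \<tau> \<kappa>) (V \<tau> \<kappa>) j i v) \<longlongrightarrow> g \<tau> j i v) at_top"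
    using * by (rule eventually_mono) (simp add: pair_moment_def)
qed

text \<open>A bounded error is negligible on the scale sqrt \<tau>, the only scale on which the last
  parameter is seen.\<close>

lemma tendsto_of_bigo_const:
  fixes f :: "real \<Rightarrow> real"
  assumes "(\<lambda>\<tau>. f \<tau> - (\<tau> + sqrt (2 * \<tau>) * c)) \<in> O[at_top](\<lambda>_. 1)"
  shows "((\<lambda>\<tau>. (f \<tau> - \<tau>) / sqrt \<tau>) \<longlongrightarrow> sqrt 2 * c) at_top"
proof -
  obtain K where K: "\<forall>\<^sub>F \<tau> in at_top. norm (f \<tau> - (\<tau> + sqrt (2 * \<tau>) * c)) \<le> K * norm (1 :: real)"
    using assms by (rule landau_o.bigE)
  have "((\<lambda>\<tau>. (f \<tau> - (\<tau> + sqrt (2 * \<tau>) * c)) / sqrt \<tau>) \<longlongrightarrow> 0) at_top"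
  proof (rule Lim_null_comparison)
    show "((\<lambda>\<tau>. K / sqrt \<tau>) \<longlongrightarrow> 0) at_top" by real_asymp
    show "\<forall>\<^sub>F \<tau> in at_top. norm ((f \<tau> - (\<tau> + sqrt (2 * \<tau>) * c)) / sqrt \<tau>) \<le> K / sqrt \<tau>"
      using K eventually_gt_at_top[of 0] by eventually_elim (simp add: divide_right_mono)
  qed
  then have "((\<lambda>\<tau>. (f \<tau> - (\<tau> + sqrt (2 * \<tau>) * c)) / sqrt \<tau> + sqrt 2 * c) \<longlongrightarrow> 0 + sqrt 2 * c) at_top"
    by (intro tendsto_intros)
  moreover have "\<forall>\<^sub>F \<tau> in at_top. (f \<tau> - (\<tau> + sqrt (2 * \<tau>) * c)) / sqrt \<tau> + sqrt 2 * c = (f \<tau> - \<tau>) / sqrt \<tau>"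
    using eventually_gt_at_top[of 0] by eventually_elim (simp add: real_sqrt_mult field_simps)
  ultimately show ?thesis
    by (simp add: tendsto_cong)
qed

theorem corollary5p24:
  fixes r p :: nat
    and d \<rho> \<xi> :: "nat \<Rightarrow> real"
    and ah \<omega> :: real
    and l :: "nat \<Rightarrow> nat"
    and a b \<beta> :: "real \<Rightarrow> nat \<Rightarrow> real"
  assumes p: "p \<ge> 1"
    and d_pos: "\<forall>h<r. d h > 0"
    and rho_pos: "\<forall>h<r. \<rho> h > 0"
    and xi_distinct: "inj_on \<xi> {..<p}"
    and xi_rho: "\<forall>i<p. \<forall>h<r. \<xi> i + \<rho> h > 0"
    and l_near: "\<forall>j\<le>r. \<forall>j'\<le>r. l j \<le> l j' + 1"
    and rho_distinct: "inj_on \<rho> {h. h < r \<and> l h > 0}"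
    and omega: "\<omega> > 0"
    and a_gt: "\<forall>\<^sub>F \<tau> in at_top. \<forall>\<nu>\<le>r. a \<tau> \<nu> > -1"
    and b_gt: "\<forall>\<^sub>F \<tau> in at_top. \<forall>h<r. b \<tau> h > a \<tau> h"
    and a_last: "(\<lambda>\<tau>. a \<tau> r + 1 - (\<tau> + sqrt (2 * \<tau>) * ah)) \<in> O[at_top](\<lambda>_. 1)"
    and a_lim: "\<forall>h<r. ((\<lambda>\<tau>. sqrt (2 / \<tau>) * (a \<tau> h + 1)) \<longlongrightarrow> \<rho> h) at_top"
    and b_lim: "\<forall>h<r. ((\<lambda>\<tau>. b \<tau> h - a \<tau> h) \<longlongrightarrow> d h) at_top"
    and beta_lim: "\<forall>i<p. ((\<lambda>\<tau>. sqrt (2 / \<tau>) * \<beta> \<tau> i) \<longlongrightarrow> \<xi> i) at_top"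
  shows
    "(\<forall>j\<le>r. \<forall>i<p. \<forall>v.
        integrable lborel (\<lambda>t. t ^ v * (hermite_row r \<rho> d ah j t * hermite_col \<xi> i t)) \<and>
        direct_integral_limit
          (\<lambda>\<tau> t. t ^ v * (direct_row r \<rho> d ah \<tau> j t * direct_col \<xi> \<tau> i t))
          (LINT t|lborel. t ^ v * (hermite_row r \<rho> d ah j t * hermite_col \<xi> i t)) \<and>
        iterated_integral_limit
          (\<lambda>\<tau> \<kappa> t. t ^ v * (laguerre1_row r (a \<tau>) (b \<tau>) \<omega> \<tau> \<kappa> j t * laguerre1_col (\<beta> \<tau>) \<tau> i t))
          (LINT t|lborel. t ^ v * (hermite_row r \<rho> d ah j t * hermite_col \<xi> i t)) \<and>
        iterated_integral_limit
          (\<lambda>\<tau> \<kappa> t. t ^ v * (laguerre2_row r \<rho> d ah \<tau> \<kappa> j t * laguerre2_col \<xi> ah \<tau> \<kappa> i t))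
          (LINT t|lborel. t ^ v * (hermite_row r \<rho> d ah j t * hermite_col \<xi> i t)))
   \<and> (\<forall>m. (\<Sum>i<p. m i) = (\<Sum>j\<le>r. l j) + 1 \<longrightarrow>
        unique_up_to_scalar (A_solution p r m l (hermite_row r \<rho> d ah) (hermite_col \<xi>)) \<and>
        (\<forall>AH i\<^sub>0 k\<^sub>0.
          A_solution p r m l (hermite_row r \<rho> d ah) (hermite_col \<xi>) AH \<and> coeff (AH i\<^sub>0) k\<^sub>0 = 1 \<longrightarrow>
          direct_vector_limit
            (\<lambda>\<tau>. A_solution p r m l (direct_row r \<rho> d ah \<tau>) (direct_col \<xi> \<tau>)) i\<^sub>0 k\<^sub>0 AH \<and>
          iterated_vector_limit
            (\<lambda>\<tau> \<kappa>. A_solution p r m l (laguerre1_row r (a \<tau>) (b \<tau>) \<omega> \<tau> \<kappa>) (laguerre1_col (\<beta> \<tau>) \<tau>))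
            i\<^sub>0 k\<^sub>0 AH \<and>
          iterated_vector_limit
            (\<lambda>\<tau> \<kappa>. A_solution p r m l (laguerre2_row r \<rho> d ah \<tau> \<kappa>) (laguerre2_col \<xi> ah \<tau> \<kappa>))
            i\<^sub>0 k\<^sub>0 AH))
   \<and> (\<forall>m. (\<Sum>j\<le>r. l j) = (\<Sum>i<p. m i) + 1 \<longrightarrow>
        unique_up_to_scalar (B_solution p r m l (hermite_row r \<rho> d ah) (hermite_col \<xi>)) \<and>
        (\<forall>BH j\<^sub>0 k\<^sub>0.
          B_solution p r m l (hermite_row r \<rho> d ah) (hermite_col \<xi>) BH \<and> coeff (BH j\<^sub>0) k\<^sub>0 = 1 \<longrightarrow>
          direct_vector_limit
            (\<lambda>\<tau>. B_solution p r m l (direct_row r \<rho> d ah \<tau>) (direct_col \<xi> \<tau>)) j\<^sub>0 k\<^sub>0 BH \<and>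
          iterated_vector_limit
            (\<lambda>\<tau> \<kappa>. B_solution p r m l (laguerre1_row r (a \<tau>) (b \<tau>) \<omega> \<tau> \<kappa>) (laguerre1_col (\<beta> \<tau>) \<tau>))
            j\<^sub>0 k\<^sub>0 BH \<and>
          iterated_vector_limit
            (\<lambda>\<tau> \<kappa>. B_solution p r m l (laguerre2_row r \<rho> d ah \<tau> \<kappa>) (laguerre2_col \<xi> ah \<tau> \<kappa>))
            j\<^sub>0 k\<^sub>0 BH))"
proof -
  let ?U = "hermite_row r \<rho> d ah" and ?V = "hermite_col \<xi>"
  let ?U1 = "\<lambda>\<tau> \<kappa>. laguerre1_row r (a \<tau>) (b \<tau>) \<omega> \<tau> \<kappa>" and ?V1 = "\<lambda>\<tau> (\<kappa>::real). laguerre1_col (\<beta> \<tau>) \<tau>"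
  let ?U2 = "laguerre2_row r \<rho> d ah" and ?V2 = "laguerre2_col \<xi> ah"
  \<comment> \<open>The common target of the three routes; \<open>mom\<close> identifies it with the
    Hermite moments.\<close>
  let ?M = "\<lambda>j i v. exp_moment v (hermite_laplace r \<rho> d ah j) (\<xi> i)"
  have d: "d h > 0" and \<rho>: "\<rho> h > 0" if "h < r" for h
    using d_pos rho_pos that by auto
  have \<xi>: "\<xi> i + \<rho> h > 0" if "i < p" "h < r" for i h
    using xi_rho that by blast
  have mom: "has_bochner_integral lborel (\<lambda>t. t ^ v * (?U j t * ?V i t)) (?M j i v)" if "i < p" for j i v
    using d \<rho> \<xi>[OF that] by (rule has_bochner_integral_hermite_moment)
  have int0: "pair_integrable p r ?U ?V"
    using mom unfolding pair_integrable_def by (auto simp: has_bochner_integral_iff)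
  have mom0: "pair_moment ?U ?V j i v = ?M j i v" if "i < p" for j i v
    unfolding pair_moment_def using mom[OF that] by (rule has_bochner_integral_integral_eq)

  have intD: "\<forall>\<^sub>F \<tau> in at_top. pair_integrable p r (direct_row r \<rho> d ah \<tau>) (direct_col \<xi> \<tau>)"
    by (rule eventually_pair_integrable) (rule direct_route(1), use d \<rho> \<xi> in auto)
  have limD: "((\<lambda>\<tau>. pair_moment (direct_row r \<rho> d ah \<tau>) (direct_col \<xi> \<tau>) j i v) \<longlongrightarrow> pair_moment ?U ?V j i v) at_top"
    if "j \<le> r" "i < p" for j i v
    unfolding mom0[OF that(2)] unfolding pair_moment_def
    by (rule direct_route(2)) (use d \<rho> \<xi> that in auto)

  have a_lim': "((\<lambda>\<tau>. (a \<tau> r + 1 - \<tau>) / sqrt \<tau>) \<longlongrightarrow> sqrt 2 * ah) at_top"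
    using a_last by (rule tendsto_of_bigo_const)
  \<comment> \<open>The values between the two limits: at fixed \<tau> still a list with positive
    step.\<close>
  define g1 where "g1 \<tau> j i v = list_eval (power_list v (sqrt (2 / \<tau>)) 0 (sqrt (2 / \<tau>) * \<beta> \<tau> i)) (laguerre1_transform r (a \<tau>) (b \<tau>) \<tau> j)"
    for \<tau> j i v
  have l1: "\<forall>\<^sub>F \<tau> in at_top. (\<forall>\<^sub>F \<kappa> in at_top. \<forall>v. integrable lborel (\<lambda>t. t ^ v * (?U1 \<tau> \<kappa> j t * ?V1 \<tau> \<kappa> i t))) \<and>
      (\<forall>v. ((\<lambda>\<kappa>. LINT t|lborel. t ^ v * (?U1 \<tau> \<kappa> j t * ?V1 \<tau> \<kappa> i t)) \<longlongrightarrow> g1 \<tau> j i v) at_top)"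
    and lim1: "((\<lambda>\<tau>. g1 \<tau> j i v) \<longlongrightarrow> pair_moment ?U ?V j i v) at_top"
    if ji: "j \<le> r" "i < p" for j i v
    using laguerre1_route[where a = a and b = b and \<beta> = \<beta> and ah = ah and \<omega> = \<omega> and i = i and j = j and \<rho> = \<rho> and d = d and \<xi> = \<xi> and r = r,
        OF a_gt b_gt a_lim' a_lim[rule_format] b_lim[rule_format] beta_lim[rule_format, OF ji(2)] \<rho> \<xi>[OF ji(2)] omega ji(1)]
    unfolding g1_def mom0[OF ji(2)] by simp_all
  note int1 = iterated_pair_facts(1)[of r p ?U1 ?V1 g1, OF l1] and lim1' = iterated_pair_facts(2)[of r p ?U1 ?V1 g1, OF l1]

  \<comment> \<open>On this route the values between the limits are already moments of a
    functional.\<close>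
  define g2 where "g2 \<tau> j i v = exp_moment v (laguerre2_transform r \<rho> d ah \<tau> j) (\<xi> i)" for \<tau> j i v
  have l2: "\<forall>\<^sub>F \<tau> in at_top. (\<forall>\<^sub>F \<kappa> in at_top. \<forall>v. integrable lborel (\<lambda>t. t ^ v * (?U2 \<tau> \<kappa> j t * ?V2 \<tau> \<kappa> i t))) \<and>
      (\<forall>v. ((\<lambda>\<kappa>. LINT t|lborel. t ^ v * (?U2 \<tau> \<kappa> j t * ?V2 \<tau> \<kappa> i t)) \<longlongrightarrow> g2 \<tau> j i v) at_top)"
    and lim2: "((\<lambda>\<tau>. g2 \<tau> j i v) \<longlongrightarrow> pair_moment ?U ?V j i v) at_top"
    if ji: "j \<le> r" "i < p" for j i v
    using laguerre2_route[where i = i and j = j and \<rho> = \<rho> and d = d and \<xi> = \<xi> and r = r and ah = ah,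
        OF d \<rho> \<xi>[OF ji(2)] ji(1)]
    unfolding g2_def mom0[OF ji(2)] by simp_all
  note int2 = iterated_pair_facts(1)[of r p ?U2 ?V2 g2, OF l2] and lim2' = iterated_pair_facts(2)[of r p ?U2 ?V2 g2, OF l2]

  have uniqA: "unique_up_to_scalar (A_solution p r m l ?U ?V)" if "(\<Sum>i<p. m i) = (\<Sum>j<Suc r. l j) + 1" for m
  proof -
    have "A_solution p r m l ?U ?V = poly_sol p m (Suc r) l ?M"
      by (intro ext) (simp add: A_solution_iff_pair[OF int0] poly_sol_def mom0 del: sum.lessThan_Suc)
    then show ?thesis
      using hermite_unique_A[where \<rho> = \<rho> and d = d and \<xi> = \<xi> and ah = ah and r = r, OF d \<rho> xi_distinct \<xi> l_near[rule_format] rho_distinct that]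
      by simp
  qed
  have uniqB: "unique_up_to_scalar (B_solution p r m l ?U ?V)" if "(\<Sum>j<Suc r. l j) = (\<Sum>i<p. m i) + 1" for m
  proof -
    have "B_solution p r m l ?U ?V = poly_sol (Suc r) l p m (\<lambda>i j. ?M j i)"
      by (intro ext) (simp add: B_solution_iff_pair[OF int0] poly_sol_def mom0 del: sum.lessThan_Suc)
    then show ?thesis
      using hermite_unique_B[where \<rho> = \<rho> and d = d and \<xi> = \<xi> and ah = ah and r = r, OF d \<rho> xi_distinct \<xi> l_near[rule_format] rho_distinct that]
      by simp
  qed
  note limits = direct_vector_limits[OF int0 intD limD] iterated_vector_limits[OF int0 int1 lim1' lim1]
    iterated_vector_limits[OF int0 int2 lim2' lim2]
  show ?thesis
    \<comment> \<open>The goal sums over j \<le> r, the lemmas count r + 1 rows.\<close>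
    unfolding lessThan_Suc_atMost[symmetric]
  proof (intro conjI allI impI; (elim conjE)?)
    fix j i v assume ji: "j \<le> r" "i < p"
    note pair_moment_def[symmetric, simp]
    show "integrable lborel (\<lambda>t. t ^ v * (?U j t * ?V i t))"
      using int0 ji by (simp add: pair_integrable_def)
    show "direct_integral_limit (\<lambda>\<tau> t. t ^ v * (direct_row r \<rho> d ah \<tau> j t * direct_col \<xi> \<tau> i t))
        (LINT t|lborel. t ^ v * (?U j t * ?V i t))"
      using direct_integral_limit_pair[OF intD ji limD[OF ji]] by simp
    show "iterated_integral_limit (\<lambda>\<tau> \<kappa> t. t ^ v * (?U1 \<tau> \<kappa> j t * ?V1 \<tau> \<kappa> i t)) (LINT t|lborel. t ^ v * (?U j t * ?V i t))"
      using iterated_integral_limit_pair[OF int1 ji lim1' lim1[OF ji]] by simp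
    show "iterated_integral_limit (\<lambda>\<tau> \<kappa> t. t ^ v * (?U2 \<tau> \<kappa> j t * ?V2 \<tau> \<kappa> i t)) (LINT t|lborel. t ^ v * (?U j t * ?V i t))"
      using iterated_integral_limit_pair[OF int2 ji lim2' lim2[OF ji]] by simp
  qed (assumption | rule uniqA uniqB limits)+
qed

end
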